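(* Fix $k\in\{1,2,3,4\}$ and choose $x,t>0$. Let $g\in\mathbb{R}^{n_1\times\cdots\times n_d}$ be arbitrary. For every $M\in\mathcal P[d]\setminus\{\emptyset\}$ and $h\in[k]^{d-|M|}$ let $S_{M,h}$, of size $s_{M,h}$, be a subset of $I^k_{M,h}$ satisfying the conditions for a hyperrectangular tessellation suitable for derivative matching. For $M\neq\emptyset$ and a large enough constant $C>0$ only depending on $k$, choose $$\lambda_{M,h}\ge C\,|M|\,\sqrt{\sum_{i\in M}\left(\frac{d_{i,\max}(S_{M,h})}{n_i}\right)^{2k-1}}\ \lambda_0\big(t+d\log(k+1)\big).$$ Then, with probability at least $1-e^{-x}-e^{-t}$, it holds that $$\frac{\|\hat f-f^0\|_2^2}{n}\le\frac{\|g-f^0\|_2^2}{n}+4\sum_{\substack{M\in\mathcal P[d]\setminus\{\emptyset\}\\ h\in[k]^{d-|M|}}}\lambda_{M,h}\big\|(D^k_M g)_{-S_{M,h}}\big\|_1$$ $$+\frac{2\sigma^2}{n}\left(\sqrt{x+d\log(k+1)}+\sqrt{k^d}\right)^2+\sum_{\substack{M\in\mathcal P[d]\setminus\{\emptyset\}\\ h\in[k]^{d-|M|}}}\frac{2\sigma^2}{n}\left(\sqrt{x+d\log(k+1)}+\sqrt{k\,s_{M,h}}\right)^2$$ $$+\ \mathcal O\!\left(\sum_{\substack{M\in\mathcal P[d]\setminus\{\emptyset\}\\ h\in[k]^{d-|M|}}}\lambda_{M,h}^2\Big(\sum_{i\in M}\log\big(e\,d_{i,\max}(S_{M,h})\big)\Big)\sum_{m=1}^{s_{M,h}}\sum_{z\in\{-,+\}^{|M|}}\left(\frac{n_M}{d_m^z(S_{M,h})}\right)^{2k-1}\right).$$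 In particular, the constraint on $C$ is $$C\ge\frac{k^{\frac{2k-1}2}}{a_0}\quad\text{with}\quad a_0=\begin{cases}1,&k=1,\\ 8\sqrt2/7\approx1.62,&k=2,\\144\sqrt3/76\approx3.28,&k=3,\\10.10,&k=4,\end{cases}$$ as $\min_{i\in M}\min_{m\in[s_{M,h}]}\min_{h\in[k]^{d-|M|}}\min\{d_{i,m}^-(S_{M,h}),d_{i,m}^+(S_{M,h})\}\to\infty$.
   Context: Notation: $[i:j]=\{i,\dots,j\}$, $[j]=[1:j]$, $\mathcal P[d]$ is the power set of $[d]$. $\|a\|_2$ is the Frobenius norm, $\|a\|_1$ the sum of absolute entries, $a_{-S}$ the entries of $a$ with index not in $S$. For vectors (or lower-dimensional tensors) $\times$ denotes the outer product: $(f_1\times\cdots\times f_d)(j_1,\dots,j_d)=\prod_if_i(j_i)$, factors being placed in their own coordinates. Model: $Y=f^0+\epsilon$ in $\mathbb{R}^{n_1\times\cdots\times n_d}$, $n=n_1\cdots n_d$, $\epsilon$ with i.i.d. $\mathcal N(0,\sigma^2)$ entries, $\sigma\in(0,\infty)$ known. $\lambda_0(t):=\sigma\sqrt{(2\log(2n)+2t)/n}$. One-dimensional dictionary (for length $N$; used with $N=n_i$ for coordinate $i$): $\phi^1_j=\{1_{\{j'\ge j\}}\}_{j'\in[N]}$; for $k\ge2$, $\phi^k_j=\phi^j_j$ if $j\in[k-1]$ and $\phi^k_j=\sum_{l\ge j}\phi^{k-1}_l/N$ if $j\in[k:N]$. With $\mathrm A_{W}$ the orthogonal projection onto the orthogonal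 complement of $\mathrm{span}(W)$: $\tilde\phi^k_j=\sqrt N\,\mathrm A_{\{\phi_l^l,l\in[j-1]\}}\phi^j_j/\|\mathrm A_{\{\phi_l^l,l\in[j-1]\}}\phi^j_j\|_2$ for $j\in[k]$, and $\tilde\phi^k_j=\mathrm A_{\{\phi^l_l,l\in[k]\}}\phi^k_j$ for $j\in[k+1:N]$. In $d$ dimensions $\tilde\phi^k_{j_1,\dots,j_d}=\tilde\phi^k_{j_1}\times\cdots\times\tilde\phi^k_{j_d}$. ANOVA decomposition: for $M\in\mathcal P[d]$ and $h=(h_i)_{i\notin M}\in[k]^{d-|M|}$ let $I^k_{M,h}$ be the set of indices $(k_1,\dots,k_d)$ with $k_i\in[k+1:n_i]$ for $i\in M$ and $k_i=h_i$ for $i\notin M$ (identified with $\times_{i\in M}[k+1:n_i]$), and $\mathcal M(M,h)=\mathrm{span}\{\tilde\phi^k_{k_1,\dots,k_d}:(k_1,\dots,k_d)\in I^k_{M,h}\}$. These spaces are mutually orthogonal and sum to $\mathbb{R}^{n_1\times\cdots\times n_d}$. $f_{\mathcal M(M,h)}$ is the orthogonal projection of $f$ onto $\mathcal M(M,h)$; it has the form $f_{\mathcal M(M,h)}=\bar f_{\mathcal M(M,h)}\times(\times_{i\notin M}\tilde\phi^k_{h_i})$ with $\bar f_{\mathcal M(M,h)}\in\mathbb{R}^{\times_{i\in M}n_i}$ (a scalar if $M=\emptyset$). Similarly for $Y$ and $g$. Put $n_M=\prod_{i\in M}n_i$. Estimator: for $M\neq\emptyset$ let $D^k_M:=n_M^{k-1}\prod_{i\in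 M}D^k_i$, where $(D_i^kf)(\dots,j_i,\dots)=n_i^{k-1}\sum_{l=0}^k(-1)^l\binom kl f(\dots,j_i-l,\dots)$, $j_i\in[k+1:n_i]$. Then $\hat f=\sum_{M\in\mathcal P[d]}\sum_{h\in[k]^{d-|M|}}\hat f_{\mathcal M(M,h)}$ with $\hat f_{\mathcal M(\emptyset,h)}=Y_{\mathcal M(\emptyset,h)}$ and, for $M\ne\emptyset$, $\hat f_{\mathcal M(M,h)}=\hat{\bar f}_{\mathcal M(M,h)}\times(\times_{i\notin M}\tilde\phi^k_{h_i})$, where $$\hat{\bar f}_{\mathcal M(M,h)}=\arg\min_{\bar{\mathrm f}_{\mathcal M(M,h)}\in\mathbb{R}^{\times_{i\in M}n_i}}\left\{\|\bar Y_{\mathcal M(M,h)}-\bar{\mathrm f}_{\mathcal M(M,h)}\|_2^2/n_M+2\lambda_{M,h}\|D_M^k\bar{\mathrm f}_{\mathcal M(M,h)}\|_1\right\},$$ with tuning parameters $\lambda_{M,h}>0$. In the $(M,h)$-summand of the bound, $(D_M^kg)_{-S_{M,h}}$ is shorthand: $D_M^k$ acts on $|M|$-dimensional tensors, so $g$ enters through its margin $\bar g_{\mathcal M(M,h)}$, and the index set is $I^k_{M,h}$. Active sets and tessellations: $S_{M,h}=\{t_1,\dots,t_{s_{M,h}}\}$, $t_m=(t_{i,m})_{i\in M}$, is contained in $\times_{i\in M}[k+1+(k+2)k:n_i-k+1-(k+2)k]$ and comes with a hyperrectangular tessellation of $\times_{i\in M}[k+1:n_i]$: hyperrectangles $R_m=\times_{i\in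 M}[t^-_{i,m}:t^+_{i,m}]$, $m\in[s_{M,h}]$, with union $\times_{i\in M}[k+1:n_i]$, pairwise sharing possibly boundary points but no interior points, with all points of $\times_{i\in M}[t_{i,m}:t_{i,m}+k-1]$ interior to $R_m$. Put $d^-_{i,m}=t_{i,m}-t^-_{i,m}$, $d^+_{i,m}=t^+_{i,m}-t_{i,m}-k+1$, $d_m^z=\prod_{i\in M}d_{i,m}^{z_i}$ for $z\in\{-,+\}^{|M|}$, $d_{i,\max}=\max_m\max\{d^-_{i,m},d^+_{i,m}\}$, all depending on $S_{M,h}$. "Suitable for derivative matching" means $\min\{d^-_{i,m},d^+_{i,m}\}\ge(k+2)k$ for all $i\in M$ and all $m$. The $\mathcal O(\cdot)$ neglects constants, which may depend on $k$ and $d$.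
   Formalization: The factor n_M^{k-1} enters D^k_M only once (through the n_i^{k-1} of the D^k_i), not twice as the two definitions read together; with the double factor the bound fails for k≥2, e.g. d=1, k=2, g=f^0 a linear spline with one knot in S. *)

theory Defs
  imports "HOL-Probability.Probability"
begin

text \<open>
  Coordinates are numbered by \<open>{1..d}\<close>. A multi-index over a set \<open>M\<close> of coordinates is an
  extensional function on \<open>M\<close>, so the restriction \<open>j \<mapsto> (j\<^sub>i)\<^bsub>i \<in> M\<^esub>\<close> is
  \<open>restrict j M\<close>. For \<open>M = {}\<close> there is exactly one multi-index, and tensors over it are scalars.
  Tensors are real functions of multi-indices; all notions below only look at their entries in
  the relevant grid, and everything that is constructed (dictionary, projections, margins,
  estimator) vanishes off the grid, which makes projections and margins unique as functions.
\<close>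

type_synonym mindex = "nat \<Rightarrow> nat"
type_synonym tensor = "mindex \<Rightarrow> real"

definition grid :: "(nat \<Rightarrow> nat) \<Rightarrow> nat set \<Rightarrow> mindex set" where
  "grid n M = (\<Pi>\<^sub>E i\<in>M. {1..n i})"

definition inner_grid :: "nat \<Rightarrow> (nat \<Rightarrow> nat) \<Rightarrow> nat set \<Rightarrow> mindex set" where
  "inner_grid k n M = (\<Pi>\<^sub>E i\<in>M. {k+1..n i})"

definition tensors :: "(nat \<Rightarrow> nat) \<Rightarrow> nat set \<Rightarrow> tensor set" where
  "tensors n M = {f. \<forall>j. j \<notin> grid n M \<longrightarrow> f j = 0}"

definition nprod :: "(nat \<Rightarrow> nat) \<Rightarrow> nat set \<Rightarrow> real" where
  "nprod n M = (\<Prod>i\<in>M. real (n i))"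


section \<open>Spans and orthogonal projections\<close>

text \<open>Span of a finite set \<open>W\<close> of functions.\<close>

definition fun_span :: "('a \<Rightarrow> real) set \<Rightarrow> ('a \<Rightarrow> real) set" where
  "fun_span W = {\<lambda>x. \<Sum>w\<in>W. c w * w x | c. True}"

text \<open>Orthogonal projection onto \<open>V\<close> for the Euclidean inner product of the entries with index in
  the finite set \<open>J\<close>; unique if \<open>V\<close> is a span of finitely many functions that vanish off \<open>J\<close>.\<close>

definition ortho_proj :: "'a set \<Rightarrow> ('a \<Rightarrow> real) set \<Rightarrow> ('a \<Rightarrow> real) \<Rightarrow> 'a \<Rightarrow> real" where
  "ortho_proj J V f = (THE p. p \<in> V \<and> (\<forall>v\<in>V. (\<Sum>j\<in>J. (f j - p j) * v j) = 0))"

definition anti_proj :: "'a set \<Rightarrow> ('a \<Rightarrow> real) set \<Rightarrow> ('a \<Rightarrow> real) \<Rightarrow> 'a \<Rightarrow> real" where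
  "anti_proj J W f = (\<lambda>j. f j - ortho_proj J (fun_span W) f j)"


section \<open>Dictionary\<close>

text \<open>\<open>phi N k j\<close> is \<open>\<phi>\<^sup>k\<^sub>j\<close> for length \<open>N\<close>, extended by zero off \<open>{1..N}\<close>. Only \<open>k, j \<ge> 1\<close> are
  meaningful.\<close>

fun phi :: "nat \<Rightarrow> nat \<Rightarrow> nat \<Rightarrow> nat \<Rightarrow> real" where
  "phi N 0 j = (\<lambda>x. 0)"
| "phi N (Suc 0) j = (\<lambda>x. if j \<le> x \<and> x \<le> N then 1 else 0)"
| "phi N (Suc (Suc k)) j =
     (if j \<le> Suc k then phi N j j else (\<lambda>x. (\<Sum>l=j..N. phi N (Suc k) l x) / real N))"

definition phi_t :: "nat \<Rightarrow> nat \<Rightarrow> nat \<Rightarrow> nat \<Rightarrow> real" where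
  "phi_t N k j =
     (if j \<le> k then
        (let u = anti_proj {1..N} ((\<lambda>l. phi N l l) ` {1..<j}) (phi N j j)
         in (\<lambda>x. sqrt (real N) * u x / L2_set u {1..N}))
      else anti_proj {1..N} ((\<lambda>l. phi N l l) ` {1..k}) (phi N k j))"

definition Phi_t :: "nat \<Rightarrow> nat \<Rightarrow> (nat \<Rightarrow> nat) \<Rightarrow> mindex \<Rightarrow> tensor" where
  "Phi_t k d n \<kappa> = (\<lambda>j. if j \<in> grid n {1..d} then \<Prod>i\<in>{1..d}. phi_t (n i) k (\<kappa> i) (j i) else 0)"


section \<open>ANOVA decomposition\<close>

definition hset :: "nat \<Rightarrow> nat \<Rightarrow> nat set \<Rightarrow> mindex set" where
  "hset k d M = (\<Pi>\<^sub>E i\<in>{1..d} - M. {1..k})"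

definition atom_index :: "nat \<Rightarrow> nat \<Rightarrow> (nat \<Rightarrow> nat) \<Rightarrow> nat set \<Rightarrow> mindex \<Rightarrow> mindex set" where
  "atom_index k d n M h = (\<Pi>\<^sub>E i\<in>{1..d}. if i \<in> M then {k+1..n i} else {h i})"

definition anova_space :: "nat \<Rightarrow> nat \<Rightarrow> (nat \<Rightarrow> nat) \<Rightarrow> nat set \<Rightarrow> mindex \<Rightarrow> tensor set" where
  "anova_space k d n M h = fun_span (Phi_t k d n ` atom_index k d n M h)"

definition anova_part :: "nat \<Rightarrow> nat \<Rightarrow> (nat \<Rightarrow> nat) \<Rightarrow> nat set \<Rightarrow> mindex \<Rightarrow> tensor \<Rightarrow> tensor" where
  "anova_part k d n M h f = ortho_proj (grid n {1..d}) (anova_space k d n M h) f"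

text \<open>The outer product of a tensor over the coordinates in \<open>M\<close> with the vectors \<open>phi_t\<close> selected
  by \<open>h\<close> in the remaining coordinates.\<close>

definition extend_margin :: "nat \<Rightarrow> nat \<Rightarrow> (nat \<Rightarrow> nat) \<Rightarrow> nat set \<Rightarrow> mindex \<Rightarrow> tensor \<Rightarrow> tensor" where
  "extend_margin k d n M h b =
     (\<lambda>j. if j \<in> grid n {1..d}
          then b (restrict j M) * (\<Prod>i\<in>{1..d} - M. phi_t (n i) k (h i) (j i)) else 0)"

definition margin :: "nat \<Rightarrow> nat \<Rightarrow> (nat \<Rightarrow> nat) \<Rightarrow> nat set \<Rightarrow> mindex \<Rightarrow> tensor \<Rightarrow> tensor" where
  "margin k d n M h f =
     (THE b. b \<in> tensors n M \<and> anova_part k d n M h f = extend_margin k d n M h b)"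


section \<open>Difference operators and the estimator\<close>

text \<open>
  The normalization enters once: the factor \<open>n\<^sub>i\<^sup>k\<^sup>-\<^sup>1\<close> sits in the one-dimensional operator, so that
  their composition over \<open>M\<close> carries exactly the factor \<open>n\<^sub>M\<^sup>k\<^sup>-\<^sup>1\<close> that belongs to \<open>D\<^sup>k\<^sub>M\<close>.
  This is the normalization dual to the dictionary (the difference operator of order \<open>k\<close> maps
  \<open>phi N k j\<close>, \<open>j > k\<close>, to the unit vector at \<open>j\<close>, on indices above \<open>k\<close>). The operators in different
  coordinates commute, hence \<open>Finite_Set.fold\<close> is their composition.
  Values are meaningful at indices \<open>j\<close> with \<open>j i > k\<close>.
\<close>

definition diff_op :: "nat \<Rightarrow> (nat \<Rightarrow> nat) \<Rightarrow> nat \<Rightarrow> tensor \<Rightarrow> tensor" where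
  "diff_op k n i f =
     (\<lambda>j. real (n i) ^ (k - 1) * (\<Sum>l=0..k. (-1) ^ l * real (k choose l) * f (j(i := j i - l))))"

definition diff_ops :: "nat \<Rightarrow> (nat \<Rightarrow> nat) \<Rightarrow> nat set \<Rightarrow> tensor \<Rightarrow> tensor" where
  "diff_ops k n M f = Finite_Set.fold (diff_op k n) f M"

definition pen_objective ::
  "nat \<Rightarrow> (nat \<Rightarrow> nat) \<Rightarrow> nat set \<Rightarrow> real \<Rightarrow> tensor \<Rightarrow> tensor \<Rightarrow> real" where
  "pen_objective k n M lam y b =
     (\<Sum>j\<in>grid n M. (y j - b j)\<^sup>2) / nprod n M
     + 2 * lam * (\<Sum>j\<in>inner_grid k n M. \<bar>diff_ops k n M b j\<bar>)"

definition margin_estimator ::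
  "nat \<Rightarrow> nat \<Rightarrow> (nat \<Rightarrow> nat) \<Rightarrow> nat set \<Rightarrow> mindex \<Rightarrow> real \<Rightarrow> tensor \<Rightarrow> tensor" where
  "margin_estimator k d n M h lam Y =
     arg_min_on (pen_objective k n M lam (margin k d n M h Y)) (tensors n M)"

definition estimator ::
  "nat \<Rightarrow> nat \<Rightarrow> (nat \<Rightarrow> nat) \<Rightarrow> (nat set \<Rightarrow> mindex \<Rightarrow> real) \<Rightarrow> tensor \<Rightarrow> tensor" where
  "estimator k d n lam Y =
     (\<lambda>j. \<Sum>M\<in>Pow {1..d}. \<Sum>h\<in>hset k d M.
        if M = {} then anova_part k d n M h Y j
        else extend_margin k d n M h (margin_estimator k d n M h (lam M h) Y) j)"


section \<open>Noise\<close>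

text \<open>The joint law of i.i.d. centred normal entries with variance \<open>\<sigma>\<^sup>2\<close>.\<close>

definition noise :: "nat \<Rightarrow> (nat \<Rightarrow> nat) \<Rightarrow> real \<Rightarrow> tensor measure" where
  "noise d n \<sigma> = (\<Pi>\<^sub>M j\<in>grid n {1..d}. density lborel (normal_density 0 \<sigma>))"

definition lambda0 :: "nat \<Rightarrow> (nat \<Rightarrow> nat) \<Rightarrow> real \<Rightarrow> real \<Rightarrow> real" where
  "lambda0 d n \<sigma> t =
     \<sigma> * sqrt ((2 * ln (2 * nprod n {1..d}) + 2 * t) / nprod n {1..d})"


section \<open>Hyperrectangular tessellations\<close>

text \<open>
  The elements \<open>\<tau>\<close> of the active set \<open>S\<close> themselves serve as labels \<open>m\<close> of the hyperrectangles:
  \<open>lo \<tau>\<close> and \<open>hi \<tau>\<close> are the lower and upper corners of the hyperrectangle of \<open>\<tau>\<close>.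
\<close>

definition rect :: "nat set \<Rightarrow> (mindex \<Rightarrow> mindex) \<Rightarrow> (mindex \<Rightarrow> mindex) \<Rightarrow> mindex \<Rightarrow> mindex set" where
  "rect M lo hi \<tau> = (\<Pi>\<^sub>E i\<in>M. {lo \<tau> i..hi \<tau> i})"

definition rect_interior ::
  "nat set \<Rightarrow> (mindex \<Rightarrow> mindex) \<Rightarrow> (mindex \<Rightarrow> mindex) \<Rightarrow> mindex \<Rightarrow> mindex set" where
  "rect_interior M lo hi \<tau> = (\<Pi>\<^sub>E i\<in>M. {lo \<tau> i<..<hi \<tau> i})"

definition tessellation ::
  "nat \<Rightarrow> (nat \<Rightarrow> nat) \<Rightarrow> nat set \<Rightarrow> mindex set
     \<Rightarrow> (mindex \<Rightarrow> mindex) \<Rightarrow> (mindex \<Rightarrow> mindex) \<Rightarrow> bool" where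
  "tessellation k n M S lo hi \<longleftrightarrow>
     S \<subseteq> (\<Pi>\<^sub>E i\<in>M. {k + 1 + (k + 2) * k..n i + 1 - k - (k + 2) * k}) \<and>
     (\<Union>\<tau>\<in>S. rect M lo hi \<tau>) = inner_grid k n M \<and>
     (\<forall>\<tau>\<in>S. \<forall>\<tau>'\<in>S. \<tau> \<noteq> \<tau>' \<longrightarrow> rect M lo hi \<tau> \<inter> rect_interior M lo hi \<tau>' = {}) \<and>
     (\<forall>\<tau>\<in>S. (\<Pi>\<^sub>E i\<in>M. {\<tau> i..\<tau> i + k - 1}) \<subseteq> rect_interior M lo hi \<tau>)"

text \<open>\<open>dist_side k lo hi \<tau> i s\<close> is \<open>d\<^sup>-\<close> for \<open>s = False\<close> and \<open>d\<^sup>+\<close> for \<open>s = True\<close>, in coordinate \<open>i\<close>.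
  The natural subtractions do not truncate for a tessellation.\<close>

definition dist_side ::
  "nat \<Rightarrow> (mindex \<Rightarrow> mindex) \<Rightarrow> (mindex \<Rightarrow> mindex) \<Rightarrow> mindex \<Rightarrow> nat \<Rightarrow> bool \<Rightarrow> nat" where
  "dist_side k lo hi \<tau> i s = (if s then hi \<tau> i + 1 - (\<tau> i + k) else \<tau> i - lo \<tau> i)"

definition derivative_matching ::
  "nat \<Rightarrow> nat set \<Rightarrow> mindex set \<Rightarrow> (mindex \<Rightarrow> mindex) \<Rightarrow> (mindex \<Rightarrow> mindex) \<Rightarrow> bool" where
  "derivative_matching k M S lo hi \<longleftrightarrow>
     (\<forall>i\<in>M. \<forall>\<tau>\<in>S. min (dist_side k lo hi \<tau> i False) (dist_side k lo hi \<tau> i True) \<ge> (k + 2) * k)"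

definition dist_max ::
  "nat \<Rightarrow> mindex set \<Rightarrow> (mindex \<Rightarrow> mindex) \<Rightarrow> (mindex \<Rightarrow> mindex) \<Rightarrow> nat \<Rightarrow> nat" where
  "dist_max k S lo hi i =
     Max ((\<lambda>\<tau>. max (dist_side k lo hi \<tau> i False) (dist_side k lo hi \<tau> i True)) ` S)"

text \<open>For fixed \<open>M\<close>, the smallest distance over all \<open>h\<close>, all active points and all coordinates in
  \<open>M\<close>; the active sets and corners are given as families indexed by \<open>h\<close>.\<close>

definition dist_min ::
  "nat \<Rightarrow> nat \<Rightarrow> nat set \<Rightarrow> (mindex \<Rightarrow> mindex set)
     \<Rightarrow> (mindex \<Rightarrow> mindex \<Rightarrow> mindex) \<Rightarrow> (mindex \<Rightarrow> mindex \<Rightarrow> mindex) \<Rightarrow> nat" where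
  "dist_min k d M S lo hi =
     Min {min (dist_side k (lo h) (hi h) \<tau> i False) (dist_side k (lo h) (hi h) \<tau> i True) | h \<tau> i.
            h \<in> hset k d M \<and> \<tau> \<in> S h \<and> i \<in> M}"

definition dist_prod ::
  "nat \<Rightarrow> nat set \<Rightarrow> (mindex \<Rightarrow> mindex) \<Rightarrow> (mindex \<Rightarrow> mindex) \<Rightarrow> mindex \<Rightarrow> (nat \<Rightarrow> bool) \<Rightarrow> real" where
  "dist_prod k M lo hi \<tau> z = (\<Prod>i\<in>M. real (dist_side k lo hi \<tau> i (z i)))"

definition a0 :: "nat \<Rightarrow> real" where
  "a0 k = (if k = 1 then 1
           else if k = 2 then 8 * sqrt 2 / 7
           else if k = 3 then 144 * sqrt 3 / 76
           else 10.10)"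

end

theory Submission
  imports Defs
begin

text \<open>Each ANOVA component obeys the basic inequality of penalized least squares, with the quadratic
  gain coming from the growth of the objective at its minimizer. The noise is paired with the
  dictionary atoms, and every atom is split into its projection onto the atoms at the active points
  and a remainder. The projected noise lives in dimension of order \<open>s\<close> and is controlled for all
  components at once by a chi-square bound. A remainder is small near an active point, because
  the atom is approximated there by the active atoms; a union bound over all atoms turns
  this into an \<open>\<ell>\<^sub>1\<close> bound with weights below the tuning parameter.
  An interpolating tensor, equal to the signs of the differences on the active set and falling
  below one in absolute value by at least these weights elsewhere, then absorbs the remainders;
  summation by parts and Cauchy-Schwarz charge it to its energy, which is one logarithm
  times the sums of \<open>(n\<^sub>M / d\<^sub>m\<^sup>z)\<^sup>2\<^sup>k\<^sup>-\<^sup>1\<close>.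
  Since \<open>\<sigma>\<^sup>2 s / n\<close> is itself dominated by that energy times \<open>\<lambda>\<^sup>2\<close>, terms proportional to
  the dimension can be moved into the final summand, and every \<open>C \<ge> 1\<close> suffices for the tuning
  parameters; the limiting constant in the claim is at least 1 for \<open>k \<le> 4\<close>.\<close>

section \<open>Finite spans and projections\<close>

text \<open>One exponent couples the noise to the interpolation. Truncating a spline atom of order k
  at distance D from a block of knots leaves at most D entries of size (D/N)^(k-1), so the residual
  has norm of order sqrt(N) (D/N)^(k-1/2). The interpolating tensor must therefore fall from one at
  least like y^(k-1/2), and k-th differences of such a profile are of order y^(-1/2): their squares
  sum to the harmonic series, which is the origin of the logarithm. A product of such profiles over
  the coordinates would multiply the logarithms, so products with a single rough factor are averaged
  instead; the averaging costs the factor |M| in the tuning parameter. The ANOVA spaces are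
  orthogonal, so the bases attached to the components form one orthonormal system, and a single
  chi-square event of probability at most exp(-x) serves all of them. The factor 3/2 from completing
  squares times the factor 8/3 from the chi-square bound is 4; the resulting 4 \<sigma>^2 x / n is
  two copies of 2 \<sigma>^2 x / n, one charged to the variance term of the unpenalized components
  and one to the summand with M = {1..d}.\<close>

definition ip :: "'a set \<Rightarrow> ('a \<Rightarrow> real) \<Rightarrow> ('a \<Rightarrow> real) \<Rightarrow> real" where
  "ip J f g = (\<Sum>j\<in>J. f j * g j)"

lemma ip_commute: "ip J f g = ip J g f"
  by (simp add: ip_def mult.commute)

lemma ip_add_left: "ip J (\<lambda>x. f x + g x) h = ip J f h + ip J g h"
  and ip_diff_left: "ip J (\<lambda>x. f x - g x) h = ip J f h - ip J g h"
  and ip_scale_left: "ip J (\<lambda>x. c * f x) h = c * ip J f h"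
  and ip_sum_left: "ip J (\<lambda>x. \<Sum>a\<in>A. F a x) h = (\<Sum>a\<in>A. ip J (F a) h)"
  by (auto simp: ip_def algebra_simps sum.distrib sum_subtractf sum_distrib_left
      sum_distrib_right intro: sum.swap)

lemma ip_add_right: "ip J h (\<lambda>x. f x + g x) = ip J h f + ip J h g"
  and ip_diff_right: "ip J h (\<lambda>x. f x - g x) = ip J h f - ip J h g"
  and ip_scale_right: "ip J h (\<lambda>x. c * f x) = c * ip J h f"
  and ip_sum_right: "ip J h (\<lambda>x. \<Sum>a\<in>A. F a x) = (\<Sum>a\<in>A. ip J h (F a))"
  unfolding ip_commute[of J h] by (rule ip_add_left ip_diff_left ip_scale_left ip_sum_left)+

lemma ip_nonneg [simp]: "0 \<le> ip J f f"
  by (simp add: ip_def sum_nonneg)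

lemma ip_eq_0_iff: "finite J \<Longrightarrow> ip J f f = 0 \<longleftrightarrow> (\<forall>j\<in>J. f j = 0)"
  by (simp add: ip_def sum_nonneg_eq_0_iff)

lemma ip_cong: "(\<And>j. j \<in> J \<Longrightarrow> f j = f' j) \<Longrightarrow> (\<And>j. j \<in> J \<Longrightarrow> g j = g' j) \<Longrightarrow> ip J f g = ip J f' g'"
  by (simp add: ip_def)

lemma ip_Cauchy_Schwarz: "ip J f g \<le> sqrt (ip J f f) * sqrt (ip J g g)"
proof -
  have "ip J f g \<le> (\<Sum>j\<in>J. \<bar>f j\<bar> * \<bar>g j\<bar>)"
    unfolding ip_def by (intro sum_mono) (metis abs_ge_self abs_mult)
  also have "\<dots> \<le> L2_set f J * L2_set g J"
    by (rule L2_set_mult_ineq)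
  finally show ?thesis by (simp add: L2_set_def ip_def power2_eq_square)
qed

lemma fun_spanI: "(\<And>x. f x = (\<Sum>w\<in>W. c w * w x)) \<Longrightarrow> f \<in> fun_span W"
  by (auto simp: fun_span_def)

lemma fun_span_base: assumes "finite W" "w \<in> W" shows "w \<in> fun_span W"
proof (rule fun_spanI[where c = "\<lambda>v. if v = w then 1 else 0"])
  fix x
  have "(\<Sum>v\<in>W. (if v = w then 1 else 0) * v x) = (\<Sum>v\<in>W. if v = w then v x else 0)"
    by (intro sum.cong) auto
  thus "w x = (\<Sum>v\<in>W. (if v = w then 1 else 0) * v x)" using assms by simp
qed

lemma fun_span_scale: assumes "f \<in> fun_span W" shows "(\<lambda>x. a * f x) \<in> fun_span W"
proof -
  obtain c where "f = (\<lambda>x. \<Sum>w\<in>W. c w * w x)" using assms by (auto simp: fun_span_def)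
  thus ?thesis by (intro fun_spanI[where c = "\<lambda>w. a * c w"]) (simp add: sum_distrib_left mult.assoc)
qed

lemma fun_span_add: assumes "f \<in> fun_span W" "g \<in> fun_span W"
  shows "(\<lambda>x. f x + g x) \<in> fun_span W"
proof -
  obtain c d where "f = (\<lambda>x. \<Sum>w\<in>W. c w * w x)" "g = (\<lambda>x. \<Sum>w\<in>W. d w * w x)"
    using assms by (auto simp: fun_span_def)
  thus ?thesis
    by (intro fun_spanI[where c = "\<lambda>w. c w + d w"]) (simp add: sum.distrib algebra_simps)
qed

lemma fun_span_zero: "(\<lambda>x. 0) \<in> fun_span W"
  by (rule fun_spanI[where c = "\<lambda>_. 0"]) simp

lemma fun_span_diff: "f \<in> fun_span W \<Longrightarrow> g \<in> fun_span W \<Longrightarrow> (\<lambda>x. f x - g x) \<in> fun_span W"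
  using fun_span_add[of f W "\<lambda>x. -1 * g x"] fun_span_scale[of g W "-1"] by simp

lemma fun_span_sum:
  "(\<And>a. a \<in> A \<Longrightarrow> F a \<in> fun_span W) \<Longrightarrow> (\<lambda>x. \<Sum>a\<in>A. c a * F a x) \<in> fun_span W"
  by (induction A rule: infinite_finite_induct)
    (simp_all add: fun_span_zero fun_span_add fun_span_scale)

lemma fun_span_subset:
  assumes "W \<subseteq> fun_span W'" shows "fun_span W \<subseteq> fun_span W'"
proof
  fix f assume "f \<in> fun_span W"
  then obtain c where "f = (\<lambda>x. \<Sum>w\<in>W. c w * w x)" by (auto simp: fun_span_def)
  moreover have "(\<lambda>x. \<Sum>w\<in>W. c w * w x) \<in> fun_span W'"
    using assms by (intro fun_span_sum) auto
  ultimately show "f \<in> fun_span W'" by simp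
qed

lemma fun_span_mono: "finite W' \<Longrightarrow> W \<subseteq> W' \<Longrightarrow> fun_span W \<subseteq> fun_span W'"
  by (intro fun_span_subset) (auto intro: fun_span_base)

lemma fun_span_orth:
  assumes "v \<in> fun_span W" "\<And>w. w \<in> W \<Longrightarrow> ip J f w = 0" shows "ip J f v = 0"
proof -
  obtain c where "v = (\<lambda>x. \<Sum>w\<in>W. c w * w x)" using assms by (auto simp: fun_span_def)
  thus ?thesis using assms(2) by (simp add: ip_sum_right ip_scale_right)
qed

lemma fun_span_vanish:
  "v \<in> fun_span W \<Longrightarrow> (\<And>w. w \<in> W \<Longrightarrow> w j = 0) \<Longrightarrow> v j = 0"
  by (auto simp: fun_span_def intro!: sum.neutral)

section \<open>Orthonormal bases of finite spans and the projections they give\<close>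

definition orthonormal :: "'a set \<Rightarrow> ('a \<Rightarrow> real) set \<Rightarrow> bool" where
  "orthonormal J B \<longleftrightarrow> (\<forall>b\<in>B. \<forall>b'\<in>B. ip J b b' = (if b = b' then 1 else 0))"

definition coord_proj :: "'a set \<Rightarrow> ('a \<Rightarrow> real) set \<Rightarrow> ('a \<Rightarrow> real) \<Rightarrow> 'a \<Rightarrow> real" where
  "coord_proj J B f = (\<lambda>x. \<Sum>b\<in>B. ip J f b * b x)"

lemma coord_proj_in_span: "coord_proj J B f \<in> fun_span B"
  unfolding coord_proj_def by (rule fun_spanI) simp

lemma coord_proj_orth:
  assumes "finite B" "orthonormal J B" "v \<in> fun_span B"
  shows "ip J (\<lambda>x. f x - coord_proj J B f x) v = 0"
proof (rule fun_span_orth[OF assms(3)])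
  fix w assume w: "w \<in> B"
  have "ip J (coord_proj J B f) w = (\<Sum>b\<in>B. ip J f b * ip J b w)"
    by (simp add: coord_proj_def ip_sum_left ip_scale_left)
  also have "\<dots> = (\<Sum>b\<in>B. if b = w then ip J f b else 0)"
    using assms(2) w by (intro sum.cong) (auto simp: orthonormal_def)
  also have "\<dots> = ip J f w" using w assms(1) by simp
  finally show "ip J (\<lambda>x. f x - coord_proj J B f x) w = 0" by (simp add: ip_diff_left)
qed

text \<open>Gram-Schmidt over an arbitrary finite generating set. A generator whose residual
  vanishes on \<open>J\<close> is skipped, hence only an inequality of cardinalities. The support
  hypothesis turns equality on \<open>J\<close> into equality of functions.\<close>

lemma orthonormal_basis_exists:
  assumes "finite J" "finite W" "\<And>w j. w \<in> W \<Longrightarrow> j \<notin> J \<Longrightarrow> w j = 0"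
  obtains B where "finite B" "card B \<le> card W" "orthonormal J B" "fun_span B = fun_span W"
    "B \<subseteq> fun_span W"
proof -
  have "\<exists>B. finite B \<and> card B \<le> card W \<and> orthonormal J B \<and> B \<subseteq> fun_span W \<and> W \<subseteq> fun_span B"
    using assms(2,3)
  proof (induction W)
    case empty
    thus ?case by (intro exI[of _ "{}"]) (auto simp: orthonormal_def)
  next
    case (insert w W)
    then obtain B where B: "finite B" "card B \<le> card W" "orthonormal J B" "B \<subseteq> fun_span W"
      "W \<subseteq> fun_span B" by auto
    define r where "r = (\<lambda>x. w x - coord_proj J B w x)"
    have sub: "fun_span W \<subseteq> fun_span (insert w W)"
      using insert.hyps by (intro fun_span_mono) auto
    have w_in: "w \<in> fun_span (insert w W)" using insert.hyps by (intro fun_span_base) auto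
    have proj_in: "coord_proj J B w \<in> fun_span W"
      using coord_proj_in_span fun_span_subset[OF B(4)] by blast
    have r_orth: "ip J r v = 0" if "v \<in> fun_span B" for v
      unfolding r_def by (rule coord_proj_orth[OF B(1,3) that])
    show ?case
    proof (cases "\<forall>j\<in>J. r j = 0")
      case True
      have "w = coord_proj J B w"
      proof
        fix j
        show "w j = coord_proj J B w j"
        proof (cases "j \<in> J")
          case True
          thus ?thesis using \<open>\<forall>j\<in>J. r j = 0\<close> by (simp add: r_def)
        next
          case False
          hence "w j = 0" "\<And>v. v \<in> W \<Longrightarrow> v j = 0" using insert.prems by auto
          thus ?thesis using fun_span_vanish[OF proj_in] by metis
        qed
      qed
      hence "w \<in> fun_span B" using coord_proj_in_span by metis
      thus ?thesis using B sub insert.hyps by (intro exI[of _ B]) auto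
    next
      case False
      define s where "s = sqrt (ip J r r)"
      have s: "s > 0" "ip J r r = s\<^sup>2"
        using False ip_eq_0_iff[OF assms(1), of r] ip_nonneg[of J r] unfolding s_def
        by (auto simp: less_le)
      define b where "b = (\<lambda>x. (1/s) * r x)"
      have bb: "ip J b b = 1" using s unfolding b_def ip_scale_left ip_scale_right by (simp add: power2_eq_square)
      have b_orth: "ip J b v = 0" if "v \<in> fun_span B" for v
        using r_orth[OF that] unfolding b_def ip_scale_left by simp
      have bB: "b \<notin> B" using b_orth[of b] bb fun_span_base[OF B(1)] by auto
      have r_in: "r \<in> fun_span (insert w W)"
        unfolding r_def using w_in proj_in sub by (intro fun_span_diff) auto
      have fin: "finite (insert b B)" using B by simp
      have subB: "fun_span B \<subseteq> fun_span (insert b B)" using fin by (intro fun_span_mono) auto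
      have "w = (\<lambda>x. coord_proj J B w x + s * b x)" using s by (simp add: b_def r_def)
      moreover have "(\<lambda>x. coord_proj J B w x + s * b x) \<in> fun_span (insert b B)"
        using subB coord_proj_in_span[of J B w] fun_span_base[OF fin, of b]
        by (intro fun_span_add fun_span_scale) auto
      ultimately have w_in': "w \<in> fun_span (insert b B)" by simp
      show ?thesis
      proof (intro exI[of _ "insert b B"] conjI)
        show "card (insert b B) \<le> card (insert w W)" using B bB insert.hyps by simp
        show "orthonormal J (insert b B)"
          unfolding orthonormal_def
        proof (intro ballI)
          fix u v assume uv: "u \<in> insert b B" "v \<in> insert b B"
          have *: "ip J b v = 0" "ip J v b = 0" if "v \<in> B" for v
            using b_orth[OF fun_span_base[OF B(1) that]] by (simp_all add: ip_commute)
          show "ip J u v = (if u = v then 1 else 0)"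
            using uv B(3) bb bB *[of u] *[of v] by (auto simp: orthonormal_def)
        qed
        have "b \<in> fun_span (insert w W)" unfolding b_def by (rule fun_span_scale[OF r_in])
        thus "insert b B \<subseteq> fun_span (insert w W)" using B(4) sub by auto
        show "insert w W \<subseteq> fun_span (insert b B)" using w_in' B(5) subB by auto
      qed (use fin in auto)
    qed
  qed
  then obtain B where "finite B" "card B \<le> card W" "orthonormal J B" "B \<subseteq> fun_span W"
      "W \<subseteq> fun_span B" by auto
  thus ?thesis using that fun_span_subset[of W B] fun_span_subset[of B W] by auto
qed

text \<open>Uniqueness is what the definite description asks for: the difference of two candidates
  lies in the span and is orthogonal to itself, so it vanishes on \<open>J\<close>, and off
  \<open>J\<close> because all generators do.\<close>

lemma ortho_proj_eqI:
  assumes "finite J" "\<And>w j. w \<in> W \<Longrightarrow> j \<notin> J \<Longrightarrow> w j = 0"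
    and p: "p \<in> fun_span W" "\<And>w. w \<in> W \<Longrightarrow> ip J (\<lambda>x. f x - p x) w = 0"
  shows "ortho_proj J (fun_span W) f = p"
  unfolding ortho_proj_def
proof (rule the_equality)
  show "p \<in> fun_span W \<and> (\<forall>v\<in>fun_span W. (\<Sum>j\<in>J. (f j - p j) * v j) = 0)"
    using p fun_span_orth[of _ W J "\<lambda>x. f x - p x"] by (auto simp: ip_def)
next
  fix q assume q: "q \<in> fun_span W \<and> (\<forall>v\<in>fun_span W. (\<Sum>j\<in>J. (f j - q j) * v j) = 0)"
  define e where "e = (\<lambda>x. p x - q x)"
  have e: "e \<in> fun_span W" unfolding e_def using p q by (intro fun_span_diff) auto
  have "ip J (\<lambda>x. f x - p x) e = 0" using fun_span_orth[OF e] p(2) by blast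
  moreover have "ip J (\<lambda>x. f x - q x) e = 0" using q e by (auto simp: ip_def)
  moreover have "ip J e e = ip J (\<lambda>x. f x - q x) e - ip J (\<lambda>x. f x - p x) e"
    unfolding ip_diff_left[symmetric] by (simp add: e_def)
  ultimately have "ip J e e = 0" by simp
  hence "\<forall>j\<in>J. e j = 0" using ip_eq_0_iff[OF assms(1)] by auto
  moreover have "e j = 0" if "j \<notin> J" for j using fun_span_vanish[OF e] assms(2) that by auto
  ultimately have e0: "e x = 0" for x by blast
  show "q = p" using e0 by (simp add: e_def fun_eq_iff)
qed

text \<open>The span of an image counts each function once, while a sum over the index set may
  repeat it. A subset of indices on which \<open>F\<close> is injective carries the coefficients,
  and the other indices get zero.\<close>

lemma fun_span_image:
  assumes "finite A"
  shows "fun_span (F ` A) = {\<lambda>x. \<Sum>a\<in>A. c a * F a x | c. True}"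
proof (intro equalityI subsetI)
  fix f assume "f \<in> fun_span (F ` A)"
  then obtain c where f: "f = (\<lambda>x. \<Sum>w\<in>F ` A. c w * w x)" by (auto simp: fun_span_def)
  obtain A' where A': "A' \<subseteq> A" "inj_on F A'" "F ` A = F ` A'"
    by (meson subset_image_inj order_refl)
  have "f = (\<lambda>x. \<Sum>a\<in>A. (if a \<in> A' then c (F a) else 0) * F a x)"
  proof
    fix x
    have "(\<Sum>a\<in>A. (if a \<in> A' then c (F a) else 0) * F a x) = (\<Sum>a\<in>A'. c (F a) * F a x)"
      using A' assms by (intro sum.mono_neutral_cong_right) auto
    thus "f x = (\<Sum>a\<in>A. (if a \<in> A' then c (F a) else 0) * F a x)"
      using A' by (simp add: f sum.reindex)
  qed
  thus "f \<in> {\<lambda>x. \<Sum>a\<in>A. c a * F a x | c. True}"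
    by (intro CollectI exI[of _ "\<lambda>a. if a \<in> A' then c (F a) else 0"]) simp
next
  fix f assume "f \<in> {\<lambda>x. \<Sum>a\<in>A. c a * F a x | c. True}"
  thus "f \<in> fun_span (F ` A)" using assms by (auto intro!: fun_span_sum fun_span_base)
qed

section \<open>The dictionary in one dimension\<close>

text \<open>With \<open>c l = f (\<kappa> - l)\<close> this is the backward difference of order k at
  \<kappa>; with \<open>c l = f (y + real l)\<close> it is the forward difference up to sign.
  Treating the stencil values as a bare sequence lets both uses share one algebra.\<close>

definition altsum :: "nat \<Rightarrow> (nat \<Rightarrow> real) \<Rightarrow> real" where
  "altsum k c = (\<Sum>l=0..k. (-1) ^ l * real (k choose l) * c l)"

lemma altsum_cong: "(\<And>l. l \<le> k \<Longrightarrow> c l = c' l) \<Longrightarrow> altsum k c = altsum k c'"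
  by (simp add: altsum_def)

lemma altsum_scale: "altsum k (\<lambda>l. a * c l) = a * altsum k c"
  by (simp add: altsum_def sum_distrib_left algebra_simps)

lemma altsum_0 [simp]: "altsum 0 c = c 0"
  by (simp add: altsum_def)

text \<open>Pascal's rule: a difference of order k + 1 is the difference of order k of the first
  differences.\<close>

lemma altsum_Suc: "altsum (Suc k) c = altsum k (\<lambda>l. c l - c (Suc l))"
proof -
  have "altsum (Suc k) c = c 0 + (\<Sum>l\<le>k. (-1) ^ Suc l * real (Suc k choose Suc l) * c (Suc l))"
    unfolding altsum_def atLeast0AtMost sum.atMost_Suc_shift by simp
  also have "\<dots> = c 0 + (\<Sum>l\<le>k. (-1) ^ Suc l * real (k choose Suc l) * c (Suc l))
      - (\<Sum>l\<le>k. (-1) ^ l * real (k choose l) * c (Suc l))"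
    unfolding add_diff_eq[symmetric] sum_subtractf[symmetric]
    by (intro arg_cong2[where f = "(+)"] sum.cong) (simp_all add: algebra_simps)
  also have "c 0 + (\<Sum>l\<le>k. (-1) ^ Suc l * real (k choose Suc l) * c (Suc l))
      = (\<Sum>l\<le>Suc k. (-1) ^ l * real (k choose l) * c l)"
    unfolding sum.atMost_Suc_shift by simp
  also have "\<dots> = (\<Sum>l\<le>k. (-1) ^ l * real (k choose l) * c l)"
    by (simp add: binomial_eq_0)
  finally show ?thesis
    by (simp add: altsum_def atLeast0AtMost algebra_simps sum_subtractf)
qed

lemma altsum_abs_le:
  assumes "\<And>l. l \<le> k \<Longrightarrow> \<bar>c l\<bar> \<le> B" shows "\<bar>altsum k c\<bar> \<le> 2 ^ k * B"
proof -
  have "\<bar>altsum k c\<bar> \<le> (\<Sum>l\<le>k. real (k choose l) * \<bar>c l\<bar>)"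
    unfolding altsum_def atLeast0AtMost by (rule order_trans[OF sum_abs]) (simp add: abs_mult)
  also have "\<dots> \<le> (\<Sum>l\<le>k. real (k choose l) * B)"
    using assms by (intro sum_mono mult_left_mono) auto
  also have "\<dots> = 2 ^ k * B"
    unfolding sum_distrib_right[symmetric] of_nat_sum[symmetric] choose_row_sum by simp
  finally show ?thesis .
qed

text \<open>Generalised binomials serve as the polynomials of degree m. One difference lowers the
  degree by one and shifts the base point, so k differences annihilate every degree below k. The
  base point is real because spline pieces are continued as polynomials to the left of their
  knot.\<close>

lemma altsum_gbinomial: "m < k \<Longrightarrow> altsum k (\<lambda>l. (y - real l) gchoose m) = 0"
proof (induction k arbitrary: m y)
  case (Suc k)
  show ?case
  proof (cases m)
    case 0
    thus ?thesis by (simp add: altsum_Suc) (simp add: altsum_def)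
  next
    case (Suc m')
    have "((y - real l) gchoose m) - ((y - real (Suc l)) gchoose m) = ((y - 1) - real l) gchoose m'" for l
      using gbinomial_Suc_Suc[of "y - 1 - real l" m'] by (simp add: Suc algebra_simps)
    hence "altsum (Suc k) (\<lambda>l. (y - real l) gchoose m) = altsum k (\<lambda>l. ((y - 1) - real l) gchoose m')"
      unfolding altsum_Suc by presburger
    thus ?thesis using Suc.IH[of m' "y - 1"] Suc Suc.prems by simp
  qed
qed simp

text \<open>Iterated cumulative sums of an indicator are binomial coefficients; the hockey-stick
  identity \<open>choose_rising_sum\<close> carries the induction.\<close>

lemma phi_eq_high:
  "Suc k \<le> j \<Longrightarrow> phi N (Suc k) j x =
     (if j \<le> x \<and> x \<le> N then real ((x - j + k) choose k) / real N ^ k else 0)"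
proof (induction k arbitrary: j)
  case (Suc k)
  have "phi N (Suc (Suc k)) j x = (\<Sum>l=j..N. phi N (Suc k) l x) / real N"
    using Suc.prems by simp
  also have "(\<Sum>l=j..N. phi N (Suc k) l x) =
      (\<Sum>l=j..N. if l \<le> x \<and> x \<le> N then real ((x - l + k) choose k) / real N ^ k else 0)"
    using Suc.prems by (intro sum.cong Suc.IH) auto
  also have "\<dots> = (if j \<le> x \<and> x \<le> N then real ((x - j + Suc k) choose Suc k) / real N ^ k else 0)"
  proof (cases "j \<le> x \<and> x \<le> N")
    case True
    have "(\<Sum>l=j..N. if l \<le> x \<and> x \<le> N then real ((x - l + k) choose k) / real N ^ k else 0)
        = (\<Sum>l=j..x. real ((x - l + k) choose k) / real N ^ k)"
      using True by (intro sum.mono_neutral_cong_right) auto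
    also have "\<dots> = (\<Sum>i\<le>x - j. real ((k + i) choose k) / real N ^ k)"
      using True by (intro sum.reindex_bij_witness[of _ "\<lambda>i. x - i" "\<lambda>l. x - l"]) (auto simp: add.commute)
    also have "\<dots> = real ((k + (x - j) + 1) choose (k + 1)) / real N ^ k"
      unfolding sum_divide_distrib[symmetric] of_nat_sum[symmetric] choose_rising_sum(1) ..
    finally show ?thesis using True by (simp add: add.commute)
  next
    case False
    thus ?thesis by (auto intro!: sum.neutral)
  qed
  finally show ?case by simp
qed simp

lemma phi_low: "1 \<le> j \<Longrightarrow> j \<le> k \<Longrightarrow> phi N k j = phi N j j"
proof (cases k)
  case (Suc k')
  assume *: "1 \<le> j" "j \<le> k"
  show ?thesis
  proof (cases k')
    case 0
    thus ?thesis using * Suc by (simp add: le_Suc_eq)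
  next
    case (Suc k'')
    thus ?thesis using * \<open>k = Suc k'\<close> by (cases "j = k") auto
  qed
qed simp

text \<open>The low-order atoms are polynomials of degree j - 1 on the whole of {1..N}, not only to
  the right of j: the binomial has its zeros exactly at the grid points below j.\<close>

lemma phi_diag_eq: "1 \<le> j \<Longrightarrow> 1 \<le> x \<Longrightarrow> x \<le> N \<Longrightarrow>
    phi N j j x = ((real x - 1) gchoose (j - 1)) / real N ^ (j - 1)"
proof -
  assume *: "1 \<le> j" "1 \<le> x" "x \<le> N"
  hence "real x - 1 = real (x - 1)" by simp
  hence "(real x - 1) gchoose (j - 1) = real ((x - 1) choose (j - 1))"
    by (simp only: binomial_gbinomial)
  thus ?thesis
    using phi_eq_high[of "j - 1" j N x] * by (cases "j \<le> x") (auto simp: binomial_eq_0)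
qed

lemma phi_vanish: "1 \<le> k \<Longrightarrow> 1 \<le> j \<Longrightarrow> x \<notin> {j..N} \<Longrightarrow> phi N k j x = 0"
  using phi_eq_high[of "k - 1" j N x] phi_eq_high[of "j - 1" j N x] phi_low[of j k N]
  by (cases "j \<le> k") auto

lemma phi_diag_pos: "1 \<le> k \<Longrightarrow> 1 \<le> j \<Longrightarrow> j \<le> N \<Longrightarrow> phi N k j j > 0"
  using phi_eq_high[of "k - 1" j N j] phi_eq_high[of "j - 1" j N j] phi_low[of j k N]
  by (cases "j \<le> k") auto

text \<open>Row \<kappa> of the difference operator as an N by N matrix. The test
  \<open>x \<le> \<kappa>\<close> guards the natural subtraction; entries more than k below \<kappa>
  vanish through the binomial.\<close>

definition dker :: "nat \<Rightarrow> nat \<Rightarrow> nat \<Rightarrow> nat \<Rightarrow> real" where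
  "dker N k \<kappa> x =
     (if x \<le> \<kappa> then real N ^ (k - 1) * ((-1) ^ (\<kappa> - x) * real (k choose (\<kappa> - x))) else 0)"

lemma dker_sum:
  assumes "\<kappa> \<in> {k+1..N}"
  shows "(\<Sum>x=1..N. dker N k \<kappa> x * f x) = real N ^ (k - 1) * altsum k (\<lambda>l. f (\<kappa> - l))"
proof -
  have "(\<Sum>x=1..N. dker N k \<kappa> x * f x) = (\<Sum>x=\<kappa>-k..\<kappa>. dker N k \<kappa> x * f x)"
    using assms by (intro sum.mono_neutral_right) (auto simp: dker_def binomial_eq_0)
  also have "\<dots> = (\<Sum>l=0..k. dker N k \<kappa> (\<kappa> - l) * f (\<kappa> - l))"
    using assms by (intro sum.reindex_bij_witness[of _ "\<lambda>l. \<kappa> - l" "\<lambda>x. \<kappa> - x"]) auto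
  also have "\<dots> = real N ^ (k - 1) * altsum k (\<lambda>l. f (\<kappa> - l))"
    unfolding altsum_def sum_distrib_left
    using assms by (intro sum.cong) (auto simp: dker_def)
  finally show ?thesis .
qed

text \<open>Differences are dual to the atoms. A low-order atom is a polynomial of degree below k
  and is annihilated. A high-order atom is zero left of its knot and a polynomial of degree k - 1
  from there on, so only the stencil that ends at the knot gives a nonzero value.\<close>

lemma dker_phi:
  assumes "1 \<le> k" "\<kappa> \<in> {k+1..N}" "j \<in> {1..N}"
  shows "(\<Sum>x=1..N. dker N k \<kappa> x * phi N k j x) = (if j = \<kappa> then 1 else 0)"
proof (cases "j \<le> k")
  case True
  have "altsum k (\<lambda>l. phi N k j (\<kappa> - l)) =
      altsum k (\<lambda>l. (1 / real N ^ (j - 1)) * ((real \<kappa> - 1 - real l) gchoose (j - 1)))"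
  proof (rule altsum_cong)
    fix l assume "l \<le> k"
    hence "phi N k j (\<kappa> - l) = ((real (\<kappa> - l) - 1) gchoose (j - 1)) / real N ^ (j - 1)"
      using True assms phi_low[of j k N] phi_diag_eq[of j "\<kappa> - l" N] \<open>l \<le> k\<close> by auto
    moreover have "real (\<kappa> - l) - 1 = real \<kappa> - 1 - real l"
      using \<open>l \<le> k\<close> assms by (simp add: of_nat_diff)
    ultimately show "phi N k j (\<kappa> - l) = (1 / real N ^ (j - 1)) * ((real \<kappa> - 1 - real l) gchoose (j - 1))"
      by (simp only:) simp
  qed
  also have "\<dots> = 0"
    using True assms unfolding altsum_scale by (subst altsum_gbinomial) auto
  finally show ?thesis using True assms unfolding dker_sum[OF assms(2)] by simp
next
  case j: False
  have N: "N > 0" using assms by simp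
  have phi: "phi N k j x = (if j \<le> x then real ((x - j + (k - 1)) choose (k - 1)) / real N ^ (k - 1) else 0)"
    if "x \<le> N" for x
    using phi_eq_high[of "k - 1" j N x] j assms that by simp
  consider "\<kappa> < j" | "\<kappa> = j" | "j < \<kappa>" by linarith
  thus ?thesis
  proof cases
    case 1
    hence "altsum k (\<lambda>l. phi N k j (\<kappa> - l)) = altsum k (\<lambda>l. 0 * 1)"
      using assms by (intro altsum_cong) (auto simp: phi)
    thus ?thesis using 1 assms unfolding dker_sum[OF assms(2)] by (simp add: altsum_def)
  next
    case 2
    have "altsum k (\<lambda>l. phi N k j (\<kappa> - l)) =
        (\<Sum>l=0..k. if l = 0 then 1 / real N ^ (k - 1) else 0)"
      unfolding altsum_def using 2 assms by (intro sum.cong) (auto simp: phi)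
    thus ?thesis using 2 N unfolding dker_sum[OF assms(2)] by simp
  next
    case 3
    \<comment> \<open>The stencil may reach up to k - 1 points left of the knot, where the atom is
      zero. The polynomial also vanishes at exactly these points, so it represents the atom on the
      full stencil.\<close>
    have "altsum k (\<lambda>l. phi N k j (\<kappa> - l)) =
      altsum k (\<lambda>l. (1 / real N ^ (k - 1)) * ((real \<kappa> - real j + real k - 1 - real l) gchoose (k - 1)))"
    proof (rule altsum_cong)
      fix l assume l: "l \<le> k"
      define m where "m = \<kappa> - l + (k - 1) - j"
      have m: "real \<kappa> - real j + real k - 1 - real l = real m"
        using l 3 assms j by (simp add: m_def of_nat_diff)
      show "phi N k j (\<kappa> - l) =
          (1 / real N ^ (k - 1)) * ((real \<kappa> - real j + real k - 1 - real l) gchoose (k - 1))"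
        unfolding m binomial_gbinomial[symmetric] using l assms 3
        by (subst phi) (auto simp: m_def intro!: binomial_eq_0)
    qed
    also have "\<dots> = 0" using assms unfolding altsum_scale by (subst altsum_gbinomial) auto
    finally show ?thesis using 3 assms unfolding dker_sum[OF assms(2)] by simp
  qed
qed

section \<open>Gram-Schmidt for the low-order atoms and the resulting projection kernels\<close>

lemma triangular_expansion:
  fixes f :: "nat \<Rightarrow> nat \<Rightarrow> real"
  assumes "\<And>j x. j \<in> {1..N} \<Longrightarrow> x < j \<Longrightarrow> f j x = 0" "\<And>j. j \<in> {1..N} \<Longrightarrow> f j j \<noteq> 0"
  shows "\<exists>a. \<forall>x\<in>{1..N}. u x = (\<Sum>j=1..N. a j * f j x)"
  using assms
proof (induction N)
  case (Suc N)
  then obtain a where a: "\<And>x. x \<in> {1..N} \<Longrightarrow> u x = (\<Sum>j=1..N. a j * f j x)" by force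
  define a' where "a' = a(Suc N := (u (Suc N) - (\<Sum>j=1..N. a j * f j (Suc N))) / f (Suc N) (Suc N))"
  have eq: "(\<Sum>j=1..Suc N. a' j * f j x) = (\<Sum>j=1..N. a j * f j x) + a' (Suc N) * f (Suc N) x" for x
    by (auto simp: a'_def intro!: sum.cong)
  show ?case
  proof (intro exI[of _ a'] ballI)
    fix x assume x: "x \<in> {1..Suc N}"
    show "u x = (\<Sum>j=1..Suc N. a' j * f j x)"
    proof (cases "x = Suc N")
      case True
      thus ?thesis unfolding eq using Suc.prems(2)[of "Suc N"] by (simp add: a'_def)
    next
      case False
      thus ?thesis unfolding eq using Suc.prems(1)[of "Suc N" x] a[of x] x by simp
    qed
  qed
qed simp

lemma triangular_independent:
  fixes f :: "nat \<Rightarrow> nat \<Rightarrow> real"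
  assumes "\<And>j x. j \<in> {1..N} \<Longrightarrow> x < j \<Longrightarrow> f j x = 0" "\<And>j. j \<in> {1..N} \<Longrightarrow> f j j \<noteq> 0"
    and 0: "\<And>x. x \<in> {1..N} \<Longrightarrow> (\<Sum>j=1..N. a j * f j x) = 0"
  shows "l \<in> {1..N} \<Longrightarrow> a l = 0"
proof (induction l rule: less_induct)
  case (less l)
  have "(\<Sum>j=1..N. a j * f j l) = (\<Sum>j=1..N. if j = l then a l * f l l else 0)"
    using less assms(1) by (intro sum.cong) (auto, metis linorder_neqE_nat)
  also have "\<dots> = a l * f l l" using less.prems by simp
  finally show ?case using 0[OF less.prems] assms(2)[OF less.prems] by simp
qed

text \<open>The projection is taken onto the span of the raw family \<open>P\<close>, but it is
  computed through an orthogonal family \<open>p\<close> with the same span whose members all have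
  squared norm \<open>N\<close>, as the normalised low-order atoms do.\<close>

lemma anti_proj_orthogonal:
  assumes J: "finite J" and N: "N > 0"
    and orth: "\<And>l l'. l \<in> A \<Longrightarrow> l' \<in> A \<Longrightarrow> ip J (p l) (p l') = (if l = l' then N else 0)"
    and A: "finite A" and span: "fun_span (P ` A) = fun_span (p ` A)"
    and van: "\<And>l j. l \<in> A \<Longrightarrow> j \<notin> J \<Longrightarrow> P l j = 0"
  shows "anti_proj J (P ` A) f = (\<lambda>x. f x - (\<Sum>l\<in>A. ip J f (p l) / N * p l x))"
proof -
  define q where "q = (\<lambda>x. \<Sum>l\<in>A. ip J f (p l) / N * p l x)"
  have "ortho_proj J (fun_span (P ` A)) f = q"
  proof (rule ortho_proj_eqI[OF J])
    show "q \<in> fun_span (P ` A)"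
      unfolding span q_def using A by (intro fun_span_sum fun_span_base) auto
  next
    fix w assume "w \<in> P ` A"
    hence w: "w \<in> fun_span (p ` A)" unfolding span[symmetric] using A by (intro fun_span_base) auto
    show "ip J (\<lambda>x. f x - q x) w = 0"
    proof (rule fun_span_orth[OF w])
      fix v assume "v \<in> p ` A"
      then obtain m where m: "m \<in> A" "v = p m" by auto
      have "ip J q v = (\<Sum>l\<in>A. ip J f (p l) / N * ip J (p l) (p m))"
        unfolding q_def m by (simp only: ip_sum_left ip_scale_left)
      also have "\<dots> = (\<Sum>l\<in>A. if l = m then ip J f (p l) else 0)"
        using m N by (intro sum.cong) (auto simp: orth)
      finally show "ip J (\<lambda>x. f x - q x) v = 0" using m A by (simp add: ip_diff_left)
    qed
  qed (use van in auto)
  thus ?thesis unfolding anti_proj_def q_def by simp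
qed

text \<open>Kernels of k + 1 mutually orthogonal projections of R^N that sum to the identity: c in
  {1..k} selects the line of the c-th low-order atom, and c = 0 selects the orthogonal complement of
  all of them. Division by N compensates the squared norm of the atoms.\<close>

definition qker :: "nat \<Rightarrow> nat \<Rightarrow> nat \<Rightarrow> nat \<Rightarrow> nat \<Rightarrow> real" where
  "qker N k c x y = (if c = 0 then (if x = y then 1 else 0) - (\<Sum>l=1..k. phi_t N k l x * phi_t N k l y / real N)
     else phi_t N k c x * phi_t N k c y / real N)"

context
  fixes N k :: nat
  assumes k: "1 \<le> k" and kN: "k < N"
  notes One_nat_def [simp del]
begin

text \<open>Orthogonality and equality of spans have to be carried together: equality of the spans
  up to m allows the next residual, defined through the raw atoms, to be computed with the
  orthogonal ones.\<close>

lemma phi_t_Gram_Schmidt: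
  "m \<le> k \<Longrightarrow>
    (\<forall>l\<in>{1..m}. \<forall>l'\<in>{1..m}. ip {1..N} (phi_t N k l) (phi_t N k l') = (if l = l' then real N else 0)) \<and>
    fun_span ((\<lambda>l. phi N l l) ` {1..m}) = fun_span (phi_t N k ` {1..m})"
proof (induction m)
  case (Suc m)
  let ?P = "\<lambda>l. phi N l l" and ?p = "phi_t N k" and ?J = "{1..N}"
  from Suc have orth: "ip ?J (?p l) (?p l') = (if l = l' then real N else 0)"
    if "l \<in> {1..m}" "l' \<in> {1..m}" for l l' using that by auto
  from Suc have span: "fun_span (?P ` {1..m}) = fun_span (?p ` {1..m})" by auto
  have van: "?P l j = 0" if "l \<in> {1..Suc m}" "j \<notin> ?J" for l j
    using that by (intro phi_vanish) auto
  define u where "u = anti_proj ?J (?P ` {1..m}) (?P (Suc m))"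
  have u: "u = (\<lambda>x. ?P (Suc m) x - (\<Sum>l\<in>{1..m}. ip ?J (?P (Suc m)) (?p l) / real N * ?p l x))"
    unfolding u_def by (rule anti_proj_orthogonal) (use orth span van kN in auto)
  have p: "?p (Suc m) = (\<lambda>x. sqrt (real N) * u x / L2_set u ?J)"
    using Suc.prems unfolding phi_t_def u_def
    by (simp add: Let_def atLeastLessThanSuc_atLeastAtMost)
  have u_orth: "ip ?J u (?p m') = 0" if "m' \<in> {1..m}" for m'
  proof -
    have "ip ?J (\<lambda>x. \<Sum>l\<in>{1..m}. ip ?J (?P (Suc m)) (?p l) / real N * ?p l x) (?p m')
       = (\<Sum>l\<in>{1..m}. ip ?J (?P (Suc m)) (?p l) / real N * ip ?J (?p l) (?p m'))"
      by (simp only: ip_sum_left ip_scale_left)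
    also have "\<dots> = (\<Sum>l\<in>{1..m}. if l = m' then ip ?J (?P (Suc m)) (?p l) else 0)"
      using that kN by (intro sum.cong refl) (subst orth, auto)
    finally show ?thesis using that by (simp add: u ip_diff_left)
  qed
  have u_span: "(\<lambda>x. \<Sum>l\<in>{1..m}. ip ?J (?P (Suc m)) (?p l) / real N * ?p l x) \<in> fun_span (?p ` {1..m})"
    by (intro fun_span_sum fun_span_base) auto
  \<comment> \<open>A vanishing residual would write the atom m + 1 as a combination of the earlier
    ones on {1..N}. These atoms start at different indices, so the triangular system forces the
    coefficient 1 of the last one to be 0.\<close>
  have u0: "ip ?J u u > 0"
  proof (rule ccontr)
    assume "\<not> ip ?J u u > 0"
    hence "ip ?J u u = 0" using ip_nonneg[of ?J u] by linarith
    hence 0: "\<And>x. x \<in> ?J \<Longrightarrow> u x = 0" by (simp add: ip_eq_0_iff)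
    obtain c where c: "(\<lambda>x. \<Sum>l\<in>{1..m}. ip ?J (?P (Suc m)) (?p l) / real N * ?p l x) =
        (\<lambda>x. \<Sum>l\<in>{1..m}. c l * ?P l x)"
      using u_span unfolding span[symmetric] unfolding fun_span_image[OF finite_atLeastAtMost] mem_Collect_eq
      by (elim exE conjE) (rule that)
    define a where "a = (\<lambda>l. if l = Suc m then 1 else - c l)"
    have "a (Suc m) = 0"
    proof (rule triangular_independent[where N = "Suc m" and f = ?P])
      fix x assume x: "x \<in> {1..Suc m}"
      have "(\<Sum>j=1..Suc m. a j * ?P j x) = ?P (Suc m) x - (\<Sum>l\<in>{1..m}. c l * ?P l x)"
        by (simp add: a_def sum_negf)
      also have "\<dots> = u x" using fun_cong[OF c, of x] by (simp add: u)
      finally show "(\<Sum>j=1..Suc m. a j * ?P j x) = 0" using 0[of x] x Suc.prems kN by simp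
    next
      fix j assume "j \<in> {1..Suc m}"
      thus "?P j j \<noteq> 0" using phi_diag_pos[of j j N] Suc.prems kN by simp
    next
      fix j x assume "j \<in> {1..Suc m}" "x < j"
      thus "?P j x = 0" by (intro phi_vanish) auto
    qed simp
    thus False by (simp add: a_def)
  qed
  have L2: "L2_set u ?J > 0" "(L2_set u ?J)\<^sup>2 = ip ?J u u"
    using u0 by (auto simp: L2_set_def ip_def power2_eq_square sum_nonneg)
  define s where "s = sqrt (real N) / L2_set u ?J"
  have s: "s > 0" "s * s * ip ?J u u = real N"
    using L2 kN by (auto simp: s_def field_simps power2_eq_square)
  have p': "?p (Suc m) = (\<lambda>x. s * u x)" unfolding p s_def by simp
  have pp: "ip ?J (?p (Suc m)) (?p (Suc m)) = real N"
    unfolding p' ip_scale_left ip_scale_right using s by simp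
  have po: "ip ?J (?p (Suc m)) (?p l) = 0" "ip ?J (?p l) (?p (Suc m)) = 0" if "l \<in> {1..m}" for l
    using u_orth[OF that] by (simp_all add: p' ip_scale_left ip_scale_right ip_commute[of _ _ u])
  have sub1: "fun_span (?p ` {1..m}) \<subseteq> fun_span (?p ` {1..Suc m})"
    and sub2: "fun_span (?P ` {1..m}) \<subseteq> fun_span (?P ` {1..Suc m})"
    by (intro fun_span_mono; force)+
  have "?P ` {1..Suc m} \<subseteq> fun_span (?p ` {1..Suc m})"
  proof -
    have "?P l \<in> fun_span (?p ` {1..Suc m})" if "l \<in> {1..m}" for l
      using span fun_span_base[of "?P ` {1..m}" "?P l"] that sub1 by auto
    moreover have "?P (Suc m) = (\<lambda>x. (1/s) * ?p (Suc m) x +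
        (\<Sum>l\<in>{1..m}. ip ?J (?P (Suc m)) (?p l) / real N * ?p l x))"
      using s unfolding p' u by simp
    moreover have "(\<lambda>x. (1/s) * ?p (Suc m) x +
        (\<Sum>l\<in>{1..m}. ip ?J (?P (Suc m)) (?p l) / real N * ?p l x)) \<in> fun_span (?p ` {1..Suc m})"
      using u_span sub1
      by (intro fun_span_add[OF fun_span_scale[OF fun_span_base]]) auto
    ultimately show ?thesis by (auto simp: atLeastAtMostSuc_conv)
  qed
  moreover have "?p ` {1..Suc m} \<subseteq> fun_span (?P ` {1..Suc m})"
  proof -
    have "?p l \<in> fun_span (?P ` {1..Suc m})" if "l \<in> {1..m}" for l
      using span fun_span_base[of "?p ` {1..m}" "?p l"] that sub2 by auto
    moreover have "?p (Suc m) \<in> fun_span (?P ` {1..Suc m})"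
      unfolding p' u using u_span sub2 span
      by (intro fun_span_scale fun_span_diff[OF fun_span_base]) auto
    ultimately show ?thesis by (auto simp: atLeastAtMostSuc_conv)
  qed
  ultimately have "fun_span (?P ` {1..Suc m}) = fun_span (?p ` {1..Suc m})"
    by (meson fun_span_subset subset_antisym)
  moreover have "ip ?J (?p l) (?p l') = (if l = l' then real N else 0)"
    if "l \<in> {1..Suc m}" "l' \<in> {1..Suc m}" for l l'
    using that orth pp po by (cases "l = Suc m"; cases "l' = Suc m") auto
  ultimately show ?case by blast
qed simp

lemma phi_t_orthogonal: "l \<in> {1..k} \<Longrightarrow> l' \<in> {1..k} \<Longrightarrow>
    ip {1..N} (phi_t N k l) (phi_t N k l') = (if l = l' then real N else 0)"
  using phi_t_Gram_Schmidt[of k] by simp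

lemma phi_t_high: "j > k \<Longrightarrow> phi_t N k j =
    (\<lambda>x. phi N k j x - (\<Sum>l\<in>{1..k}. ip {1..N} (phi N k j) (phi_t N k l) / real N * phi_t N k l x))"
proof -
  assume j: "j > k"
  have "anti_proj {1..N} ((\<lambda>l. phi N l l) ` {1..k}) (phi N k j) =
    (\<lambda>x. phi N k j x - (\<Sum>l\<in>{1..k}. ip {1..N} (phi N k j) (phi_t N k l) / real N * phi_t N k l x))"
  proof (rule anti_proj_orthogonal)
    fix l x assume "l \<in> {1..k}" "x \<notin> {1..N}"
    thus "phi N l l x = 0" by (intro phi_vanish) auto
  qed (use phi_t_Gram_Schmidt[of k] kN in simp_all)
  thus ?thesis using j by (simp only: phi_t_def[of N k j] not_le[symmetric] if_False)
qed

lemma fun_span_phi_t: "fun_span ((\<lambda>l. phi N l l) ` {1..k}) = fun_span (phi_t N k ` {1..k})"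
  using phi_t_Gram_Schmidt[of k] by simp

lemma phi_t_vanish: "1 \<le> l \<Longrightarrow> x \<notin> {1..N} \<Longrightarrow> phi_t N k l x = 0"
proof -
  assume *: "1 \<le> l" "x \<notin> {1..N}"
  have low: "phi_t N k l' x = 0" if "l' \<in> {1..k}" for l'
  proof -
    have "phi_t N k l' \<in> fun_span ((\<lambda>l. phi N l l) ` {1..k})"
      unfolding fun_span_phi_t using that by (intro fun_span_base) auto
    thus ?thesis
      by (rule fun_span_vanish) (use * in \<open>auto intro!: phi_vanish\<close>)
  qed
  show ?thesis
  proof (cases "l \<le> k")
    case False
    hence "phi N k l x = 0" using * k by (intro phi_vanish) auto
    thus ?thesis using False low by (simp add: phi_t_high)
  qed (use low * in auto)
qed

lemma qker_symmetric: "qker N k c x y = qker N k c y x"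
  by (cases "x = y") (auto simp: qker_def mult.commute)

lemma qker_sum: "x \<in> {1..N} \<Longrightarrow> y \<in> {1..N} \<Longrightarrow> (\<Sum>c=0..k. qker N k c x y) = (if x = y then 1 else 0)"
  by (simp add: sum.atLeast_Suc_atMost qker_def One_nat_def)

lemma qker_0_apply: "x \<in> {1..N} \<Longrightarrow> (\<Sum>y=1..N. qker N k 0 x y * u y) =
    u x - (\<Sum>l\<in>{1..k}. ip {1..N} u (phi_t N k l) / real N * phi_t N k l x)"
proof -
  assume x: "x \<in> {1..N}"
  have "(\<Sum>y=1..N. qker N k 0 x y * u y) = (\<Sum>y=1..N. if y = x then u y else 0)
      - (\<Sum>y=1..N. \<Sum>l=1..k. phi_t N k l x * phi_t N k l y / real N * u y)"
    unfolding sum_subtractf[symmetric] qker_def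
    by (intro sum.cong) (auto simp: left_diff_distrib sum_distrib_right)
  also have "(\<Sum>y=1..N. \<Sum>l=1..k. phi_t N k l x * phi_t N k l y / real N * u y)
     = (\<Sum>l\<in>{1..k}. ip {1..N} u (phi_t N k l) / real N * phi_t N k l x)"
    unfolding ip_def sum_divide_distrib sum_distrib_right
    by (subst sum.swap) (simp add: mult_ac)
  finally show ?thesis using x by simp
qed

lemma qker_c_apply: "c \<noteq> 0 \<Longrightarrow> (\<Sum>y=1..N. qker N k c x y * u y) =
    ip {1..N} u (phi_t N k c) / real N * phi_t N k c x"
  unfolding ip_def sum_divide_distrib sum_distrib_right by (simp add: qker_def mult_ac)

lemma qker_0_phi_t_low: "l \<in> {1..k} \<Longrightarrow> x \<in> {1..N} \<Longrightarrow> (\<Sum>y=1..N. qker N k 0 x y * phi_t N k l y) = 0"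
proof -
  assume l: "l \<in> {1..k}" and x: "x \<in> {1..N}"
  have "(\<Sum>l'\<in>{1..k}. ip {1..N} (phi_t N k l) (phi_t N k l') / real N * phi_t N k l' x)
    = (\<Sum>l'\<in>{1..k}. if l' = l then phi_t N k l x else 0)"
    using l kN by (intro sum.cong refl) (subst phi_t_orthogonal, auto)
  thus ?thesis using l unfolding qker_0_apply[OF x] by simp
qed

lemma phi_t_high_orthogonal: "l \<in> {1..k} \<Longrightarrow> j > k \<Longrightarrow> ip {1..N} (phi_t N k j) (phi_t N k l) = 0"
proof -
  assume l: "l \<in> {1..k}" and j: "j > k"
  have "ip {1..N} (\<lambda>x. \<Sum>l'\<in>{1..k}. ip {1..N} (phi N k j) (phi_t N k l') / real N * phi_t N k l' x) (phi_t N k l)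
     = (\<Sum>l'\<in>{1..k}. ip {1..N} (phi N k j) (phi_t N k l') / real N * ip {1..N} (phi_t N k l') (phi_t N k l))"
    by (simp only: ip_sum_left ip_scale_left)
  also have "\<dots> = (\<Sum>l'\<in>{1..k}. if l' = l then ip {1..N} (phi N k j) (phi_t N k l) else 0)"
    using l kN by (intro sum.cong refl) (subst phi_t_orthogonal, auto)
  finally show ?thesis using l by (subst phi_t_high[OF j]) (simp add: ip_diff_left)
qed

lemma qker_0_phi_t_high: "j > k \<Longrightarrow> x \<in> {1..N} \<Longrightarrow>
    (\<Sum>y=1..N. qker N k 0 x y * phi_t N k j y) = phi_t N k j x"
  by (subst qker_0_apply) (auto simp: phi_t_high_orthogonal intro!: sum.neutral)

text \<open>The kernels belong to projections onto mutually orthogonal spaces, so composition is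
  diagonal in the selector. Everything reduces to the action on low-order atoms, also for the
  complement kernel, which is the identity minus their kernels.\<close>

lemma qker_compose:
  assumes "c \<le> k" "c' \<le> k" "x \<in> {1..N}" "y \<in> {1..N}"
  shows "(\<Sum>z=1..N. qker N k c x z * qker N k c' z y) = (if c = c' then qker N k c x y else 0)"
proof -
  have low: "(\<Sum>z=1..N. qker N k c x z * phi_t N k l z) = (if c = l then phi_t N k l x else 0)"
    if "l \<in> {1..k}" for l
  proof (cases "c = 0")
    case False
    hence "c \<in> {1..k}" using assms by auto
    have "(\<Sum>z=1..N. qker N k c x z * phi_t N k l z) =
        ip {1..N} (phi_t N k l) (phi_t N k c) / real N * phi_t N k c x"
      by (rule qker_c_apply[OF False])
    also have "\<dots> = (if c = l then phi_t N k l x else 0)"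
      unfolding phi_t_orthogonal[OF that \<open>c \<in> {1..k}\<close>] using kN by simp
    finally show ?thesis .
  qed (use that assms qker_0_phi_t_low in auto)
  show ?thesis
  proof (cases "c' = 0")
    case False
    hence c': "c' \<in> {1..k}" using assms by auto
    have "(\<Sum>z=1..N. qker N k c x z * qker N k c' z y) = (\<Sum>z=1..N. qker N k c x z * phi_t N k c' z) * phi_t N k c' y / real N"
      using False by (simp add: qker_def[of N k c'] sum_distrib_right sum_divide_distrib mult.assoc)
    also have "\<dots> = (if c = c' then phi_t N k c' x else 0) * phi_t N k c' y / real N"
      unfolding low[OF c'] ..
    finally show ?thesis using False by (auto simp: qker_def)
  next
    case True
    have "(\<Sum>z=1..N. qker N k c x z * qker N k 0 z y) = (\<Sum>z=1..N. if z = y then qker N k c x y else 0)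
       - (\<Sum>z=1..N. \<Sum>l=1..k. qker N k c x z * phi_t N k l z * (phi_t N k l y / real N))"
      unfolding sum_subtractf[symmetric] qker_def[of N k 0]
      by (intro sum.cong refl) (auto simp: right_diff_distrib sum_distrib_left mult.assoc)
    also have "(\<Sum>z=1..N. \<Sum>l=1..k. qker N k c x z * phi_t N k l z * (phi_t N k l y / real N))
       = (\<Sum>l=1..k. (\<Sum>z=1..N. qker N k c x z * phi_t N k l z) * (phi_t N k l y / real N))"
      by (subst sum.swap) (simp only: sum_distrib_right)
    also have "\<dots> = (\<Sum>l=1..k. if l = c then phi_t N k c x * (phi_t N k c y / real N) else 0)"
      by (intro sum.cong refl) (subst low, auto)
    also have "\<dots> = (if c = 0 then 0 else qker N k c x y)"
      using assms by (auto simp: qker_def)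
    finally show ?thesis using assms True by auto
  qed
qed

lemma dker_phi_t_low:
  assumes "\<kappa> \<in> {k+1..N}" "l \<in> {1..k}" shows "(\<Sum>x=1..N. dker N k \<kappa> x * phi_t N k l x) = 0"
proof -
  have "phi_t N k l \<in> fun_span ((\<lambda>l. phi N l l) ` {1..k})"
    unfolding fun_span_phi_t using assms by (intro fun_span_base) auto
  hence "ip {1..N} (dker N k \<kappa>) (phi_t N k l) = 0"
  proof (rule fun_span_orth)
    fix w assume "w \<in> (\<lambda>l. phi N l l) ` {1..k}"
    then obtain j where j: "j \<in> {1..k}" "w = phi N j j" by auto
    thus "ip {1..N} (dker N k \<kappa>) w = 0"
      using dker_phi[OF k assms(1), of j] phi_low[of j k N] kN assms by (simp add: ip_def)
  qed
  thus ?thesis by (simp add: ip_def)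
qed

text \<open>The kernel for c = 0 differs from the identity by low-order atoms only, and these have
  vanishing differences.\<close>

lemma dker_qker_0:
  assumes "\<kappa> \<in> {k+1..N}" "y \<in> {1..N}"
  shows "(\<Sum>x=1..N. dker N k \<kappa> x * qker N k 0 x y) = dker N k \<kappa> y"
proof -
  have "(\<Sum>x=1..N. dker N k \<kappa> x * qker N k 0 x y) = (\<Sum>x=1..N. if x = y then dker N k \<kappa> y else 0)
     - (\<Sum>x=1..N. \<Sum>l=1..k. dker N k \<kappa> x * phi_t N k l x * (phi_t N k l y / real N))"
    unfolding sum_subtractf[symmetric] qker_def
    by (intro sum.cong refl) (auto simp: right_diff_distrib sum_distrib_left mult.assoc)
  also have "(\<Sum>x=1..N. \<Sum>l=1..k. dker N k \<kappa> x * phi_t N k l x * (phi_t N k l y / real N))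
     = (\<Sum>l=1..k. (\<Sum>x=1..N. dker N k \<kappa> x * phi_t N k l x) * (phi_t N k l y / real N))"
    by (subst sum.swap) (simp only: sum_distrib_right)
  also have "\<dots> = 0" by (intro sum.neutral ballI) (subst dker_phi_t_low, use assms in auto)
  finally show ?thesis using assms by simp
qed

text \<open>Reconstruction from differences. By triangularity the atoms of order k form a basis;
  duality reads off the coefficients with index above k as differences, and the projection kills the
  remaining atoms and turns \<open>phi\<close> into \<open>phi_t\<close>.\<close>

lemma qker_0_synthesis:
  assumes "x \<in> {1..N}"
  shows "(\<Sum>y=1..N. qker N k 0 x y * u y) =
    (\<Sum>\<kappa>=k+1..N. (\<Sum>y=1..N. dker N k \<kappa> y * u y) * phi_t N k \<kappa> x)"
proof -
  have "\<exists>a. \<forall>x\<in>{1..N}. u x = (\<Sum>j=1..N. a j * phi N k j x)"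
  proof (rule triangular_expansion)
    fix j assume "j \<in> {1..N}"
    thus "phi N k j j \<noteq> 0" using phi_diag_pos[of k j N] k by simp
  next
    fix j x :: nat assume "j \<in> {1..N}" "x < j"
    thus "phi N k j x = 0" using k by (intro phi_vanish) auto
  qed
  then obtain a where a: "\<And>x. x \<in> {1..N} \<Longrightarrow> u x = (\<Sum>j=1..N. a j * phi N k j x)" by auto
  have swap: "(\<Sum>y=1..N. F y * u y) = (\<Sum>j=1..N. a j * (\<Sum>y=1..N. F y * phi N k j y))" for F :: "nat \<Rightarrow> real"
  proof -
    have "(\<Sum>y=1..N. F y * u y) = (\<Sum>y=1..N. \<Sum>j=1..N. a j * (F y * phi N k j y))"
      by (intro sum.cong) (auto simp: a sum_distrib_left algebra_simps)
    thus ?thesis by (subst (asm) sum.swap) (simp add: sum_distrib_left)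
  qed
  have D: "(\<Sum>y=1..N. dker N k \<kappa> y * u y) = a \<kappa>" if "\<kappa> \<in> {k+1..N}" for \<kappa>
  proof -
    have "(\<Sum>y=1..N. dker N k \<kappa> y * u y) = (\<Sum>j=1..N. if j = \<kappa> then a \<kappa> else 0)"
      unfolding swap by (intro sum.cong refl) (subst dker_phi[OF k that], auto)
    thus ?thesis using that k by auto
  qed
  have Q: "(\<Sum>y=1..N. qker N k 0 x y * phi N k j y) = (if j \<le> k then 0 else phi_t N k j x)"
    if "j \<in> {1..N}" for j
  proof (cases "j \<le> k")
    case False
    thus ?thesis using qker_0_apply[OF assms, of "phi N k j"] by (simp add: phi_t_high)
  next
    case True
    hence "phi N k j \<in> fun_span (phi_t N k ` {1..k})"
      unfolding fun_span_phi_t[symmetric] using that phi_low[of j k N] by (intro fun_span_base) auto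
    hence "ip {1..N} (\<lambda>y. qker N k 0 x y) (phi N k j) = 0"
      by (rule fun_span_orth) (use qker_0_phi_t_low assms in \<open>auto simp: ip_def\<close>)
    thus ?thesis using True by (simp add: ip_def)
  qed
  have "(\<Sum>y=1..N. qker N k 0 x y * u y) = (\<Sum>j=1..N. a j * (if j \<le> k then 0 else phi_t N k j x))"
    unfolding swap by (intro sum.cong refl) (subst Q, auto)
  also have "\<dots> = (\<Sum>j=k+1..N. a j * phi_t N k j x)"
    by (intro sum.mono_neutral_cong_right) auto
  also have "\<dots> = (\<Sum>\<kappa>=k+1..N. (\<Sum>y=1..N. dker N k \<kappa> y * u y) * phi_t N k \<kappa> x)"
    by (intro sum.cong refl) (subst D, auto)
  finally show ?thesis .
qed

end

section \<open>Norms of atoms and their approximation by the atoms at a block of knots\<close>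

lemma ip_self_le_of_projection:
  assumes "ip J v v = ip J v u" shows "ip J v v \<le> ip J u u"
proof -
  have "0 \<le> ip J (\<lambda>x. u x - v x) (\<lambda>x. u x - v x)" by simp
  also have "\<dots> = ip J u u - ip J v v"
    using assms by (simp add: ip_diff_left ip_diff_right ip_commute[of J u v])
  finally show ?thesis by simp
qed

lemma binomial_le_Suc_power: "(r + m) choose m \<le> Suc r ^ m"
proof (induction m)
  case (Suc m)
  have "Suc m * ((r + Suc m) choose Suc m) = Suc (r + m) * ((r + m) choose m)"
    using Suc_times_binomial[of m "r + m"] by simp
  also have "\<dots> \<le> (Suc m * Suc r) * Suc r ^ m"
    by (intro mult_mono Suc.IH) auto
  finally show ?case by (simp only: mult.assoc Suc_mult_le_cancel1 power_Suc)
qed simp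

text \<open>Distance from j to the block of k consecutive knots t, ..., t + k - 1. Truncated
  subtraction makes it zero on the block itself.\<close>

definition knot_dist :: "nat \<Rightarrow> nat \<Rightarrow> nat \<Rightarrow> nat" where
  "knot_dist k t j = (if j \<le> t then t - j else j - (t + k - 1))"

text \<open>Origin of the exponent 2k - 1: at most D entries, each with square at most (D/N)^(2k-2),
  give D (D/N)^(2k-2) = N (D/N)^(2k-1).\<close>

lemma sum_sq_le_knot:
  fixes e :: "nat \<Rightarrow> real"
  assumes "1 \<le> k" "N > 0" "finite J" "A \<subseteq> J" "card A \<le> D" "\<And>x. x \<in> J - A \<Longrightarrow> e x = 0"
    and "\<And>x. x \<in> A \<Longrightarrow> \<bar>e x\<bar> \<le> real D ^ (k - 1) / real N ^ (k - 1)"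
  shows "ip J e e \<le> real N * (real D / real N) ^ (2 * k - 1)"
proof -
  have "ip J e e = (\<Sum>x\<in>A. (e x)\<^sup>2)"
    unfolding ip_def using assms by (intro sum.mono_neutral_cong_right) (auto simp: power2_eq_square)
  also have "\<dots> \<le> (\<Sum>x\<in>A. (real D ^ (k - 1) / real N ^ (k - 1))\<^sup>2)"
    using assms(7) by (intro sum_mono) (metis abs_ge_zero power2_abs power_mono)
  also have "\<dots> \<le> real D * (real D ^ (k - 1) / real N ^ (k - 1))\<^sup>2"
    using assms(5) by (simp add: mult_right_mono)
  also have "\<dots> = real N * (real D / real N) ^ (2 * k - 1)"
  proof -
    have "2 * k - 1 = Suc ((k - 1) * 2)" using assms(1) by simp
    thus ?thesis using assms(2) by (simp only: power_Suc power_mult power_divide) (simp add: field_simps power2_eq_square)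
  qed
  finally show ?thesis .
qed

context
  fixes N k :: nat
  assumes k: "1 \<le> k" and kN: "k < N"
  notes One_nat_def [simp del]
begin

lemma qker_0_contraction:
  "ip {1..N} (\<lambda>x. \<Sum>y=1..N. qker N k 0 x y * u y) (\<lambda>x. \<Sum>y=1..N. qker N k 0 x y * u y)
     \<le> ip {1..N} u u"
proof (rule ip_self_le_of_projection)
  define Q where "Q = (\<lambda>u x. \<Sum>y=1..N. qker N k 0 x y * u y)"
  have sym: "ip {1..N} (Q u) v = ip {1..N} u (Q v)" for u v
    unfolding ip_def Q_def sum_distrib_left sum_distrib_right
    by (subst sum.swap) (simp add: qker_symmetric[OF k kN] mult_ac)
  have idem: "Q (Q u) x = Q u x" if x: "x \<in> {1..N}" for x
  proof -
    have "Q (Q u) x = (\<Sum>z=1..N. \<Sum>y=1..N. qker N k 0 x y * qker N k 0 y z * u z)"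
      unfolding Q_def sum_distrib_left by (subst sum.swap) (simp add: mult.assoc)
    also have "\<dots> = (\<Sum>z=1..N. (\<Sum>y=1..N. qker N k 0 x y * qker N k 0 y z) * u z)"
      by (simp only: sum_distrib_right)
    also have "\<dots> = Q u x"
      unfolding Q_def using x by (intro sum.cong refl) (subst qker_compose[OF k kN], auto)
    finally show ?thesis .
  qed
  have "ip {1..N} (Q u) (Q u) = ip {1..N} (Q (Q u)) u"
    using sym[of "Q u" u] by simp
  also have "\<dots> = ip {1..N} (Q u) u" by (intro ip_cong idem) auto
  finally show "ip {1..N} (\<lambda>x. \<Sum>y=1..N. qker N k 0 x y * u y) (\<lambda>x. \<Sum>y=1..N. qker N k 0 x y * u y)
     = ip {1..N} (\<lambda>x. \<Sum>y=1..N. qker N k 0 x y * u y) u" by (simp only: Q_def)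
qed

lemma phi_t_high_qker: "j > k \<Longrightarrow> x \<in> {1..N} \<Longrightarrow>
    phi_t N k j x = (\<Sum>y=1..N. qker N k 0 x y * phi N k j y)"
  using qker_0_apply[OF k kN, of x "phi N k j"] by (simp add: phi_t_high[OF k kN])

text \<open>Projecting does not increase the norm, and the normalisation by N^(k-1) keeps the
  entries of the raw atom in [0, 1].\<close>

lemma phi_t_high_norm: assumes "j > k" shows "ip {1..N} (phi_t N k j) (phi_t N k j) \<le> real N"
proof -
  have "ip {1..N} (phi_t N k j) (phi_t N k j) \<le> ip {1..N} (phi N k j) (phi N k j)"
    using qker_0_contraction[of "phi N k j"] assms
    by (subst ip_cong[OF phi_t_high_qker phi_t_high_qker]) auto
  also have "\<dots> \<le> (\<Sum>x=1..N. 1)"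
    unfolding ip_def
  proof (intro sum_mono)
    fix x assume x: "x \<in> {1..N}"
    have "0 \<le> phi N k j x \<and> phi N k j x \<le> 1"
    proof (cases "j \<le> x")
      case True
      have "(x - j + (k - 1)) choose (k - 1) \<le> Suc (x - j) ^ (k - 1)"
        by (rule binomial_le_Suc_power)
      also have "\<dots> \<le> N ^ (k - 1)" using True x assms k by (intro power_mono) auto
      finally have "real ((x - j + (k - 1)) choose (k - 1)) \<le> real N ^ (k - 1)"
        by (metis of_nat_le_iff of_nat_power)
      thus ?thesis using phi_eq_high[of "k - 1" j N x] k kN assms True x by simp
    qed (use phi_eq_high[of "k - 1" j N x] k assms in simp)
    thus "phi N k j x * phi N k j x \<le> 1" by (simp add: mult_le_one)
  qed
  finally show ?thesis by simp
qed

(* The approximant keeps the polynomial piece of phi right of the knots; its k-th differences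
   vanish except at the k knots. *)
lemma phi_t_knot_approximation:
  assumes t: "k + 1 \<le> t" "t + k - 1 \<le> N" and j: "j \<in> {k+1..N}"
  obtains p where "p \<in> fun_span (phi_t N k ` {t..t+k-1})"
    "ip {1..N} (\<lambda>x. phi_t N k j x - p x) (\<lambda>x. phi_t N k j x - p x)
       \<le> real N * (real (knot_dist k t j) / real N) ^ (2 * k - 1)"
proof -
  define poly where "poly = (\<lambda>x::nat. ((real x - real j + real k - 1) gchoose (k - 1)) / real N ^ (k - 1))"
  define v where "v = (\<lambda>x. if t \<le> x then poly x else 0)"
  define e where "e = (\<lambda>x. phi N k j x - v x)"
  define D where "D = (\<lambda>\<kappa>. \<Sum>y=1..N. dker N k \<kappa> y * v y)"
  define p where "p = (\<lambda>x. \<Sum>\<kappa>=t..t+k-1. D \<kappa> * phi_t N k \<kappa> x)"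
  \<comment> \<open>A stencil ending before t sees only zeros, and one ending at t + k or later sees
    only the polynomial, of degree k - 1. Only the k stencils straddling the cut survive.\<close>
  have D0: "D \<kappa> = 0" if "\<kappa> \<in> {k+1..N}" "\<kappa> \<notin> {t..t+k-1}" for \<kappa>
  proof (cases "\<kappa> < t")
    case True
    hence "altsum k (\<lambda>l. v (\<kappa> - l)) = altsum k (\<lambda>l. 0 * 1)"
      by (intro altsum_cong) (auto simp: v_def)
    thus ?thesis unfolding D_def dker_sum[OF that(1)] by (simp add: altsum_def)
  next
    case False
    hence "altsum k (\<lambda>l. v (\<kappa> - l)) =
       altsum k (\<lambda>l. (1 / real N ^ (k - 1)) * (((real \<kappa> - real j + real k - 1) - real l) gchoose (k - 1)))"
      using that by (intro altsum_cong) (auto simp: v_def poly_def algebra_simps)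
    also have "\<dots> = 0" using k by (subst altsum_scale, subst altsum_gbinomial) auto
    finally show ?thesis unfolding D_def dker_sum[OF that(1)] by simp
  qed
  have Qe: "phi_t N k j x - p x = (\<Sum>y=1..N. qker N k 0 x y * e y)" if x: "x \<in> {1..N}" for x
  proof -
    have "(\<Sum>y=1..N. qker N k 0 x y * v y) = (\<Sum>\<kappa>=k+1..N. D \<kappa> * phi_t N k \<kappa> x)"
      unfolding D_def by (rule qker_0_synthesis[OF k kN x])
    also have "\<dots> = p x"
      unfolding p_def using t D0 by (intro sum.mono_neutral_right) auto
    finally show ?thesis
      using j x by (subst phi_t_high_qker) (auto simp: e_def right_diff_distrib sum_subtractf)
  qed
  have "ip {1..N} (\<lambda>x. phi_t N k j x - p x) (\<lambda>x. phi_t N k j x - p x) \<le> ip {1..N} e e"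
    using qker_0_contraction[of e] by (subst ip_cong[OF Qe Qe]) auto
  also have "\<dots> \<le> real N * (real (knot_dist k t j) / real N) ^ (2 * k - 1)"
  proof (cases "j \<le> t")
    case True
    \<comment> \<open>For j \<le> t the error is the part of the atom that the cut at t removes; it
      occupies t - j points.\<close>
    have val: "e x = (if x \<in> {j..<t} then real ((x - j + (k - 1)) choose (k - 1)) / real N ^ (k - 1) else 0)"
      if "x \<in> {1..N}" for x
    proof -
      have "poly x = real ((x - j + (k - 1)) choose (k - 1)) / real N ^ (k - 1)" if "j \<le> x"
      proof -
        have "real x - real j + real k - 1 = real (x - j + (k - 1))" using that k by simp
        thus ?thesis unfolding poly_def by (simp only: binomial_gbinomial)
      qed
      thus ?thesis
        using phi_eq_high[of "k - 1" j N x] k j that True by (auto simp: e_def v_def)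
    qed
    show ?thesis
    proof (rule sum_sq_le_knot[OF k, where A = "{j..<t}"])
      fix x assume x: "x \<in> {j..<t}"
      have "(x - j + (k - 1)) choose (k - 1) \<le> Suc (x - j) ^ (k - 1)"
        by (rule binomial_le_Suc_power)
      also have "\<dots> \<le> knot_dist k t j ^ (k - 1)"
        using x True by (intro power_mono) (auto simp: knot_dist_def)
      finally have "real ((x - j + (k - 1)) choose (k - 1)) \<le> real (knot_dist k t j) ^ (k - 1)"
        by (metis of_nat_le_iff of_nat_power)
      moreover have "e x = real ((x - j + (k - 1)) choose (k - 1)) / real N ^ (k - 1)"
      proof -
        have "x < t" "1 \<le> x" using x j by auto
        hence "x \<in> {1..N}" using t(2) k by (simp only: atLeastAtMost_iff) arith
        thus ?thesis using val x by simp
      qed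
      ultimately show "\<bar>e x\<bar> \<le> real (knot_dist k t j) ^ (k - 1) / real N ^ (k - 1)"
        by (simp only: abs_divide abs_of_nat power_abs) (rule divide_right_mono, auto)
    qed (use t j True val in \<open>auto simp: knot_dist_def\<close>)
  next
    case False
    \<comment> \<open>Upper negation: continued to the left of the knot, the polynomial takes
      binomial values again, now with the argument counting downwards from the knot.\<close>
    have v_val: "\<bar>poly x\<bar> = real ((j - 1 - x) choose (k - 1)) / real N ^ (k - 1)" if "x < j" for x
    proof -
      have "real (k - 1) - (real x - real j + real k - 1) - 1 = real (j - 1 - x)"
        using that k by simp
      hence "(real x - real j + real k - 1) gchoose (k - 1) = (-1) ^ (k - 1) * real ((j - 1 - x) choose (k - 1))"
        by (subst gbinomial_negated_upper) (simp only: binomial_gbinomial)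
      thus ?thesis by (simp add: poly_def abs_mult)
    qed
    have e_val: "e x = (if x \<in> {t..<j} then - poly x else 0)" if "x \<in> {1..N}" for x
    proof -
      have "poly x = real ((x - j + (k - 1)) choose (k - 1)) / real N ^ (k - 1)" if "j \<le> x"
      proof -
        have "real x - real j + real k - 1 = real (x - j + (k - 1))" using that k by simp
        thus ?thesis unfolding poly_def by (simp only: binomial_gbinomial)
      qed
      thus ?thesis
        using phi_eq_high[of "k - 1" j N x] k j that False by (auto simp: e_def v_def)
    qed
    \<comment> \<open>For j > t the error is the polynomial continued backwards from j to t. It
      vanishes at the last k - 1 points before j, so only t, ..., j - k remain. These are j - (t + k
      - 1) points, which is why the distance is measured from the far end of the block.\<close>
    show ?thesis
    proof (rule sum_sq_le_knot[OF k, where A = "{t..<j - k + 1}"])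
      fix x assume x: "x \<in> {t..<j - k + 1}"
      define r where "r = j - 1 - x - (k - 1)"
      have r: "j - 1 - x = r + (k - 1)" "Suc r \<le> knot_dist k t j"
        using x False k j by (auto simp: r_def knot_dist_def One_nat_def)
      have "(j - 1 - x) choose (k - 1) \<le> Suc r ^ (k - 1)"
        unfolding r(1) by (rule binomial_le_Suc_power)
      also have "\<dots> \<le> knot_dist k t j ^ (k - 1)" using r by (intro power_mono) auto
      finally have "real ((j - 1 - x) choose (k - 1)) \<le> real (knot_dist k t j) ^ (k - 1)"
        by (metis of_nat_le_iff of_nat_power)
      thus "\<bar>e x\<bar> \<le> real (knot_dist k t j) ^ (k - 1) / real N ^ (k - 1)"
      proof -
        have "x \<in> {1..N}" "x \<in> {t..<j}" using x t j k by auto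
        hence "\<bar>e x\<bar> = real ((j - 1 - x) choose (k - 1)) / real N ^ (k - 1)"
          using e_val v_val[of x] by simp
        thus ?thesis
          using \<open>real ((j - 1 - x) choose (k - 1)) \<le> real (knot_dist k t j) ^ (k - 1)\<close>
          by (simp only:) (rule divide_right_mono, auto)
      qed
    next
      fix x assume x: "x \<in> {1..N} - {t..<j - k + 1}"
      show "e x = 0"
      proof (cases "x \<in> {t..<j}")
        case True
        hence "(j - 1 - x) choose (k - 1) = 0" using x j k by (intro binomial_eq_0) auto
        hence "\<bar>poly x\<bar> = 0" using True v_val[of x] by simp
        thus ?thesis using e_val[of x] x by simp
      qed (use e_val[of x] x in auto)
    next
      show "card {t..<j - k + 1} \<le> knot_dist k t j"
        using False j k by (auto simp: knot_dist_def)
    qed (use t j k in auto)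
  qed
  finally have "ip {1..N} (\<lambda>x. phi_t N k j x - p x) (\<lambda>x. phi_t N k j x - p x)
       \<le> real N * (real (knot_dist k t j) / real N) ^ (2 * k - 1)" .
  moreover have "p \<in> fun_span (phi_t N k ` {t..t+k-1})"
    unfolding p_def by (intro fun_span_sum fun_span_base) auto
  ultimately show ?thesis using that by blast
qed

end

section \<open>Finite differences of bump functions\<close>

text \<open>Iterated mean value theorem. The family \<open>g\<close> lists a function with its
  successive derivatives, so the induction can pass to the unit differences of all members: this is
  again such a list, shorter by one, and a single mean value bounds its last member.\<close>

lemma altsum_le_derivative:
  assumes "\<And>i x. i < k \<Longrightarrow> x \<in> {y..y + real k} \<Longrightarrow> (g i has_real_derivative g (Suc i) x) (at x)"
    and "\<And>x. x \<in> {y..y + real k} \<Longrightarrow> \<bar>g k x\<bar> \<le> B"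
  shows "\<bar>altsum k (\<lambda>l. g 0 (y + real l))\<bar> \<le> B"
  using assms
proof (induction k arbitrary: g)
  case (Suc k)
  define g' where "g' = (\<lambda>i x. g i x - g i (x + 1))"
  have "\<bar>altsum k (\<lambda>l. g' 0 (y + real l))\<bar> \<le> B"
  proof (rule Suc.IH)
    fix i x assume i: "i < k" and x: "x \<in> {y..y + real k}"
    have "(g i has_real_derivative g (Suc i) x) (at x)" using i x by (intro Suc.prems(1)) auto
    moreover have "(g i has_real_derivative g (Suc i) (x + 1)) (at (x + 1))"
      using i x by (intro Suc.prems(1)) auto
    hence "((\<lambda>x. g i (x + 1)) has_real_derivative g (Suc i) (x + 1)) (at x)"
      by (simp add: DERIV_shift)
    ultimately show "(g' i has_real_derivative g' (Suc i) x) (at x)"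
      unfolding g'_def by (rule DERIV_diff)
  next
    fix x assume x: "x \<in> {y..y + real k}"
    have "\<exists>z>x. z < x + 1 \<and> g k (x + 1) - g k x = (x + 1 - x) * g (Suc k) z"
      using x by (intro MVT2 Suc.prems(1)) auto
    then obtain z where "z > x" "z < x + 1" "g k (x + 1) - g k x = g (Suc k) z" by auto
    thus "\<bar>g' k x\<bar> \<le> B"
      using Suc.prems(2)[of z] x unfolding g'_def by (simp add: abs_minus_commute)
  qed
  thus ?case by (simp add: altsum_Suc g'_def algebra_simps)
qed simp

lemma altsum_reflect: "altsum k c = (-1) ^ k * altsum k (\<lambda>l. c (k - l))"
proof -
  have "altsum k c = (\<Sum>l=0..k. (-1) ^ (k - l) * real (k choose (k - l)) * c (k - l))"
    unfolding altsum_def by (rule sum.reindex_bij_witness[of _ "\<lambda>l. k - l" "\<lambda>l. k - l"]) auto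
  also have "\<dots> = (\<Sum>l=0..k. (-1) ^ k * ((-1) ^ l * real (k choose l) * c (k - l)))"
  proof (intro sum.cong refl)
    fix l assume "l \<in> {0..k}"
    hence l: "l \<le> k" by simp
    have "(-1 :: real) ^ k = (-1) ^ (k - l) * (-1) ^ l"
      using l by (simp flip: power_add)
    hence "(-1 :: real) ^ k * (-1) ^ l = (-1) ^ (k - l) * ((-1) ^ l * (-1) ^ l)"
      by (simp only: mult.assoc)
    also have "(-1 :: real) ^ l * (-1) ^ l = 1" by (simp flip: power_add)
    finally show "(-1) ^ (k - l) * real (k choose (k - l)) * c (k - l) =
        (-1) ^ k * ((-1) ^ l * real (k choose l) * c (k - l))"
      using binomial_symmetric[OF l] by simp
  qed
  finally show ?thesis by (simp add: altsum_def sum_distrib_left)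
qed

text \<open>A profile that is 1 at the centre and 0 from \<rho> on. The exponent \<open>a\<close>
  fixes how fast it leaves the value 1; the k-th power produces a zero of order k at the edge, so
  that k-th differences stay small across it. The exponents used are k - 1/2 (rough) and k
  (smooth).\<close>

definition bump :: "real \<Rightarrow> nat \<Rightarrow> nat \<Rightarrow> real \<Rightarrow> real" where
  "bump a k \<rho> y = (if y < real \<rho> then (1 - (y / real \<rho>) powr a) ^ k else 0)"

text \<open>The factor 2^k is the sum of the binomial coefficients; the other factor bounds the k
  factors \<open>a * real m - real l\<close> produced by differentiating a power k times.\<close>

definition bump_const :: "nat \<Rightarrow> real" where
  "bump_const k = 2 ^ k * (real k ^ 2 + real k) ^ k"

text \<open>The offset is an integer because stencils lie on both sides of the centre: z is the
  position of the leftmost stencil point relative to it, and the profile is continued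
  evenly.\<close>

definition bump_diff :: "real \<Rightarrow> nat \<Rightarrow> nat \<Rightarrow> int \<Rightarrow> real" where
  "bump_diff a k \<rho> z = altsum k (\<lambda>l. bump a k \<rho> \<bar>real_of_int z + real l\<bar>)"

lemma bump_outside: "real \<rho> \<le> y \<Longrightarrow> bump a k \<rho> y = 0"
  by (simp add: bump_def)

lemma bump_at_0: "\<rho> > 0 \<Longrightarrow> bump a k \<rho> 0 = 1"
  by (simp add: bump_def)

lemma bump_arg_bounds:
  assumes "a \<ge> 0" "0 \<le> y" "y < real \<rho>" shows "0 \<le> (y / real \<rho>) powr a" "(y / real \<rho>) powr a \<le> 1"
  using assms by (auto intro!: powr_le1)

lemma bump_nonneg: "a \<ge> 0 \<Longrightarrow> 0 \<le> y \<Longrightarrow> 0 \<le> bump a k \<rho> y"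
  and bump_le_1: "a \<ge> 0 \<Longrightarrow> 0 \<le> y \<Longrightarrow> bump a k \<rho> y \<le> 1"
  using bump_arg_bounds[of a y \<rho>] by (auto simp: bump_def intro!: power_le_one)

lemma bump_deficit:
  assumes "a \<ge> 0" "0 \<le> y" "k \<ge> 1" "y < real \<rho>" shows "(y / real \<rho>) powr a \<le> 1 - bump a k \<rho> y"
proof -
  have "(1 - (y / real \<rho>) powr a) ^ k \<le> (1 - (y / real \<rho>) powr a) ^ 1"
    using assms bump_arg_bounds[of a y \<rho>] by (intro power_decreasing) auto
  thus ?thesis using assms by (simp add: bump_def)
qed

lemma bump_deficit_upper:
  assumes "a \<ge> 0" "0 \<le> y" "y < real \<rho>" shows "1 - bump a k \<rho> y \<le> real k * (y / real \<rho>) powr a"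
proof -
  have "1 + real k * (- ((y / real \<rho>) powr a)) \<le> (1 + - ((y / real \<rho>) powr a)) ^ k"
    using assms bump_arg_bounds[of a y \<rho>] by (intro Bernoulli_inequality) auto
  thus ?thesis using assms by (simp add: bump_def)
qed

context
  fixes a :: real and k \<rho> :: nat
  assumes a: "0 < a" "a \<le> real k" and k: "1 \<le> k" and \<rho>: "k < \<rho>"
begin

text \<open>A stencil strictly to one side of the centre and inside the radius sees a finite sum of
  powers. Its k-th derivative exists there and is of size \<rho>^(-a) x^(a-k), so the mean value
  bound applies.\<close>

lemma bump_inner_difference:
  assumes z: "0 < z" "z + real k \<le> real \<rho>"
  shows "\<bar>altsum k (\<lambda>l. bump a k \<rho> (z + real l))\<bar> \<le> bump_const k * (real \<rho> powr (-a) * z powr (a - real k))"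
proof -
  \<comment> \<open>Falling factorials, the coefficients of derivatives of powers;
    \<open>g i\<close> is the i-th derivative of the binomially expanded profile.\<close>
  define ff where "ff = (\<lambda>b i. \<Prod>l<i. b - real l)"
  define g where "g = (\<lambda>i x. \<Sum>m\<le>k. (real (k choose m) * (-1) ^ m * real \<rho> powr (- (a * real m))) *
     (ff (a * real m) i * x powr (a * real m - real i)))"
  have g0: "bump a k \<rho> x = g 0 x" if x: "0 < x" "x \<le> real \<rho>" for x
  proof -
    have "bump a k \<rho> x = (1 - (x / real \<rho>) powr a) ^ k"
      using x k \<rho> by (auto simp: bump_def)
    also have "\<dots> = (\<Sum>m\<le>k. real (k choose m) * (- ((x / real \<rho>) powr a)) ^ m)"
      using binomial_ring[of "- ((x / real \<rho>) powr a)" 1 k] by simp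
    also have "\<dots> = g 0 x"
      unfolding g_def
    proof (intro sum.cong refl)
      fix m
      have "(- ((x / real \<rho>) powr a)) ^ m = (-1) ^ m * ((x / real \<rho>) powr a) ^ m"
        by (rule power_minus)
      also have "((x / real \<rho>) powr a) ^ m = (x / real \<rho>) powr (a * real m)"
        using x by (simp add: powr_powr flip: powr_realpow)
      also have "\<dots> = real \<rho> powr (- (a * real m)) * x powr (a * real m)"
        using x \<rho> by (simp add: powr_divide powr_minus field_simps)
      finally show "real (k choose m) * (- ((x / real \<rho>) powr a)) ^ m =
        (real (k choose m) * (-1) ^ m * real \<rho> powr (- (a * real m))) *
         (ff (a * real m) 0 * x powr (a * real m - real 0))"
        by (simp add: ff_def)
    qed
    finally show ?thesis .
  qed
  have "\<bar>altsum k (\<lambda>l. g 0 (z + real l))\<bar> \<le> bump_const k * (real \<rho> powr (-a) * z powr (a - real k))"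
  proof (rule altsum_le_derivative)
    fix i x assume "i < k" and "x \<in> {z..z + real k}"
    hence x: "x > 0" using z by auto
    show "(g i has_real_derivative g (Suc i) x) (at x)"
      unfolding g_def
    proof (intro DERIV_sum DERIV_cmult)
      fix m
      have "((\<lambda>x. ff (a * real m) i * x powr (a * real m - real i)) has_real_derivative
        ff (a * real m) i * ((a * real m - real i) * x powr (a * real m - real i - 1))) (at x)"
        using x by (intro DERIV_cmult has_real_derivative_powr)
      thus "((\<lambda>x. ff (a * real m) i * x powr (a * real m - real i)) has_real_derivative
        ff (a * real m) (Suc i) * x powr (a * real m - real (Suc i))) (at x)"
        by (simp add: ff_def algebra_simps)
    qed
  next
    fix x assume "x \<in> {z..z + real k}"
    hence x: "z \<le> x" "x \<le> real \<rho>" "0 < x" using z by auto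
    have "\<bar>g k x\<bar> \<le> (\<Sum>m\<le>k. real (k choose m) * ((real k ^ 2 + real k) ^ k * (real \<rho> powr (-a) * z powr (a - real k))))"
      unfolding g_def
    proof (rule order_trans[OF sum_abs], intro sum_mono)
      fix m assume m: "m \<in> {..k}"
      have ff: "\<bar>ff (a * real m) k\<bar> \<le> (real k ^ 2 + real k) ^ k"
      proof -
        have "\<bar>ff (a * real m) k\<bar> = (\<Prod>l<k. \<bar>a * real m - real l\<bar>)"
          by (simp add: ff_def abs_prod)
        also have "\<dots> \<le> (\<Prod>l<k. real k ^ 2 + real k)"
        proof (intro prod_mono conjI)
          fix l assume "l \<in> {..<k}"
          moreover have "a * real m \<le> real k * real k" using a m by (intro mult_mono) auto
          moreover have "0 \<le> a * real m" using a by simp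
          ultimately show "\<bar>a * real m - real l\<bar> \<le> real k ^ 2 + real k"
            unfolding power2_eq_square abs_le_iff by auto
        qed simp
        finally show ?thesis by simp
      qed
      \<comment> \<open>The constant term m = 0 is differentiated away. Among the others m = 1
        dominates because x \<le> \<rho>; and since a \<le> k the remaining power of x decreases, so
        it is largest at z.\<close>
      have "\<bar>ff (a * real m) k\<bar> * (real \<rho> powr (- (a * real m)) * x powr (a * real m - real k))
          \<le> (real k ^ 2 + real k) ^ k * (real \<rho> powr (-a) * z powr (a - real k))"
      proof (cases "m = 0")
        case True
        have "ff 0 k = 0" unfolding ff_def using k by (intro prod_zero) auto
        thus ?thesis using True by simp
      next
        case False
        have "real \<rho> powr (- (a * real m)) * x powr (a * real m - real k) =
            (x / real \<rho>) powr (a * real m) * x powr (- real k)"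
          using x \<rho> by (simp add: powr_divide powr_minus powr_diff divide_simps)
        also have "\<dots> \<le> (x / real \<rho>) powr a * x powr (- real k)"
          using x \<rho> False a by (intro mult_right_mono powr_mono') auto
        also have "\<dots> = real \<rho> powr (-a) * x powr (a - real k)"
          using x \<rho> by (simp add: powr_divide powr_minus powr_diff divide_simps)
        also have "\<dots> \<le> real \<rho> powr (-a) * z powr (a - real k)"
          using x z a by (intro mult_left_mono powr_mono2') auto
        finally show ?thesis by (intro mult_mono[OF ff]) auto
      qed
      thus "\<bar>real (k choose m) * (- 1) ^ m * real \<rho> powr - (a * real m) *
             (ff (a * real m) k * x powr (a * real m - real k))\<bar>
         \<le> real (k choose m) * ((real k ^ 2 + real k) ^ k * (real \<rho> powr (-a) * z powr (a - real k)))"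
        by (simp add: abs_mult power_abs mult.assoc mult_left_mono mult.left_commute)
    qed
    also have "\<dots> = bump_const k * (real \<rho> powr (-a) * z powr (a - real k))"
      unfolding sum_distrib_right[symmetric] of_nat_sum[symmetric] choose_row_sum
      by (simp add: bump_const_def)
    finally show "\<bar>g k x\<bar> \<le> bump_const k * (real \<rho> powr (-a) * z powr (a - real k))" .
  qed
  also have "altsum k (\<lambda>l. g 0 (z + real l)) = altsum k (\<lambda>l. bump a k \<rho> (z + real l))"
    using z by (intro altsum_cong g0[symmetric]) auto
  finally show ?thesis .
qed

text \<open>No smoothness is available across the edge. Instead all values in the stencil are small:
  within k of the edge the base is at most k^2/\<rho>, by Bernoulli and a \<le> k, and its k-th
  power is already of the required order.\<close>

lemma bump_outer_difference:
  assumes z: "0 < z" "z < real \<rho>" "real \<rho> < z + real k"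
  shows "\<bar>altsum k (\<lambda>l. bump a k \<rho> (z + real l))\<bar> \<le> bump_const k * (real \<rho> powr (-a) * z powr (a - real k))"
proof -
  have "abs (bump a k \<rho> y) \<le> (real k ^ 2 / real \<rho>) ^ k" if y: "z \<le> y" for y
  proof (cases "y < real \<rho>")
    case True
    have "1 + real k * (- ((real \<rho> - y) / real \<rho>)) \<le> (1 + (- ((real \<rho> - y) / real \<rho>))) ^ k"
      using y z True by (intro Bernoulli_inequality) (auto simp: field_simps)
    also have "1 + (- ((real \<rho> - y) / real \<rho>)) = y / real \<rho>" using \<rho> by (simp add: field_simps)
    also have "(y / real \<rho>) ^ k = (y / real \<rho>) powr (real k)"
      using y z by (simp add: powr_realpow)
    also have "\<dots> \<le> (y / real \<rho>) powr a"
      using y z True a \<rho> by (intro powr_mono') auto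
    finally have "1 - (y / real \<rho>) powr a \<le> real k * ((real \<rho> - y) / real \<rho>)" by simp
    also have "\<dots> \<le> real k * (real k / real \<rho>)"
      using y z by (intro mult_left_mono divide_right_mono) auto
    finally have "1 - (y / real \<rho>) powr a \<le> real k ^ 2 / real \<rho>" by (simp add: power2_eq_square)
    thus ?thesis
      using bump_arg_bounds[of a y \<rho>] True a y z by (auto simp: bump_def intro!: power_mono)
  qed (simp add: bump_def)
  hence "\<bar>altsum k (\<lambda>l. bump a k \<rho> (z + real l))\<bar> \<le> 2 ^ k * (real k ^ 2 / real \<rho>) ^ k"
    by (intro altsum_abs_le) auto
  also have "\<dots> = 2 ^ k * (real k ^ 2) ^ k * (real \<rho> powr (- real k))"
    using \<rho> by (simp add: power_divide powr_minus powr_realpow field_simps)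
  also have "\<dots> \<le> bump_const k * (real \<rho> powr (-a) * z powr (a - real k))"
  proof (rule mult_mono)
    show "2 ^ k * (real k ^ 2) ^ k \<le> bump_const k"
      unfolding bump_const_def by (intro mult_left_mono power_mono) auto
    have "real \<rho> powr (- real k) = real \<rho> powr (-a) * real \<rho> powr (a - real k)"
      by (simp flip: powr_add)
    also have "\<dots> \<le> real \<rho> powr (-a) * z powr (a - real k)"
      using z a by (intro mult_left_mono powr_mono2') auto
    finally show "real \<rho> powr (- real k) \<le> real \<rho> powr (-a) * z powr (a - real k)" .
  qed (auto simp: bump_const_def)
  finally show ?thesis .
qed

text \<open>The even continuation need not be smooth at the centre. The constant 1 has zero
  differences and may be subtracted; what is left is the deficit, of order \<rho>^(-a) at the points
  within k of the centre.\<close>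

lemma bump_central_difference:
  assumes z: "- real k \<le> z" "z \<le> 0"
  shows "\<bar>altsum k (\<lambda>l. bump a k \<rho> \<bar>z + real l\<bar>)\<bar> \<le> bump_const k * real \<rho> powr (-a)"
proof -
  have "altsum k (\<lambda>l. bump a k \<rho> \<bar>z + real l\<bar>) = altsum k (\<lambda>l. bump a k \<rho> \<bar>z + real l\<bar> - 1)"
  proof -
    have "altsum k (\<lambda>l. (0 - real l) gchoose 0) = 0" using k by (intro altsum_gbinomial) auto
    thus ?thesis
      by (simp add: altsum_def right_diff_distrib sum_subtractf)
  qed
  also have "\<bar>\<dots>\<bar> \<le> 2 ^ k * (real k * (real k / real \<rho>) powr a)"
  proof (rule altsum_abs_le)
    fix l assume l: "l \<le> k"
    hence y: "\<bar>z + real l\<bar> \<le> real k" using z by auto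
    hence "\<bar>z + real l\<bar> < real \<rho>" using \<rho> by linarith
    hence "1 - bump a k \<rho> \<bar>z + real l\<bar> \<le> real k * (\<bar>z + real l\<bar> / real \<rho>) powr a"
      using a by (intro bump_deficit_upper) auto
    also have "\<dots> \<le> real k * (real k / real \<rho>) powr a"
      using y a by (intro mult_left_mono powr_mono2 divide_right_mono) auto
    finally show "abs (bump a k \<rho> \<bar>z + real l\<bar> - 1) \<le> real k * (real k / real \<rho>) powr a"
      using bump_le_1[of a "\<bar>z + real l\<bar>" k \<rho>] a by simp
  qed
  also have "\<dots> = 2 ^ k * (real k * real k powr a) * real \<rho> powr (-a)"
    using \<rho> by (simp add: powr_divide powr_minus field_simps)
  also have "\<dots> \<le> bump_const k * real \<rho> powr (-a)"
  proof (intro mult_right_mono)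
    have "real k * real k powr a \<le> real k ^ k * real k powr (real k)"
      using a k self_le_power[of "real k" k] by (intro mult_mono powr_mono) auto
    also have "\<dots> = (real k ^ 2) ^ k" using k by (simp add: powr_realpow power2_eq_square power_mult_distrib)
    also have "\<dots> \<le> (real k ^ 2 + real k) ^ k" by (intro power_mono) auto
    finally show "2 ^ k * (real k * real k powr a) \<le> bump_const k" by (simp add: bump_const_def)
  qed simp
  finally show ?thesis .
qed

lemma bump_diff_positive:
  assumes "z \<ge> 1"
  shows "\<bar>bump_diff a k \<rho> z\<bar> \<le> (if z < int \<rho> then bump_const k * (real \<rho> powr (-a) * real_of_int z powr (a - real k)) else 0)"
proof -
  have eq: "bump_diff a k \<rho> z = altsum k (\<lambda>l. bump a k \<rho> (real_of_int z + real l))"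
    unfolding bump_diff_def using assms by (intro altsum_cong) auto
  show ?thesis
  proof (cases "z < int \<rho>")
    case True
    thus ?thesis unfolding eq using bump_inner_difference[of "real_of_int z"] bump_outer_difference[of "real_of_int z"] assms
      by (cases "real_of_int z + real k \<le> real \<rho>") auto
  next
    case False
    hence "bump a k \<rho> (real_of_int z + real l) = 0" for l by (intro bump_outside) linarith
    thus ?thesis using False by (simp add: eq altsum_def)
  qed
qed

text \<open>Reflecting the stencil z, ..., z + k about the centre gives the one that starts at - z -
  k, and the profile is even.\<close>

lemma bump_diff_reflect: "\<bar>bump_diff a k \<rho> (- z - int k)\<bar> = \<bar>bump_diff a k \<rho> z\<bar>"
proof -
  have "bump_diff a k \<rho> z = (-1) ^ k * bump_diff a k \<rho> (- z - int k)"
    unfolding bump_diff_def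
    by (subst altsum_reflect, intro arg_cong2[where f = times] altsum_cong refl)
      (auto simp: abs_minus_commute intro!: arg_cong[where f = "bump a k \<rho>"])
  thus ?thesis by (simp add: abs_mult power_abs)
qed

text \<open>Stencils to the right of the centre, their mirror images, and the k + 1 stencils that
  contain the centre are bounded separately; the last group gives the summand
  \<open>real k + 1\<close>.\<close>

lemma bump_diff_energy:
  assumes "finite A"
  shows "(\<Sum>z\<in>A. (bump_diff a k \<rho> z)\<^sup>2) \<le> (bump_const k)\<^sup>2 * real \<rho> powr (-2 * a) *
     (real k + 1 + 2 * (\<Sum>m=1..\<rho>. real m powr (2 * a - 2 * real k)))"
proof -
  define E where "E = (bump_const k)\<^sup>2 * real \<rho> powr (-2 * a)"
  define F where "F = (\<lambda>z::int. real_of_int z powr (2 * a - 2 * real k))"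
  have E0: "E \<ge> 0" by (simp add: E_def)
  have pos: "(bump_diff a k \<rho> z)\<^sup>2 \<le> (if z \<in> {1..int \<rho>} then E * F z else 0)" if "z \<ge> 1" for z
  proof -
    have "(bump_const k * (real \<rho> powr (-a) * real_of_int z powr (a - real k)))\<^sup>2 = E * F z"
      by (simp add: E_def F_def power2_eq_square algebra_simps flip: powr_add)
    moreover have "(bump_diff a k \<rho> z)\<^sup>2 \<le> (if z < int \<rho> then bump_const k * (real \<rho> powr (-a) * real_of_int z powr (a - real k)) else 0)\<^sup>2"
      using bump_diff_positive[OF that] by (metis abs_ge_zero power2_abs power_mono)
    ultimately show ?thesis using that E0 by (auto split: if_splits simp: F_def)
  qed
  have neg: "(bump_diff a k \<rho> z)\<^sup>2 \<le> (if - z - int k \<in> {1..int \<rho>} then E * F (- z - int k) else 0)" if "- z - int k \<ge> 1" for z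
    using pos[OF that] bump_diff_reflect[of z] by (metis power2_abs)
  have cen: "(bump_diff a k \<rho> z)\<^sup>2 \<le> E" if "- int k \<le> z" "z \<le> 0" for z
  proof -
    have "\<bar>bump_diff a k \<rho> z\<bar> \<le> bump_const k * real \<rho> powr (-a)"
      unfolding bump_diff_def using that by (intro bump_central_difference) auto
    hence "(bump_diff a k \<rho> z)\<^sup>2 \<le> (bump_const k * real \<rho> powr (-a))\<^sup>2"
      by (metis abs_ge_zero power2_abs power_mono)
    also have "\<dots> = E" by (simp add: E_def power2_eq_square algebra_simps flip: powr_add)
    finally show ?thesis .
  qed
  have le: "(\<Sum>z\<in>A. if P z then G z else 0) \<le> (\<Sum>z | P z. G z)"
    if "finite {z. P z}" "\<And>z. P z \<Longrightarrow> G z \<ge> 0" for P and G :: "int \<Rightarrow> real"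
  proof -
    have "(\<Sum>z\<in>A. if P z then G z else 0) = (\<Sum>z\<in>A \<inter> {z. P z}. G z)"
      using assms by (simp add: sum.inter_restrict)
    also have "\<dots> \<le> (\<Sum>z | P z. G z)" using that by (intro sum_mono2) auto
    finally show ?thesis .
  qed
  have FE: "E * F z \<ge> 0" for z using E0 by (simp add: F_def)
  have "(\<Sum>z\<in>A. (bump_diff a k \<rho> z)\<^sup>2) \<le> (\<Sum>z\<in>A. (if - int k \<le> z \<and> z \<le> 0 then E else 0) +
      (if 1 \<le> z \<and> z \<le> int \<rho> then E * F z else 0) +
      (if 1 \<le> - z - int k \<and> - z - int k \<le> int \<rho> then E * F (- z - int k) else 0))"
  proof (intro sum_mono)
    fix z
    consider "z \<ge> 1" | "- int k \<le> z" "z \<le> 0" | "- z - int k \<ge> 1" by linarith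
    thus "(bump_diff a k \<rho> z)\<^sup>2 \<le> (if - int k \<le> z \<and> z \<le> 0 then E else 0) +
      (if 1 \<le> z \<and> z \<le> int \<rho> then E * F z else 0) +
      (if 1 \<le> - z - int k \<and> - z - int k \<le> int \<rho> then E * F (- z - int k) else 0)"
    proof cases
      case 1 thus ?thesis using pos[OF 1] by auto
    next
      case 2 thus ?thesis using cen[OF 2] by auto
    next
      case 3 thus ?thesis using neg[OF 3] by auto
    qed
  qed
  also have "\<dots> \<le> (\<Sum>z | - int k \<le> z \<and> z \<le> 0. E) + (\<Sum>z | 1 \<le> z \<and> z \<le> int \<rho>. E * F z)
      + (\<Sum>z | 1 \<le> - z - int k \<and> - z - int k \<le> int \<rho>. E * F (- z - int k))"
  proof -
    have *: "{z. - int k \<le> z \<and> z \<le> 0} = {- int k..0}" "{z. 1 \<le> z \<and> z \<le> int \<rho>} = {1..int \<rho>}"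
      "{z. 1 \<le> - z - int k \<and> - z - int k \<le> int \<rho>} = {- int \<rho> - int k..- 1 - int k}" by auto
    show ?thesis
      unfolding sum.distrib by (intro add_mono le) (use E0 FE in \<open>auto simp: *\<close>)
  qed
  also have "(\<Sum>z | - int k \<le> z \<and> z \<le> 0. E) = (real k + 1) * E"
  proof -
    have "{z. - int k \<le> z \<and> z \<le> 0} = {- int k..0}" by auto
    thus ?thesis by simp
  qed
  also have "(\<Sum>z | 1 \<le> z \<and> z \<le> int \<rho>. E * F z) = (\<Sum>m=1..\<rho>. E * real m powr (2 * a - 2 * real k))"
    by (rule sum.reindex_bij_witness[of _ int nat]) (auto simp: F_def)
  also have "(\<Sum>z | 1 \<le> - z - int k \<and> - z - int k \<le> int \<rho>. E * F (- z - int k)) =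
      (\<Sum>m=1..\<rho>. E * real m powr (2 * a - 2 * real k))"
    by (rule sum.reindex_bij_witness[of _ "\<lambda>m. - int m - int k" "\<lambda>z. nat (- z - int k)"]) (auto simp: F_def)
  finally show ?thesis by (simp add: E_def algebra_simps sum_distrib_left)
qed

end

lemma sum_inverse_le_ln: "\<rho> \<ge> 1 \<Longrightarrow> (\<Sum>m=1..\<rho>. 1 / real m) \<le> ln (exp 1 * real \<rho>)"
proof (induction \<rho> rule: dec_induct)
  case (step n)
  have "ln (real n / real (Suc n)) \<le> real n / real (Suc n) - 1"
    using step by (intro ln_le_minus_one) auto
  also have "\<dots> = - (1 / real (Suc n))" by (simp add: field_simps)
  finally have "1 / real (Suc n) \<le> ln (real (Suc n)) - ln (real n)"
    using step by (simp add: ln_div)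
  thus ?case using step by (simp add: ln_mult)
qed simp

text \<open>The exponent 2a - 2k of the summands is -1 for the rough profile, which gives a harmonic
  sum and hence the logarithm, and 0 for the smooth one, where the \<rho> equal terms cancel one of
  the 2k inverse powers of \<rho>.\<close>

lemma
  assumes k: "1 \<le> k" and \<rho>: "k < \<rho>" and A: "finite A"
  shows rough_bump_energy:
      "(\<Sum>z\<in>A. (bump_diff (real k - 1/2) k \<rho> z)\<^sup>2)
       \<le> (real k + 3) * (bump_const k)\<^sup>2 * ln (exp 1 * real \<rho>) / real \<rho> ^ (2 * k - 1)"
    and smooth_bump_energy:
      "(\<Sum>z\<in>A. (bump_diff (real k) k \<rho> z)\<^sup>2)
       \<le> (real k + 3) * (bump_const k)\<^sup>2 / real \<rho> ^ (2 * k - 1)"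
proof -
  have \<rho>1: "\<rho> \<ge> 1" using \<rho> by simp
  have exp1: "2 * (real k - 1/2) = real (2 * k - 1)" using k by simp
  have ln1: "ln (exp 1 * real \<rho>) \<ge> 1" using \<rho>1 by (simp add: ln_mult)
  have "(\<Sum>z\<in>A. (bump_diff (real k - 1/2) k \<rho> z)\<^sup>2)
    \<le> (bump_const k)\<^sup>2 * real \<rho> powr (-2 * (real k - 1/2)) *
     (real k + 1 + 2 * (\<Sum>m=1..\<rho>. real m powr (2 * (real k - 1/2) - 2 * real k)))"
    using bump_diff_energy[of "real k - 1/2", OF _ _ k \<rho> A] k by linarith
  also have "real \<rho> powr (-2 * (real k - 1/2)) = 1 / real \<rho> ^ (2 * k - 1)"
  proof -
    have *: "-2 * (real k - 1/2) = - real (2 * k - 1)" unfolding exp1[symmetric] by simp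
    show ?thesis
      unfolding * powr_minus_divide using powr_realpow[of "real \<rho>" "2 * k - 1"] \<rho>1 by simp
  qed
  also have "(\<Sum>m=1..\<rho>. real m powr (2 * (real k - 1/2) - 2 * real k)) = (\<Sum>m=1..\<rho>. 1 / real m)"
    by (intro sum.cong) (auto simp: powr_minus_divide)
  also have "(bump_const k)\<^sup>2 * (1 / real \<rho> ^ (2 * k - 1)) * (real k + 1 + 2 * (\<Sum>m=1..\<rho>. 1 / real m))
      \<le> (bump_const k)\<^sup>2 * (1 / real \<rho> ^ (2 * k - 1)) * ((real k + 3) * ln (exp 1 * real \<rho>))"
  proof (intro mult_left_mono)
    have "(real k + 1) * 1 \<le> (real k + 1) * ln (exp 1 * real \<rho>)"
      using ln1 by (intro mult_left_mono) auto
    moreover have "(\<Sum>m=1..\<rho>. 1 / real m) \<le> ln (exp 1 * real \<rho>)" by (rule sum_inverse_le_ln[OF \<rho>1])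
    ultimately show "real k + 1 + 2 * (\<Sum>m=1..\<rho>. 1 / real m) \<le> (real k + 3) * ln (exp 1 * real \<rho>)"
      by (simp add: algebra_simps)
  qed simp
  finally show "(\<Sum>z\<in>A. (bump_diff (real k - 1/2) k \<rho> z)\<^sup>2)
       \<le> (real k + 3) * (bump_const k)\<^sup>2 * ln (exp 1 * real \<rho>) / real \<rho> ^ (2 * k - 1)"
    by (simp add: field_simps)
next
  have \<rho>1: "\<rho> \<ge> 1" using \<rho> by simp
  have "(\<Sum>z\<in>A. (bump_diff (real k) k \<rho> z)\<^sup>2)
    \<le> (bump_const k)\<^sup>2 * real \<rho> powr (-2 * real k) *
     (real k + 1 + 2 * (\<Sum>m=1..\<rho>. real m powr (2 * real k - 2 * real k)))"
    using bump_diff_energy[of "real k", OF _ _ k \<rho> A] k by linarith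
  also have "(\<Sum>m=1..\<rho>. real m powr (2 * real k - 2 * real k)) = real \<rho>" by simp
  also have "(bump_const k)\<^sup>2 * real \<rho> powr (-2 * real k) * (real k + 1 + 2 * real \<rho>)
     \<le> (bump_const k)\<^sup>2 * real \<rho> powr (-2 * real k) * ((real k + 3) * real \<rho>)"
  proof (intro mult_left_mono)
    have "(real k + 1) * 1 \<le> (real k + 1) * real \<rho>" using \<rho>1 by (intro mult_left_mono) auto
    thus "real k + 1 + 2 * real \<rho> \<le> (real k + 3) * real \<rho>" by (simp add: algebra_simps)
  qed simp
  also have "real \<rho> powr (-2 * real k) = 1 / (real \<rho> * real \<rho> ^ (2 * k - 1))"
  proof -
    have "real \<rho> powr (-2 * real k) = 1 / real \<rho> powr (real (2 * k))"
      by (simp flip: powr_minus_divide)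
    also have "real \<rho> powr (real (2 * k)) = real \<rho> ^ Suc (2 * k - 1)"
      using \<rho>1 k by (subst powr_realpow) auto
    finally show ?thesis by simp
  qed
  also have "(bump_const k)\<^sup>2 * (1 / (real \<rho> * real \<rho> ^ (2 * k - 1))) * ((real k + 3) * real \<rho>)
      = (real k + 3) * (bump_const k)\<^sup>2 / real \<rho> ^ (2 * k - 1)"
    using \<rho>1 by simp
  finally show "(\<Sum>z\<in>A. (bump_diff (real k) k \<rho> z)\<^sup>2)
       \<le> (real k + 3) * (bump_const k)\<^sup>2 / real \<rho> ^ (2 * k - 1)" .
qed

section \<open>Gaussian noise\<close>

abbreviation gauss :: "real \<Rightarrow> real measure" where
  "gauss \<sigma> \<equiv> density lborel (normal_density 0 \<sigma>)"

definition iid_gauss :: "'a set \<Rightarrow> real \<Rightarrow> ('a \<Rightarrow> real) measure" where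
  "iid_gauss J \<sigma> = (\<Pi>\<^sub>M j\<in>J. gauss \<sigma>)"

lemma nn_integral_normal_density: "\<sigma> > 0 \<Longrightarrow> (\<integral>\<^sup>+x. ennreal (normal_density \<mu> \<sigma> x) \<partial>lborel) = 1"
  by (subst nn_integral_eq_integral) auto

lemma gauss_mgf:
  assumes "\<sigma> > 0"
  shows "(\<integral>\<^sup>+x. ennreal (exp (a * x)) \<partial>gauss \<sigma>) = ennreal (exp (a\<^sup>2 * \<sigma>\<^sup>2 / 2))"
proof -
  have eq: "normal_density 0 \<sigma> x * exp (a * x) = exp (a\<^sup>2 * \<sigma>\<^sup>2 / 2) * normal_density (a * \<sigma>\<^sup>2) \<sigma> x" for x
  proof -
    have "- x\<^sup>2 / (2 * \<sigma>\<^sup>2) + a * x = a\<^sup>2 * \<sigma>\<^sup>2 / 2 + - (x - a * \<sigma>\<^sup>2)\<^sup>2 / (2 * \<sigma>\<^sup>2)"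
      using assms by (simp add: field_simps power2_eq_square)
    thus ?thesis by (simp add: normal_density_def flip: exp_add)
  qed
  have "(\<integral>\<^sup>+x. ennreal (exp (a * x)) \<partial>gauss \<sigma>) =
      (\<integral>\<^sup>+x. ennreal (normal_density 0 \<sigma> x) * ennreal (exp (a * x)) \<partial>lborel)"
    by (subst nn_integral_density) auto
  also have "\<dots> = (\<integral>\<^sup>+x. ennreal (exp (a\<^sup>2 * \<sigma>\<^sup>2 / 2)) * ennreal (normal_density (a * \<sigma>\<^sup>2) \<sigma> x) \<partial>lborel)"
    by (intro nn_integral_cong) (simp add: eq flip: ennreal_mult)
  also have "\<dots> = ennreal (exp (a\<^sup>2 * \<sigma>\<^sup>2 / 2))"
    using assms by (subst nn_integral_cmult) (auto simp: nn_integral_normal_density)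
  finally show ?thesis .
qed

text \<open>The value (1 - 2c)^(-1/2) at c = 3/8 is exactly 2: the tilted density is twice the
  density of standard deviation 2.\<close>

lemma gauss_square_mgf: "(\<integral>\<^sup>+x. ennreal (exp (3/8 * x\<^sup>2)) \<partial>gauss 1) = 2"
proof -
  have eq: "normal_density 0 1 x * exp (3/8 * x\<^sup>2) = 2 * normal_density 0 2 x" for x :: real
  proof -
    have "sqrt (2 * pi * 2\<^sup>2) = 2 * sqrt (2 * pi)" by (subst real_sqrt_mult) simp
    moreover have "- x\<^sup>2 / 2 + 3/8 * x\<^sup>2 = - x\<^sup>2 / 8" by simp
    hence "exp (- x\<^sup>2 / 2) * exp (3/8 * x\<^sup>2) = exp (- x\<^sup>2 / 8)" by (simp flip: exp_add)
    ultimately show ?thesis by (simp add: normal_density_def field_simps)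
  qed
  have "(\<integral>\<^sup>+x. ennreal (exp (3/8 * x\<^sup>2)) \<partial>gauss 1) =
      (\<integral>\<^sup>+x. ennreal (normal_density 0 1 x) * ennreal (exp (3/8 * x\<^sup>2)) \<partial>lborel)"
    by (subst nn_integral_density) auto
  also have "\<dots> = (\<integral>\<^sup>+x. 2 * ennreal (normal_density 0 2 x) \<partial>lborel)"
    by (intro nn_integral_cong, simp only: ennreal_mult[symmetric] normal_density_nonneg exp_ge_zero eq)
      (simp add: ennreal_mult)
  also have "\<dots> = 2"
    by (subst nn_integral_cmult) (auto simp: nn_integral_normal_density)
  finally show ?thesis .
qed

lemma prob_space_gauss: "\<sigma> > 0 \<Longrightarrow> prob_space (gauss \<sigma>)"
  by (rule prob_space_normal_density)

lemma product_prob_space_gauss: "\<sigma> > 0 \<Longrightarrow> product_prob_space (\<lambda>_. gauss \<sigma>)"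
  using prob_space_gauss[of \<sigma>] 
  by (intro product_prob_spaceI) auto

lemma prob_space_iid_gauss: "\<sigma> > 0 \<Longrightarrow> prob_space (iid_gauss J \<sigma>)"
  unfolding iid_gauss_def by (intro prob_space_PiM prob_space_gauss)

lemma measurable_iid_gauss_component:
  "j \<in> J \<Longrightarrow> (\<lambda>e. e j) \<in> borel_measurable (iid_gauss J \<sigma>)"
proof -
  assume "j \<in> J"
  hence "(\<lambda>e. e j) \<in> measurable (iid_gauss J \<sigma>) (gauss \<sigma>)"
    unfolding iid_gauss_def by (rule measurable_component_singleton)
  thus ?thesis by (simp cong: measurable_cong_sets)
qed

lemma measurable_iid_gauss_ip:
  "(\<lambda>e. ip J e a) \<in> borel_measurable (iid_gauss J \<sigma>)"
  unfolding ip_def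
  by (intro borel_measurable_sum borel_measurable_times measurable_iid_gauss_component borel_measurable_const)

lemma iid_gauss_prod:
  assumes "finite J" "\<sigma> > 0" "\<And>j. j \<in> J \<Longrightarrow> f j \<in> borel_measurable borel"
  shows "(\<integral>\<^sup>+e. (\<Prod>j\<in>J. f j (e j)) \<partial>iid_gauss J \<sigma>) = (\<Prod>j\<in>J. \<integral>\<^sup>+x. f j x \<partial>gauss \<sigma>)"
proof -
  interpret product_prob_space "\<lambda>_. gauss \<sigma>" using product_prob_space_gauss[OF assms(2)] .
  show ?thesis unfolding iid_gauss_def
    using assms by (intro product_nn_integral_prod) auto
qed

lemma iid_gauss_mgf:
  assumes "finite J" "\<sigma> > 0"
  shows "(\<integral>\<^sup>+e. ennreal (exp (ip J e a)) \<partial>iid_gauss J \<sigma>) = ennreal (exp (\<sigma>\<^sup>2 * ip J a a / 2))"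
proof -
  have "(\<integral>\<^sup>+e. ennreal (exp (ip J e a)) \<partial>iid_gauss J \<sigma>) =
     (\<integral>\<^sup>+e. (\<Prod>j\<in>J. ennreal (exp (a j * e j))) \<partial>iid_gauss J \<sigma>)"
    by (intro nn_integral_cong) (simp add: ip_def exp_sum[OF assms(1)] prod_ennreal mult.commute)
  also have "\<dots> = (\<Prod>j\<in>J. \<integral>\<^sup>+x. ennreal (exp (a j * x)) \<partial>gauss \<sigma>)"
    using assms by (intro iid_gauss_prod) auto
  also have "\<dots> = ennreal (\<Prod>j\<in>J. exp ((a j)\<^sup>2 * \<sigma>\<^sup>2 / 2))"
    using assms by (simp add: gauss_mgf prod_ennreal)
  also have "(\<Prod>j\<in>J. exp ((a j)\<^sup>2 * \<sigma>\<^sup>2 / 2)) = exp (\<sigma>\<^sup>2 * ip J a a / 2)"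
  proof -
    have "\<sigma>\<^sup>2 * ip J a a / 2 = (\<Sum>j\<in>J. (a j)\<^sup>2 * \<sigma>\<^sup>2 / 2)"
      unfolding ip_def sum_distrib_left sum_divide_distrib by (simp add: power2_eq_square mult_ac)
    thus ?thesis by (simp only: exp_sum[OF assms(1)])
  qed
  finally show ?thesis .
qed

section \<open>Tail bounds for linear and quadratic forms in the noise\<close>

lemma exp_Markov:
  assumes "prob_space M" and [measurable]: "f \<in> borel_measurable M"
    and "(\<integral>\<^sup>+e. ennreal (exp (f e)) \<partial>M) \<le> ennreal C" "C \<ge> 0"
  shows "measure M {e \<in> space M. y < f e} \<le> exp (-y) * C"
proof -
  interpret prob_space M by fact
  have "emeasure M {e \<in> space M. y < f e} \<le> emeasure M {e \<in> space M. y \<le> f e}"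
  proof (rule emeasure_mono)
    show "{e \<in> space M. y \<le> f e} \<in> sets M" using assms(2) by (rule borel_measurable_le[OF borel_measurable_const])
  qed auto
  also have "\<dots> \<le> ennreal (exp (-y)) * (\<integral>\<^sup>+e. ennreal (exp (f e)) * indicator (space M) e \<partial>M)"
    using Chernoff_ineq_nn_integral_ge[of 1 "space M" M f y] assms(2) by simp
  also have "(\<integral>\<^sup>+e. ennreal (exp (f e)) * indicator (space M) e \<partial>M) = (\<integral>\<^sup>+e. ennreal (exp (f e)) \<partial>M)"
    by (intro nn_integral_cong) auto
  also have "ennreal (exp (-y)) * \<dots> \<le> ennreal (exp (-y)) * ennreal C"
    using assms(3) by (rule mult_left_mono) auto
  also have "\<dots> = ennreal (exp (-y) * C)" using assms(4) by (simp add: ennreal_mult)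
  finally have "ennreal (measure M {e \<in> space M. y < f e}) \<le> ennreal (exp (-y) * C)"
    unfolding emeasure_eq_measure .
  thus ?thesis
    using assms(4) by (subst (asm) ennreal_le_iff) simp_all
qed

text \<open>Chernoff bound with the optimal exponent \<theta>. The strict inequality matters for a
  vanishing vector, where the event is then empty. For L = 0 the one-sided bound is trivial and
  \<theta> would degenerate.\<close>

lemma iid_gauss_tail:
  assumes J: "finite J" and \<sigma>: "\<sigma> > 0" and L: "L \<ge> 0"
  shows "measure (iid_gauss J \<sigma>) {e \<in> space (iid_gauss J \<sigma>).
      \<bar>ip J e a\<bar> > \<sigma> * sqrt (2 * L) * sqrt (ip J a a)} \<le> 2 * exp (- L)"
proof (cases "ip J a a = 0")
  case True
  hence "\<forall>j\<in>J. a j = 0" using J by (simp add: ip_eq_0_iff)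
  hence "ip J e a = 0" for e by (simp add: ip_def)
  thus ?thesis using True by simp
next
  case False
  define V where "V = ip J a a"
  have V: "V > 0" using False ip_nonneg[of J a] by (simp add: V_def less_le)
  interpret prob_space "iid_gauss J \<sigma>" by (rule prob_space_iid_gauss[OF \<sigma>])
  note [measurable] = measurable_iid_gauss_ip
  define \<theta> where "\<theta> = sqrt (2 * L) / (\<sigma> * sqrt V)"
  define y where "y = \<sigma> * sqrt (2 * L) * sqrt V"
  have half: "measure (iid_gauss J \<sigma>) {e \<in> space (iid_gauss J \<sigma>). s * ip J e a > y} \<le> exp (- L)"
    if s: "s * s = 1" for s
  proof (cases "L = 0")
    case False
    have \<theta>0: "\<theta> > 0" using L False \<sigma> V by (simp add: \<theta>_def)
    have "{e \<in> space (iid_gauss J \<sigma>). s * ip J e a > y} =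
        {e \<in> space (iid_gauss J \<sigma>). \<theta> * y < ip J e (\<lambda>j. \<theta> * s * a j)}"
      using \<theta>0 by (simp add: ip_scale_right mult.assoc)
    also have "measure (iid_gauss J \<sigma>) \<dots> \<le> exp (- (\<theta> * y)) * exp (\<sigma>\<^sup>2 * ip J (\<lambda>j. \<theta> * s * a j) (\<lambda>j. \<theta> * s * a j) / 2)"
      by (rule exp_Markov[OF prob_space_axioms measurable_iid_gauss_ip]) (simp_all add: iid_gauss_mgf[OF J \<sigma>])
    also have "\<dots> = exp (- L)"
    proof -
      have "\<theta> * y = 2 * L" using V \<sigma> L by (simp add: \<theta>_def y_def)
      moreover have "ip J (\<lambda>j. \<theta> * s * a j) (\<lambda>j. \<theta> * s * a j) = \<theta>\<^sup>2 * (s * s) * V"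
        unfolding ip_scale_left ip_scale_right V_def by (simp add: power2_eq_square)
      moreover have "\<sigma>\<^sup>2 * (\<theta>\<^sup>2 * V) = 2 * L"
        using V \<sigma> L by (simp add: \<theta>_def power_divide power_mult_distrib)
      ultimately show ?thesis using s by (simp flip: exp_add)
    qed
    finally show ?thesis .
  qed simp
  have sets: "{e \<in> space (iid_gauss J \<sigma>). s * ip J e a > y} \<in> sets (iid_gauss J \<sigma>)" for s
    by measurable
  have "{e \<in> space (iid_gauss J \<sigma>). \<bar>ip J e a\<bar> > y} =
     {e \<in> space (iid_gauss J \<sigma>). 1 * ip J e a > y} \<union> {e \<in> space (iid_gauss J \<sigma>). (-1) * ip J e a > y}"
    by (auto simp: abs_if)
  hence "measure (iid_gauss J \<sigma>) {e \<in> space (iid_gauss J \<sigma>). \<bar>ip J e a\<bar> > y} \<le>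
     measure (iid_gauss J \<sigma>) {e \<in> space (iid_gauss J \<sigma>). 1 * ip J e a > y}
     + measure (iid_gauss J \<sigma>) {e \<in> space (iid_gauss J \<sigma>). (-1) * ip J e a > y}"
    using measure_Un_le[OF sets[of 1] sets[of "-1"]] by (simp only:)
  hence "measure (iid_gauss J \<sigma>) {e \<in> space (iid_gauss J \<sigma>). \<bar>ip J e a\<bar> > y} \<le> 2 * exp (- L)"
    using half[of 1] half[of "-1"] by linarith
  thus ?thesis by (simp only: y_def V_def)
qed

text \<open>The square is linearised instead of rotating the noise: exp of a square is the
  exponential moment of a linear form in auxiliary standard normals z indexed by \<open>B\<close>.
  After exchanging the integrals, integrating out the noise first returns squares of z by
  orthonormality, and these are independent.\<close>

lemma iid_gauss_chi_square_mgf: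
  assumes J: "finite J" and \<sigma>: "\<sigma> > 0" and B: "finite B" "orthonormal J B"
  shows "(\<integral>\<^sup>+e. ennreal (exp (3/8 * (\<Sum>b\<in>B. (ip J e b)\<^sup>2) / \<sigma>\<^sup>2)) \<partial>iid_gauss J \<sigma>) = 2 ^ card B"
proof -
  \<comment> \<open>This value makes both Gaussian integrals produce the same coefficient: r^2 / 2 =
    3/(8 \<sigma>^2) from integrating over z, and r^2 \<sigma>^2 / 2 = 3/8 from integrating over the
    noise.\<close>
  define r where "r = sqrt (3/4) / \<sigma>"
  have r2: "r\<^sup>2 * \<sigma>\<^sup>2 = 3/4" using \<sigma> by (simp add: r_def power_divide)
  define T where "T = (\<lambda>z j. r * (\<Sum>b\<in>B. z b * b j))"
  interpret E: prob_space "iid_gauss J \<sigma>" by (rule prob_space_iid_gauss[OF \<sigma>])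
  interpret Z: prob_space "iid_gauss B 1" by (rule prob_space_iid_gauss) simp
  interpret pair_sigma_finite "iid_gauss J \<sigma>" "iid_gauss B 1" ..
  have lin: "ip B z (\<lambda>b. r * ip J e b) = ip J e (T z)" for z e
  proof -
    have "ip J e (T z) = r * (\<Sum>b\<in>B. z b * ip J e b)"
      unfolding T_def ip_scale_right ip_sum_right ..
    thus ?thesis by (simp add: ip_def[of B] sum_distrib_left mult_ac)
  qed
  have orth: "ip J (T z) (T z) = r\<^sup>2 * (\<Sum>b\<in>B. (z b)\<^sup>2)" for z
  proof -
    have "ip J (T z) (T z) = r\<^sup>2 * (\<Sum>b\<in>B. z b * (\<Sum>b'\<in>B. z b' * ip J b b'))"
      unfolding T_def ip_scale_right ip_scale_left ip_sum_right ip_sum_left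
      by (simp add: power2_eq_square ip_commute)
    also have "(\<Sum>b\<in>B. z b * (\<Sum>b'\<in>B. z b' * ip J b b')) = (\<Sum>b\<in>B. z b * (\<Sum>b'\<in>B. if b' = b then z b else 0))"
      using B(2) by (intro sum.cong refl arg_cong2[where f = times]) (auto simp: orthonormal_def)
    finally show ?thesis using B(1) by (simp add: power2_eq_square)
  qed
  have meas: "(\<lambda>(e, z). ennreal (exp (ip J e (T z)))) \<in> borel_measurable (iid_gauss J \<sigma> \<Otimes>\<^sub>M iid_gauss B 1)"
    unfolding lin[symmetric] unfolding ip_def case_prod_beta
    by (intro measurable_compose[OF _ measurable_ennreal] borel_measurable_exp[THEN measurable_compose[rotated]]
        borel_measurable_sum borel_measurable_times measurable_compose[OF measurable_snd]
        measurable_compose[OF measurable_fst] measurable_iid_gauss_component)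
     (auto intro!: borel_measurable_const)
  have "(\<integral>\<^sup>+e. ennreal (exp (3/8 * (\<Sum>b\<in>B. (ip J e b)\<^sup>2) / \<sigma>\<^sup>2)) \<partial>iid_gauss J \<sigma>) =
     (\<integral>\<^sup>+e. \<integral>\<^sup>+z. ennreal (exp (ip J e (T z))) \<partial>iid_gauss B 1 \<partial>iid_gauss J \<sigma>)"
  proof (intro nn_integral_cong)
    fix e
    have "(\<integral>\<^sup>+z. ennreal (exp (ip J e (T z))) \<partial>iid_gauss B 1) =
       ennreal (exp (1\<^sup>2 * ip B (\<lambda>b. r * ip J e b) (\<lambda>b. r * ip J e b) / 2))"
      unfolding lin[symmetric] by (intro iid_gauss_mgf B) simp
    also have "1\<^sup>2 * ip B (\<lambda>b. r * ip J e b) (\<lambda>b. r * ip J e b) / 2 = r\<^sup>2 * (\<Sum>b\<in>B. (ip J e b)\<^sup>2) / 2"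
      by (simp add: ip_def[of B] sum_distrib_left power2_eq_square mult_ac)
    also have "r\<^sup>2 = 3/4 / \<sigma>\<^sup>2" using r2 \<sigma> by (simp add: field_simps)
    finally show "ennreal (exp (3/8 * (\<Sum>b\<in>B. (ip J e b)\<^sup>2) / \<sigma>\<^sup>2)) = (\<integral>\<^sup>+z. ennreal (exp (ip J e (T z))) \<partial>iid_gauss B 1)"
      by simp
  qed
  also have "\<dots> = (\<integral>\<^sup>+z. \<integral>\<^sup>+e. ennreal (exp (ip J e (T z))) \<partial>iid_gauss J \<sigma> \<partial>iid_gauss B 1)"
    by (rule Fubini'[OF meas, symmetric])
  also have "\<dots> = (\<integral>\<^sup>+z. (\<Prod>b\<in>B. ennreal (exp (3/8 * (z b)\<^sup>2))) \<partial>iid_gauss B 1)"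
  proof (intro nn_integral_cong)
    fix z :: "('a \<Rightarrow> real) \<Rightarrow> real"
    have "\<sigma>\<^sup>2 * ip J (T z) (T z) / 2 = r\<^sup>2 * \<sigma>\<^sup>2 * (\<Sum>b\<in>B. (z b)\<^sup>2) / 2" by (simp add: orth)
    also have "\<dots> = (\<Sum>b\<in>B. 3/8 * (z b)\<^sup>2)" by (simp add: r2 sum_distrib_left sum_divide_distrib)
    finally show "(\<integral>\<^sup>+e. ennreal (exp (ip J e (T z))) \<partial>iid_gauss J \<sigma>) = (\<Prod>b\<in>B. ennreal (exp (3/8 * (z b)\<^sup>2)))"
      by (simp only: iid_gauss_mgf[OF J \<sigma>] exp_sum[OF B(1)] prod_ennreal exp_ge_zero)
  qed
  also have "\<dots> = (\<Prod>b\<in>B. \<integral>\<^sup>+x. ennreal (exp (3/8 * x\<^sup>2)) \<partial>gauss 1)"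
    using B by (intro iid_gauss_prod) auto
  also have "\<dots> = 2 ^ card B" unfolding gauss_square_mgf by simp
  finally show ?thesis .
qed

text \<open>The exponential moment 2^card is at most e^card, so shifting the level by the dimension
  absorbs it; 8/3 inverts the coefficient 3/8.\<close>

lemma iid_gauss_chi_square_tail:
  assumes J: "finite J" and \<sigma>: "\<sigma> > 0" and B: "finite B" "orthonormal J B"
  shows "measure (iid_gauss J \<sigma>) {e \<in> space (iid_gauss J \<sigma>).
     8/3 * \<sigma>\<^sup>2 * (x + real (card B)) < (\<Sum>b\<in>B. (ip J e b)\<^sup>2)} \<le> exp (- x)"
proof -
  have eq: "{e \<in> space (iid_gauss J \<sigma>). 8/3 * \<sigma>\<^sup>2 * (x + real (card B)) < (\<Sum>b\<in>B. (ip J e b)\<^sup>2)} =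
     {e \<in> space (iid_gauss J \<sigma>). x + real (card B) < 3/8 * (\<Sum>b\<in>B. (ip J e b)\<^sup>2) / \<sigma>\<^sup>2}"
    using \<sigma> by (simp add: field_simps)
  have "measure (iid_gauss J \<sigma>) {e \<in> space (iid_gauss J \<sigma>). x + real (card B) < 3/8 * (\<Sum>b\<in>B. (ip J e b)\<^sup>2) / \<sigma>\<^sup>2}
      \<le> exp (- (x + real (card B))) * 2 ^ card B"
  proof (rule exp_Markov[OF prob_space_iid_gauss[OF \<sigma>]])
    note [measurable] = measurable_iid_gauss_ip
    show "(\<lambda>e. 3/8 * (\<Sum>b\<in>B. (ip J e b)\<^sup>2) / \<sigma>\<^sup>2) \<in> borel_measurable (iid_gauss J \<sigma>)" by measurable
    show "(\<integral>\<^sup>+e. ennreal (exp (3/8 * (\<Sum>b\<in>B. (ip J e b)\<^sup>2) / \<sigma>\<^sup>2)) \<partial>iid_gauss J \<sigma>) \<le> ennreal (2 ^ card B)"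
      unfolding iid_gauss_chi_square_mgf[OF assms] by (simp flip: ennreal_power)
  qed simp
  also have "\<dots> \<le> exp (- (x + real (card B))) * exp (real (card B))"
  proof (intro mult_left_mono)
    have "(2::real) ^ card B \<le> exp 1 ^ card B"
      using exp_ge_add_one_self[of "1::real"] by (intro power_mono) auto
    thus "(2::real) ^ card B \<le> exp (real (card B))" by (simp flip: exp_of_nat_mult)
  qed simp
  also have "\<dots> = exp (- x)" by (simp flip: exp_add)
  finally show ?thesis unfolding eq .
qed

section \<open>Tensor products of one-dimensional operators\<close>

definition tens :: "(nat \<Rightarrow> nat) \<Rightarrow> nat set \<Rightarrow> (nat \<Rightarrow> nat \<Rightarrow> real) \<Rightarrow> tensor" where
  "tens n I u = (\<lambda>x. if x \<in> grid n I then \<Prod>i\<in>I. u i (x i) else 0)"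

(* The tensor product of the kernels selected by c: coordinate-wise projection onto the complement
   of the low-order atoms (c i = 0) or onto the low-order atom c i. *)
definition tproj :: "(nat \<Rightarrow> nat) \<Rightarrow> nat \<Rightarrow> nat set \<Rightarrow> (nat \<Rightarrow> nat) \<Rightarrow> tensor \<Rightarrow> tensor" where
  "tproj n k I c f = (\<lambda>x. if x \<in> grid n I
     then \<Sum>y\<in>grid n I. (\<Prod>i\<in>I. qker (n i) k (c i) (x i) (y i)) * f y else 0)"

text \<open>The mixed difference in matrix form, with reference to the entries on the grid of
  \<open>I\<close> only. By duality these are the coefficients of a tensor in the high-order product
  atoms.\<close>

definition dcoef :: "(nat \<Rightarrow> nat) \<Rightarrow> nat \<Rightarrow> nat set \<Rightarrow> tensor \<Rightarrow> mindex \<Rightarrow> real" where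
  "dcoef n k I f \<kappa> = (\<Sum>y\<in>grid n I. (\<Prod>i\<in>I. dker (n i) k (\<kappa> i) (y i)) * f y)"

lemma finite_grid [simp]: "finite I \<Longrightarrow> finite (grid n I)"
  by (auto simp: grid_def intro: finite_PiE)

lemma finite_inner_grid [simp]: "finite I \<Longrightarrow> finite (inner_grid k n I)"
  by (auto simp: inner_grid_def intro: finite_PiE)

lemma inner_grid_subset: "inner_grid k n I \<subseteq> grid n I"
  unfolding inner_grid_def grid_def by (rule PiE_mono) auto

lemma gridD: "x \<in> grid n I \<Longrightarrow> i \<in> I \<Longrightarrow> x i \<in> {1..n i}"
  by (auto simp: grid_def)

lemma grid_sum_prod:
  fixes a :: "nat \<Rightarrow> nat \<Rightarrow> real"
  shows "finite I \<Longrightarrow> (\<Sum>y\<in>grid n I. \<Prod>i\<in>I. a i (y i)) = (\<Prod>i\<in>I. \<Sum>y=1..n i. a i y)"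
  unfolding grid_def by (rule prod_sum_PiE[symmetric]) auto

lemma inner_grid_sum_prod:
  fixes a :: "nat \<Rightarrow> nat \<Rightarrow> real"
  shows "finite I \<Longrightarrow> (\<Sum>y\<in>inner_grid k n I. \<Prod>i\<in>I. a i (y i)) = (\<Prod>i\<in>I. \<Sum>y=k+1..n i. a i y)"
  unfolding inner_grid_def by (rule prod_sum_PiE[symmetric]) auto

lemma card_grid: "finite I \<Longrightarrow> real (card (grid n I)) = nprod n I"
  by (simp add: grid_def nprod_def card_PiE)

lemma grid_split:
  assumes "M \<subseteq> I"
  shows "(\<Sum>j\<in>grid n I. F j) = (\<Sum>x\<in>grid n M. \<Sum>y\<in>grid n (I - M). F (\<lambda>i. if i \<in> M then x i else y i))"
proof -
  have "(\<Sum>j\<in>grid n I. F j) = (\<Sum>(x, y)\<in>grid n M \<times> grid n (I - M). F (\<lambda>i. if i \<in> M then x i else y i))"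
    by (rule sum.reindex_bij_witness[of _ "\<lambda>(x, y) i. if i \<in> M then x i else y i"
          "\<lambda>j. (restrict j M, restrict j (I - M))"])
      (use assms in \<open>auto simp: grid_def PiE_iff extensional_def fun_eq_iff intro!: arg_cong[where f = F]\<close>)
  thus ?thesis by (simp add: sum.cartesian_product)
qed

lemma prod_eq_indicator: "finite I \<Longrightarrow> x \<in> grid n I \<Longrightarrow> y \<in> grid n I \<Longrightarrow>
    (\<Prod>i\<in>I. if x i = y i then 1 else 0 :: real) = (if x = y then 1 else 0)"
proof -
  assume I: "finite I" and xy: "x \<in> grid n I" "y \<in> grid n I"
  have "x = y \<longleftrightarrow> (\<forall>i\<in>I. x i = y i)"
    using xy unfolding grid_def by (metis PiE_ext)
  thus ?thesis using I by (auto intro!: prod_zero)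
qed

lemma ip_tens: "finite I \<Longrightarrow> ip (grid n I) (tens n I u) (tens n I v) = (\<Prod>i\<in>I. ip {1..n i} (u i) (v i))"
  unfolding ip_def grid_sum_prod[symmetric] by (intro sum.cong) (auto simp: tens_def prod.distrib)

lemma tproj_diff: "tproj n k I c (\<lambda>x. f x - g x) = (\<lambda>x. tproj n k I c f x - tproj n k I c g x)"
  by (auto simp: tproj_def right_diff_distrib sum_subtractf)

lemma tproj_add: "tproj n k I c (\<lambda>x. f x + g x) = (\<lambda>x. tproj n k I c f x + tproj n k I c g x)"
  by (auto simp: tproj_def distrib_left sum.distrib)

lemma tproj_scale: "tproj n k I c (\<lambda>x. a * f x) = (\<lambda>x. a * tproj n k I c f x)"
  by (auto simp: tproj_def sum_distrib_left mult_ac)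

lemma tproj_sum: "tproj n k I c (\<lambda>x. \<Sum>a\<in>A. g a x) = (\<lambda>x. \<Sum>a\<in>A. tproj n k I c (g a) x)"
proof
  fix x
  show "tproj n k I c (\<lambda>x. \<Sum>a\<in>A. g a x) x = (\<Sum>a\<in>A. tproj n k I c (g a) x)"
    unfolding tproj_def sum_distrib_left by (simp add: sum.swap[of _ A])
qed

lemma tproj_index_cong: "(\<And>i. i \<in> I \<Longrightarrow> c i = c' i) \<Longrightarrow> tproj n k I c f = tproj n k I c' f"
  by (auto simp: tproj_def intro!: sum.cong prod.cong ext)

lemma tproj_vanish: "x \<notin> grid n I \<Longrightarrow> tproj n k I c f x = 0"
  by (simp add: tproj_def)

lemma dcoef_diff: "dcoef n k I (\<lambda>x. f x - g x) \<kappa> = dcoef n k I f \<kappa> - dcoef n k I g \<kappa>"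
  unfolding dcoef_def sum_subtractf[symmetric] by (simp add: right_diff_distrib)

locale dict_grid =
  fixes n :: "nat \<Rightarrow> nat" and k :: nat and I :: "nat set"
  assumes fin: "finite I" and k1: "1 \<le> k" and kn: "\<And>i. i \<in> I \<Longrightarrow> k < n i"
begin

abbreviation "G \<equiv> grid n I"

lemma n_pos: "i \<in> I \<Longrightarrow> 0 < n i"
  using kn by fastforce

lemma nprod_pos: "nprod n I > 0"
  unfolding nprod_def using n_pos by (intro prod_pos) auto

lemma tproj_symmetric: "ip G (tproj n k I c f) g = ip G f (tproj n k I c g)"
proof -
  have "ip G (tproj n k I c f) g = (\<Sum>x\<in>G. \<Sum>y\<in>G. (\<Prod>i\<in>I. qker (n i) k (c i) (x i) (y i)) * f y * g x)"
    by (simp add: ip_def tproj_def sum_distrib_right)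
  also have "\<dots> = (\<Sum>y\<in>G. \<Sum>x\<in>G. (\<Prod>i\<in>I. qker (n i) k (c i) (x i) (y i)) * f y * g x)"
    by (rule sum.swap)
  also have "\<dots> = (\<Sum>y\<in>G. \<Sum>x\<in>G. f y * ((\<Prod>i\<in>I. qker (n i) k (c i) (y i) (x i)) * g x))"
  proof (intro sum.cong refl)
    fix x y
    have "(\<Prod>i\<in>I. qker (n i) k (c i) (x i) (y i)) = (\<Prod>i\<in>I. qker (n i) k (c i) (y i) (x i))"
      using k1 kn by (intro prod.cong refl qker_symmetric) auto
    thus "(\<Prod>i\<in>I. qker (n i) k (c i) (x i) (y i)) * f y * g x = f y * ((\<Prod>i\<in>I. qker (n i) k (c i) (y i) (x i)) * g x)"
      by simp
  qed
  also have "\<dots> = ip G f (tproj n k I c g)"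
    by (simp add: ip_def tproj_def sum_distrib_left)
  finally show ?thesis .
qed

text \<open>A product kernel composes coordinate by coordinate, and one coordinate in which the
  selectors differ already contributes the factor zero.\<close>

lemma tproj_compose:
  assumes "\<And>i. i \<in> I \<Longrightarrow> c i \<le> k" "\<And>i. i \<in> I \<Longrightarrow> c' i \<le> k"
  shows "tproj n k I c (tproj n k I c' f) = (if \<forall>i\<in>I. c i = c' i then tproj n k I c f else (\<lambda>_. 0))"
proof
  fix x
  show "tproj n k I c (tproj n k I c' f) x = (if \<forall>i\<in>I. c i = c' i then tproj n k I c f else (\<lambda>_. 0)) x"
  proof (cases "x \<in> G")
    case x: True
    have "tproj n k I c (tproj n k I c' f) x =
      (\<Sum>y\<in>G. \<Sum>z\<in>G. (\<Prod>i\<in>I. qker (n i) k (c i) (x i) (y i)) * ((\<Prod>i\<in>I. qker (n i) k (c' i) (y i) (z i)) * f z))"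
      using x by (simp add: tproj_def sum_distrib_left)
    also have "\<dots> = (\<Sum>z\<in>G. \<Sum>y\<in>G. (\<Prod>i\<in>I. qker (n i) k (c i) (x i) (y i)) * ((\<Prod>i\<in>I. qker (n i) k (c' i) (y i) (z i)) * f z))"
      by (rule sum.swap)
    also have "\<dots> = (\<Sum>z\<in>G. (\<Sum>y\<in>G. \<Prod>i\<in>I. qker (n i) k (c i) (x i) (y i) * qker (n i) k (c' i) (y i) (z i)) * f z)"
      by (simp add: prod.distrib sum_distrib_right mult.assoc)
    also have "\<dots> = (\<Sum>z\<in>G. (if \<forall>i\<in>I. c i = c' i then \<Prod>i\<in>I. qker (n i) k (c i) (x i) (z i) else 0) * f z)"
    proof (intro sum.cong refl arg_cong2[where f = times])
      fix z assume z: "z \<in> G"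
      have "(\<Sum>y\<in>G. \<Prod>i\<in>I. qker (n i) k (c i) (x i) (y i) * qker (n i) k (c' i) (y i) (z i)) =
          (\<Prod>i\<in>I. if c i = c' i then qker (n i) k (c i) (x i) (z i) else 0)"
        unfolding grid_sum_prod[OF fin, where a = "\<lambda>i y. qker (n i) k (c i) (x i) y * qker (n i) k (c' i) y (z i)"]
        using assms k1 kn gridD[OF x] gridD[OF z] by (intro prod.cong refl qker_compose) auto
      also have "\<dots> = (if \<forall>i\<in>I. c i = c' i then \<Prod>i\<in>I. qker (n i) k (c i) (x i) (z i) else 0)"
        using fin by (auto intro!: prod_zero)
      finally show "(\<Sum>y\<in>G. \<Prod>i\<in>I. qker (n i) k (c i) (x i) (y i) * qker (n i) k (c' i) (y i) (z i)) =
          (if \<forall>i\<in>I. c i = c' i then \<Prod>i\<in>I. qker (n i) k (c i) (x i) (z i) else 0)" .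
    qed
    finally have eq: "tproj n k I c (tproj n k I c' f) x =
      (\<Sum>z\<in>G. (if \<forall>i\<in>I. c i = c' i then \<Prod>i\<in>I. qker (n i) k (c i) (x i) (z i) else 0) * f z)" .
    show ?thesis
    proof (cases "\<forall>i\<in>I. c i = c' i")
      case True
      thus ?thesis unfolding eq using x by (simp add: tproj_def)
    next
      case False
      thus ?thesis unfolding eq by (simp only: if_False) simp
    qed
  qed (simp add: tproj_def)
qed

lemma tproj_idem: "(\<And>i. i \<in> I \<Longrightarrow> c i \<le> k) \<Longrightarrow> tproj n k I c (tproj n k I c f) = tproj n k I c f"
  using tproj_compose[of c c f] by simp

lemma tproj_contraction:
  assumes "\<And>i. i \<in> I \<Longrightarrow> c i \<le> k"
  shows "ip G (tproj n k I c f) (tproj n k I c f) \<le> ip G f f"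
proof (rule ip_self_le_of_projection)
  show "ip G (tproj n k I c f) (tproj n k I c f) = ip G (tproj n k I c f) f"
    using tproj_symmetric[of c "tproj n k I c f" f] by (simp add: tproj_idem assms)
qed

text \<open>Expanding the product over the coordinates of the one-dimensional resolutions of the
  identity.\<close>

lemma tproj_partition:
  assumes "x \<in> G"
  shows "(\<Sum>c\<in>(\<Pi>\<^sub>E i\<in>I. {0..k}). tproj n k I c f x) = f x"
proof -
  have "(\<Sum>c\<in>(\<Pi>\<^sub>E i\<in>I. {0..k}). tproj n k I c f x) =
     (\<Sum>y\<in>G. (\<Sum>c\<in>(\<Pi>\<^sub>E i\<in>I. {0..k}). \<Prod>i\<in>I. qker (n i) k (c i) (x i) (y i)) * f y)"
    using assms by (simp add: tproj_def sum_distrib_right) (rule sum.swap)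
  also have "\<dots> = (\<Sum>y\<in>G. (if x = y then 1 else 0) * f y)"
  proof (intro sum.cong refl arg_cong2[where f = times])
    fix y assume y: "y \<in> G"
    have "(\<Sum>c\<in>(\<Pi>\<^sub>E i\<in>I. {0..k}). \<Prod>i\<in>I. qker (n i) k (c i) (x i) (y i)) =
        (\<Prod>i\<in>I. \<Sum>c=0..k. qker (n i) k c (x i) (y i))"
      using fin by (intro prod_sum_PiE[symmetric]) auto
    also have "\<dots> = (\<Prod>i\<in>I. if x i = y i then 1 else 0)"
      using k1 kn gridD[OF assms] gridD[OF y] by (intro prod.cong refl qker_sum) auto
    finally show "(\<Sum>c\<in>(\<Pi>\<^sub>E i\<in>I. {0..k}). \<Prod>i\<in>I. qker (n i) k (c i) (x i) (y i)) = (if x = y then 1 else 0)"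
      using prod_eq_indicator[OF fin assms y] by simp
  qed
  also have "\<dots> = (\<Sum>y\<in>G. if x = y then f x else 0)" by (intro sum.cong) auto
  also have "\<dots> = f x" using assms fin by simp
  finally show ?thesis .
qed

lemma tproj_tens:
  "tproj n k I c (tens n I u) = tens n I (\<lambda>i x. \<Sum>y=1..n i. qker (n i) k (c i) x y * u i y)"
proof
  fix x
  show "tproj n k I c (tens n I u) x = tens n I (\<lambda>i x. \<Sum>y=1..n i. qker (n i) k (c i) x y * u i y) x"
  proof (cases "x \<in> G")
    case True
    have "tproj n k I c (tens n I u) x = (\<Sum>y\<in>G. \<Prod>i\<in>I. qker (n i) k (c i) (x i) (y i) * u i (y i))"
      using True by (auto simp: tproj_def tens_def prod.distrib intro!: sum.cong)
    also have "\<dots> = (\<Prod>i\<in>I. \<Sum>y=1..n i. qker (n i) k (c i) (x i) y * u i y)"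
      by (rule grid_sum_prod[OF fin])
    finally show ?thesis using True by (simp add: tens_def)
  qed (simp add: tproj_def tens_def)
qed

text \<open>The synthesis formula applied to the indicator of y.\<close>

lemma qker_0_as_sum:
  assumes "i \<in> I" "x \<in> {1..n i}" "y \<in> {1..n i}"
  shows "qker (n i) k 0 x y = (\<Sum>\<kappa>=k+1..n i. dker (n i) k \<kappa> y * phi_t (n i) k \<kappa> x)"
proof -
  have "(\<Sum>z=1..n i. F z * (if z = y then 1 else 0)) = F y" for F :: "nat \<Rightarrow> real"
  proof -
    have "(\<Sum>z=1..n i. F z * (if z = y then 1 else 0)) = (\<Sum>z=1..n i. if z = y then F y else 0)"
      by (intro sum.cong) auto
    thus ?thesis using assms by simp
  qed
  thus ?thesis using qker_0_synthesis[OF k1 kn[OF assms(1)] assms(2), of "\<lambda>z. if z = y then 1 else 0"]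
    by simp
qed

lemma tproj_synthesis:
  "tproj n k I (\<lambda>_. 0) f = (\<lambda>x. \<Sum>\<kappa>\<in>inner_grid k n I. dcoef n k I f \<kappa> * tens n I (\<lambda>i. phi_t (n i) k (\<kappa> i)) x)"
proof
  fix x
  show "tproj n k I (\<lambda>_. 0) f x = (\<Sum>\<kappa>\<in>inner_grid k n I. dcoef n k I f \<kappa> * tens n I (\<lambda>i. phi_t (n i) k (\<kappa> i)) x)"
  proof (cases "x \<in> G")
    case True
    have "tproj n k I (\<lambda>_. 0) f x = (\<Sum>y\<in>G. (\<Sum>\<kappa>\<in>inner_grid k n I.
        \<Prod>i\<in>I. dker (n i) k (\<kappa> i) (y i) * phi_t (n i) k (\<kappa> i) (x i)) * f y)"
    proof -
      have "(\<Prod>i\<in>I. qker (n i) k 0 (x i) (y i)) = (\<Sum>\<kappa>\<in>inner_grid k n I.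
        \<Prod>i\<in>I. dker (n i) k (\<kappa> i) (y i) * phi_t (n i) k (\<kappa> i) (x i))" if "y \<in> G" for y
        unfolding inner_grid_sum_prod[OF fin, where a = "\<lambda>i \<kappa>. dker (n i) k \<kappa> (y i) * phi_t (n i) k \<kappa> (x i)"]
        using gridD[OF True] gridD[OF that] by (intro prod.cong refl qker_0_as_sum) auto
      thus ?thesis using True by (simp add: tproj_def)
    qed
    also have "\<dots> = (\<Sum>\<kappa>\<in>inner_grid k n I. dcoef n k I f \<kappa> * (\<Prod>i\<in>I. phi_t (n i) k (\<kappa> i) (x i)))"
      unfolding dcoef_def sum_distrib_right
      by (subst sum.swap) (simp add: prod.distrib mult_ac)
    finally show ?thesis using True by (simp add: tens_def)
  qed (simp add: tproj_def tens_def)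
qed

text \<open>Removing low-order content in any coordinate leaves all mixed differences unchanged.
  This keeps the penalty fixed when a tensor is projected onto the range of the margins.\<close>

lemma dcoef_tproj:
  assumes "\<kappa> \<in> inner_grid k n I"
  shows "dcoef n k I (tproj n k I (\<lambda>_. 0) f) \<kappa> = dcoef n k I f \<kappa>"
proof -
  have "dcoef n k I (tproj n k I (\<lambda>_. 0) f) \<kappa> = (\<Sum>x\<in>G. \<Sum>y\<in>G.
      (\<Prod>i\<in>I. dker (n i) k (\<kappa> i) (x i) * qker (n i) k 0 (x i) (y i)) * f y)"
    by (simp add: dcoef_def tproj_def sum_distrib_left prod.distrib mult.assoc)
  also have "\<dots> = (\<Sum>y\<in>G. (\<Sum>x\<in>G. \<Prod>i\<in>I. dker (n i) k (\<kappa> i) (x i) * qker (n i) k 0 (x i) (y i)) * f y)"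
    by (subst sum.swap) (simp add: sum_distrib_right)
  also have "\<dots> = dcoef n k I f \<kappa>"
    unfolding dcoef_def
  proof (intro sum.cong refl arg_cong2[where f = times])
    fix y assume y: "y \<in> G"
    show "(\<Sum>x\<in>G. \<Prod>i\<in>I. dker (n i) k (\<kappa> i) (x i) * qker (n i) k 0 (x i) (y i)) = (\<Prod>i\<in>I. dker (n i) k (\<kappa> i) (y i))"
      unfolding grid_sum_prod[OF fin, where a = "\<lambda>i x. dker (n i) k (\<kappa> i) x * qker (n i) k 0 x (y i)"]
      using k1 kn gridD[OF y] assms by (intro prod.cong refl dker_qker_0) (auto simp: inner_grid_def)
  qed
  finally show ?thesis .
qed

end

section \<open>The difference operators\<close>

lemma diff_op_commute: "diff_op k n i (diff_op k n i' f) = diff_op k n i' (diff_op k n i f)"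
proof (cases "i = i'")
  case False
  hence "(j(i := j i - l))(i' := (j(i := j i - l)) i' - l') = (j(i' := j i' - l'))(i := (j(i' := j i' - l')) i - l)" for j :: mindex and l l'
    by (auto simp: fun_eq_iff)
  thus ?thesis
    unfolding diff_op_def sum_distrib_left
    by (subst sum.swap) (simp add: mult_ac)
qed simp

lemma comp_fun_commute_diff_op: "comp_fun_commute (diff_op k n)"
  by unfold_locales (auto simp: fun_eq_iff diff_op_commute)

lemma diff_ops_insert:
  "finite M \<Longrightarrow> i \<notin> M \<Longrightarrow> diff_ops k n (insert i M) f = diff_op k n i (diff_ops k n M f)"
proof -
  interpret comp_fun_commute "diff_op k n" by (rule comp_fun_commute_diff_op)
  show "finite M \<Longrightarrow> i \<notin> M \<Longrightarrow> diff_ops k n (insert i M) f = diff_op k n i (diff_ops k n M f)"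
    unfolding diff_ops_def by (rule fold_insert)
qed

text \<open>The multi-index j may have coordinates outside M, and f is evaluated at a mixture of y
  on M and j elsewhere. The induction needs this generality: the coordinate being added is frozen at
  z while the hypothesis is applied to the others.\<close>

lemma diff_ops_eq_dcoef:
  assumes "finite M" "1 \<le> k" "\<And>i. i \<in> M \<Longrightarrow> j i \<in> {k+1..n i}"
  shows "diff_ops k n M f j =
    (\<Sum>y\<in>grid n M. (\<Prod>i\<in>M. dker (n i) k (j i) (y i)) * f (\<lambda>i. if i \<in> M then y i else j i))"
  using assms(1,3)
proof (induction M arbitrary: j)
  case empty
  thus ?case by (simp add: diff_ops_def grid_def)
next
  case (insert i M)
  let ?g = "\<lambda>z y. f (\<lambda>i'. if i' \<in> insert i M then (y(i := z)) i' else j i')"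
  have ji: "j i \<in> {k+1..n i}" using insert.prems by auto
  have "diff_ops k n (insert i M) f j = real (n i) ^ (k - 1) * altsum k (\<lambda>l. diff_ops k n M f (j(i := j i - l)))"
    unfolding diff_ops_insert[OF insert.hyps] by (simp add: diff_op_def altsum_def)
  also have "\<dots> = (\<Sum>z=1..n i. dker (n i) k (j i) z * diff_ops k n M f (j(i := z)))"
    using dker_sum[OF ji, of "\<lambda>z. diff_ops k n M f (j(i := z))"] by simp
  also have "\<dots> = (\<Sum>z=1..n i. dker (n i) k (j i) z * (\<Sum>y\<in>grid n M. (\<Prod>i\<in>M. dker (n i) k (j i) (y i)) * ?g z y))"
  proof (intro sum.cong refl arg_cong2[where f = times])
    fix z
    have "diff_ops k n M f (j(i := z)) = (\<Sum>y\<in>grid n M. (\<Prod>i'\<in>M. dker (n i') k ((j(i := z)) i') (y i')) *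
        f (\<lambda>i'. if i' \<in> M then y i' else (j(i := z)) i'))"
      using insert.prems insert.hyps by (intro insert.IH) auto
    also have "\<dots> = (\<Sum>y\<in>grid n M. (\<Prod>i\<in>M. dker (n i) k (j i) (y i)) * ?g z y)"
      using insert.hyps by (intro sum.cong refl arg_cong2[where f = times] prod.cong arg_cong[where f = f] ext) auto
    finally show "diff_ops k n M f (j(i := z)) = (\<Sum>y\<in>grid n M. (\<Prod>i\<in>M. dker (n i) k (j i) (y i)) * ?g z y)" .
  qed
  also have "\<dots> = (\<Sum>(z, y)\<in>{1..n i} \<times> grid n M. dker (n i) k (j i) z * ((\<Prod>i\<in>M. dker (n i) k (j i) (y i)) * ?g z y))"
    by (simp add: sum_distrib_left sum.cartesian_product)
  also have "\<dots> = (\<Sum>y\<in>grid n (insert i M). (\<Prod>i\<in>insert i M. dker (n i) k (j i) (y i)) *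
      f (\<lambda>i'. if i' \<in> insert i M then y i' else j i'))"
  proof -
    have geq: "grid n (insert i M) = (\<lambda>(z, y). y(i := z)) ` ({1..n i} \<times> grid n M)"
      by (simp add: grid_def PiE_insert_eq)
    have inj: "inj_on (\<lambda>(z, y). y(i := z)) ({1..n i} \<times> grid n M)"
      unfolding grid_def using insert.hyps(2) by (rule inj_combinator)
    have pr: "(\<Prod>i'\<in>M. dker (n i') k (j i') ((y(i := z)) i')) = (\<Prod>i'\<in>M. dker (n i') k (j i') (y i'))" for y z
      using insert.hyps by (intro prod.cong) auto
    show ?thesis
      unfolding geq sum.reindex[OF inj] o_def unfolding case_prod_beta prod.insert[OF insert.hyps] pr
      by (simp add: mult.assoc)
  qed
  finally show ?case .
qed

lemma (in dict_grid) diff_ops_inner: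
  assumes "\<kappa> \<in> inner_grid k n I" shows "diff_ops k n I f \<kappa> = dcoef n k I f \<kappa>"
proof -
  have "diff_ops k n I f \<kappa> =
    (\<Sum>y\<in>G. (\<Prod>i\<in>I. dker (n i) k (\<kappa> i) (y i)) * f (\<lambda>i. if i \<in> I then y i else \<kappa> i))"
    using assms by (intro diff_ops_eq_dcoef fin k1) (auto simp: inner_grid_def)
  also have "\<dots> = dcoef n k I f \<kappa>"
    unfolding dcoef_def
  proof (intro sum.cong refl arg_cong2[where f = times] arg_cong[where f = f] ext)
    fix y i assume "y \<in> G"
    thus "(if i \<in> I then y i else \<kappa> i) = y i"
      using assms by (auto simp: grid_def inner_grid_def PiE_iff extensional_def)
  qed
  finally show ?thesis .
qed

section \<open>ANOVA parts and margins\<close>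

declare One_nat_def [simp del]

text \<open>Encodes a pair (M, h) as one selector for the coordinate kernels: 0 marks the
  coordinates of M, a positive value the low-order atom chosen by h.\<close>

definition csel :: "nat set \<Rightarrow> mindex \<Rightarrow> nat \<Rightarrow> nat" where
  "csel M h i = (if i \<in> M then 0 else h i)"

definition atom_merge :: "nat set \<Rightarrow> mindex \<Rightarrow> mindex \<Rightarrow> mindex" where
  "atom_merge M h \<kappa> = (\<lambda>i. if i \<in> M then \<kappa> i else h i)"

lemma tens_cong:
  "(\<And>i x. i \<in> I \<Longrightarrow> x \<in> {1..n i} \<Longrightarrow> u i x = v i x) \<Longrightarrow> tens n I u = tens n I v"
  unfolding tens_def by (intro ext if_cong refl prod.cong) (metis gridD)

lemma extend_margin_diff:
  "extend_margin k d n M h (\<lambda>x. a x - b x) = (\<lambda>j. extend_margin k d n M h a j - extend_margin k d n M h b j)"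
  by (auto simp: extend_margin_def left_diff_distrib)

lemma extend_margin_scale:
  "extend_margin k d n M h (\<lambda>x. a * b x) = (\<lambda>j. a * extend_margin k d n M h b j)"
  by (auto simp: extend_margin_def)

lemma extend_margin_sum:
  "extend_margin k d n M h (\<lambda>x. \<Sum>a\<in>A. g a x) = (\<lambda>j. \<Sum>a\<in>A. extend_margin k d n M h (g a) j)"
  by (auto simp: extend_margin_def sum_distrib_right)

locale anova =
  fixes n :: "nat \<Rightarrow> nat" and k d :: nat
  assumes k1': "1 \<le> k" and kn': "\<And>i. i \<in> {1..d} \<Longrightarrow> k < n i"
begin

sublocale dict_grid n k "{1..d}"
  by unfold_locales (use k1' kn' in auto)

lemma dict_grid_subset: "M \<subseteq> {1..d} \<Longrightarrow> dict_grid n k M"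
  by unfold_locales (use k1' kn' in \<open>auto intro: finite_subset\<close>)

lemma csel_le: "M \<subseteq> {1..d} \<Longrightarrow> h \<in> hset k d M \<Longrightarrow> i \<in> {1..d} \<Longrightarrow> csel M h i \<le> k"
  by (auto simp: csel_def hset_def PiE_iff)

lemma hsetD: "h \<in> hset k d M \<Longrightarrow> i \<in> {1..d} - M \<Longrightarrow> h i \<in> {1..k}"
  by (auto simp: hset_def)

lemma prod_split: "M \<subseteq> {1..d} \<Longrightarrow> (\<Prod>i\<in>{1..d}. f i) = (\<Prod>i\<in>M. f i) * (\<Prod>i\<in>{1..d} - M. f i :: real)"
  by (subst prod.subset_diff[of M]) auto

lemma nprod_split: "M \<subseteq> {1..d} \<Longrightarrow> nprod n {1..d} = nprod n M * nprod n ({1..d} - M)"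
  unfolding nprod_def by (rule prod_split)

lemma Phi_t_eq_tens: "Phi_t k d n \<kappa> = tens n {1..d} (\<lambda>i. phi_t (n i) k (\<kappa> i))"
  by (simp add: Phi_t_def tens_def)

lemma tproj_Phi_t:
  assumes "M \<subseteq> {1..d}" "h \<in> hset k d M" "\<kappa> \<in> atom_index k d n M h"
  shows "tproj n k {1..d} (csel M h) (Phi_t k d n \<kappa>) = Phi_t k d n \<kappa>"
proof -
  have eq: "(\<Sum>y=1..n i. qker (n i) k (csel M h i) x y * phi_t (n i) k (\<kappa> i) y) = phi_t (n i) k (\<kappa> i) x"
    if i: "i \<in> {1..d}" and x: "x \<in> {1..n i}" for i x
  proof (cases "i \<in> M")
    case True
    hence "\<kappa> i \<in> {k+1..n i}" using assms(3) i unfolding atom_index_def by (auto dest!: PiE_mem[of _ _ _ i])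
    thus ?thesis using True qker_0_phi_t_high[OF k1 kn[OF i] _ x, of "\<kappa> i"] by (simp add: csel_def)
  next
    case False
    hence \<kappa>: "\<kappa> i = h i" using assms(3) i unfolding atom_index_def by (auto dest!: PiE_mem[of _ _ _ i])
    have h: "h i \<in> {1..k}" using assms(2) i False by (intro hsetD[of h M]) auto
    hence "h i \<noteq> 0" by auto
    thus ?thesis
      using False h n_pos[OF i] qker_c_apply[OF k1 kn[OF i], of "h i" x "phi_t (n i) k (h i)"]
        phi_t_orthogonal[OF k1 kn[OF i] h h]
      by (simp add: csel_def \<kappa>)
  qed
  show ?thesis
    unfolding Phi_t_eq_tens tproj_tens by (rule tens_cong) (rule eq)
qed

lemma finite_atom_index: "finite (atom_index k d n M h)"
  unfolding atom_index_def by (intro finite_PiE) auto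

lemma tproj_in_anova_space:
  assumes "M \<subseteq> {1..d}" "h \<in> hset k d M"
  shows "tproj n k {1..d} (csel M h) f \<in> anova_space k d n M h"
proof -
  define E where "E = (\<lambda>i \<kappa> y. if i \<in> M then dker (n i) k \<kappa> y else phi_t (n i) k \<kappa> y / real (n i))"
  define A where "A = (\<lambda>i. if i \<in> M then {k+1..n i} else {h i})"
  define co where "co = (\<lambda>\<kappa>. \<Sum>y\<in>G. (\<Prod>i\<in>{1..d}. E i (\<kappa> i) (y i)) * f y)"
  have q: "qker (n i) k (csel M h i) x y = (\<Sum>\<kappa>\<in>A i. E i \<kappa> y * phi_t (n i) k \<kappa> x)"
    if i: "i \<in> {1..d}" and xy: "x \<in> {1..n i}" "y \<in> {1..n i}" for i x y
  proof (cases "i \<in> M")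
    case True
    thus ?thesis using qker_0_as_sum[OF i xy] by (simp add: csel_def A_def E_def)
  next
    case False
    thus ?thesis using hsetD[OF assms(2), of i] i by (simp add: csel_def A_def E_def qker_def)
  qed
  have "tproj n k {1..d} (csel M h) f = (\<lambda>x. \<Sum>\<kappa>\<in>atom_index k d n M h. co \<kappa> * Phi_t k d n \<kappa> x)"
  proof
    fix x
    show "tproj n k {1..d} (csel M h) f x = (\<Sum>\<kappa>\<in>atom_index k d n M h. co \<kappa> * Phi_t k d n \<kappa> x)"
    proof (cases "x \<in> G")
      case True
      have "(\<Prod>i\<in>{1..d}. qker (n i) k (csel M h i) (x i) (y i)) =
        (\<Sum>\<kappa>\<in>atom_index k d n M h. \<Prod>i\<in>{1..d}. E i (\<kappa> i) (y i) * phi_t (n i) k (\<kappa> i) (x i))" if "y \<in> G" for y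
      proof -
        have "(\<Prod>i\<in>{1..d}. qker (n i) k (csel M h i) (x i) (y i)) =
            (\<Prod>i\<in>{1..d}. \<Sum>\<kappa>\<in>A i. E i \<kappa> (y i) * phi_t (n i) k \<kappa> (x i))"
          using gridD[OF True] gridD[OF that] by (intro prod.cong refl q) auto
        also have "\<dots> = (\<Sum>\<kappa>\<in>PiE {1..d} A. \<Prod>i\<in>{1..d}. E i (\<kappa> i) (y i) * phi_t (n i) k (\<kappa> i) (x i))"
          by (intro prod_sum_PiE) (auto simp: A_def)
        finally show ?thesis by (simp add: atom_index_def A_def)
      qed
      hence "tproj n k {1..d} (csel M h) f x = (\<Sum>y\<in>G. (\<Sum>\<kappa>\<in>atom_index k d n M h.
          \<Prod>i\<in>{1..d}. E i (\<kappa> i) (y i) * phi_t (n i) k (\<kappa> i) (x i)) * f y)"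
        using True by (simp add: tproj_def)
      also have "\<dots> = (\<Sum>\<kappa>\<in>atom_index k d n M h. co \<kappa> * (\<Prod>i\<in>{1..d}. phi_t (n i) k (\<kappa> i) (x i)))"
        unfolding co_def sum_distrib_right
        by (subst sum.swap) (simp add: prod.distrib mult_ac)
      finally show ?thesis using True by (simp add: Phi_t_def)
    qed (simp add: tproj_def Phi_t_def)
  qed
  moreover have "(\<lambda>x. \<Sum>\<kappa>\<in>atom_index k d n M h. co \<kappa> * Phi_t k d n \<kappa> x) \<in> anova_space k d n M h"
    unfolding anova_space_def using finite_atom_index by (intro fun_span_sum fun_span_base) auto
  ultimately show ?thesis by simp
qed

text \<open>The product kernel maps into the space, is self-adjoint, and fixes every generator;
  hence its residual is orthogonal to all of them.\<close>

lemma anova_part_eq: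
  assumes "M \<subseteq> {1..d}" "h \<in> hset k d M"
  shows "anova_part k d n M h f = tproj n k {1..d} (csel M h) f"
  unfolding anova_part_def anova_space_def
proof (rule ortho_proj_eqI)
  show "tproj n k {1..d} (csel M h) f \<in> fun_span (Phi_t k d n ` atom_index k d n M h)"
    using tproj_in_anova_space[OF assms] by (simp add: anova_space_def)
next
  fix w assume "w \<in> Phi_t k d n ` atom_index k d n M h"
  hence "tproj n k {1..d} (csel M h) w = w" using tproj_Phi_t[OF assms] by auto
  thus "ip G (\<lambda>x. f x - tproj n k {1..d} (csel M h) f x) w = 0"
    using tproj_symmetric[of "csel M h" f w] by (simp add: ip_diff_left)
qed (auto simp: Phi_t_def)

lemma extend_margin_tens:
  assumes "M \<subseteq> {1..d}"
  shows "extend_margin k d n M h (tens n M u) = tens n {1..d} (\<lambda>i. if i \<in> M then u i else phi_t (n i) k (h i))"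
proof
  fix x
  show "extend_margin k d n M h (tens n M u) x = tens n {1..d} (\<lambda>i. if i \<in> M then u i else phi_t (n i) k (h i)) x"
  proof (cases "x \<in> G")
    case True
    hence "restrict x M \<in> grid n M" using assms by (auto simp: grid_def)
    thus ?thesis using True by (simp add: extend_margin_def tens_def prod_split[OF assms])
  qed (simp add: extend_margin_def tens_def)
qed

text \<open>Each fixed low-order atom has squared norm n_i, so extending a margin scales inner
  products by the product of the n_i outside M. A loss per n_M on margins is therefore a loss per n
  on full tensors.\<close>

lemma ip_extend_margin:
  assumes "M \<subseteq> {1..d}" "h \<in> hset k d M"
  shows "ip G (extend_margin k d n M h a) (extend_margin k d n M h b) =
    nprod n ({1..d} - M) * ip (grid n M) a b"
proof -
  let ?C = "{1..d} - M"
  let ?m = "\<lambda>x y i. if i \<in> M then x i else y i"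
  define P where "P = (\<lambda>y. \<Prod>i\<in>?C. (phi_t (n i) k (h i) (y i))\<^sup>2)"
  have in_G: "?m x y \<in> G" if "x \<in> grid n M" "y \<in> grid n ?C" for x y
    using that assms(1) by (auto simp: grid_def PiE_iff extensional_def)
  have res: "restrict (?m x y) M = x" if "x \<in> grid n M" for x y :: mindex
    using that by (auto simp: grid_def PiE_iff extensional_def fun_eq_iff)
  have pr: "(\<Prod>i\<in>?C. phi_t (n i) k (h i) (?m x y i)) = (\<Prod>i\<in>?C. phi_t (n i) k (h i) (y i))" for x y :: mindex
    by (intro prod.cong) auto
  have "ip G (extend_margin k d n M h a) (extend_margin k d n M h b) =
      (\<Sum>x\<in>grid n M. \<Sum>y\<in>grid n ?C. a x * b x * P y)"
    unfolding ip_def grid_split[OF assms(1)]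
    by (intro sum.cong refl)
      (simp add: extend_margin_def in_G res pr P_def power2_eq_square prod.distrib del: atLeastAtMost_iff)
  also have "\<dots> = ip (grid n M) a b * (\<Sum>y\<in>grid n ?C. P y)"
    by (simp add: ip_def sum_product)
  also have "(\<Sum>y\<in>grid n ?C. P y) = (\<Prod>i\<in>?C. \<Sum>y=1..n i. (phi_t (n i) k (h i) y)\<^sup>2)"
    unfolding P_def by (rule grid_sum_prod) simp
  also have "\<dots> = nprod n ?C"
    unfolding nprod_def
  proof (intro prod.cong refl)
    fix i assume i: "i \<in> ?C"
    have "(\<Sum>y=1..n i. (phi_t (n i) k (h i) y)\<^sup>2) = ip {1..n i} (phi_t (n i) k (h i)) (phi_t (n i) k (h i))"
      by (simp add: ip_def power2_eq_square)
    also have "\<dots> = real (n i)" using phi_t_orthogonal[OF k1 kn hsetD[OF assms(2) i] hsetD[OF assms(2) i]] i by simp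
    finally show "(\<Sum>y=1..n i. (phi_t (n i) k (h i) y)\<^sup>2) = real (n i)" .
  qed
  finally show ?thesis by simp
qed

lemma extend_margin_inject:
  assumes M: "M \<subseteq> {1..d}" "h \<in> hset k d M" and ab: "a \<in> tensors n M" "b \<in> tensors n M"
    and eq: "extend_margin k d n M h a = extend_margin k d n M h b"
  shows "a = b"
proof -
  interpret M: dict_grid n k M by (rule dict_grid_subset[OF M(1)])
  have "nprod n ({1..d} - M) \<noteq> 0" unfolding nprod_def using n_pos by (auto simp: prod_zero_iff)
  moreover have "ip G (extend_margin k d n M h (\<lambda>x. a x - b x)) (extend_margin k d n M h (\<lambda>x. a x - b x)) = 0"
    by (simp add: extend_margin_diff eq ip_def)
  ultimately have "ip (grid n M) (\<lambda>x. a x - b x) (\<lambda>x. a x - b x) = 0"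
    unfolding ip_extend_margin[OF M] by simp
  hence "\<forall>x\<in>grid n M. a x = b x" by (simp add: ip_eq_0_iff M.fin)
  thus ?thesis using ab by (auto simp: tensors_def fun_eq_iff)
qed

text \<open>An explicit margin: contract f with the fixed atoms outside M and apply the complement
  kernel in each coordinate of M. It is linear in f, unlike the definite description in
  \<open>margin\<close>, whose linearity and measurability would not be visible.\<close>

definition pmargin :: "nat set \<Rightarrow> mindex \<Rightarrow> tensor \<Rightarrow> tensor" where
  "pmargin M h f = (\<lambda>x. \<Sum>y\<in>G. (f y * (\<Prod>i\<in>{1..d} - M. phi_t (n i) k (h i) (y i) / real (n i))) *
     tens n M (\<lambda>i z. qker (n i) k 0 z (y i)) x)"

lemma pmargin_vanish: "x \<notin> grid n M \<Longrightarrow> pmargin M h f x = 0"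
  by (simp add: pmargin_def tens_def)

lemma extend_pmargin:
  assumes "M \<subseteq> {1..d}" "h \<in> hset k d M"
  shows "extend_margin k d n M h (pmargin M h f) = tproj n k {1..d} (csel M h) f"
proof
  fix x
  show "extend_margin k d n M h (pmargin M h f) x = tproj n k {1..d} (csel M h) f x"
  proof (cases "x \<in> G")
    case True
    have "(\<Prod>i\<in>{1..d}. qker (n i) k (csel M h i) (x i) (y i)) =
      (\<Prod>i\<in>{1..d} - M. phi_t (n i) k (h i) (y i) / real (n i)) *
      tens n {1..d} (\<lambda>i. if i \<in> M then (\<lambda>z. qker (n i) k 0 z (y i)) else phi_t (n i) k (h i)) x" for y
    proof -
      have "(\<Prod>i\<in>{1..d} - M. qker (n i) k (csel M h i) (x i) (y i)) =
         (\<Prod>i\<in>{1..d} - M. phi_t (n i) k (h i) (y i) / real (n i)) * (\<Prod>i\<in>{1..d} - M. phi_t (n i) k (h i) (x i))"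
        unfolding prod.distrib[symmetric]
        using hsetD[OF assms(2)] by (intro prod.cong refl) (force simp: csel_def qker_def)
      moreover have "(\<Prod>i\<in>M. qker (n i) k (csel M h i) (x i) (y i)) = (\<Prod>i\<in>M. qker (n i) k 0 (x i) (y i))"
        by (intro prod.cong) (auto simp: csel_def)
      ultimately show ?thesis
        using True unfolding prod_split[OF assms(1)] tens_def by (simp add: prod.distrib prod_split[OF assms(1)])
    qed
    thus ?thesis using True
      unfolding pmargin_def extend_margin_sum extend_margin_scale extend_margin_tens[OF assms(1)]
      by (simp add: tproj_def mult_ac)
  qed (simp add: tproj_def extend_margin_def)
qed

lemma margin_eq:
  assumes "M \<subseteq> {1..d}" "h \<in> hset k d M"
  shows "margin k d n M h f = pmargin M h f"
  unfolding margin_def anova_part_eq[OF assms]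
proof (rule the_equality)
  show "pmargin M h f \<in> tensors n M \<and> tproj n k {1..d} (csel M h) f = extend_margin k d n M h (pmargin M h f)"
    using extend_pmargin[OF assms] by (auto simp: tensors_def pmargin_vanish)
  fix b assume "b \<in> tensors n M \<and> tproj n k {1..d} (csel M h) f = extend_margin k d n M h b"
  thus "b = pmargin M h f"
    using extend_margin_inject[OF assms, of b "pmargin M h f"] extend_pmargin[OF assms]
    by (auto simp: tensors_def pmargin_vanish)
qed

lemma tproj_pmargin:
  assumes "M \<subseteq> {1..d}"
  shows "tproj n k M (\<lambda>_. 0) (pmargin M h f) = pmargin M h f"
proof -
  interpret M: dict_grid n k M by (rule dict_grid_subset[OF assms])
  have "tproj n k M (\<lambda>_. 0) (tens n M (\<lambda>i z. qker (n i) k 0 z (y i))) = tens n M (\<lambda>i z. qker (n i) k 0 z (y i))"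
    if y: "y \<in> G" for y
  proof -
    have "(\<Sum>z=1..n i. qker (n i) k 0 x z * qker (n i) k 0 z (y i)) = qker (n i) k 0 x (y i)"
      if "i \<in> M" "x \<in> {1..n i}" for i x
      using qker_compose[OF k1 M.kn[OF that(1)] _ _ that(2), of 0 0 "y i"] gridD[OF y, of i] that assms by auto
    thus ?thesis unfolding M.tproj_tens by (rule tens_cong)
  qed
  thus ?thesis unfolding pmargin_def tproj_sum tproj_scale by simp
qed

lemma extend_margin_synthesis:
  assumes "M \<subseteq> {1..d}" "h \<in> hset k d M" "tproj n k M (\<lambda>_. 0) b = b"
  shows "extend_margin k d n M h b =
    (\<lambda>x. \<Sum>\<kappa>\<in>inner_grid k n M. dcoef n k M b \<kappa> * Phi_t k d n (atom_merge M h \<kappa>) x)"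
proof -
  interpret M: dict_grid n k M by (rule dict_grid_subset[OF assms(1)])
  have Phi: "extend_margin k d n M h (tens n M (\<lambda>i. phi_t (n i) k (\<kappa> i))) = Phi_t k d n (atom_merge M h \<kappa>)" for \<kappa>
    unfolding extend_margin_tens[OF assms(1)] Phi_t_eq_tens
    by (intro arg_cong[where f = "tens n {1..d}"] ext) (simp add: atom_merge_def)
  have "extend_margin k d n M h b = extend_margin k d n M h
      (\<lambda>x. \<Sum>\<kappa>\<in>inner_grid k n M. dcoef n k M b \<kappa> * tens n M (\<lambda>i. phi_t (n i) k (\<kappa> i)) x)"
    unfolding M.tproj_synthesis[symmetric] assms(3) ..
  thus ?thesis unfolding extend_margin_sum extend_margin_scale Phi .
qed

lemma atom_merge_in: "M \<subseteq> {1..d} \<Longrightarrow> h \<in> hset k d M \<Longrightarrow> \<kappa> \<in> inner_grid k n M \<Longrightarrow>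
    atom_merge M h \<kappa> \<in> atom_index k d n M h"
  by (auto simp: atom_merge_def atom_index_def inner_grid_def hset_def PiE_iff extensional_def)

lemma tproj_extend_margin:
  assumes "M \<subseteq> {1..d}" "h \<in> hset k d M" "tproj n k M (\<lambda>_. 0) b = b"
  shows "tproj n k {1..d} (csel M h) (extend_margin k d n M h b) = extend_margin k d n M h b"
  unfolding extend_margin_synthesis[OF assms] tproj_sum tproj_scale
  using tproj_Phi_t[OF assms(1,2) atom_merge_in[OF assms(1,2)]] by simp

subsection \<open>Indexing the ANOVA components\<close>

text \<open>One selector in {0..k} per coordinate replaces the pair (M, h), so double sums become
  sums over a set of (k + 1)^d elements. This count is the source of the terms d ln(k + 1).\<close>

abbreviation "comps \<equiv> (\<Pi>\<^sub>E i\<in>{1..d}. {0..k})"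

definition zeros :: "mindex \<Rightarrow> nat set" where "zeros c = {i\<in>{1..d}. c i = 0}"

definition nonzeros :: "mindex \<Rightarrow> mindex" where "nonzeros c = restrict c ({1..d} - zeros c)"

lemma zeros_subset: "zeros c \<subseteq> {1..d}"
  by (auto simp: zeros_def)

lemma nonzeros_in: "c \<in> comps \<Longrightarrow> nonzeros c \<in> hset k d (zeros c)"
  by (fastforce simp: nonzeros_def zeros_def hset_def PiE_iff)

lemma csel_zeros: "i \<in> {1..d} \<Longrightarrow> csel (zeros c) (nonzeros c) i = c i"
  by (auto simp: csel_def zeros_def nonzeros_def)

lemma finite_hset: "finite (hset k d M)"
  unfolding hset_def by (intro finite_PiE) auto

lemma sum_components:
  "(\<Sum>M\<in>Pow {1..d}. \<Sum>h\<in>hset k d M. F M h) = (\<Sum>c\<in>comps. F (zeros c) (nonzeros c))"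
proof -
  have "(\<Sum>M\<in>Pow {1..d}. \<Sum>h\<in>hset k d M. F M h) = (\<Sum>(M, h)\<in>Sigma (Pow {1..d}) (hset k d). F M h)"
    by (rule sum.Sigma) (auto intro: finite_hset)
  also have "\<dots> = (\<Sum>c\<in>comps. F (zeros c) (nonzeros c))"
  proof (rule sum.reindex_bij_witness[of _ "\<lambda>c. (zeros c, nonzeros c)" "\<lambda>(M, h). \<lambda>i\<in>{1..d}. csel M h i"])
    fix a assume "a \<in> Sigma (Pow {1..d}) (hset k d)"
    then obtain M h where a: "a = (M, h)" "M \<subseteq> {1..d}" "h \<in> hset k d M" by auto
    have z: "zeros (\<lambda>i\<in>{1..d}. csel M h i) = M"
      using a(2) hsetD[OF a(3)] by (force simp: zeros_def csel_def)
    have nz: "nonzeros (\<lambda>i\<in>{1..d}. csel M h i) = h"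
      unfolding nonzeros_def z using a(3)
      by (auto simp: hset_def PiE_iff extensional_def fun_eq_iff csel_def)
    show "(zeros (case a of (M, h) \<Rightarrow> \<lambda>i\<in>{1..d}. csel M h i), nonzeros (case a of (M, h) \<Rightarrow> \<lambda>i\<in>{1..d}. csel M h i)) = a"
      by (simp only: a prod.case z nz)
    show "(case a of (M, h) \<Rightarrow> \<lambda>i\<in>{1..d}. csel M h i) \<in> comps"
      using csel_le[OF a(2,3)] by (simp only: a prod.case) auto
    show "F (zeros (case a of (M, h) \<Rightarrow> \<lambda>i\<in>{1..d}. csel M h i)) (nonzeros (case a of (M, h) \<Rightarrow> \<lambda>i\<in>{1..d}. csel M h i)) = (case a of (M, h) \<Rightarrow> F M h)"
      by (simp only: a prod.case z nz)
  next
    fix c assume c: "c \<in> comps"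
    show "(zeros c, nonzeros c) \<in> Sigma (Pow {1..d}) (hset k d)"
      using zeros_subset nonzeros_in[OF c] by auto
    have "(\<lambda>i\<in>{1..d}. csel (zeros c) (nonzeros c) i) = restrict c {1..d}"
      by (intro restrict_ext csel_zeros)
    thus "(case (zeros c, nonzeros c) of (M, h) \<Rightarrow> \<lambda>i\<in>{1..d}. csel M h i) = c"
      using c by simp
  qed
  finally show ?thesis .
qed

lemma tproj_component: "c \<in> comps \<Longrightarrow> tproj n k {1..d} (csel (zeros c) (nonzeros c)) f = tproj n k {1..d} c f"
  by (rule tproj_index_cong) (rule csel_zeros)

lemma ip_component_orthogonal:
  assumes "c \<in> comps" "c' \<in> comps" "c \<noteq> c'" "tproj n k {1..d} c f = f" "tproj n k {1..d} c' g = g"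
  shows "ip G f g = 0"
proof -
  have "\<not> (\<forall>i\<in>{1..d}. c i = c' i)" using assms(1-3) by (metis PiE_ext)
  hence "tproj n k {1..d} c (tproj n k {1..d} c' g) = (\<lambda>_. 0)"
    using assms(1,2) by (subst tproj_compose) auto
  moreover have "ip G f g = ip G f (tproj n k {1..d} c g)"
    using tproj_symmetric[of c f g] assms(4) by simp
  ultimately show ?thesis using assms(5) by (simp add: ip_def)
qed

lemma Parseval_components:
  assumes "\<And>c. c \<in> comps \<Longrightarrow> tproj n k {1..d} c (u c) = u c"
  shows "ip G (\<lambda>x. \<Sum>c\<in>comps. u c x) (\<lambda>x. \<Sum>c\<in>comps. u c x) = (\<Sum>c\<in>comps. ip G (u c) (u c))"
proof -
  have fin: "finite comps" by (intro finite_PiE) auto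
  have "ip G (\<lambda>x. \<Sum>c\<in>comps. u c x) (\<lambda>x. \<Sum>c\<in>comps. u c x) = (\<Sum>c\<in>comps. \<Sum>c'\<in>comps. ip G (u c) (u c'))"
    unfolding ip_sum_left ip_sum_right ..
  also have "\<dots> = (\<Sum>c\<in>comps. \<Sum>c'\<in>comps. if c' = c then ip G (u c) (u c) else 0)"
    using ip_component_orthogonal assms by (intro sum.cong refl) auto
  finally show ?thesis using fin by simp
qed

end

section \<open>Penalized least squares\<close>

text \<open>The sublevel sets are countable unions over rational points q of the events that the
  value at q plus the l1 distance to q stays below c. Meant for a minimizer picked by a choice
  operator, of which only a Lipschitz bound is known.\<close>

lemma borel_measurable_Lipschitz:
  fixes Gf :: "('a \<Rightarrow> real) \<Rightarrow> real" and Y :: "'a \<Rightarrow> 'w \<Rightarrow> real"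
  assumes J: "finite J" and lip: "\<And>y y'. \<bar>Gf y - Gf y'\<bar> \<le> (\<Sum>x\<in>J. \<bar>y x - y' x\<bar>)"
    and Y: "\<And>x. x \<in> J \<Longrightarrow> Y x \<in> borel_measurable M"
  shows "(\<lambda>w. Gf (\<lambda>x. Y x w)) \<in> borel_measurable M"
proof -
  define Q where "Q = (\<Pi>\<^sub>E x\<in>J. (\<rat> :: real set))"
  have "countable Q" unfolding Q_def using J by (intro countable_PiE) (auto simp: countable_rat)
  have "{w \<in> space M. Gf (\<lambda>x. Y x w) < c} \<in> sets M" for c
  proof -
    have "{w \<in> space M. Gf (\<lambda>x. Y x w) < c} =
      (\<Union>q\<in>Q. {w \<in> space M. Gf q + (\<Sum>x\<in>J. \<bar>Y x w - q x\<bar>) < c})" (is "?L = ?R")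
    proof (intro equalityI subsetI)
      fix w assume w: "w \<in> ?R"
      then obtain q where q: "w \<in> space M" "Gf q + (\<Sum>x\<in>J. \<bar>Y x w - q x\<bar>) < c" by auto
      thus "w \<in> ?L" using lip[of "\<lambda>x. Y x w" q] by auto
    next
      fix w assume w: "w \<in> ?L"
      \<comment> \<open>The distance to q enters twice, once through the Lipschitz bound and once in
        the event, and there are \<open>card J\<close> coordinates; the additional 1 keeps the final
        inequality strict and the denominator positive.\<close>
      define e where "e = (c - Gf (\<lambda>x. Y x w)) / (2 * (real (card J) + 1))"
      have e: "e > 0" using w by (auto simp: e_def)
      have "\<exists>r\<in>\<rat>. \<bar>Y x w - r\<bar> < e" for x
      proof -
        obtain r where "r \<in> \<rat>" "Y x w - e < r" "r < Y x w + e"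
          using Rats_dense_in_real[of "Y x w - e" "Y x w + e"] e by auto
        thus ?thesis by (intro bexI[of _ r]) (auto simp: abs_less_iff)
      qed
      then obtain r where r: "\<And>x. r x \<in> \<rat>" "\<And>x. \<bar>Y x w - r x\<bar> < e" by metis
      define q where "q = restrict r J"
      have q: "q \<in> Q" using r by (auto simp: q_def Q_def)
      have "(\<Sum>x\<in>J. \<bar>Y x w - q x\<bar>) \<le> (\<Sum>x\<in>J. e)"
        using r by (intro sum_mono) (auto simp: q_def less_imp_le)
      hence s: "(\<Sum>x\<in>J. \<bar>Y x w - q x\<bar>) \<le> real (card J) * e" by simp
      have "Gf q \<le> Gf (\<lambda>x. Y x w) + (\<Sum>x\<in>J. \<bar>Y x w - q x\<bar>)"
        using lip[of "\<lambda>x. Y x w" q] by linarith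
      hence "Gf q + (\<Sum>x\<in>J. \<bar>Y x w - q x\<bar>) \<le> Gf (\<lambda>x. Y x w) + 2 * (real (card J) * e)"
        using s by linarith
      also have "\<dots> < Gf (\<lambda>x. Y x w) + 2 * (real (card J) + 1) * e" using e by (simp add: algebra_simps)
      also have "\<dots> = c" by (simp add: e_def)
      finally show "w \<in> ?R" using q w by auto
    qed
    moreover have "{w \<in> space M. Gf q + (\<Sum>x\<in>J. \<bar>Y x w - q x\<bar>) < c} \<in> sets M" for q
    proof -
      have "(\<lambda>w. Gf q + (\<Sum>x\<in>J. \<bar>Y x w - q x\<bar>)) \<in> borel_measurable M"
        using Y by (intro borel_measurable_add borel_measurable_const borel_measurable_sum borel_measurable_abs
            borel_measurable_diff) auto
      thus ?thesis by (rule borel_measurable_less[OF _ borel_measurable_const])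
    qed
    ultimately show ?thesis using \<open>countable Q\<close> by (auto intro: sets.countable_UN'')
  qed
  thus ?thesis by (simp add: borel_measurable_iff_less)
qed

text \<open>The margin problem without its tensor structure: the penalty is a sum of absolute values
  of arbitrary linear functionals, and the arguments rest on convexity alone.\<close>

locale pen_ls =
  fixes J :: "'a set" and K :: "'b set" and A :: "'b \<Rightarrow> 'a \<Rightarrow> real" and lam N :: real
  assumes finJ: "finite J" and finK: "finite K" and lam: "lam \<ge> 0" and N: "N > 0"
begin

definition obj :: "('a \<Rightarrow> real) \<Rightarrow> ('a \<Rightarrow> real) \<Rightarrow> real" where
  "obj y b = (\<Sum>j\<in>J. (y j - b j)\<^sup>2) / N + 2 * lam * (\<Sum>\<kappa>\<in>K. \<bar>\<Sum>x\<in>J. A \<kappa> x * b x\<bar>)"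

definition V :: "('a \<Rightarrow> real) set" where "V = {f. \<forall>j. j \<notin> J \<longrightarrow> f j = 0}"

definition sqd :: "('a \<Rightarrow> real) \<Rightarrow> ('a \<Rightarrow> real) \<Rightarrow> real" where
  "sqd b b' = (\<Sum>j\<in>J. (b j - b' j)\<^sup>2)"

lemma obj_nonneg: "obj y b \<ge> 0"
  unfolding obj_def using lam N by (intro add_nonneg_nonneg divide_nonneg_pos mult_nonneg_nonneg sum_nonneg) auto

text \<open>Strong convexity with the exact modulus: for the squared loss the last term comes from
  an identity, and the penalty is convex. Existence, growth, uniqueness and stability of the
  minimizer all follow from it.\<close>

lemma obj_convex:
  assumes s: "0 \<le> s" "s \<le> 1"
  shows "obj y (\<lambda>x. (1 - s) * b x + s * b' x) \<le> (1 - s) * obj y b + s * obj y b' - s * (1 - s) / N * sqd b b'"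
proof -
  have "(\<Sum>j\<in>J. (y j - ((1 - s) * b j + s * b' j))\<^sup>2) =
     (1 - s) * (\<Sum>j\<in>J. (y j - b j)\<^sup>2) + s * (\<Sum>j\<in>J. (y j - b' j)\<^sup>2) - s * (1 - s) * sqd b b'"
    unfolding sqd_def sum_distrib_left sum.distrib[symmetric] sum_subtractf[symmetric]
    by (intro sum.cong refl) (simp add: power2_eq_square algebra_simps)
  hence q: "(\<Sum>j\<in>J. (y j - ((1 - s) * b j + s * b' j))\<^sup>2) / N =
     (1 - s) * ((\<Sum>j\<in>J. (y j - b j)\<^sup>2) / N) + s * ((\<Sum>j\<in>J. (y j - b' j)\<^sup>2) / N) - s * (1 - s) / N * sqd b b'"
    by (simp add: add_divide_distrib diff_divide_distrib)
  have "(\<Sum>\<kappa>\<in>K. \<bar>\<Sum>x\<in>J. A \<kappa> x * ((1 - s) * b x + s * b' x)\<bar>)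
    \<le> (\<Sum>\<kappa>\<in>K. (1 - s) * \<bar>\<Sum>x\<in>J. A \<kappa> x * b x\<bar> + s * \<bar>\<Sum>x\<in>J. A \<kappa> x * b' x\<bar>)"
  proof (intro sum_mono)
    fix \<kappa>
    have "(\<Sum>x\<in>J. A \<kappa> x * ((1 - s) * b x + s * b' x)) =
        (1 - s) * (\<Sum>x\<in>J. A \<kappa> x * b x) + s * (\<Sum>x\<in>J. A \<kappa> x * b' x)"
      unfolding sum_distrib_left sum.distrib[symmetric] by (intro sum.cong refl) (simp add: algebra_simps)
    thus "\<bar>\<Sum>x\<in>J. A \<kappa> x * ((1 - s) * b x + s * b' x)\<bar>
        \<le> (1 - s) * \<bar>\<Sum>x\<in>J. A \<kappa> x * b x\<bar> + s * \<bar>\<Sum>x\<in>J. A \<kappa> x * b' x\<bar>"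
      using s abs_triangle_ineq[of "(1 - s) * (\<Sum>x\<in>J. A \<kappa> x * b x)" "s * (\<Sum>x\<in>J. A \<kappa> x * b' x)"]
      by (simp add: abs_mult)
  qed
  hence "2 * lam * (\<Sum>\<kappa>\<in>K. \<bar>\<Sum>x\<in>J. A \<kappa> x * ((1 - s) * b x + s * b' x)\<bar>)
    \<le> 2 * lam * ((1 - s) * (\<Sum>\<kappa>\<in>K. \<bar>\<Sum>x\<in>J. A \<kappa> x * b x\<bar>) + s * (\<Sum>\<kappa>\<in>K. \<bar>\<Sum>x\<in>J. A \<kappa> x * b' x\<bar>))"
    using lam unfolding sum.distrib sum_distrib_left[symmetric] by (intro mult_left_mono) auto
  thus ?thesis unfolding obj_def q by (simp add: algebra_simps)
qed

lemma sqd_nonneg: "sqd b b' \<ge> 0" and sqd_commute: "sqd b b' = sqd b' b"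
  by (auto simp: sqd_def power2_commute intro!: sum_nonneg)

lemma abs_diff_le_sqd: "x \<in> J \<Longrightarrow> \<bar>b x - b' x\<bar> \<le> sqrt (sqd b b')"
  using member_le_L2_set[OF finJ, of x "\<lambda>x. b x - b' x"] 
    L2_set_def[of "\<lambda>x. \<bar>b x - b' x\<bar>" J] member_le_L2_set[OF finJ, of x "\<lambda>x. \<bar>b x - b' x\<bar>"]
  by (simp add: sqd_def)

text \<open>A minimizing sequence is Cauchy because midpoints of almost minimal points would
  otherwise fall below the infimum. No compactness of sublevel sets is involved; the limit is taken
  coordinate by coordinate.\<close>

lemma minimizer_exists: "\<exists>b\<in>V. \<forall>b'\<in>V. obj y b \<le> obj y b'"
proof -
  define m where "m = Inf (obj y ` V)"
  have V0: "(\<lambda>_. 0) \<in> V" by (simp add: V_def)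
  have bdd: "bdd_below (obj y ` V)" using obj_nonneg by (intro bdd_belowI[of _ 0]) auto
  have m: "m \<le> obj y b" if "b \<in> V" for b
    unfolding m_def using that bdd by (intro cINF_lower) auto
  have "\<exists>b\<in>V. obj y b < m + 1 / real (Suc i)" for i
  proof -
    have "Inf (obj y ` V) < m + 1 / real (Suc i)" by (simp add: m_def)
    thus ?thesis using V0 bdd by (subst (asm) cInf_less_iff) auto
  qed
  then obtain b where b: "\<And>i. b i \<in> V" "\<And>i. obj y (b i) < m + 1 / real (Suc i)" by metis
  have close: "sqd (b i) (b j) \<le> 4 * N * (1 / real (Suc l))" if "i \<ge> l" "j \<ge> l" for i j l
  proof -
    have "m \<le> obj y (\<lambda>x. (1 - 1/2) * b i x + 1/2 * b j x)"
      using b(1) by (intro m) (simp add: V_def)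
    also have "\<dots> \<le> (1 - 1/2) * obj y (b i) + 1/2 * obj y (b j) - 1/2 * (1 - 1/2) / N * sqd (b i) (b j)"
      by (rule obj_convex) auto
    finally have "m \<le> obj y (b i) / 2 + obj y (b j) / 2 - sqd (b i) (b j) / (4 * N)" by simp
    hence "sqd (b i) (b j) / (4 * N) \<le> (obj y (b i) + obj y (b j)) / 2 - m"
      unfolding add_divide_distrib by (simp only: le_diff_eq add.commute add.left_commute diff_le_eq)
    also have "\<dots> \<le> 1 / real (Suc l)"
    proof -
      have "1 / real (Suc i) \<le> 1 / real (Suc l)" "1 / real (Suc j) \<le> 1 / real (Suc l)"
        using that by (auto intro!: divide_left_mono)
      moreover have "(a + c) / 2 - m \<le> r" if "p \<le> r" "q \<le> r" "a < m + p" "c < m + q" for a c p q r :: real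
        using that by (simp add: field_simps)
      ultimately show ?thesis using b(2)[of i] b(2)[of j] by blast
    qed
    finally show ?thesis using N by (simp add: field_simps)
  qed
  have conv: "\<exists>l. (\<lambda>i. b i x) \<longlonglongrightarrow> l" for x
  proof (cases "x \<in> J")
    case True
    have "Cauchy (\<lambda>i. b i x)"
    proof (rule metric_CauchyI)
      fix e :: real assume e: "e > 0"
      obtain l where l: "4 * N / e\<^sup>2 < real (Suc l)" using reals_Archimedean2 [of "4 * N / e\<^sup>2"]
        by (metis less_trans of_nat_less_iff lessI)
      show "\<exists>l. \<forall>i\<ge>l. \<forall>j\<ge>l. dist (b i x) (b j x) < e"
      proof (intro exI allI impI)
        fix i j assume ij: "i \<ge> l" "j \<ge> l"
        have "dist (b i x) (b j x) \<le> sqrt (sqd (b i) (b j))"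
          using abs_diff_le_sqd[OF True] by (simp add: dist_real_def)
        also have "\<dots> \<le> sqrt (4 * N * (1 / real (Suc l)))" using close[OF ij] by simp
        also have "\<dots> < sqrt (e\<^sup>2)"
        proof (rule real_sqrt_less_mono)
          have "4 * N < real (Suc l) * e\<^sup>2" using l e by (simp add: divide_less_eq)
          thus "4 * N * (1 / real (Suc l)) < e\<^sup>2" by (simp add: divide_less_eq mult.commute)
        qed
        finally show "dist (b i x) (b j x) < e" using e by simp
      qed
    qed
    thus ?thesis by (simp add: real_Cauchy_convergent convergentD)
  next
    case False
    hence "b i x = 0" for i using b(1) by (auto simp: V_def)
    thus ?thesis by auto
  qed
  then obtain c where c: "\<And>x. (\<lambda>i. b i x) \<longlonglongrightarrow> c x" by metis
  have cV: "c \<in> V"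
    unfolding V_def
  proof (intro CollectI allI impI)
    fix x assume "x \<notin> J"
    hence "b i x = 0" for i using b(1) by (auto simp: V_def)
    hence "(\<lambda>_. 0) \<longlonglongrightarrow> c x" using c[of x] by simp
    thus "c x = 0" by (metis LIMSEQ_unique tendsto_const)
  qed
  have lim1: "(\<lambda>i. obj y (b i)) \<longlonglongrightarrow> obj y c"
    unfolding obj_def using N by (intro tendsto_intros c) auto
  have "(\<lambda>i. 1 / real (Suc i)) \<longlonglongrightarrow> 0"
    using LIMSEQ_Suc[OF lim_1_over_n] by simp
  hence lim2: "(\<lambda>i. m + 1 / real (Suc i)) \<longlonglongrightarrow> m + 0"
    by (intro tendsto_add tendsto_const)
  have "obj y c \<le> m + 0"
    by (rule LIMSEQ_le[OF lim1 lim2], rule exI[of _ 0]) (use b(2) less_imp_le in blast)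
  hence "obj y c \<le> m" by simp
  thus ?thesis using cV m by (meson order_trans)
qed

text \<open>Moving from the minimizer a fraction s towards b' cannot decrease the objective;
  dividing the convexity inequality by s and letting s tend to 0 leaves the full distance
  term.\<close>

lemma minimizer_growth:
  assumes "b \<in> V" "\<And>b'. b' \<in> V \<Longrightarrow> obj y b \<le> obj y b'" "b' \<in> V"
  shows "obj y b + sqd b b' / N \<le> obj y b'"
proof -
  have "(1 - s) * (sqd b b' / N) \<le> obj y b' - obj y b" if s: "0 < s" "s < 1" for s
  proof -
    have "obj y b \<le> obj y (\<lambda>x. (1 - s) * b x + s * b' x)"
      using assms by (intro assms(2)) (auto simp: V_def)
    also have "\<dots> \<le> (1 - s) * obj y b + s * obj y b' - s * (1 - s) / N * sqd b b'"
      using s by (intro obj_convex) auto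
    finally have "s * ((1 - s) * (sqd b b' / N)) \<le> s * (obj y b' - obj y b)" by (simp add: algebra_simps)
    thus ?thesis using s by (simp only: mult_le_cancel_left_pos)
  qed
  moreover have "((\<lambda>s. (1 - s) * (sqd b b' / N)) \<longlongrightarrow> (1 - 0) * (sqd b b' / N)) (at_right 0)"
    by (intro tendsto_intros)
  moreover have "eventually (\<lambda>s::real. 0 < s \<and> s < 1) (at_right 0)"
    using eventually_at_right_real[of 0 "1::real"] by simp
  ultimately have "(1 - 0) * (sqd b b' / N) \<le> obj y b' - obj y b"
    by (intro tendsto_upperbound[where F = "at_right 0"]) (auto elim: eventually_mono)
  thus ?thesis by simp
qed

definition amin :: "('a \<Rightarrow> real) \<Rightarrow> 'a \<Rightarrow> real" where
  "amin y = arg_min_on (obj y) V"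

lemma amin: "amin y \<in> V" "b \<in> V \<Longrightarrow> obj y (amin y) \<le> obj y b"
proof -
  obtain b0 where "b0 \<in> V" "\<forall>b'\<in>V. obj y b0 \<le> obj y b'" using minimizer_exists by blast
  hence "is_arg_min (obj y) (\<lambda>b. b \<in> V) b0" by (auto simp: is_arg_min_def not_less)
  hence "is_arg_min (obj y) (\<lambda>b. b \<in> V) (amin y)"
    unfolding amin_def arg_min_on_def arg_min_def
    using someI[of "is_arg_min (obj y) (\<lambda>b. b \<in> V)" b0] by simp
  thus "amin y \<in> V" "b \<in> V \<Longrightarrow> obj y (amin y) \<le> obj y b" by (auto simp: is_arg_min_def not_less)
qed

lemma amin_growth: "b \<in> V \<Longrightarrow> obj y (amin y) + sqd (amin y) b / N \<le> obj y b"
  using amin by (intro minimizer_growth) auto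

lemma amin_unique: assumes "b \<in> V" "obj y b \<le> obj y (amin y)" shows "b = amin y"
proof -
  have "sqd (amin y) b / N \<le> 0" using amin_growth[OF assms(1), of y] assms(2) by simp
  hence "sqd (amin y) b \<le> 0" using N by (simp add: divide_le_0_iff)
  hence "sqd (amin y) b = 0" using sqd_nonneg[of "amin y" b] by simp
  hence "\<forall>j\<in>J. amin y j = b j" using finJ by (simp add: sqd_def sum_nonneg_eq_0_iff)
  thus ?thesis using assms(1) amin(1)[of y] unfolding V_def by (auto intro!: ext) (metis)
qed

text \<open>Adding the growth inequalities of the two minimizers, each tested at the other, cancels
  the penalties. What remains is an inner product of the data difference with the difference of the
  minimizers, split by the arithmetic-geometric inequality.\<close>

lemma amin_contraction: "sqd (amin y) (amin y') \<le> sqd y y'"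
proof -
  define b b' where "b = amin y" and "b' = amin y'"
  have "2 * (sqd b b' / N) \<le> (obj y b' - obj y' b') - (obj y b - obj y' b)"
    using amin_growth[OF amin(1)[of y'], of y] amin_growth[OF amin(1)[of y], of y']
    by (simp add: b_def b'_def sqd_commute[of "amin y'"])
  also have "\<dots> = 2 * ((\<Sum>j\<in>J. (y j - y' j) * (b j - b' j)) / N)"
  proof -
    have "(obj y b' - obj y' b') - (obj y b - obj y' b) =
       (\<Sum>j\<in>J. ((y j - b' j)\<^sup>2 - (y' j - b' j)\<^sup>2) - ((y j - b j)\<^sup>2 - (y' j - b j)\<^sup>2)) / N"
      by (simp add: obj_def diff_divide_distrib sum_subtractf)
    also have "(\<Sum>j\<in>J. ((y j - b' j)\<^sup>2 - (y' j - b' j)\<^sup>2) - ((y j - b j)\<^sup>2 - (y' j - b j)\<^sup>2)) =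
       2 * (\<Sum>j\<in>J. (y j - y' j) * (b j - b' j))"
      unfolding sum_distrib_left by (intro sum.cong refl) (simp add: power2_eq_square algebra_simps)
    finally show ?thesis by simp
  qed
  finally have "sqd b b' \<le> (\<Sum>j\<in>J. (y j - y' j) * (b j - b' j))" using N by (simp add: divide_le_cancel)
  moreover have "(\<Sum>j\<in>J. (y j - y' j) * (b j - b' j)) \<le> (\<Sum>j\<in>J. ((y j - y' j)\<^sup>2 + (b j - b' j)\<^sup>2) / 2)"
  proof (intro sum_mono)
    fix j
    show "(y j - y' j) * (b j - b' j) \<le> ((y j - y' j)\<^sup>2 + (b j - b' j)\<^sup>2) / 2"
      using sum_squares_bound[of "y j - y' j" "b j - b' j"] by (simp only: le_divide_eq_numeral1 mult_ac)
  qed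
  moreover have "(\<Sum>j\<in>J. ((y j - y' j)\<^sup>2 + (b j - b' j)\<^sup>2) / 2) = (sqd y y' + sqd b b') / 2"
    by (simp add: sqd_def sum.distrib sum_divide_distrib add_divide_distrib)
  ultimately show ?thesis by (simp add: b_def b'_def)
qed

lemma amin_Lipschitz: "\<bar>amin y x - amin y' x\<bar> \<le> (\<Sum>x\<in>J. \<bar>y x - y' x\<bar>)"
proof (cases "x \<in> J")
  case True
  have "\<bar>amin y x - amin y' x\<bar> \<le> sqrt (sqd y y')"
    using abs_diff_le_sqd[OF True, of "amin y" "amin y'"] amin_contraction[of y y']
    by (meson order_trans real_sqrt_le_iff)
  also have "\<dots> = L2_set (\<lambda>x. y x - y' x) J" by (simp add: L2_set_def sqd_def)
  also have "\<dots> \<le> (\<Sum>x\<in>J. \<bar>y x - y' x\<bar>)" by (rule L2_set_le_sum_abs)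
  finally show ?thesis .
next
  case False
  thus ?thesis using amin(1)[of y] amin(1)[of y'] by (simp add: V_def sum_nonneg)
qed

lemma amin_measurable:
  assumes "\<And>x. x \<in> J \<Longrightarrow> Y x \<in> borel_measurable M"
  shows "(\<lambda>w. amin (\<lambda>x. Y x w) x0) \<in> borel_measurable M"
  by (rule borel_measurable_Lipschitz[where Gf = "\<lambda>y. amin y x0", OF finJ amin_Lipschitz assms])

end

section \<open>Approximating atoms by the atoms at an active point\<close>

text \<open>The orthogonality of the residual to p itself is exported because it makes the error of
  a tensor product of such approximations computable.\<close>

lemma best_approximation:
  assumes "finite J" "finite W" "\<And>w j. w \<in> W \<Longrightarrow> j \<notin> J \<Longrightarrow> w j = 0"
  obtains p where "p \<in> fun_span W" "ip J (\<lambda>x. f x - p x) p = 0"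
    "\<And>q. q \<in> fun_span W \<Longrightarrow> ip J (\<lambda>x. f x - p x) (\<lambda>x. f x - p x) \<le> ip J (\<lambda>x. f x - q x) (\<lambda>x. f x - q x)"
proof -
  obtain B where B: "finite B" "orthonormal J B" "fun_span B = fun_span W"
    by (rule orthonormal_basis_exists[of J W]) (use assms in auto)
  define p where "p = coord_proj J B f"
  have p: "p \<in> fun_span W" unfolding p_def B(3)[symmetric] by (rule coord_proj_in_span)
  have orth: "ip J (\<lambda>x. f x - p x) v = 0" if "v \<in> fun_span W" for v
    unfolding p_def using that B by (intro coord_proj_orth) auto
  have "ip J (\<lambda>x. f x - p x) (\<lambda>x. f x - p x) \<le> ip J (\<lambda>x. f x - q x) (\<lambda>x. f x - q x)"
    if q: "q \<in> fun_span W" for q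
  proof (rule ip_self_le_of_projection)
    have "ip J (\<lambda>x. f x - p x) (\<lambda>x. p x - q x) = 0" using p q by (intro orth fun_span_diff)
    moreover have "ip J (\<lambda>x. f x - p x) (\<lambda>x. f x - q x) =
       ip J (\<lambda>x. f x - p x) (\<lambda>x. (f x - p x) + (p x - q x))" by simp
    ultimately show "ip J (\<lambda>x. f x - p x) (\<lambda>x. f x - p x) = ip J (\<lambda>x. f x - p x) (\<lambda>x. f x - q x)"
      by (simp only: ip_add_right)
  qed
  thus ?thesis using that p orth[OF p] by blast
qed

text \<open>Replacing one factor at a time; all other factors are at most one.\<close>

lemma prod_diff_le_sum:
  fixes a b :: "'a \<Rightarrow> real"
  assumes "finite I" "\<And>i. i \<in> I \<Longrightarrow> 0 \<le> b i \<and> b i \<le> a i \<and> a i \<le> 1"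
  shows "(\<Prod>i\<in>I. a i) - (\<Prod>i\<in>I. b i) \<le> (\<Sum>i\<in>I. a i - b i)"
  using assms
proof (induction I)
  case (insert i I)
  have a1: "(\<Prod>i\<in>I. a i) \<le> 1" using insert.prems by (intro prod_le_1) force
  have ab: "(\<Prod>i\<in>I. b i) \<le> (\<Prod>i\<in>I. a i)" using insert.prems by (intro prod_mono) auto
  have bi: "0 \<le> b i" "b i \<le> a i" "a i \<le> 1" using insert.prems by auto
  have "(\<Prod>i\<in>insert i I. a i) - (\<Prod>i\<in>insert i I. b i) =
     (a i - b i) * (\<Prod>i\<in>I. a i) + b i * ((\<Prod>i\<in>I. a i) - (\<Prod>i\<in>I. b i))"
    using insert.hyps by (simp add: algebra_simps)
  also have "\<dots> \<le> (a i - b i) * 1 + 1 * ((\<Prod>i\<in>I. a i) - (\<Prod>i\<in>I. b i))"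
    using a1 ab bi by (intro add_mono mult_left_mono mult_right_mono) auto
  also have "\<dots> \<le> (a i - b i) + (\<Sum>i\<in>I. a i - b i)" using insert by auto
  finally show ?case using insert.hyps by simp
qed simp

context anova begin

text \<open>With best approximations in every coordinate, the squared error of the product is
  exactly the product of squared norms of the atoms minus that of the approximants. After
  normalisation by n_i all factors lie in [0, 1], so the coordinate errors simply add, with constant
  one.\<close>

lemma Phi_t_approximation:
  assumes M: "M \<subseteq> {1..d}" and h: "h \<in> hset k d M"
    and \<tau>: "\<And>i. i \<in> M \<Longrightarrow> k + 1 \<le> \<tau> i \<and> \<tau> i + k - 1 \<le> n i" and \<kappa>: "\<kappa> \<in> inner_grid k n M"
  obtains p where "p \<in> fun_span ((\<lambda>\<kappa>'. Phi_t k d n (atom_merge M h \<kappa>')) ` (\<Pi>\<^sub>E i\<in>M. {\<tau> i..\<tau> i + k - 1}))"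
    "ip G (\<lambda>x. Phi_t k d n (atom_merge M h \<kappa>) x - p x) (\<lambda>x. Phi_t k d n (atom_merge M h \<kappa>) x - p x)
      \<le> nprod n {1..d} * (\<Sum>i\<in>M. (real (knot_dist k (\<tau> i) (\<kappa> i)) / real (n i)) ^ (2 * k - 1))"
proof -
  define \<phi> where "\<phi> = (\<lambda>i. phi_t (n i) k (atom_merge M h \<kappa> i))"
  define e where "e = (\<lambda>i. (real (knot_dist k (\<tau> i) (\<kappa> i)) / real (n i)) ^ (2 * k - 1))"
  have finM: "finite M" using M finite_subset by blast
  have "\<exists>p. p \<in> fun_span (phi_t (n i) k ` {\<tau> i..\<tau> i + k - 1}) \<and> ip {1..n i} (\<lambda>x. \<phi> i x - p x) p = 0 \<and>
     ip {1..n i} (\<lambda>x. \<phi> i x - p x) (\<lambda>x. \<phi> i x - p x) \<le> real (n i) * e i" if i: "i \<in> M" for i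
  proof -
    have i': "i \<in> {1..d}" using i M by auto
    have \<kappa>i: "\<kappa> i \<in> {k+1..n i}" using \<kappa> i by (auto simp: inner_grid_def)
    have t: "k + 1 \<le> \<tau> i" "\<tau> i + k - 1 \<le> n i" using \<tau>[OF i] by auto
    obtain q where q: "q \<in> fun_span (phi_t (n i) k ` {\<tau> i..\<tau> i + k - 1})"
      "ip {1..n i} (\<lambda>x. phi_t (n i) k (\<kappa> i) x - q x) (\<lambda>x. phi_t (n i) k (\<kappa> i) x - q x) \<le> real (n i) * e i"
      unfolding e_def by (rule phi_t_knot_approximation[OF k1 kn[OF i'] t \<kappa>i])
    have van: "w j = 0" if "w \<in> phi_t (n i) k ` {\<tau> i..\<tau> i + k - 1}" "j \<notin> {1..n i}" for w j
      using that t phi_t_vanish[OF k1 kn[OF i']] by auto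
    \<comment> \<open>The spline approximant q only certifies the size of the error; the best
      approximation inherits this bound and has a residual orthogonal to itself.\<close>
    obtain p where p: "p \<in> fun_span (phi_t (n i) k ` {\<tau> i..\<tau> i + k - 1})"
      "ip {1..n i} (\<lambda>x. \<phi> i x - p x) p = 0"
      "\<And>q. q \<in> fun_span (phi_t (n i) k ` {\<tau> i..\<tau> i + k - 1}) \<Longrightarrow>
        ip {1..n i} (\<lambda>x. \<phi> i x - p x) (\<lambda>x. \<phi> i x - p x) \<le> ip {1..n i} (\<lambda>x. \<phi> i x - q x) (\<lambda>x. \<phi> i x - q x)"
      by (rule best_approximation[of "{1..n i}" "phi_t (n i) k ` {\<tau> i..\<tau> i + k - 1}" "\<phi> i"]) (use van in auto)
    have \<phi>i: "\<phi> i = phi_t (n i) k (\<kappa> i)" using i by (simp add: \<phi>_def atom_merge_def)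
    have "ip {1..n i} (\<lambda>x. \<phi> i x - p x) (\<lambda>x. \<phi> i x - p x) \<le> real (n i) * e i"
      using order_trans[OF p(3)[OF q(1)], unfolded \<phi>i, OF q(2)] unfolding \<phi>i .
    with p(1,2) show ?thesis by blast
  qed
  hence "\<forall>i\<in>M. \<exists>p. p \<in> fun_span (phi_t (n i) k ` {\<tau> i..\<tau> i + k - 1}) \<and> ip {1..n i} (\<lambda>x. \<phi> i x - p x) p = 0 \<and>
     ip {1..n i} (\<lambda>x. \<phi> i x - p x) (\<lambda>x. \<phi> i x - p x) \<le> real (n i) * e i" by blast
  from bchoice[OF this] obtain p0 where p0: "\<And>i. i \<in> M \<Longrightarrow> p0 i \<in> fun_span (phi_t (n i) k ` {\<tau> i..\<tau> i + k - 1})"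
    "\<And>i. i \<in> M \<Longrightarrow> ip {1..n i} (\<lambda>x. \<phi> i x - p0 i x) (p0 i) = 0"
    "\<And>i. i \<in> M \<Longrightarrow> ip {1..n i} (\<lambda>x. \<phi> i x - p0 i x) (\<lambda>x. \<phi> i x - p0 i x) \<le> real (n i) * e i"
    by blast
  define p where "p = (\<lambda>i. if i \<in> M then p0 i else phi_t (n i) k (h i))"
  define \<alpha> where "\<alpha> = (\<lambda>i. ip {1..n i} (\<phi> i) (\<phi> i))"
  define \<beta> where "\<beta> = (\<lambda>i. ip {1..n i} (p i) (p i))"
  have \<phi>p: "ip {1..n i} (\<phi> i) (p i) = \<beta> i" for i
  proof (cases "i \<in> M")
    case True
    thus ?thesis using p0(2)[OF True] by (simp add: p_def \<beta>_def ip_diff_left)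
  qed (simp add: p_def \<beta>_def \<phi>_def atom_merge_def)
  have \<alpha>\<beta>: "\<alpha> i - \<beta> i = ip {1..n i} (\<lambda>x. \<phi> i x - p i x) (\<lambda>x. \<phi> i x - p i x)" for i
    using \<phi>p[of i] by (simp add: \<alpha>_def \<beta>_def ip_diff_left ip_diff_right ip_commute[of _ "p i" "\<phi> i"])
  have \<alpha>\<beta>_le: "\<alpha> i - \<beta> i \<le> (if i \<in> M then real (n i) * e i else 0)" for i
    using p0(3)[of i] \<alpha>\<beta>[of i] by (auto simp: p_def \<phi>_def atom_merge_def ip_def)
  have \<alpha>_le: "\<alpha> i \<le> real (n i)" if i: "i \<in> {1..d}" for i
  proof (cases "i \<in> M")
    case True
    hence "\<kappa> i \<in> {k+1..n i}" using \<kappa> by (auto simp: inner_grid_def)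
    hence "\<kappa> i > k" by simp
    thus ?thesis using phi_t_high_norm[OF k1 kn[OF i], of "\<kappa> i"] True by (simp add: \<alpha>_def \<phi>_def atom_merge_def)
  next
    case False
    thus ?thesis using phi_t_orthogonal[OF k1 kn[OF i], of "h i" "h i"] hsetD[OF h, of i] i
      by (simp add: \<alpha>_def \<phi>_def atom_merge_def)
  qed
  define P where "P = tens n {1..d} p"
  have Phi: "Phi_t k d n (atom_merge M h \<kappa>) = tens n {1..d} \<phi>"
    unfolding Phi_t_eq_tens \<phi>_def ..
  \<comment> \<open>The cross terms equal the squared norm of P because the coordinatewise inner
    products of \<phi> and p are \<beta>.\<close>
  have "ip G (\<lambda>x. tens n {1..d} \<phi> x - P x) (\<lambda>x. tens n {1..d} \<phi> x - P x) = (\<Prod>i\<in>{1..d}. \<alpha> i) - (\<Prod>i\<in>{1..d}. \<beta> i)"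
    unfolding ip_diff_left ip_diff_right P_def ip_tens[OF fin] ip_commute[of _ "tens n {1..d} p" "tens n {1..d} \<phi>"]
    using \<phi>p by (simp add: \<alpha>_def \<beta>_def)
  also have "\<dots> = nprod n {1..d} * ((\<Prod>i\<in>{1..d}. \<alpha> i / real (n i)) - (\<Prod>i\<in>{1..d}. \<beta> i / real (n i)))"
    using nprod_pos unfolding prod_dividef nprod_def[symmetric] by (simp add: right_diff_distrib)
  also have "\<dots> \<le> nprod n {1..d} * (\<Sum>i\<in>{1..d}. \<alpha> i / real (n i) - \<beta> i / real (n i))"
  proof (intro mult_left_mono prod_diff_le_sum conjI)
    fix i assume i: "i \<in> {1..d}"
    show "0 \<le> \<beta> i / real (n i)" by (simp add: \<beta>_def)
    have "\<beta> i \<le> \<alpha> i" using \<alpha>\<beta>[of i] ip_nonneg[of "{1..n i}" "\<lambda>x. \<phi> i x - p i x"] by linarith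
    thus "\<beta> i / real (n i) \<le> \<alpha> i / real (n i)" by (rule divide_right_mono) simp
    show "\<alpha> i / real (n i) \<le> 1" using \<alpha>_le[OF i] n_pos[OF i] by (simp add: divide_le_eq_1)
  qed (use nprod_pos in auto)
  also have "\<dots> \<le> nprod n {1..d} * (\<Sum>i\<in>{1..d}. if i \<in> M then e i else 0)"
  proof (intro mult_left_mono sum_mono)
    fix i assume i: "i \<in> {1..d}"
    have "(\<alpha> i - \<beta> i) / real (n i) \<le> (if i \<in> M then real (n i) * e i else 0) / real (n i)"
      using \<alpha>\<beta>_le by (intro divide_right_mono) auto
    thus "\<alpha> i / real (n i) - \<beta> i / real (n i) \<le> (if i \<in> M then e i else 0)"
      using n_pos[OF i] by (simp add: diff_divide_distrib split: if_splits)
  qed (use nprod_pos in auto)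
  also have "(\<Sum>i\<in>{1..d}. if i \<in> M then e i else 0) = (\<Sum>i\<in>M. e i)"
    using M by (simp add: sum.inter_restrict[symmetric] Int_absorb1)
  finally have bound: "ip G (\<lambda>x. tens n {1..d} \<phi> x - P x) (\<lambda>x. tens n {1..d} \<phi> x - P x) \<le> nprod n {1..d} * (\<Sum>i\<in>M. e i)" .
  \<comment> \<open>Multiplying out the coordinate expansions shows that P uses only product atoms
    whose index lies in the block of knots at \<tau>.\<close>
  have "\<forall>i\<in>M. \<exists>c. p0 i = (\<lambda>x. \<Sum>l\<in>{\<tau> i..\<tau> i + k - 1}. c l * phi_t (n i) k l x)"
    using p0(1) unfolding fun_span_image[OF finite_atLeastAtMost] mem_Collect_eq by blast
  from bchoice[OF this] obtain c where c: "\<And>i. i \<in> M \<Longrightarrow> p0 i = (\<lambda>x. \<Sum>l\<in>{\<tau> i..\<tau> i + k - 1}. c i l * phi_t (n i) k l x)" by blast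
  let ?E = "\<Pi>\<^sub>E i\<in>M. {\<tau> i..\<tau> i + k - 1}"
  have "P = (\<lambda>x. \<Sum>\<kappa>'\<in>?E. (\<Prod>i\<in>M. c i (\<kappa>' i)) * Phi_t k d n (atom_merge M h \<kappa>') x)"
  proof
    fix x
    show "P x = (\<Sum>\<kappa>'\<in>?E. (\<Prod>i\<in>M. c i (\<kappa>' i)) * Phi_t k d n (atom_merge M h \<kappa>') x)"
    proof (cases "x \<in> G")
      case True
      have rest: "(\<Prod>i\<in>{1..d} - M. phi_t (n i) k (atom_merge M h \<kappa>' i) (x i)) = (\<Prod>i\<in>{1..d} - M. p i (x i))" for \<kappa>'
        by (intro prod.cong) (auto simp: atom_merge_def p_def)
      have inn: "(\<Prod>i\<in>M. phi_t (n i) k (atom_merge M h \<kappa>' i) (x i)) = (\<Prod>i\<in>M. phi_t (n i) k (\<kappa>' i) (x i))" for \<kappa>'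
        by (intro prod.cong) (auto simp: atom_merge_def)
      have "(\<Prod>i\<in>M. p i (x i)) = (\<Prod>i\<in>M. \<Sum>l\<in>{\<tau> i..\<tau> i + k - 1}. c i l * phi_t (n i) k l (x i))"
        by (intro prod.cong) (auto simp: p_def c)
      also have "\<dots> = (\<Sum>\<kappa>'\<in>?E. \<Prod>i\<in>M. c i (\<kappa>' i) * phi_t (n i) k (\<kappa>' i) (x i))"
        using finM by (intro prod_sum_PiE) auto
      finally have pM: "(\<Prod>i\<in>M. p i (x i)) = (\<Sum>\<kappa>'\<in>?E. (\<Prod>i\<in>M. c i (\<kappa>' i)) * (\<Prod>i\<in>M. phi_t (n i) k (\<kappa>' i) (x i)))"
        by (simp add: prod.distrib)
      show ?thesis
        using True unfolding P_def tens_def Phi_t_def prod_split[OF M] rest inn pM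
        by (simp add: sum_distrib_right mult.assoc)
    qed (simp add: P_def tens_def Phi_t_def)
  qed
  hence "P \<in> fun_span ((\<lambda>\<kappa>'. Phi_t k d n (atom_merge M h \<kappa>')) ` ?E)"
    using finite_PiE[OF finM, of "\<lambda>i. {\<tau> i..\<tau> i + k - 1}"]
    by (auto intro!: fun_span_sum fun_span_base)
  thus ?thesis using that[of P] bound unfolding Phi e_def by blast
qed

end

section \<open>Interpolating tensors\<close>

definition energy_const :: "nat \<Rightarrow> real" where "energy_const k = (real k + 3) * (bump_const k)\<^sup>2"

lemma energy_const_ge_1: assumes "k \<ge> 1" shows "energy_const k \<ge> 1"
proof -
  have k: "real k \<ge> 1" using assms by simp
  have "1 \<le> real k ^ 2 + real k" using k by (simp add: add_increasing)
  hence "1 \<le> bump_const k" unfolding bump_const_def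
    using mult_mono[of 1 "2 ^ k" 1 "(real k ^ 2 + real k) ^ k"] by (simp add: one_le_power)
  hence "1 \<le> (bump_const k)\<^sup>2" by (simp add: one_le_power)
  thus ?thesis unfolding energy_const_def using k mult_mono[of 1 "real k + 3" 1 "(bump_const k)\<^sup>2"] by simp
qed

locale tess_grid = dict_grid n k M for n k M +
  fixes S :: "mindex set" and lo hi :: "mindex \<Rightarrow> mindex"
  assumes M_ne: "M \<noteq> {}" and tess: "tessellation k n M S lo hi"
    and dm: "derivative_matching k M S lo hi"
begin

section \<open>Geometry of the tessellation\<close>

abbreviation "dminus \<tau> i \<equiv> dist_side k lo hi \<tau> i False"
abbreviation "dplus \<tau> i \<equiv> dist_side k lo hi \<tau> i True"
abbreviation "dmax \<equiv> dist_max k S lo hi"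

definition rho :: "mindex \<Rightarrow> nat \<Rightarrow> nat" where "rho \<tau> i = min (dminus \<tau> i) (dplus \<tau> i)"

lemma finite_S: "finite S"
proof (rule finite_subset)
  show "S \<subseteq> (\<Pi>\<^sub>E i\<in>M. {k + 1 + (k + 2) * k..n i + 1 - k - (k + 2) * k})"
    using tess by (simp add: tessellation_def)
qed (use fin in \<open>auto intro: finite_PiE\<close>)

lemma S_extensional: "\<tau> \<in> S \<Longrightarrow> \<tau> \<in> extensional M"
  using tess unfolding tessellation_def by (auto simp: PiE_iff)

lemma interior_point: "\<tau> \<in> S \<Longrightarrow> i \<in> M \<Longrightarrow> lo \<tau> i < \<tau> i \<and> \<tau> i + k - 1 < hi \<tau> i"
proof -
  assume \<tau>: "\<tau> \<in> S" and i: "i \<in> M"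
  have sub: "(\<Pi>\<^sub>E i\<in>M. {\<tau> i..\<tau> i + k - 1}) \<subseteq> rect_interior M lo hi \<tau>"
    using tess \<tau> by (simp add: tessellation_def)
  have "\<tau> \<in> rect_interior M lo hi \<tau>"
    using S_extensional[OF \<tau>] k1 by (intro subsetD[OF sub]) (auto simp: PiE_iff)
  moreover have "(\<lambda>i\<in>M. \<tau> i + k - 1) \<in> rect_interior M lo hi \<tau>"
    using k1 by (intro subsetD[OF sub]) (auto simp: PiE_iff)
  ultimately show ?thesis using i by (force simp: rect_interior_def PiE_iff)
qed

lemma rect_subset: "\<tau> \<in> S \<Longrightarrow> rect M lo hi \<tau> \<subseteq> inner_grid k n M"
  using tess unfolding tessellation_def by blast

lemma corners: "\<tau> \<in> S \<Longrightarrow> i \<in> M \<Longrightarrow> k + 1 \<le> lo \<tau> i \<and> hi \<tau> i \<le> n i"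
proof -
  assume \<tau>: "\<tau> \<in> S" and i: "i \<in> M"
  have le: "lo \<tau> i \<le> hi \<tau> i" if "i \<in> M" for i using interior_point[OF \<tau> that] k1 by linarith
  have "(\<lambda>i\<in>M. lo \<tau> i) \<in> inner_grid k n M" "(\<lambda>i\<in>M. hi \<tau> i) \<in> inner_grid k n M"
    using le by (auto intro!: subsetD[OF rect_subset[OF \<tau>]] simp: rect_def)
  thus ?thesis using i by (force simp: inner_grid_def PiE_iff)
qed

lemma S_in_rect: "\<tau> \<in> S \<Longrightarrow> \<tau> \<in> rect M lo hi \<tau>"
  using interior_point S_extensional k1 by (force simp: rect_def PiE_iff)

lemma S_subset: "S \<subseteq> inner_grid k n M"
  using S_in_rect rect_subset by blast

lemma S_ne: "S \<noteq> {}"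
proof -
  have "k + 1 \<le> n i" if "i \<in> M" for i using kn[OF that] by linarith
  hence "(\<lambda>i\<in>M. k + 1) \<in> inner_grid k n M" by (auto simp: inner_grid_def)
  thus ?thesis using tess unfolding tessellation_def by blast
qed

lemma rect_cover: "\<kappa> \<in> inner_grid k n M \<Longrightarrow> \<exists>\<tau>\<in>S. \<kappa> \<in> rect M lo hi \<tau>"
proof -
  assume "\<kappa> \<in> inner_grid k n M"
  moreover have "(\<Union>\<tau>\<in>S. rect M lo hi \<tau>) = inner_grid k n M" using tess by (simp add: tessellation_def)
  ultimately show ?thesis by blast
qed

lemma rect_disjoint: "\<tau> \<in> S \<Longrightarrow> \<tau>' \<in> S \<Longrightarrow> \<kappa> \<in> rect M lo hi \<tau> \<Longrightarrow> \<kappa> \<in> rect_interior M lo hi \<tau>' \<Longrightarrow> \<tau> = \<tau>'"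
  using tess unfolding tessellation_def by blast

lemma rect_interior_subset: "rect_interior M lo hi \<tau> \<subseteq> rect M lo hi \<tau>"
  by (auto simp: rect_interior_def rect_def PiE_iff less_imp_le)

lemma sides:
  assumes "\<tau> \<in> S" "i \<in> M"
  shows "dminus \<tau> i = \<tau> i - lo \<tau> i" "dplus \<tau> i = hi \<tau> i + 1 - (\<tau> i + k)"
  by (simp_all add: dist_side_def)

text \<open>Derivative matching provides radii of at least (k + 2) k; the bump estimates need them
  to exceed k.\<close>

lemma rho_gt: "\<tau> \<in> S \<Longrightarrow> i \<in> M \<Longrightarrow> k < rho \<tau> i"
proof -
  assume "\<tau> \<in> S" "i \<in> M"
  hence "(k + 2) * k \<le> rho \<tau> i" using dm by (simp add: derivative_matching_def rho_def)
  moreover have "1 * k < (k + 2) * k" using k1 by (intro mult_strict_right_mono) auto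
  ultimately show ?thesis by linarith
qed

lemma side_le_dmax: "\<tau> \<in> S \<Longrightarrow> dminus \<tau> i \<le> dmax i \<and> dplus \<tau> i \<le> dmax i"
proof -
  assume \<tau>: "\<tau> \<in> S"
  have "max (dminus \<tau> i) (dplus \<tau> i) \<le> dmax i"
    unfolding dist_max_def using finite_S \<tau> by (intro Max_ge) auto
  thus ?thesis by simp
qed

lemma rho_le_dmax: "\<tau> \<in> S \<Longrightarrow> rho \<tau> i \<le> dmax i"
  using side_le_dmax[of \<tau> i] by (auto simp: rho_def)

lemma side_le_n: "\<tau> \<in> S \<Longrightarrow> i \<in> M \<Longrightarrow> dist_side k lo hi \<tau> i s \<le> n i"
  using corners[of \<tau> i] interior_point[of \<tau> i] by (auto simp: dist_side_def)

lemma side_pos: "\<tau> \<in> S \<Longrightarrow> i \<in> M \<Longrightarrow> dist_side k lo hi \<tau> i s > 0"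
  using rho_gt[of \<tau> i] by (cases s) (auto simp: rho_def)

lemma knot_dist_le_dmax:
  assumes "\<tau> \<in> S" "\<kappa> \<in> rect M lo hi \<tau>" "i \<in> M"
  shows "knot_dist k (\<tau> i) (\<kappa> i) \<le> dmax i"
proof -
  have "lo \<tau> i \<le> \<kappa> i" "\<kappa> i \<le> hi \<tau> i" using assms by (auto simp: rect_def)
  hence "knot_dist k (\<tau> i) (\<kappa> i) \<le> dminus \<tau> i \<or> knot_dist k (\<tau> i) (\<kappa> i) \<le> dplus \<tau> i"
    using interior_point[OF assms(1,3)] k1 by (auto simp: knot_dist_def sides[OF assms(1,3)])
  thus ?thesis using side_le_dmax[OF assms(1), of i] by linarith
qed

section \<open>Bumps on the rectangles, their deficit and their energy\<close>

definition bfac :: "mindex \<Rightarrow> nat \<Rightarrow> nat \<Rightarrow> nat \<Rightarrow> real" where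
  "bfac \<tau> i i' j = bump (if i' = i then real k - 1/2 else real k) k (rho \<tau> i') \<bar>real j - real (\<tau> i')\<bar>"

text \<open>The transposed difference of the factor \<open>bfac\<close> along coordinate i'. In
  both, i names the rough coordinate of the product and i' the coordinate of the factor.\<close>

definition dfac :: "mindex \<Rightarrow> nat \<Rightarrow> nat \<Rightarrow> nat \<Rightarrow> real" where
  "dfac \<tau> i i' x = real (n i') ^ (k - 1) *
     bump_diff (if i' = i then real k - 1/2 else real k) k (rho \<tau> i') (int x - int (\<tau> i'))"

(* Only one factor of each product is rough (carrying a logarithm in its energy), which makes the
   energy additive in the logarithms while the deficit 1 - bumpt controls every coordinate. *)
definition bumpt :: "mindex \<Rightarrow> mindex \<Rightarrow> real" where
  "bumpt \<tau> \<kappa> = (\<Sum>i\<in>M. \<Prod>i'\<in>M. bfac \<tau> i i' (\<kappa> i')) / real (card M)"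

definition dbumpt :: "mindex \<Rightarrow> mindex \<Rightarrow> real" where
  "dbumpt \<tau> x = (\<Sum>i\<in>M. \<Prod>i'\<in>M. dfac \<tau> i i' (x i')) / real (card M)"

lemma card_M: "real (card M) \<ge> 1"
  using M_ne fin by (simp add: Suc_leI card_gt_0_iff One_nat_def)

lemma bfac_bounds: "0 \<le> bfac \<tau> i i' j" "bfac \<tau> i i' j \<le> 1"
  unfolding bfac_def using k1 by (auto intro!: bump_nonneg bump_le_1)

lemma bfac_outside: "\<tau> \<in> S \<Longrightarrow> i' \<in> M \<Longrightarrow> \<not> (lo \<tau> i' < j \<and> j < hi \<tau> i') \<Longrightarrow> bfac \<tau> i i' j = 0"
proof -
  assume *: "\<tau> \<in> S" "i' \<in> M" "\<not> (lo \<tau> i' < j \<and> j < hi \<tau> i')"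
  have "rho \<tau> i' \<le> \<tau> i' - lo \<tau> i'" "rho \<tau> i' \<le> hi \<tau> i' + 1 - (\<tau> i' + k)"
    using sides[OF *(1,2)] by (auto simp: rho_def)
  hence "real (rho \<tau> i') \<le> \<bar>real j - real (\<tau> i')\<bar>"
    using *(3) interior_point[OF *(1,2)] k1 by linarith
  thus ?thesis unfolding bfac_def by (rule bump_outside)
qed

lemma bfac_self: "\<tau> \<in> S \<Longrightarrow> i' \<in> M \<Longrightarrow> bfac \<tau> i i' (\<tau> i') = 1"
  using rho_gt[of \<tau> i'] unfolding bfac_def by (simp add: bump_at_0)

text \<open>Summation by parts leaves no boundary terms: the bump vanishes at and beyond the faces
  of its rectangle, so the sum over the inner grid may be replaced by the full stencil x, ..., x +
  k.\<close>

lemma dker_bfac: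
  assumes \<tau>: "\<tau> \<in> S" "i' \<in> M"
  shows "(\<Sum>j=k+1..n i'. dker (n i') k j x * bfac \<tau> i i' j) = dfac \<tau> i i' x"
proof -
  have "(\<Sum>j=k+1..n i'. dker (n i') k j x * bfac \<tau> i i' j) = (\<Sum>j=x..x+k. dker (n i') k j x * bfac \<tau> i i' j)"
  proof (rule sum.mono_neutral_cong)
    fix j assume "j \<in> {x..x + k} - {k+1..n i'}"
    hence "\<not> (lo \<tau> i' < j \<and> j < hi \<tau> i')" using corners[OF \<tau>] by auto
    thus "dker (n i') k j x * bfac \<tau> i i' j = 0" using bfac_outside[OF \<tau>] by simp
  next
    fix j assume "j \<in> {k+1..n i'} - {x..x + k}"
    thus "dker (n i') k j x * bfac \<tau> i i' j = 0" by (auto simp: dker_def)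
  qed auto
  also have "\<dots> = (\<Sum>l=0..k. dker (n i') k (x + l) x * bfac \<tau> i i' (x + l))"
    by (rule sum.reindex_bij_witness[of _ "\<lambda>l. x + l" "\<lambda>j. j - x"]) auto
  also have "\<dots> = dfac \<tau> i i' x"
    unfolding dfac_def bump_diff_def altsum_def sum_distrib_left
    by (intro sum.cong refl) (simp add: dker_def bfac_def algebra_simps)
  finally show ?thesis .
qed

lemma dker_bumpt:
  assumes "\<tau> \<in> S"
  shows "(\<Sum>\<kappa>\<in>inner_grid k n M. (\<Prod>i\<in>M. dker (n i) k (\<kappa> i) (x i)) * bumpt \<tau> \<kappa>) = dbumpt \<tau> x"
proof -
  have "(\<Sum>\<kappa>\<in>inner_grid k n M. (\<Prod>i\<in>M. dker (n i) k (\<kappa> i) (x i)) * bumpt \<tau> \<kappa>) =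
     (\<Sum>\<kappa>\<in>inner_grid k n M. \<Sum>i\<in>M. (\<Prod>i'\<in>M. dker (n i') k (\<kappa> i') (x i') * bfac \<tau> i i' (\<kappa> i'))) / real (card M)"
    by (simp add: bumpt_def sum_distrib_left sum_divide_distrib prod.distrib)
  also have "(\<Sum>\<kappa>\<in>inner_grid k n M. \<Sum>i\<in>M. (\<Prod>i'\<in>M. dker (n i') k (\<kappa> i') (x i') * bfac \<tau> i i' (\<kappa> i'))) =
     (\<Sum>i\<in>M. \<Sum>\<kappa>\<in>inner_grid k n M. (\<Prod>i'\<in>M. dker (n i') k (\<kappa> i') (x i') * bfac \<tau> i i' (\<kappa> i')))"
    by (rule sum.swap)
  also have "\<dots> = (\<Sum>i\<in>M. \<Prod>i'\<in>M. dfac \<tau> i i' (x i'))"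
  proof (intro sum.cong refl)
    fix i
    show "(\<Sum>\<kappa>\<in>inner_grid k n M. (\<Prod>i'\<in>M. dker (n i') k (\<kappa> i') (x i') * bfac \<tau> i i' (\<kappa> i'))) = (\<Prod>i'\<in>M. dfac \<tau> i i' (x i'))"
      unfolding inner_grid_sum_prod[OF fin, where a = "\<lambda>i' j. dker (n i') k j (x i') * bfac \<tau> i i' j"]
      using dker_bfac[OF assms] by (intro prod.cong refl) auto
  qed
  finally show ?thesis by (simp add: dbumpt_def)
qed

lemma bumpt_bounds: "0 \<le> bumpt \<tau> \<kappa>"
  unfolding bumpt_def using bfac_bounds by (intro divide_nonneg_nonneg sum_nonneg prod_nonneg) auto

lemma bumpt_outside:
  assumes "\<tau> \<in> S" "\<kappa> \<in> inner_grid k n M" "\<kappa> \<notin> rect_interior M lo hi \<tau>"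
  shows "bumpt \<tau> \<kappa> = 0"
proof -
  obtain i' where i': "i' \<in> M" "\<not> (lo \<tau> i' < \<kappa> i' \<and> \<kappa> i' < hi \<tau> i')"
    using assms(2,3) by (auto simp: rect_interior_def inner_grid_def PiE_iff)
  have "(\<Prod>i'\<in>M. bfac \<tau> i i' (\<kappa> i')) = 0" for i
    using i' bfac_outside[OF assms(1) i'(1,2)] fin by (intro prod_zero) auto
  thus ?thesis by (simp add: bumpt_def)
qed

lemma bumpt_self: "\<tau> \<in> S \<Longrightarrow> bumpt \<tau> \<tau> = 1"
  unfolding bumpt_def using bfac_self card_M by simp

text \<open>The product with rough coordinate i is at most its rough factor, which falls from one at
  least like the normalised distance to the power k - 1/2. Summing over i controls every coordinate,
  and the averaging in \<open>bumpt\<close> shows up as \<open>card M\<close>.\<close>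

lemma bumpt_deficit:
  assumes \<tau>: "\<tau> \<in> S" and \<kappa>: "\<kappa> \<in> rect M lo hi \<tau>"
  shows "(\<Sum>i\<in>M. (real (knot_dist k (\<tau> i) (\<kappa> i)) / real (dmax i)) powr (real k - 1/2))
     \<le> real (card M) * (1 - bumpt \<tau> \<kappa>)"
proof -
  have a: "real k - 1/2 > 0" using k1 by simp
  have "(real (knot_dist k (\<tau> i) (\<kappa> i)) / real (dmax i)) powr (real k - 1/2)
      \<le> 1 - (\<Prod>i'\<in>M. bfac \<tau> i i' (\<kappa> i'))" if i: "i \<in> M" for i
  proof -
    let ?y = "\<bar>real (\<kappa> i) - real (\<tau> i)\<bar>" and ?\<delta> = "real (knot_dist k (\<tau> i) (\<kappa> i))"
    have \<delta>y: "?\<delta> \<le> ?y" using k1 by (auto simp: knot_dist_def)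
    have rd: "real (rho \<tau> i) \<le> real (dmax i)" "0 < real (rho \<tau> i)"
      using rho_le_dmax[OF \<tau>, of i] rho_gt[OF \<tau> i] by auto
    have "(?\<delta> / real (dmax i)) powr (real k - 1/2) \<le> 1 - bfac \<tau> i i (\<kappa> i)"
    proof (cases "?y < real (rho \<tau> i)")
      case True
      have "(?\<delta> / real (dmax i)) powr (real k - 1/2) \<le> (?y / real (rho \<tau> i)) powr (real k - 1/2)"
        using a \<delta>y rd by (intro powr_mono2 frac_le) auto
      also have "\<dots> \<le> 1 - bfac \<tau> i i (\<kappa> i)"
        unfolding bfac_def using bump_deficit[of "real k - 1/2" ?y k "rho \<tau> i"] a k1 True by simp
      finally show ?thesis .
    next
      case False
      hence "bfac \<tau> i i (\<kappa> i) = 0" unfolding bfac_def by (intro bump_outside) simp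
      moreover have "(?\<delta> / real (dmax i)) powr (real k - 1/2) \<le> 1"
        using a rd knot_dist_le_dmax[OF \<tau> \<kappa> i] by (intro powr_le1) (auto simp: divide_le_eq_1)
      ultimately show ?thesis by simp
    qed
    moreover have "(\<Prod>i'\<in>M. bfac \<tau> i i' (\<kappa> i')) \<le> bfac \<tau> i i (\<kappa> i)"
    proof -
      have "(\<Prod>i'\<in>M. bfac \<tau> i i' (\<kappa> i')) = bfac \<tau> i i (\<kappa> i) * (\<Prod>i'\<in>M - {i}. bfac \<tau> i i' (\<kappa> i'))"
        using fin i by (rule prod.remove)
      also have "\<dots> \<le> bfac \<tau> i i (\<kappa> i) * 1"
        using bfac_bounds by (intro mult_left_mono prod_le_1) auto
      finally show ?thesis by simp
    qed
    ultimately show ?thesis by linarith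
  qed
  hence "(\<Sum>i\<in>M. (real (knot_dist k (\<tau> i) (\<kappa> i)) / real (dmax i)) powr (real k - 1/2))
     \<le> (\<Sum>i\<in>M. 1 - (\<Prod>i'\<in>M. bfac \<tau> i i' (\<kappa> i')))" by (rule sum_mono)
  also have "\<dots> = real (card M) * (1 - bumpt \<tau> \<kappa>)"
    using card_M by (simp add: bumpt_def sum_subtractf right_diff_distrib)
  finally show ?thesis .
qed

lemma dfac_energy:
  assumes \<tau>: "\<tau> \<in> S" "i' \<in> M"
  shows "(\<Sum>x=1..n i'. (dfac \<tau> i i' x)\<^sup>2) \<le> (real (n i') ^ (k - 1))\<^sup>2 *
    (energy_const k * (if i' = i then ln (exp 1 * real (rho \<tau> i')) else 1) / real (rho \<tau> i') ^ (2 * k - 1))"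
proof -
  let ?a = "if i' = i then real k - 1/2 else real k"
  have "(\<Sum>x=1..n i'. (bump_diff ?a k (rho \<tau> i') (int x - int (\<tau> i')))\<^sup>2) =
      (\<Sum>z\<in>(\<lambda>x. int x - int (\<tau> i')) ` {1..n i'}. (bump_diff ?a k (rho \<tau> i') z)\<^sup>2)"
    by (subst sum.reindex) (auto simp: inj_on_def)
  also have "\<dots> \<le> energy_const k * (if i' = i then ln (exp 1 * real (rho \<tau> i')) else 1) / real (rho \<tau> i') ^ (2 * k - 1)"
    using rough_bump_energy[OF k1 rho_gt[OF \<tau>], of "(\<lambda>x. int x - int (\<tau> i')) ` {1..n i'}"]
      smooth_bump_energy[OF k1 rho_gt[OF \<tau>], of "(\<lambda>x. int x - int (\<tau> i')) ` {1..n i'}"]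
    by (cases "i' = i") (simp_all add: energy_const_def)
  finally have "(real (n i') ^ (k - 1))\<^sup>2 * (\<Sum>x=1..n i'. (bump_diff ?a k (rho \<tau> i') (int x - int (\<tau> i')))\<^sup>2)
     \<le> (real (n i') ^ (k - 1))\<^sup>2 *
    (energy_const k * (if i' = i then ln (exp 1 * real (rho \<tau> i')) else 1) / real (rho \<tau> i') ^ (2 * k - 1))"
    by (rule mult_left_mono) simp
  thus ?thesis unfolding dfac_def power_mult_distrib sum_distrib_left .
qed

text \<open>The energy of a product factorises over the coordinates, and only the rough one
  contributes a logarithm. The average is treated by Cauchy-Schwarz, so the logarithms add up over
  i.\<close>

lemma dbumpt_energy:
  assumes \<tau>: "\<tau> \<in> S"
  shows "(\<Sum>x\<in>G. (dbumpt \<tau> x)\<^sup>2) \<le> energy_const k ^ card M * (\<Sum>i\<in>M. ln (exp 1 * real (dmax i))) *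
     (\<Prod>i\<in>M. (real (n i) ^ (k - 1))\<^sup>2 / real (rho \<tau> i) ^ (2 * k - 1))"
proof -
  define R where "R = (\<Prod>i\<in>M. (real (n i) ^ (k - 1))\<^sup>2 / real (rho \<tau> i) ^ (2 * k - 1))"
  have R0: "R \<ge> 0" unfolding R_def by (intro prod_nonneg) auto
  have one: "(\<Sum>x\<in>G. (\<Prod>i'\<in>M. dfac \<tau> i i' (x i'))\<^sup>2) \<le> energy_const k ^ card M * ln (exp 1 * real (dmax i)) * R"
    if i: "i \<in> M" for i
  proof -
    have "(\<Sum>x\<in>G. (\<Prod>i'\<in>M. dfac \<tau> i i' (x i'))\<^sup>2) = (\<Prod>i'\<in>M. \<Sum>x=1..n i'. (dfac \<tau> i i' x)\<^sup>2)"
      unfolding prod_power_distrib by (rule grid_sum_prod[OF fin])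
    also have "\<dots> \<le> (\<Prod>i'\<in>M. (energy_const k * ((real (n i') ^ (k - 1))\<^sup>2 / real (rho \<tau> i') ^ (2 * k - 1))) *
        (if i' = i then ln (exp 1 * real (rho \<tau> i)) else 1))"
    proof (intro prod_mono conjI sum_nonneg)
      fix i' assume i': "i' \<in> M"
      show "(\<Sum>x=1..n i'. (dfac \<tau> i i' x)\<^sup>2) \<le> (energy_const k * ((real (n i') ^ (k - 1))\<^sup>2 / real (rho \<tau> i') ^ (2 * k - 1))) *
        (if i' = i then ln (exp 1 * real (rho \<tau> i)) else 1)"
        using dfac_energy[OF \<tau> i', of i] by (cases "i' = i") (simp_all add: mult_ac)
    qed auto
    also have "\<dots> = energy_const k ^ card M * R * ln (exp 1 * real (rho \<tau> i))"
      unfolding R_def prod.distrib using fin i by (simp add: prod.delta)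
    also have "\<dots> \<le> energy_const k ^ card M * R * ln (exp 1 * real (dmax i))"
    proof (intro mult_left_mono)
      show "ln (exp 1 * real (rho \<tau> i)) \<le> ln (exp 1 * real (dmax i))"
        using rho_gt[OF \<tau> i] rho_le_dmax[OF \<tau>, of i] by (intro ln_mono) auto
    qed (use energy_const_ge_1[OF k1] R0 in auto)
    finally show ?thesis by (simp add: mult_ac)
  qed
  have "(\<Sum>x\<in>G. (dbumpt \<tau> x)\<^sup>2) \<le> (\<Sum>x\<in>G. \<Sum>i\<in>M. (\<Prod>i'\<in>M. dfac \<tau> i i' (x i'))\<^sup>2)"
  proof (intro sum_mono)
    fix x
    have "(dbumpt \<tau> x)\<^sup>2 \<le> (\<Sum>i\<in>M. (\<Prod>i'\<in>M. dfac \<tau> i i' (x i'))\<^sup>2) * real (card M) / (real (card M))\<^sup>2"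
      unfolding dbumpt_def power_divide
      by (intro divide_right_mono sum_squared_le_sum_of_squares) auto
    also have "\<dots> = (\<Sum>i\<in>M. (\<Prod>i'\<in>M. dfac \<tau> i i' (x i'))\<^sup>2) / real (card M)"
      using card_M by (simp add: power2_eq_square)
    also have "\<dots> \<le> (\<Sum>i\<in>M. (\<Prod>i'\<in>M. dfac \<tau> i i' (x i'))\<^sup>2) / 1"
      using card_M by (intro divide_left_mono sum_nonneg) auto
    finally show "(dbumpt \<tau> x)\<^sup>2 \<le> (\<Sum>i\<in>M. (\<Prod>i'\<in>M. dfac \<tau> i i' (x i'))\<^sup>2)" by simp
  qed
  also have "\<dots> = (\<Sum>i\<in>M. \<Sum>x\<in>G. (\<Prod>i'\<in>M. dfac \<tau> i i' (x i'))\<^sup>2)" by (rule sum.swap)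
  also have "\<dots> \<le> (\<Sum>i\<in>M. energy_const k ^ card M * ln (exp 1 * real (dmax i)) * R)"
    by (intro sum_mono one)
  also have "\<dots> = energy_const k ^ card M * (\<Sum>i\<in>M. ln (exp 1 * real (dmax i))) * R"
    by (simp add: sum_distrib_left sum_distrib_right)
  finally show ?thesis by (simp only: R_def)
qed

text \<open>Bumps have disjoint supports, but their differences spread over a stencil. If the
  difference at x is nonzero, some point of the stencil of x lies in the interior of that rectangle;
  distinct rectangles need distinct points, and the stencil has k + 1 points per coordinate.\<close>

lemma dbumpt_overlap:
  "card {\<tau> \<in> S. dbumpt \<tau> x \<noteq> 0} \<le> (k + 1) ^ card M"
proof -
  let ?A = "{\<tau> \<in> S. dbumpt \<tau> x \<noteq> 0}" and ?B = "\<Pi>\<^sub>E i\<in>M. {0..k}"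
  have "\<exists>\<kappa>. \<kappa> \<in> rect_interior M lo hi \<tau> \<and> (\<forall>i\<in>M. \<kappa> i - x i \<le> k \<and> x i \<le> \<kappa> i)" if "\<tau> \<in> ?A" for \<tau>
  proof -
    have \<tau>: "\<tau> \<in> S" "(\<Sum>\<kappa>\<in>inner_grid k n M. (\<Prod>i\<in>M. dker (n i) k (\<kappa> i) (x i)) * bumpt \<tau> \<kappa>) \<noteq> 0"
      using that dker_bumpt by auto
    from \<tau>(2) obtain \<kappa> where "\<kappa> \<in> inner_grid k n M" "(\<Prod>i\<in>M. dker (n i) k (\<kappa> i) (x i)) * bumpt \<tau> \<kappa> \<noteq> 0"
      by (rule sum.not_neutral_contains_not_neutral)
    hence \<kappa>: "\<kappa> \<in> inner_grid k n M" "(\<Prod>i\<in>M. dker (n i) k (\<kappa> i) (x i)) \<noteq> 0" "bumpt \<tau> \<kappa> \<noteq> 0"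
      by auto
    have "\<kappa> i - x i \<le> k \<and> x i \<le> \<kappa> i" if "i \<in> M" for i
    proof -
      have "dker (n i) k (\<kappa> i) (x i) \<noteq> 0" using \<kappa>(2) fin that by (auto simp: prod_zero_iff)
      thus ?thesis by (cases "x i \<le> \<kappa> i"; cases "\<kappa> i - x i \<le> k") (auto simp: dker_def binomial_eq_0)
    qed
    thus ?thesis using bumpt_outside[OF \<tau>(1) \<kappa>(1)] \<kappa>(3) by auto
  qed
  hence "\<forall>\<tau>\<in>?A. \<exists>\<kappa>. \<kappa> \<in> rect_interior M lo hi \<tau> \<and> (\<forall>i\<in>M. \<kappa> i - x i \<le> k \<and> x i \<le> \<kappa> i)" by blast
  from bchoice[OF this] obtain K where K: "\<And>\<tau>. \<tau> \<in> ?A \<Longrightarrow> K \<tau> \<in> rect_interior M lo hi \<tau>"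
    "\<And>\<tau> i. \<tau> \<in> ?A \<Longrightarrow> i \<in> M \<Longrightarrow> K \<tau> i - x i \<le> k \<and> x i \<le> K \<tau> i" by blast
  have "card ?A \<le> card ?B"
  proof (rule card_inj_on_le[where f = "\<lambda>\<tau>. \<lambda>i\<in>M. K \<tau> i - x i"])
    show "inj_on (\<lambda>\<tau>. \<lambda>i\<in>M. K \<tau> i - x i) ?A"
    proof (rule inj_onI)
      fix \<tau> \<tau>' assume \<tau>: "\<tau> \<in> ?A" "\<tau>' \<in> ?A" and eq: "(\<lambda>i\<in>M. K \<tau> i - x i) = (\<lambda>i\<in>M. K \<tau>' i - x i)"
      have "K \<tau> i = K \<tau>' i" if "i \<in> M" for i
        using fun_cong[OF eq, of i] K(2)[OF \<tau>(1) that] K(2)[OF \<tau>(2) that] that by auto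
      moreover have "K \<tau> \<in> extensional M" "K \<tau>' \<in> extensional M"
        using K(1)[OF \<tau>(1)] K(1)[OF \<tau>(2)] by (auto simp: rect_interior_def PiE_iff)
      ultimately have "K \<tau> = K \<tau>'" by (metis extensionalityI)
      thus "\<tau> = \<tau>'"
        using rect_disjoint[of \<tau> \<tau>' "K \<tau>"] K(1)[OF \<tau>(1)] K(1)[OF \<tau>(2)] \<tau>
          subsetD[OF rect_interior_subset[of \<tau>]] by simp
    qed
    show "(\<lambda>\<tau>. \<lambda>i\<in>M. K \<tau> i - x i) ` ?A \<subseteq> ?B" using K(2) by auto
    show "finite ?B" using fin by (intro finite_PiE) auto
  qed
  also have "card ?B = (k + 1) ^ card M" using fin by (simp add: card_PiE Suc_eq_plus1)
  finally show ?thesis .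
qed

text \<open>One bump per rectangle, with height q at the active point. At most one bump is nonzero
  at a given index, which gives interpolation and deficit; \<open>wd\<close> is the transposed
  difference of \<open>w\<close>, and its energy is the sum of the single energies up to the overlap
  count.\<close>

lemma interpolating_tensor:
  assumes q: "\<And>\<tau>. \<bar>q \<tau>\<bar> \<le> (1::real)"
  obtains w wd where
    "\<forall>\<kappa>\<in>S. w \<kappa> = q \<kappa>"
    "\<forall>\<kappa>\<in>inner_grid k n M. \<forall>\<tau>\<in>S. \<kappa> \<in> rect M lo hi \<tau> \<longrightarrow>
      (\<Sum>i\<in>M. (real (knot_dist k (\<tau> i) (\<kappa> i)) / real (dmax i)) powr (real k - 1/2))
       \<le> real (card M) * (1 - \<bar>w \<kappa>\<bar>)"
    "\<forall>u. (\<Sum>\<kappa>\<in>inner_grid k n M. w \<kappa> * dcoef n k M u \<kappa>) = ip G wd u"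
    "nprod n M * ip G wd wd \<le> ((real k + 1) * energy_const k) ^ card M * (\<Sum>i\<in>M. ln (exp 1 * real (dmax i))) *
       (\<Sum>\<tau>\<in>S. \<Sum>z\<in>(\<Pi>\<^sub>E i\<in>M. (UNIV :: bool set)). (nprod n M / dist_prod k M lo hi \<tau> z) ^ (2 * k - 1))"
proof -
  define w where "w = (\<lambda>\<kappa>. \<Sum>\<tau>\<in>S. q \<tau> * bumpt \<tau> \<kappa>)"
  define wd where "wd = (\<lambda>x. \<Sum>\<tau>\<in>S. q \<tau> * dbumpt \<tau> x)"
  have w_val: "w \<kappa> = q \<tau> * bumpt \<tau> \<kappa>" if "\<kappa> \<in> inner_grid k n M" "\<tau> \<in> S" "\<kappa> \<in> rect M lo hi \<tau>" for \<kappa> \<tau>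
  proof -
    have "w \<kappa> = (\<Sum>\<tau>'\<in>S. if \<tau>' = \<tau> then q \<tau> * bumpt \<tau> \<kappa> else 0)"
      unfolding w_def
    proof (intro sum.cong refl)
      fix \<tau>' assume \<tau>': "\<tau>' \<in> S"
      show "q \<tau>' * bumpt \<tau>' \<kappa> = (if \<tau>' = \<tau> then q \<tau> * bumpt \<tau> \<kappa> else 0)"
      proof (cases "\<tau>' = \<tau>")
        case False
        hence "\<kappa> \<notin> rect_interior M lo hi \<tau>'" using rect_disjoint[OF that(2) \<tau>' that(3)] by auto
        thus ?thesis using bumpt_outside[OF \<tau>' that(1)] False by simp
      qed simp
    qed
    thus ?thesis using that(2) finite_S by simp
  qed
  show thesis
  proof (rule that; (intro ballI allI impI)?)
    fix \<kappa> assume "\<kappa> \<in> S"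
    thus "w \<kappa> = q \<kappa>" using w_val[of \<kappa> \<kappa>] S_subset S_in_rect bumpt_self by auto
  next
    fix \<kappa> \<tau> assume *: "\<kappa> \<in> inner_grid k n M" "\<tau> \<in> S" "\<kappa> \<in> rect M lo hi \<tau>"
    have "\<bar>w \<kappa>\<bar> \<le> 1 * bumpt \<tau> \<kappa>"
      unfolding w_val[OF *] abs_mult using q bumpt_bounds[of \<tau> \<kappa>] by (intro mult_mono) auto
    hence "real (card M) * (1 - bumpt \<tau> \<kappa>) \<le> real (card M) * (1 - \<bar>w \<kappa>\<bar>)" by (intro mult_left_mono) auto
    thus "(\<Sum>i\<in>M. (real (knot_dist k (\<tau> i) (\<kappa> i)) / real (dmax i)) powr (real k - 1/2))
       \<le> real (card M) * (1 - \<bar>w \<kappa>\<bar>)"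
      using bumpt_deficit[OF *(2,3)] by linarith
  next
    fix u
    have "(\<Sum>\<kappa>\<in>inner_grid k n M. w \<kappa> * dcoef n k M u \<kappa>) =
       (\<Sum>\<kappa>\<in>inner_grid k n M. \<Sum>x\<in>G. (w \<kappa> * (\<Prod>i\<in>M. dker (n i) k (\<kappa> i) (x i))) * u x)"
      by (simp add: dcoef_def sum_distrib_left mult.assoc)
    also have "\<dots> = (\<Sum>x\<in>G. \<Sum>\<kappa>\<in>inner_grid k n M. (w \<kappa> * (\<Prod>i\<in>M. dker (n i) k (\<kappa> i) (x i))) * u x)"
      by (rule sum.swap)
    also have "\<dots> = ip G wd u"
      unfolding ip_def
    proof (intro sum.cong refl)
      fix x
      have "(\<Sum>\<kappa>\<in>inner_grid k n M. w \<kappa> * (\<Prod>i\<in>M. dker (n i) k (\<kappa> i) (x i))) =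
        (\<Sum>\<kappa>\<in>inner_grid k n M. \<Sum>\<tau>\<in>S. q \<tau> * ((\<Prod>i\<in>M. dker (n i) k (\<kappa> i) (x i)) * bumpt \<tau> \<kappa>))"
        unfolding w_def sum_distrib_right by (simp add: mult_ac)
      also have "\<dots> = (\<Sum>\<tau>\<in>S. q \<tau> * (\<Sum>\<kappa>\<in>inner_grid k n M. (\<Prod>i\<in>M. dker (n i) k (\<kappa> i) (x i)) * bumpt \<tau> \<kappa>))"
        unfolding sum_distrib_left by (rule sum.swap)
      also have "\<dots> = wd x" unfolding wd_def by (intro sum.cong refl) (simp add: dker_bumpt)
      finally show "(\<Sum>\<kappa>\<in>inner_grid k n M. (w \<kappa> * (\<Prod>i\<in>M. dker (n i) k (\<kappa> i) (x i))) * u x) = wd x * u x"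
        by (simp only: sum_distrib_right[symmetric])
    qed
    finally show "(\<Sum>\<kappa>\<in>inner_grid k n M. w \<kappa> * dcoef n k M u \<kappa>) = ip G wd u" .
  next
    define L where "L = (\<Sum>i\<in>M. ln (exp 1 * real (dmax i)))"
    define E where "E = (\<lambda>\<tau>. \<Prod>i\<in>M. (real (n i) ^ (k - 1))\<^sup>2 / real (rho \<tau> i) ^ (2 * k - 1))"
    define Z where "Z = (\<lambda>\<tau>. \<Sum>z\<in>(\<Pi>\<^sub>E i\<in>M. (UNIV :: bool set)). (nprod n M / dist_prod k M lo hi \<tau> z) ^ (2 * k - 1))"
    have L0: "L \<ge> 0" unfolding L_def
    proof (intro sum_nonneg ln_ge_zero)
      fix i assume i: "i \<in> M"
      obtain \<tau> where "\<tau> \<in> S" using S_ne by auto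
      hence "1 \<le> real (dmax i)" using rho_gt[of \<tau> i] rho_le_dmax[of \<tau> i] i by simp
      thus "1 \<le> exp 1 * real (dmax i)" using mult_mono[of 1 "exp 1" 1 "real (dmax i)"] by simp
    qed
    have EZ: "nprod n M * E \<tau> \<le> Z \<tau>" if \<tau>: "\<tau> \<in> S" for \<tau>
    proof -
      \<comment> \<open>Selects in each coordinate the shorter side, which is the radius of the
        bump; the term for this z alone dominates the energy.\<close>
      define z0 where "z0 = (\<lambda>i\<in>M. dplus \<tau> i < dminus \<tau> i)"
      have z0: "dist_side k lo hi \<tau> i (z0 i) = rho \<tau> i" if "i \<in> M" for i
        using that by (cases "dplus \<tau> i < dminus \<tau> i") (auto simp: z0_def rho_def)
      have "nprod n M * E \<tau> = (\<Prod>i\<in>M. (real (n i) / real (rho \<tau> i)) ^ (2 * k - 1))"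
        unfolding nprod_def E_def prod.distrib[symmetric]
      proof (intro prod.cong refl)
        fix i
        have e: "2 * k - 1 = Suc ((k - 1) * 2)" using k1 by (simp add: One_nat_def)
        show "real (n i) * ((real (n i) ^ (k - 1))\<^sup>2 / real (rho \<tau> i) ^ (2 * k - 1)) = (real (n i) / real (rho \<tau> i)) ^ (2 * k - 1)"
          unfolding power_divide e power_Suc power_mult by simp
      qed
      also have "\<dots> = (nprod n M / dist_prod k M lo hi \<tau> z0) ^ (2 * k - 1)"
      proof -
        have "dist_prod k M lo hi \<tau> z0 = (\<Prod>i\<in>M. real (rho \<tau> i))"
          unfolding dist_prod_def by (intro prod.cong) (auto simp: z0)
        thus ?thesis unfolding nprod_def by (simp only: prod_power_distrib[symmetric] prod_dividef)
      qed
      also have "\<dots> \<le> Z \<tau>"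
        unfolding Z_def
      proof (rule member_le_sum)
        show "z0 \<in> (\<Pi>\<^sub>E i\<in>M. UNIV)" by (auto simp: z0_def)
        show "finite (\<Pi>\<^sub>E i\<in>M. (UNIV :: bool set))" using fin by (intro finite_PiE) auto
        fix z show "0 \<le> (nprod n M / dist_prod k M lo hi \<tau> z) ^ (2 * k - 1)"
          unfolding nprod_def dist_prod_def by (intro zero_le_power divide_nonneg_nonneg prod_nonneg) auto
      qed
      finally show ?thesis .
    qed
    \<comment> \<open>Pointwise Cauchy-Schwarz over the few bumps whose differences do not vanish at
      x.\<close>
    have "ip G wd wd \<le> (\<Sum>x\<in>G. (real k + 1) ^ card M * (\<Sum>\<tau>\<in>S. (dbumpt \<tau> x)\<^sup>2))"
      unfolding ip_def
    proof (intro sum_mono)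
      fix x
      let ?A = "{\<tau> \<in> S. dbumpt \<tau> x \<noteq> 0}"
      have "wd x = (\<Sum>\<tau>\<in>?A. q \<tau> * dbumpt \<tau> x)"
        unfolding wd_def using finite_S by (intro sum.mono_neutral_right) auto
      hence "wd x * wd x = (\<Sum>\<tau>\<in>?A. q \<tau> * dbumpt \<tau> x)\<^sup>2" by (simp add: power2_eq_square)
      also have "\<dots> \<le> (\<Sum>\<tau>\<in>?A. (q \<tau> * dbumpt \<tau> x)\<^sup>2) * real (card ?A)"
        by (rule sum_squared_le_sum_of_squares)
      also have "\<dots> \<le> (\<Sum>\<tau>\<in>?A. (dbumpt \<tau> x)\<^sup>2) * real ((k + 1) ^ card M)"
      proof (intro mult_mono sum_mono)
        fix \<tau>
        have "(q \<tau>)\<^sup>2 \<le> 1" using q[of \<tau>] by (simp add: abs_square_le_1)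
        thus "(q \<tau> * dbumpt \<tau> x)\<^sup>2 \<le> (dbumpt \<tau> x)\<^sup>2"
          unfolding power_mult_distrib using mult_right_mono[of "(q \<tau>)\<^sup>2" 1 "(dbumpt \<tau> x)\<^sup>2"] by simp
        show "real (card ?A) \<le> real ((k + 1) ^ card M)" using dbumpt_overlap by (simp only: of_nat_le_iff)
      qed (auto intro: sum_nonneg)
      also have "\<dots> \<le> (\<Sum>\<tau>\<in>S. (dbumpt \<tau> x)\<^sup>2) * real ((k + 1) ^ card M)"
        using finite_S by (intro mult_right_mono sum_mono2) auto
      finally show "wd x * wd x \<le> (real k + 1) ^ card M * (\<Sum>\<tau>\<in>S. (dbumpt \<tau> x)\<^sup>2)" by (simp add: mult.commute)
    qed
    also have "\<dots> = (real k + 1) ^ card M * (\<Sum>\<tau>\<in>S. \<Sum>x\<in>G. (dbumpt \<tau> x)\<^sup>2)"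
      unfolding sum_distrib_left[symmetric] by (subst sum.swap) simp
    also have "\<dots> \<le> (real k + 1) ^ card M * (\<Sum>\<tau>\<in>S. energy_const k ^ card M * L * E \<tau>)"
      using dbumpt_energy by (intro mult_left_mono sum_mono) (auto simp: L_def E_def)
    finally have "nprod n M * ip G wd wd \<le> nprod n M * ((real k + 1) ^ card M * (\<Sum>\<tau>\<in>S. energy_const k ^ card M * L * E \<tau>))"
      using nprod_pos by (intro mult_left_mono) auto
    also have "\<dots> = ((real k + 1) * energy_const k) ^ card M * L * (\<Sum>\<tau>\<in>S. nprod n M * E \<tau>)"
      by (simp add: sum_distrib_left power_mult_distrib mult_ac)
    also have "\<dots> \<le> ((real k + 1) * energy_const k) ^ card M * L * (\<Sum>\<tau>\<in>S. Z \<tau>)"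
      using L0 energy_const_ge_1[OF k1] EZ by (intro mult_left_mono sum_mono mult_nonneg_nonneg) auto
    finally show "nprod n M * ip G wd wd \<le> ((real k + 1) * energy_const k) ^ card M * (\<Sum>i\<in>M. ln (exp 1 * real (dmax i))) *
       (\<Sum>\<tau>\<in>S. \<Sum>z\<in>(\<Pi>\<^sub>E i\<in>M. (UNIV :: bool set)). (nprod n M / dist_prod k M lo hi \<tau> z) ^ (2 * k - 1))"
      by (simp only: L_def Z_def)
  qed
qed

end

section \<open>The oracle inequality for one ANOVA component\<close>

lemma coord_proj_lincomb:
  "coord_proj J B (\<lambda>x. \<Sum>a\<in>A. c a * F a x) = (\<lambda>x. \<Sum>a\<in>A. c a * coord_proj J B (F a) x)"
proof
  fix x
  have "coord_proj J B (\<lambda>x. \<Sum>a\<in>A. c a * F a x) x = (\<Sum>b\<in>B. \<Sum>a\<in>A. c a * (ip J (F a) b * b x))"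
    by (simp add: coord_proj_def ip_sum_left ip_scale_left sum_distrib_right mult.assoc)
  also have "\<dots> = (\<Sum>a\<in>A. c a * coord_proj J B (F a) x)"
    unfolding coord_proj_def sum_distrib_left by (rule sum.swap)
  finally show "coord_proj J B (\<lambda>x. \<Sum>a\<in>A. c a * F a x) x = (\<Sum>a\<in>A. c a * coord_proj J B (F a) x)" .
qed

lemma ip_coord_proj: "ip J e (coord_proj J B f) = (\<Sum>b\<in>B. ip J f b * ip J e b)"
  by (simp add: coord_proj_def ip_sum_right ip_scale_right)

lemma Bessel:
  assumes "finite B" "orthonormal J B"
  shows "(\<Sum>b\<in>B. (ip J f b)\<^sup>2) \<le> ip J f f"
proof -
  have "ip J (coord_proj J B f) (coord_proj J B f) \<le> ip J f f"
    using coord_proj_orth[OF assms, of "coord_proj J B f" f] coord_proj_in_span[of J B f]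
    by (intro ip_self_le_of_projection) (simp add: ip_diff_left ip_commute)
  moreover have "ip J (coord_proj J B f) (coord_proj J B f) = ip J f (coord_proj J B f)"
    using coord_proj_orth[OF assms, of "coord_proj J B f" f] coord_proj_in_span[of J B f] by (simp add: ip_diff_left)
  ultimately show ?thesis by (simp add: ip_coord_proj power2_eq_square)
qed

lemma coord_proj_best:
  assumes "finite B" "orthonormal J B" "q \<in> fun_span B"
  shows "ip J (\<lambda>x. f x - coord_proj J B f x) (\<lambda>x. f x - coord_proj J B f x) \<le> ip J (\<lambda>x. f x - q x) (\<lambda>x. f x - q x)"
proof (rule ip_self_le_of_projection)
  have "ip J (\<lambda>x. f x - coord_proj J B f x) (\<lambda>x. coord_proj J B f x - q x) = 0"
    using assms coord_proj_in_span by (intro coord_proj_orth fun_span_diff) auto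
  moreover have "ip J (\<lambda>x. f x - coord_proj J B f x) (\<lambda>x. f x - q x) =
     ip J (\<lambda>x. f x - coord_proj J B f x) (\<lambda>x. (f x - coord_proj J B f x) + (coord_proj J B f x - q x))" by simp
  ultimately show "ip J (\<lambda>x. f x - coord_proj J B f x) (\<lambda>x. f x - coord_proj J B f x) =
      ip J (\<lambda>x. f x - coord_proj J B f x) (\<lambda>x. f x - q x)"
    by (simp only: ip_add_right)
qed

text \<open>Writing \<delta>/N = (\<delta>/D)(D/N) separates the residual norm of an atom into the
  square root that appears in the tuning parameter and the quantity bounded by the deficit of the
  interpolating tensor. Each single power is at most the sum over the coordinates, so no further
  constant arises.\<close>

lemma noise_level_bound:
  fixes \<delta> D N :: "'a \<Rightarrow> real"
  assumes "finite M" "1 \<le> k" "\<And>i. i \<in> M \<Longrightarrow> 0 \<le> \<delta> i" "\<And>i. i \<in> M \<Longrightarrow> 0 < D i" "\<And>i. i \<in> M \<Longrightarrow> 0 < N i"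
  shows "sqrt (\<Sum>i\<in>M. (\<delta> i / N i) ^ (2 * k - 1))
    \<le> sqrt (\<Sum>i\<in>M. (D i / N i) ^ (2 * k - 1)) * (\<Sum>i\<in>M. (\<delta> i / D i) powr (real k - 1/2))"
proof -
  define R where "R = (\<Sum>i\<in>M. (\<delta> i / D i) powr (real k - 1/2))"
  have R0: "R \<ge> 0" unfolding R_def by (intro sum_nonneg) auto
  have "(\<Sum>i\<in>M. (\<delta> i / N i) ^ (2 * k - 1)) \<le> (\<Sum>i\<in>M. R\<^sup>2 * (D i / N i) ^ (2 * k - 1))"
  proof (intro sum_mono)
    fix i assume i: "i \<in> M"
    have "((\<delta> i / D i) powr (real k - 1/2))\<^sup>2 = (\<delta> i / D i) ^ (2 * k - 1)"
    proof (cases "\<delta> i = 0")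
      case False
      hence p: "\<delta> i / D i > 0" using assms i by (simp add: less_le)
      hence "((\<delta> i / D i) powr (real k - 1/2))\<^sup>2 = (\<delta> i / D i) powr (real 2 * (real k - 1/2))"
        by (subst powr_power) auto
      also have "real 2 * (real k - 1/2) = real (2 * k - 1)" using assms(2) by simp
      finally show ?thesis using p by (simp only: powr_realpow)
    qed (use assms(2) in simp)
    moreover have "((\<delta> i / D i) powr (real k - 1/2))\<^sup>2 \<le> R\<^sup>2"
      unfolding R_def using assms(1) i by (intro power_mono member_le_sum) auto
    ultimately have "(\<delta> i / D i) ^ (2 * k - 1) * (D i / N i) ^ (2 * k - 1) \<le> R\<^sup>2 * (D i / N i) ^ (2 * k - 1)"
      using assms(4,5)[OF i] by (intro mult_right_mono zero_le_power divide_nonneg_nonneg) (simp_all add: less_imp_le)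
    moreover have "\<delta> i / N i = (\<delta> i / D i) * (D i / N i)" using assms(4)[OF i] by simp
    ultimately show "(\<delta> i / N i) ^ (2 * k - 1) \<le> R\<^sup>2 * (D i / N i) ^ (2 * k - 1)" by (simp only: power_mult_distrib)
  qed
  hence "sqrt (\<Sum>i\<in>M. (\<delta> i / N i) ^ (2 * k - 1)) \<le> sqrt (R\<^sup>2 * (\<Sum>i\<in>M. (D i / N i) ^ (2 * k - 1)))"
    by (simp add: sum_distrib_left)
  also have "\<dots> = sqrt (\<Sum>i\<in>M. (D i / N i) ^ (2 * k - 1)) * R"
    using R0 by (simp add: real_sqrt_mult)
  finally show ?thesis by (simp only: R_def)
qed

context anova begin

lemma pen_ls_margin:
  assumes "M \<subseteq> {1..d}" "lam > 0"
  shows "pen_ls (grid n M) (inner_grid k n M) lam (nprod n M)"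
proof -
  interpret M: dict_grid n k M by (rule dict_grid_subset[OF assms(1)])
  show ?thesis by unfold_locales (use M.fin M.nprod_pos assms in auto)
qed

abbreviation "dmat M \<equiv> (\<lambda>\<kappa> y. \<Prod>i\<in>M. dker (n i) k (\<kappa> i) (y i))"

lemma margin_estimator_eq:
  assumes "M \<subseteq> {1..d}" "lam > 0"
  shows "margin_estimator k d n M h lam Y =
     pen_ls.amin (grid n M) (inner_grid k n M) (dmat M) lam (nprod n M) (margin k d n M h Y)"
proof -
  interpret M: dict_grid n k M by (rule dict_grid_subset[OF assms(1)])
  interpret P: pen_ls "grid n M" "inner_grid k n M" "dmat M" lam "nprod n M" by (rule pen_ls_margin[OF assms])
  have "pen_objective k n M lam y = P.obj y" for y
  proof
    fix b
    have "(\<Sum>j\<in>inner_grid k n M. \<bar>diff_ops k n M b j\<bar>) = (\<Sum>j\<in>inner_grid k n M. \<bar>dcoef n k M b j\<bar>)"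
      by (intro sum.cong refl) (simp add: M.diff_ops_inner)
    thus "pen_objective k n M lam y b = P.obj y b"
      by (simp add: pen_objective_def P.obj_def dcoef_def)
  qed
  moreover have "tensors n M = P.V" by (simp add: tensors_def P.V_def)
  ultimately show ?thesis by (simp add: margin_estimator_def P.amin_def)
qed

text \<open>Projecting the minimizer leaves its penalty unchanged and does not increase the loss,
  because the data margin already lies in the range. Uniqueness of the minimizer then forces it to
  be its own projection.\<close>

lemma margin_estimator_in_range:
  assumes "M \<subseteq> {1..d}" "h \<in> hset k d M" "lam > 0"
  shows "tproj n k M (\<lambda>_. 0) (margin_estimator k d n M h lam Y) = margin_estimator k d n M h lam Y"
proof -
  interpret M: dict_grid n k M by (rule dict_grid_subset[OF assms(1)])
  interpret P: pen_ls "grid n M" "inner_grid k n M" "dmat M" lam "nprod n M" by (rule pen_ls_margin[OF assms(1,3)])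
  define y where "y = margin k d n M h Y"
  have Qy: "tproj n k M (\<lambda>_. 0) y = y" unfolding y_def margin_eq[OF assms(1,2)] by (rule tproj_pmargin[OF assms(1)])
  define b where "b = P.amin y"
  have "P.obj y (tproj n k M (\<lambda>_. 0) b) \<le> P.obj y b"
  proof -
    have "(\<Sum>j\<in>grid n M. (y j - tproj n k M (\<lambda>_. 0) b j)\<^sup>2) =
        ip (grid n M) (tproj n k M (\<lambda>_. 0) (\<lambda>x. y x - b x)) (tproj n k M (\<lambda>_. 0) (\<lambda>x. y x - b x))"
      unfolding tproj_diff Qy by (simp add: ip_def power2_eq_square)
    also have "\<dots> \<le> ip (grid n M) (\<lambda>x. y x - b x) (\<lambda>x. y x - b x)" by (rule M.tproj_contraction) simp
    finally have 1: "(\<Sum>j\<in>grid n M. (y j - tproj n k M (\<lambda>_. 0) b j)\<^sup>2) \<le> (\<Sum>j\<in>grid n M. (y j - b j)\<^sup>2)"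
      by (simp add: ip_def power2_eq_square)
    have "(\<Sum>\<kappa>\<in>inner_grid k n M. \<bar>dcoef n k M (tproj n k M (\<lambda>_. 0) b) \<kappa>\<bar>) = (\<Sum>\<kappa>\<in>inner_grid k n M. \<bar>dcoef n k M b \<kappa>\<bar>)"
      by (intro sum.cong refl) (simp add: M.dcoef_tproj)
    thus ?thesis using 1 M.nprod_pos by (simp add: P.obj_def dcoef_def divide_right_mono)
  qed
  hence "tproj n k M (\<lambda>_. 0) b = b"
    unfolding b_def by (intro P.amin_unique) (simp_all add: P.V_def tproj_vanish)
  thus ?thesis by (simp add: margin_estimator_eq[OF assms(1,3)] b_def y_def)
qed

lemma margin_in_range:
  "M \<subseteq> {1..d} \<Longrightarrow> h \<in> hset k d M \<Longrightarrow> tproj n k M (\<lambda>_. 0) (margin k d n M h f) = margin k d n M h f"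
  by (simp add: margin_eq tproj_pmargin)

lemma extend_margin_margin:
  "M \<subseteq> {1..d} \<Longrightarrow> h \<in> hset k d M \<Longrightarrow> extend_margin k d n M h (margin k d n M h f) = tproj n k {1..d} (csel M h) f"
  by (simp add: margin_eq extend_pmargin)

text \<open>The growth inequality at the minimizer, multiplied by n and transported to the full
  grid. The second square on the left is the growth term; it later pays for the terms linear in
  \<open>F - T g\<close>.\<close>

lemma basic_inequality:
  fixes M :: "nat set" and h :: mindex and lam :: real and e f0 g :: tensor
  assumes M: "M \<subseteq> {1..d}" and h: "h \<in> hset k d M" and lam: "lam > 0"
  defines "b \<equiv> margin_estimator k d n M h lam (\<lambda>j. f0 j + e j)" and "g' \<equiv> margin k d n M h g"
  defines "F \<equiv> extend_margin k d n M h b"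
  defines "T \<equiv> tproj n k {1..d} (csel M h)"
  shows "ip G (\<lambda>x. F x - T f0 x) (\<lambda>x. F x - T f0 x) + ip G (\<lambda>x. F x - T g x) (\<lambda>x. F x - T g x)
    \<le> ip G (\<lambda>x. T g x - T f0 x) (\<lambda>x. T g x - T f0 x) + 2 * ip G e (\<lambda>x. F x - T g x)
      + 2 * nprod n {1..d} * lam * (\<Sum>\<kappa>\<in>inner_grid k n M. \<bar>dcoef n k M g' \<kappa>\<bar> - \<bar>dcoef n k M b \<kappa>\<bar>)"
proof -
  interpret M: dict_grid n k M by (rule dict_grid_subset[OF M])
  interpret P: pen_ls "grid n M" "inner_grid k n M" "dmat M" lam "nprod n M" by (rule pen_ls_margin[OF M lam])
  define y where "y = margin k d n M h (\<lambda>j. f0 j + e j)"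
  define nR where "nR = nprod n ({1..d} - M)"
  have nR: "nR > 0" unfolding nR_def nprod_def using n_pos by (intro prod_pos) auto
  have nn: "nprod n {1..d} = nprod n M * nR" unfolding nR_def by (rule nprod_split[OF M])
  have b: "b = P.amin y" unfolding b_def margin_estimator_eq[OF M lam] y_def ..
  have g'V: "g' \<in> P.V" unfolding g'_def margin_eq[OF M h] P.V_def by (simp add: pmargin_vanish)
  have growth: "P.obj y b + P.sqd b g' / nprod n M \<le> P.obj y g'" unfolding b by (rule P.amin_growth[OF g'V])
  \<comment> \<open>n / n_M is the squared norm of the fixed atoms, so the factors cancel
    exactly.\<close>
  have scale: "nprod n {1..d} * (P.sqd p q / nprod n M) =
      ip G (\<lambda>x. extend_margin k d n M h p x - extend_margin k d n M h q x) (\<lambda>x. extend_margin k d n M h p x - extend_margin k d n M h q x)" for p q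
  proof -
    have "ip G (\<lambda>x. extend_margin k d n M h p x - extend_margin k d n M h q x) (\<lambda>x. extend_margin k d n M h p x - extend_margin k d n M h q x)
      = nR * P.sqd p q"
      unfolding extend_margin_diff[symmetric] ip_extend_margin[OF M h] nR_def
      by (simp add: ip_def P.sqd_def power2_eq_square)
    thus ?thesis using M.nprod_pos by (simp add: nn)
  qed
  have obj: "nprod n {1..d} * P.obj p q = nprod n {1..d} * (P.sqd p q / nprod n M)
      + 2 * nprod n {1..d} * lam * (\<Sum>\<kappa>\<in>inner_grid k n M. \<bar>dcoef n k M q \<kappa>\<bar>)" for p q
    by (simp add: P.obj_def P.sqd_def dcoef_def algebra_simps)
  have Y: "extend_margin k d n M h y = (\<lambda>x. T f0 x + T e x)"
    unfolding y_def extend_margin_margin[OF M h] T_def tproj_add ..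
  have Gg: "extend_margin k d n M h g' = T g" unfolding g'_def T_def by (rule extend_margin_margin[OF M h])
  have "nprod n {1..d} * P.obj y b + nprod n {1..d} * (P.sqd b g' / nprod n M) \<le> nprod n {1..d} * P.obj y g'"
    using growth nprod_pos by (simp add: distrib_left[symmetric] del: times_divide_eq_right)
  hence main: "ip G (\<lambda>x. (T f0 x + T e x) - F x) (\<lambda>x. (T f0 x + T e x) - F x) +
      2 * nprod n {1..d} * lam * (\<Sum>\<kappa>\<in>inner_grid k n M. \<bar>dcoef n k M b \<kappa>\<bar>) +
      ip G (\<lambda>x. F x - T g x) (\<lambda>x. F x - T g x)
     \<le> ip G (\<lambda>x. (T f0 x + T e x) - T g x) (\<lambda>x. (T f0 x + T e x) - T g x) +
      2 * nprod n {1..d} * lam * (\<Sum>\<kappa>\<in>inner_grid k n M. \<bar>dcoef n k M g' \<kappa>\<bar>)"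
    unfolding obj scale Y Gg F_def .
  have TF: "T F = F"
    unfolding T_def F_def b_def
    by (rule tproj_extend_margin[OF M h margin_estimator_in_range[OF M h lam]])
  have TT: "T (T g) = T g" unfolding T_def by (rule tproj_idem) (rule csel_le[OF M h])
  \<comment> \<open>The projection T is self-adjoint and fixes \<open>F - T g\<close>, so the noise
    may be used unprojected.\<close>
  have eU: "ip G (T e) (\<lambda>x. F x - T g x) = ip G e (\<lambda>x. F x - T g x)"
  proof -
    have "ip G (T e) (\<lambda>x. F x - T g x) = ip G e (T (\<lambda>x. F x - T g x))"
      unfolding T_def by (rule tproj_symmetric)
    also have "T (\<lambda>x. F x - T g x) = (\<lambda>x. F x - T g x)"
      unfolding T_def tproj_diff using TF TT by (simp add: T_def)
    finally show ?thesis .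
  qed
  have expand: "ip G (\<lambda>x. (T f0 x + T e x) - q x) (\<lambda>x. (T f0 x + T e x) - q x) =
     ip G (T e) (T e) - 2 * ip G (T e) (\<lambda>x. q x - T f0 x) + ip G (\<lambda>x. q x - T f0 x) (\<lambda>x. q x - T f0 x)" for q
    unfolding ip_def sum_distrib_left sum_subtractf[symmetric] sum.distrib[symmetric]
    by (intro sum.cong refl) (simp add: algebra_simps)
  have "ip G (T e) (\<lambda>x. F x - T f0 x) - ip G (T e) (\<lambda>x. T g x - T f0 x) = ip G (T e) (\<lambda>x. F x - T g x)"
    by (simp add: ip_diff_right)
  thus ?thesis using main unfolding expand eU by (simp add: sum_subtractf algebra_simps)
qed

text \<open>Deterministic in the noise e: the residual of every atom must be tested by e at level
  \<Lambda> relative to its norm, and B may be any orthonormal system whose span contains the atoms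
  at the blocks of knots. Projected noise and interpolating tensor both multiply the norm of
  \<open>F - T g\<close>, and its square, available on the left, is traded for 3/2 and 3 times the
  squares of their factors.\<close>

lemma component_oracle:
  fixes M :: "nat set" and h :: mindex and lam \<Lambda> :: real and e f0 g :: tensor
    and S :: "mindex set" and lo hi :: "mindex \<Rightarrow> mindex"
  assumes M: "M \<subseteq> {1..d}" "M \<noteq> {}" and h: "h \<in> hset k d M" and lam: "lam > 0"
    and tess: "tessellation k n M S lo hi" "derivative_matching k M S lo hi"
    and B: "finite B" "orthonormal G B"
      "\<And>\<tau> \<kappa>. \<tau> \<in> S \<Longrightarrow> \<kappa> \<in> (\<Pi>\<^sub>E i\<in>M. {\<tau> i..\<tau> i + k - 1}) \<Longrightarrow> Phi_t k d n (atom_merge M h \<kappa>) \<in> fun_span B"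
    and noise: "\<And>\<kappa>. \<kappa> \<in> inner_grid k n M \<Longrightarrow>
      \<bar>ip G e (\<lambda>x. Phi_t k d n (atom_merge M h \<kappa>) x - coord_proj G B (Phi_t k d n (atom_merge M h \<kappa>)) x)\<bar>
      \<le> \<Lambda> * sqrt (ip G (\<lambda>x. Phi_t k d n (atom_merge M h \<kappa>) x - coord_proj G B (Phi_t k d n (atom_merge M h \<kappa>)) x)
                    (\<lambda>x. Phi_t k d n (atom_merge M h \<kappa>) x - coord_proj G B (Phi_t k d n (atom_merge M h \<kappa>)) x))"
    and \<Lambda>: "\<Lambda> \<ge> 0"
    and lam_ge: "real (card M) * sqrt (\<Sum>i\<in>M. (real (dist_max k S lo hi i) / real (n i)) ^ (2 * k - 1)) * (\<Lambda> / sqrt (nprod n {1..d})) \<le> lam"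
  defines "F \<equiv> extend_margin k d n M h (margin_estimator k d n M h lam (\<lambda>j. f0 j + e j))"
  defines "T \<equiv> tproj n k {1..d} (csel M h)"
  shows "ip G (\<lambda>x. F x - T f0 x) (\<lambda>x. F x - T f0 x) \<le> ip G (\<lambda>x. T g x - T f0 x) (\<lambda>x. T g x - T f0 x)
     + 4 * nprod n {1..d} * lam * (\<Sum>j\<in>inner_grid k n M - S. \<bar>diff_ops k n M (margin k d n M h g) j\<bar>)
     + 3/2 * (\<Sum>b\<in>B. (ip G e b)\<^sup>2)
     + 3 * nprod n {1..d} * lam\<^sup>2 * (((real k + 1) * energy_const k) ^ card M *
        (\<Sum>i\<in>M. ln (exp 1 * real (dist_max k S lo hi i))) *
        (\<Sum>\<tau>\<in>S. \<Sum>z\<in>(\<Pi>\<^sub>E i\<in>M. (UNIV :: bool set)). (nprod n M / dist_prod k M lo hi \<tau> z) ^ (2 * k - 1)))"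
proof -
  interpret M: tess_grid n k M S lo hi
    by (intro tess_grid.intro dict_grid_subset M(1) tess_grid_axioms.intro M(2) tess)
  let ?n = "nprod n {1..d}"
  let ?K = "inner_grid k n M"
  define \<Phi> where "\<Phi> = (\<lambda>\<kappa>. Phi_t k d n (atom_merge M h \<kappa>))"
  define prB where "prB = coord_proj G B"
  define b where "b = margin_estimator k d n M h lam (\<lambda>j. f0 j + e j)"
  define g' where "g' = margin k d n M h g"
  define u where "u = (\<lambda>x. b x - g' x)"
  define U where "U = (\<lambda>x. F x - T g x)"
  define D where "D = (\<lambda>\<kappa>. dcoef n k M u \<kappa>)"
  define N where "N = (\<Sum>b\<in>B. (ip G e b)\<^sup>2)"
  define nR where "nR = nprod n ({1..d} - M)"
  have nR: "nR > 0" unfolding nR_def nprod_def using n_pos by (intro prod_pos) auto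
  have nn: "?n = nprod n M * nR" unfolding nR_def by (rule nprod_split[OF M(1)])
  have D: "D \<kappa> = dcoef n k M b \<kappa> - dcoef n k M g' \<kappa>" for \<kappa>
    unfolding D_def u_def by (rule dcoef_diff)
  have U_eq: "U = extend_margin k d n M h u"
    unfolding U_def u_def extend_margin_diff F_def b_def g'_def T_def extend_margin_margin[OF M(1) h] ..
  have Qu: "tproj n k M (\<lambda>_. 0) u = u"
    unfolding u_def tproj_diff b_def g'_def margin_in_range[OF M(1) h] margin_estimator_in_range[OF M(1) h lam] ..
  have U_sum: "U = (\<lambda>x. \<Sum>\<kappa>\<in>?K. D \<kappa> * \<Phi> \<kappa> x)"
    unfolding U_eq D_def \<Phi>_def by (rule extend_margin_synthesis[OF M(1) h Qu])
  have uu: "ip (grid n M) u u = ip G U U / nR"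
    unfolding U_eq ip_extend_margin[OF M(1) h] nR_def[symmetric] using nR by simp
  \<comment> \<open>The signs to interpolate are those of the differences of the error; they make
    the interpolating tensor recover absolute values on the active set.\<close>
  define q where "q = (\<lambda>\<kappa>. sgn (D \<kappa>))"
  have q: "\<bar>q \<tau>\<bar> \<le> 1" for \<tau> by (simp add: q_def abs_sgn_eq)
  obtain w wd where
    w_S0: "\<forall>\<kappa>\<in>S. w \<kappa> = q \<kappa>" and
    w_def0: "\<forall>\<kappa>\<in>?K. \<forall>\<tau>\<in>S. \<kappa> \<in> rect M lo hi \<tau> \<longrightarrow>
      (\<Sum>i\<in>M. (real (knot_dist k (\<tau> i) (\<kappa> i)) / real (M.dmax i)) powr (real k - 1/2))
       \<le> real (card M) * (1 - \<bar>w \<kappa>\<bar>)" and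
    w_adj0: "\<forall>u. (\<Sum>\<kappa>\<in>?K. w \<kappa> * dcoef n k M u \<kappa>) = ip (grid n M) wd u" and
    w_en: "nprod n M * ip (grid n M) wd wd \<le> ((real k + 1) * energy_const k) ^ card M * (\<Sum>i\<in>M. ln (exp 1 * real (M.dmax i))) *
       (\<Sum>\<tau>\<in>S. \<Sum>z\<in>(\<Pi>\<^sub>E i\<in>M. (UNIV :: bool set)). (nprod n M / dist_prod k M lo hi \<tau> z) ^ (2 * k - 1))"
    by (rule M.interpolating_tensor[of q, OF q])
  note w_S = w_S0[rule_format] and w_def = w_def0[rule_format] and w_adj = w_adj0[rule_format]
  \<comment> \<open>In the rectangle containing \<kappa> the residual norm is bounded by the knot
    distances, these by the deficit of w, and the factor \<open>card M\<close> of the deficit is the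
    one in the tuning parameter. The noise on an atom thus fits into the room between |w| and
    1.\<close>
  have noise_le: "\<bar>ip G e (\<lambda>x. \<Phi> \<kappa> x - prB (\<Phi> \<kappa>) x)\<bar> \<le> ?n * lam * (1 - \<bar>w \<kappa>\<bar>)" if \<kappa>: "\<kappa> \<in> ?K" for \<kappa>
  proof -
    obtain \<tau> where \<tau>: "\<tau> \<in> S" "\<kappa> \<in> rect M lo hi \<tau>" using M.rect_cover[OF \<kappa>] by auto
    let ?\<delta> = "\<lambda>i. real (knot_dist k (\<tau> i) (\<kappa> i))"
    have t: "k + 1 \<le> \<tau> i \<and> \<tau> i + k - 1 \<le> n i" if "i \<in> M" for i
      using M.corners[OF \<tau>(1) that] M.interior_point[OF \<tau>(1) that] by linarith
    obtain p where p: "p \<in> fun_span ((\<lambda>\<kappa>'. Phi_t k d n (atom_merge M h \<kappa>')) ` (\<Pi>\<^sub>E i\<in>M. {\<tau> i..\<tau> i + k - 1}))"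
      "ip G (\<lambda>x. \<Phi> \<kappa> x - p x) (\<lambda>x. \<Phi> \<kappa> x - p x) \<le> ?n * (\<Sum>i\<in>M. (?\<delta> i / real (n i)) ^ (2 * k - 1))"
      unfolding \<Phi>_def by (rule Phi_t_approximation[OF M(1) h t \<kappa>])
    have pB: "p \<in> fun_span B"
      using p(1) B(3)[OF \<tau>(1)] fun_span_subset[of "(\<lambda>\<kappa>'. Phi_t k d n (atom_merge M h \<kappa>')) ` (\<Pi>\<^sub>E i\<in>M. {\<tau> i..\<tau> i + k - 1})" B] by blast
    have "ip G (\<lambda>x. \<Phi> \<kappa> x - prB (\<Phi> \<kappa>) x) (\<lambda>x. \<Phi> \<kappa> x - prB (\<Phi> \<kappa>) x) \<le> ?n * (\<Sum>i\<in>M. (?\<delta> i / real (n i)) ^ (2 * k - 1))"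
      unfolding prB_def using coord_proj_best[OF B(1,2) pB, of "\<Phi> \<kappa>"] p(2) by linarith
    hence "\<Lambda> * sqrt (ip G (\<lambda>x. \<Phi> \<kappa> x - prB (\<Phi> \<kappa>) x) (\<lambda>x. \<Phi> \<kappa> x - prB (\<Phi> \<kappa>) x))
        \<le> \<Lambda> * (sqrt ?n * sqrt (\<Sum>i\<in>M. (?\<delta> i / real (n i)) ^ (2 * k - 1)))"
      using \<Lambda> by (intro mult_left_mono) (simp_all flip: real_sqrt_mult)
    also have "\<dots> \<le> \<Lambda> * (sqrt ?n * (sqrt (\<Sum>i\<in>M. (real (M.dmax i) / real (n i)) ^ (2 * k - 1)) *
        (\<Sum>i\<in>M. (?\<delta> i / real (M.dmax i)) powr (real k - 1/2))))"
    proof (intro mult_left_mono noise_level_bound M.fin k1)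
      fix i assume i: "i \<in> M"
      show "0 < real (M.dmax i)" using M.rho_gt[OF \<tau>(1) i] M.rho_le_dmax[OF \<tau>(1), of i] by simp
      show "0 < real (n i)" using M.n_pos[OF i] by simp
    qed (use \<Lambda> nprod_pos in auto)
    also have "\<dots> \<le> \<Lambda> * (sqrt ?n * (sqrt (\<Sum>i\<in>M. (real (M.dmax i) / real (n i)) ^ (2 * k - 1)) *
        (real (card M) * (1 - \<bar>w \<kappa>\<bar>))))"
      using w_def[OF \<kappa> \<tau>] \<Lambda> nprod_pos by (intro mult_left_mono) (auto intro!: sum_nonneg)
    also have "\<dots> = ?n * (real (card M) * sqrt (\<Sum>i\<in>M. (real (M.dmax i) / real (n i)) ^ (2 * k - 1)) * (\<Lambda> / sqrt ?n)) * (1 - \<bar>w \<kappa>\<bar>)"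
    proof -
      have alg: "A * (sq * (Q * (c * v))) = m * (c * Q * (A / sq)) * v" if "m / sq = sq" for A sq Q c v m :: real
      proof -
        have "m * (c * Q * (A / sq)) * v = (m / sq) * (A * (Q * (c * v)))"
          by (simp add: divide_inverse mult_ac)
        thus ?thesis using that by (simp add: mult_ac)
      qed
      show ?thesis by (rule alg) (use nprod_pos in \<open>simp add: real_div_sqrt\<close>)
    qed
    also have "\<dots> \<le> ?n * lam * (1 - \<bar>w \<kappa>\<bar>)"
    proof (intro mult_right_mono mult_left_mono lam_ge)
      have "0 \<le> real (card M) * (1 - \<bar>w \<kappa>\<bar>)"
        by (rule order_trans[OF sum_nonneg w_def[OF \<kappa> \<tau>]]) simp
      thus "0 \<le> 1 - \<bar>w \<kappa>\<bar>" using M.card_M by (simp add: zero_le_mult_iff)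
    qed (use nprod_pos in auto)
    finally show ?thesis using noise[OF \<kappa>] unfolding \<Phi>_def prB_def by linarith
  qed
  have proj: "ip G e (prB U) \<le> sqrt N * sqrt (ip G U U)"
  proof -
    have "ip G e (prB U) = (\<Sum>b\<in>B. ip G U b * ip G e b)" unfolding prB_def by (rule ip_coord_proj)
    also have "\<dots> \<le> L2_set (ip G U) B * L2_set (ip G e) B"
    proof -
      have "(\<Sum>b\<in>B. ip G U b * ip G e b) \<le> (\<Sum>b\<in>B. \<bar>ip G U b\<bar> * \<bar>ip G e b\<bar>)"
        by (intro sum_mono) (metis abs_ge_self abs_mult)
      thus ?thesis using L2_set_mult_ineq[of "ip G U" "ip G e" B] by linarith
    qed
    also have "\<dots> \<le> sqrt (ip G U U) * sqrt N"
      unfolding L2_set_def N_def using Bessel[OF B(1,2), of U] by (intro mult_mono) (auto intro: sum_nonneg)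
    finally show ?thesis by (simp add: mult.commute)
  qed
  have rest: "ip G e (\<lambda>x. U x - prB U x) \<le> (\<Sum>\<kappa>\<in>?K. \<bar>D \<kappa>\<bar> * (?n * lam * (1 - \<bar>w \<kappa>\<bar>)))"
  proof -
    have "(\<lambda>x. U x - prB U x) = (\<lambda>x. \<Sum>\<kappa>\<in>?K. D \<kappa> * (\<Phi> \<kappa> x - prB (\<Phi> \<kappa>) x))"
      unfolding U_sum prB_def coord_proj_lincomb by (simp add: right_diff_distrib sum_subtractf)
    hence "ip G e (\<lambda>x. U x - prB U x) = (\<Sum>\<kappa>\<in>?K. D \<kappa> * ip G e (\<lambda>x. \<Phi> \<kappa> x - prB (\<Phi> \<kappa>) x))"
      by (simp only: ip_sum_right ip_scale_right)
    also have "\<dots> \<le> (\<Sum>\<kappa>\<in>?K. \<bar>D \<kappa>\<bar> * (?n * lam * (1 - \<bar>w \<kappa>\<bar>)))"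
    proof (intro sum_mono)
      fix \<kappa> assume \<kappa>: "\<kappa> \<in> ?K"
      have "D \<kappa> * ip G e (\<lambda>x. \<Phi> \<kappa> x - prB (\<Phi> \<kappa>) x) \<le> \<bar>D \<kappa>\<bar> * \<bar>ip G e (\<lambda>x. \<Phi> \<kappa> x - prB (\<Phi> \<kappa>) x)\<bar>"
        by (metis abs_ge_self abs_mult)
      also have "\<dots> \<le> \<bar>D \<kappa>\<bar> * (?n * lam * (1 - \<bar>w \<kappa>\<bar>))" using noise_le[OF \<kappa>] by (intro mult_left_mono) auto
      finally show "D \<kappa> * ip G e (\<lambda>x. \<Phi> \<kappa> x - prB (\<Phi> \<kappa>) x) \<le> \<bar>D \<kappa>\<bar> * (?n * lam * (1 - \<bar>w \<kappa>\<bar>))" .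
    qed
    finally show ?thesis .
  qed
  \<comment> \<open>On the active set w is the sign of the difference, so the noise weight
    disappears and the triangle inequality suffices. Off it the weight 1 - |w| and the estimated
    penalty combine, at the price of twice the penalty of g.\<close>
  have point: "\<bar>D \<kappa>\<bar> * (1 - \<bar>w \<kappa>\<bar>) + (\<bar>dcoef n k M g' \<kappa>\<bar> - \<bar>dcoef n k M b \<kappa>\<bar>)
     \<le> w \<kappa> * D \<kappa> + (if \<kappa> \<in> S then 0 else 2 * \<bar>dcoef n k M g' \<kappa>\<bar>)" for \<kappa>
  proof (cases "\<kappa> \<in> S")
    case True
    have z: "\<bar>D \<kappa>\<bar> * (1 - \<bar>w \<kappa>\<bar>) = 0" using w_S[OF True] by (simp add: q_def abs_sgn_eq)
    have wD: "w \<kappa> * D \<kappa> = \<bar>D \<kappa>\<bar>" using w_S[OF True] by (simp add: q_def abs_sgn mult.commute)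
    have "\<bar>dcoef n k M g' \<kappa>\<bar> - \<bar>dcoef n k M b \<kappa>\<bar> \<le> \<bar>D \<kappa>\<bar>" unfolding D by linarith
    thus ?thesis unfolding z wD using True by simp
  next
    case False
    have "\<bar>D \<kappa>\<bar> \<le> \<bar>dcoef n k M b \<kappa>\<bar> + \<bar>dcoef n k M g' \<kappa>\<bar>" unfolding D by linarith
    moreover have "- (\<bar>w \<kappa>\<bar> * \<bar>D \<kappa>\<bar>) \<le> w \<kappa> * D \<kappa>" by (metis abs_mult abs_ge_minus_self minus_le_iff)
    ultimately show ?thesis using False by (simp add: algebra_simps)
  qed
  define Pg where "Pg = (\<Sum>j\<in>?K - S. \<bar>dcoef n k M g' j\<bar>)"
  have Pg_eq: "Pg = (\<Sum>j\<in>?K - S. \<bar>diff_ops k n M (margin k d n M h g) j\<bar>)"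
    unfolding Pg_def g'_def by (intro sum.cong refl) (auto simp: M.diff_ops_inner)
  have pen: "(\<Sum>\<kappa>\<in>?K. \<bar>D \<kappa>\<bar> * (1 - \<bar>w \<kappa>\<bar>)) + (\<Sum>\<kappa>\<in>?K. \<bar>dcoef n k M g' \<kappa>\<bar> - \<bar>dcoef n k M b \<kappa>\<bar>)
      \<le> ip (grid n M) wd u + 2 * Pg"
  proof -
    have "(\<Sum>\<kappa>\<in>?K. \<bar>D \<kappa>\<bar> * (1 - \<bar>w \<kappa>\<bar>)) + (\<Sum>\<kappa>\<in>?K. \<bar>dcoef n k M g' \<kappa>\<bar> - \<bar>dcoef n k M b \<kappa>\<bar>)
      \<le> (\<Sum>\<kappa>\<in>?K. w \<kappa> * D \<kappa> + (if \<kappa> \<in> S then 0 else 2 * \<bar>dcoef n k M g' \<kappa>\<bar>))"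
      unfolding sum.distrib[symmetric] by (intro sum_mono point)
    also have "\<dots> = ip (grid n M) wd u + (\<Sum>\<kappa>\<in>?K. if \<kappa> \<in> S then 0 else 2 * \<bar>dcoef n k M g' \<kappa>\<bar>)"
      unfolding sum.distrib D_def w_adj ..
    also have "(\<Sum>\<kappa>\<in>?K. if \<kappa> \<in> S then 0 else 2 * \<bar>dcoef n k M g' \<kappa>\<bar>) = (\<Sum>\<kappa>\<in>?K - S. 2 * \<bar>dcoef n k M g' \<kappa>\<bar>)"
      using M.fin by (intro sum.mono_neutral_cong_right) auto
    finally show ?thesis by (simp add: Pg_def sum_distrib_left)
  qed
  define X where "X = sqrt N"
  define Y where "Y = lam * sqrt (?n * (nprod n M * ip (grid n M) wd wd))"
  define s where "s = sqrt (ip G U U)"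
  \<comment> \<open>Cauchy-Schwarz happens on the grid of M; the squared norms of u and U differ by
    the factor nR, and n = n_M nR converts the bound to the full grid.\<close>
  have wdu: "?n * lam * ip (grid n M) wd u \<le> Y * s"
  proof -
    have "?n * lam * ip (grid n M) wd u \<le> ?n * lam * (sqrt (ip (grid n M) wd wd) * sqrt (ip (grid n M) u u))"
      using lam nprod_pos by (intro mult_left_mono ip_Cauchy_Schwarz) auto
    also have "\<dots> = Y * s"
    proof -
      have "sqrt (?n * nprod n M) * sqrt nR = sqrt (?n * nprod n M * nR)" by (simp only: real_sqrt_mult)
      also have "?n * nprod n M * nR = ?n * ?n" by (simp add: nn)
      also have "sqrt (?n * ?n) = ?n" using nprod_pos by (simp only: real_sqrt_abs2 abs_of_pos)
      finally have "?n = sqrt (?n * nprod n M) * sqrt nR" by (rule sym)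
      moreover have "sqrt (ip (grid n M) u u) * sqrt nR = s"
        unfolding uu s_def using nR by (simp flip: real_sqrt_mult)
      ultimately have "?n * sqrt (ip (grid n M) u u) = sqrt (?n * nprod n M) * s" by (metis mult.assoc mult.commute)
      moreover have "sqrt (?n * (nprod n M * ip (grid n M) wd wd)) = sqrt (?n * nprod n M) * sqrt (ip (grid n M) wd wd)"
        by (simp add: mult.assoc flip: real_sqrt_mult)
      ultimately show ?thesis unfolding Y_def by (simp add: mult_ac)
    qed
    finally show ?thesis .
  qed
  have s2: "s\<^sup>2 = ip G U U" unfolding s_def by simp
  have "ip G (\<lambda>x. F x - T f0 x) (\<lambda>x. F x - T f0 x) + s\<^sup>2
    \<le> ip G (\<lambda>x. T g x - T f0 x) (\<lambda>x. T g x - T f0 x) + 2 * ip G e U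
      + 2 * ?n * lam * (\<Sum>\<kappa>\<in>?K. \<bar>dcoef n k M g' \<kappa>\<bar> - \<bar>dcoef n k M b \<kappa>\<bar>)"
    using basic_inequality[OF M(1) h lam, of f0 e g] unfolding s2 U_def F_def T_def b_def g'_def .
  moreover have "ip G e U \<le> X * s + ?n * lam * (\<Sum>\<kappa>\<in>?K. \<bar>D \<kappa>\<bar> * (1 - \<bar>w \<kappa>\<bar>))"
  proof -
    have "ip G e U = ip G e (prB U) + ip G e (\<lambda>x. U x - prB U x)" by (simp add: ip_diff_right)
    moreover have "(\<Sum>\<kappa>\<in>?K. \<bar>D \<kappa>\<bar> * (?n * lam * (1 - \<bar>w \<kappa>\<bar>))) = ?n * lam * (\<Sum>\<kappa>\<in>?K. \<bar>D \<kappa>\<bar> * (1 - \<bar>w \<kappa>\<bar>))"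
      by (simp add: sum_distrib_left mult_ac)
    ultimately show ?thesis using proj rest unfolding X_def s_def by linarith
  qed
  moreover have "?n * lam * ((\<Sum>\<kappa>\<in>?K. \<bar>D \<kappa>\<bar> * (1 - \<bar>w \<kappa>\<bar>)) + (\<Sum>\<kappa>\<in>?K. \<bar>dcoef n k M g' \<kappa>\<bar> - \<bar>dcoef n k M b \<kappa>\<bar>))
     \<le> ?n * lam * (ip (grid n M) wd u + 2 * Pg)"
    using pen lam nprod_pos by (intro mult_left_mono) auto
  \<comment> \<open>Maximising over s gives (X + Y)^2. The cross term 2XY is split unevenly, as
    X^2/2 + 2Y^2, to keep the factor of the chi-square part at 3/2.\<close>
  moreover have "2 * (X * s) + 2 * (Y * s) - s\<^sup>2 \<le> 3/2 * X\<^sup>2 + 3 * Y\<^sup>2"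
  proof -
    have "3/2 * X\<^sup>2 + 3 * Y\<^sup>2 - (2 * (X * s) + 2 * (Y * s) - s\<^sup>2) = (s - (X + Y))\<^sup>2 + (X - 2 * Y)\<^sup>2 / 2"
      by (simp add: power2_eq_square field_simps)
    also have "\<dots> \<ge> 0" by simp
    finally show ?thesis by linarith
  qed
  ultimately have fin_ineq: "ip G (\<lambda>x. F x - T f0 x) (\<lambda>x. F x - T f0 x) \<le> ip G (\<lambda>x. T g x - T f0 x) (\<lambda>x. T g x - T f0 x)
     + 4 * ?n * lam * Pg + 3/2 * X\<^sup>2 + 3 * Y\<^sup>2"
    using wdu by (simp add: distrib_left)
  have "X\<^sup>2 = N" unfolding X_def N_def by (simp add: sum_nonneg)
  moreover have "3 * Y\<^sup>2 \<le> 3 * ?n * lam\<^sup>2 * (((real k + 1) * energy_const k) ^ card M *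
        (\<Sum>i\<in>M. ln (exp 1 * real (M.dmax i))) *
        (\<Sum>\<tau>\<in>S. \<Sum>z\<in>(\<Pi>\<^sub>E i\<in>M. (UNIV :: bool set)). (nprod n M / dist_prod k M lo hi \<tau> z) ^ (2 * k - 1)))"
  proof -
    have "Y\<^sup>2 = lam\<^sup>2 * (?n * (nprod n M * ip (grid n M) wd wd))"
      unfolding Y_def power_mult_distrib using nprod_pos M.nprod_pos by simp
    hence "3 * Y\<^sup>2 = 3 * ?n * lam\<^sup>2 * (nprod n M * ip (grid n M) wd wd)" by simp
    also have "\<dots> \<le> 3 * ?n * lam\<^sup>2 * (((real k + 1) * energy_const k) ^ card M *
        (\<Sum>i\<in>M. ln (exp 1 * real (M.dmax i))) *
        (\<Sum>\<tau>\<in>S. \<Sum>z\<in>(\<Pi>\<^sub>E i\<in>M. (UNIV :: bool set)). (nprod n M / dist_prod k M lo hi \<tau> z) ^ (2 * k - 1)))"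
      using nprod_pos by (intro mult_left_mono w_en) auto
    finally show ?thesis .
  qed
  ultimately show ?thesis using fin_ineq unfolding Pg_eq N_def by linarith
qed

end

section \<open>The oracle inequality\<close>

lemma (in tess_grid) ln_dmax_ge_1: "i \<in> M \<Longrightarrow> 1 \<le> ln (exp 1 * real (dmax i))"
proof -
  assume i: "i \<in> M"
  obtain \<tau> where "\<tau> \<in> S" using S_ne by auto
  hence "1 \<le> real (dmax i)" using rho_gt[of \<tau> i] rho_le_dmax[of \<tau> i] i by simp
  thus ?thesis by (simp add: ln_mult)
qed

text \<open>Each active point contributes at least one to the product of the two sums: a side is at
  most the maximal side, and all other ratios n_i / d_i are at least one. Hence r^2 s is dominated
  by \<lambda>^2 times the energy sum, which lets dimension terms be absorbed.\<close>

lemma (in tess_grid) effective_sparsity_lower: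
  assumes r: "r \<ge> 0" and lam: "sqrt (\<Sum>i\<in>M. (real (dmax i) / real (n i)) ^ (2 * k - 1)) * r \<le> lam"
  shows "r\<^sup>2 * real (card S) \<le> lam\<^sup>2 * (\<Sum>i\<in>M. ln (exp 1 * real (dmax i))) *
     (\<Sum>\<tau>\<in>S. \<Sum>z\<in>(\<Pi>\<^sub>E i\<in>M. (UNIV :: bool set)). (nprod n M / dist_prod k M lo hi \<tau> z) ^ (2 * k - 1))"
proof -
  define A where "A = (\<Sum>i\<in>M. (real (dmax i) / real (n i)) ^ (2 * k - 1))"
  define Ls where "Ls = (\<Sum>i\<in>M. ln (exp 1 * real (dmax i)))"
  define Z where "Z = (\<lambda>\<tau>. \<Sum>z\<in>(\<Pi>\<^sub>E i\<in>M. (UNIV :: bool set)). (nprod n M / dist_prod k M lo hi \<tau> z) ^ (2 * k - 1))"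
  obtain i0 where i0: "i0 \<in> M" using M_ne by auto
  have A0: "A \<ge> 0" unfolding A_def by (intro sum_nonneg) auto
  have Z1: "1 \<le> A * Z \<tau>" if \<tau>: "\<tau> \<in> S" for \<tau>
  proof -
    \<comment> \<open>The upper side in every coordinate serves as a sample term of the sum over
      z.\<close>
    define z0 where "z0 = (\<lambda>i\<in>M. True)"
    define s where "s = (\<lambda>i. dist_side k lo hi \<tau> i (z0 i))"
    have sp: "0 < s i" "s i \<le> n i" if "i \<in> M" for i
      using side_pos[OF \<tau> that] side_le_n[OF \<tau> that] by (auto simp: s_def)
    have "real (s i0) \<le> real (dmax i0)"
      using side_le_dmax[OF \<tau>, of i0] i0 by (simp add: s_def z0_def)
    hence "1 \<le> (real (dmax i0) / real (n i0)) * (real (n i0) / real (s i0))"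
      using sp[OF i0] n_pos[OF i0] by simp
    also have "\<dots> \<le> (real (dmax i0) / real (n i0)) * (\<Prod>i\<in>M. real (n i) / real (s i))"
    proof (intro mult_left_mono)
      have "1 \<le> (\<Prod>i\<in>M - {i0}. real (n i) / real (s i))"
        using sp by (intro prod_ge_1) (auto simp: divide_simps)
      hence "real (n i0) / real (s i0) * 1 \<le> real (n i0) / real (s i0) * (\<Prod>i\<in>M - {i0}. real (n i) / real (s i))"
        by (intro mult_left_mono) auto
      thus "real (n i0) / real (s i0) \<le> (\<Prod>i\<in>M. real (n i) / real (s i))"
        using prod.remove[OF fin i0, of "\<lambda>i. real (n i) / real (s i)"] by simp
    qed auto
    finally have "1 \<le> ((real (dmax i0) / real (n i0)) * (\<Prod>i\<in>M. real (n i) / real (s i))) ^ (2 * k - 1)"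
      by (rule one_le_power)
    also have "\<dots> = (real (dmax i0) / real (n i0)) ^ (2 * k - 1) * (nprod n M / dist_prod k M lo hi \<tau> z0) ^ (2 * k - 1)"
      by (simp only: power_mult_distrib nprod_def dist_prod_def prod_dividef s_def)
    also have "\<dots> \<le> A * Z \<tau>"
    proof (rule mult_mono)
      show "(real (dmax i0) / real (n i0)) ^ (2 * k - 1) \<le> A"
        unfolding A_def using fin i0 by (intro member_le_sum) auto
      have nn: "0 \<le> (nprod n M / dist_prod k M lo hi \<tau> z) ^ (2 * k - 1)" for z
        unfolding nprod_def dist_prod_def by (intro zero_le_power divide_nonneg_nonneg prod_nonneg) auto
      show "0 \<le> (nprod n M / dist_prod k M lo hi \<tau> z0) ^ (2 * k - 1)" by (rule nn)
      show "(nprod n M / dist_prod k M lo hi \<tau> z0) ^ (2 * k - 1) \<le> Z \<tau>"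
        unfolding Z_def
      proof (rule member_le_sum)
        show "z0 \<in> (\<Pi>\<^sub>E i\<in>M. UNIV)" by (auto simp: z0_def)
        show "finite (\<Pi>\<^sub>E i\<in>M. (UNIV :: bool set))" using fin by (intro finite_PiE) auto
      qed (rule nn)
    qed (rule A0)
    finally show ?thesis .
  qed
  have "r\<^sup>2 * real (card S) = r\<^sup>2 * (\<Sum>\<tau>\<in>S. 1)" by simp
  also have "\<dots> \<le> r\<^sup>2 * (\<Sum>\<tau>\<in>S. A * Z \<tau>)" using Z1 by (intro mult_left_mono sum_mono) auto
  also have "\<dots> = (sqrt A * r)\<^sup>2 * (\<Sum>\<tau>\<in>S. Z \<tau>)"
    using A0 unfolding sum_distrib_left[symmetric] by (simp add: power_mult_distrib)
  finally have 1: "r\<^sup>2 * real (card S) \<le> (sqrt A * r)\<^sup>2 * (\<Sum>\<tau>\<in>S. Z \<tau>)" .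
  have Zs: "(\<Sum>\<tau>\<in>S. Z \<tau>) \<ge> 0"
  proof (intro sum_nonneg)
    fix \<tau> show "0 \<le> Z \<tau>"
      unfolding Z_def nprod_def dist_prod_def
      by (intro sum_nonneg zero_le_power divide_nonneg_nonneg prod_nonneg) auto
  qed
  have "(sqrt A * r)\<^sup>2 \<le> lam\<^sup>2" using lam r A0 by (intro power_mono) (auto simp: A_def)
  also have "lam\<^sup>2 \<le> lam\<^sup>2 * Ls"
  proof -
    have "1 \<le> ln (exp 1 * real (dmax i0))" by (rule ln_dmax_ge_1[OF i0])
    also have "\<dots> \<le> Ls" unfolding Ls_def using fin i0 ln_dmax_ge_1
      by (intro member_le_sum) (auto intro: order_trans[OF zero_le_one])
    finally show ?thesis using mult_left_mono[of 1 Ls "lam\<^sup>2"] by simp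
  qed
  finally have "(sqrt A * r)\<^sup>2 * (\<Sum>\<tau>\<in>S. Z \<tau>) \<le> lam\<^sup>2 * Ls * (\<Sum>\<tau>\<in>S. Z \<tau>)"
    using Zs by (intro mult_right_mono)
  thus ?thesis using 1 unfolding Ls_def Z_def by linarith
qed

context anova begin

lemma finite_comps: "finite comps"
  by (intro finite_PiE) auto

lemma card_comps: "card comps = (k + 1) ^ d"
  by (simp add: card_PiE Suc_eq_plus1)

lemma sum_nonempty_components:
  "(\<Sum>M\<in>Pow {1..d} - {{}}. \<Sum>h\<in>hset k d M. F M h) =
    (\<Sum>c\<in>comps. if zeros c = {} then 0 else F (zeros c) (nonzeros c) :: real)"
proof -
  have "(\<Sum>M\<in>Pow {1..d} - {{}}. \<Sum>h\<in>hset k d M. F M h) =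
      (\<Sum>M\<in>Pow {1..d}. \<Sum>h\<in>hset k d M. if M = {} then 0 else F M h)"
    by (rule sum.mono_neutral_cong_left) simp_all
  thus ?thesis by (simp only: sum_components)
qed

lemma tproj_fun_span:
  assumes "v \<in> fun_span W" "\<And>w. w \<in> W \<Longrightarrow> tproj n k {1..d} c w = w"
  shows "tproj n k {1..d} c v = v"
proof -
  obtain a where "v = (\<lambda>x. \<Sum>w\<in>W. a w * w x)" using assms(1) by (auto simp: fun_span_def)
  thus ?thesis using assms(2) by (simp add: tproj_sum tproj_scale)
qed

lemma ip_in_span:
  assumes "finite B" "orthonormal J B" "v \<in> fun_span B"
  shows "ip J v v = (\<Sum>b\<in>B. (ip J v b)\<^sup>2)"
proof -
  have "ip J v v = ip J (coord_proj J B v) v"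
    using coord_proj_orth[OF assms, of v] by (simp add: ip_diff_left)
  also have "\<dots> = ip J v (coord_proj J B v)" by (rule ip_commute)
  finally show ?thesis by (simp add: ip_coord_proj power2_eq_square)
qed

text \<open>For M empty the component is a line. Otherwise the span of the atoms at all blocks of
  knots is taken, at most k^|M| per active point. The basis vectors are fixed by the projection of
  the component, so that bases of different components are orthogonal.\<close>

lemma component_basis:
  assumes c: "c \<in> comps"
    and tess: "zeros c \<noteq> {} \<Longrightarrow> tess_grid n k (zeros c) S lo hi"
  shows "\<exists>B. finite B \<and> card B \<le> (if zeros c = {} then 1 else k ^ d * card S) \<and> orthonormal G B \<and>
     (\<forall>b\<in>B. tproj n k {1..d} c b = b) \<and>
     (zeros c = {} \<longrightarrow> (\<forall>f. tproj n k {1..d} c f \<in> fun_span B)) \<and>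
     (zeros c \<noteq> {} \<longrightarrow> (\<forall>\<tau>\<in>S. \<forall>\<kappa>\<in>(\<Pi>\<^sub>E i\<in>zeros c. {\<tau> i..\<tau> i + k - 1}).
        Phi_t k d n (atom_merge (zeros c) (nonzeros c) \<kappa>) \<in> fun_span B))"
proof -
  let ?M = "zeros c" and ?h = "nonzeros c"
  note M = zeros_subset[of c] and h = nonzeros_in[OF c]
  define W where "W = (if ?M = {} then {Phi_t k d n ?h}
     else (\<lambda>\<kappa>. Phi_t k d n (atom_merge ?M ?h \<kappa>)) ` (\<Union>\<tau>\<in>S. \<Pi>\<^sub>E i\<in>?M. {\<tau> i..\<tau> i + k - 1}))"
  have T: "tproj n k {1..d} c f = tproj n k {1..d} (csel ?M ?h) f" for f
    by (rule tproj_component[OF c, symmetric])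
  have finM: "finite ?M" using M finite_subset by blast
  have single: "atom_index k d n {} ?h = {?h}" if "?M = {}"
  proof -
    have "?h \<in> extensional {1..d}" using h that by (auto simp: hset_def PiE_iff)
    thus ?thesis unfolding atom_index_def by (simp add: PiE_singleton)
  qed
  have W_atoms: "w \<in> Phi_t k d n ` atom_index k d n ?M ?h" if "w \<in> W" for w
  proof (cases "?M = {}")
    case True
    thus ?thesis using that single by (simp add: W_def)
  next
    case False
    interpret M: tess_grid n k ?M S lo hi by (rule tess[OF False])
    have "w \<in> (\<lambda>\<kappa>. Phi_t k d n (atom_merge ?M ?h \<kappa>)) ` (\<Union>\<tau>\<in>S. \<Pi>\<^sub>E i\<in>?M. {\<tau> i..\<tau> i + k - 1})"
      using that False by (simp only: W_def if_False)
    then obtain \<tau> \<kappa> where \<tau>: "\<tau> \<in> S" "\<kappa> \<in> (\<Pi>\<^sub>E i\<in>?M. {\<tau> i..\<tau> i + k - 1})" "w = Phi_t k d n (atom_merge ?M ?h \<kappa>)"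
      by blast
    have "{\<tau> i..\<tau> i + k - 1} \<subseteq> {k+1..n i}" if "i \<in> ?M" for i
      using M.corners[OF \<tau>(1) that] M.interior_point[OF \<tau>(1) that] by auto
    hence "\<kappa> \<in> inner_grid k n ?M" unfolding inner_grid_def using \<tau>(2) by (blast intro: PiE_mono[THEN subsetD])
    thus ?thesis using atom_merge_in[OF M h] \<tau>(3) by auto
  qed
  have W_fix: "tproj n k {1..d} c w = w" if "w \<in> W" for w
    using W_atoms[OF that] tproj_Phi_t[OF M h] by (auto simp: T)
  have finW: "finite W" and cardW: "card W \<le> (if ?M = {} then 1 else k ^ d * card S)"
  proof -
    have "finite W \<and> card W \<le> (if ?M = {} then 1 else k ^ d * card S)"
    proof (cases "?M = {}")
      case True
      thus ?thesis by (simp add: W_def)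
    next
      case False
      interpret M: tess_grid n k ?M S lo hi by (rule tess[OF False])
      have fB: "finite (\<Pi>\<^sub>E i\<in>?M. {\<tau> i..\<tau> i + k - 1})" for \<tau> :: mindex using finM by (intro finite_PiE) auto
      have cB: "card (\<Pi>\<^sub>E i\<in>?M. {\<tau> i..\<tau> i + k - 1}) \<le> k ^ d" for \<tau> :: mindex
      proof -
        have "card (\<Pi>\<^sub>E i\<in>?M. {\<tau> i..\<tau> i + k - 1}) = k ^ card ?M"
          using finM k1 by (simp add: card_PiE)
        also have "\<dots> \<le> k ^ d"
          using k1 card_mono[OF _ M] by (intro power_increasing) auto
        finally show ?thesis .
      qed
      have "card W \<le> card (\<Union>\<tau>\<in>S. \<Pi>\<^sub>E i\<in>?M. {\<tau> i..\<tau> i + k - 1})"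
        unfolding W_def using False fB M.finite_S by (simp add: card_image_le)
      also have "\<dots> \<le> (\<Sum>\<tau>\<in>S. card (\<Pi>\<^sub>E i\<in>?M. {\<tau> i..\<tau> i + k - 1}))"
        by (rule card_UN_le[OF M.finite_S])
      also have "\<dots> \<le> (\<Sum>\<tau>\<in>S. k ^ d)" by (intro sum_mono cB)
      finally show ?thesis using False fB M.finite_S by (simp add: W_def mult.commute)
    qed
    thus "finite W" "card W \<le> (if ?M = {} then 1 else k ^ d * card S)" by auto
  qed
  have van: "w j = 0" if "w \<in> W" "j \<notin> G" for w j
    using W_atoms[OF that(1)] that(2) by (auto simp: Phi_t_def)
  obtain B where B: "finite B" "card B \<le> card W" "orthonormal G B" "fun_span B = fun_span W" "B \<subseteq> fun_span W"
    by (rule orthonormal_basis_exists[of G W]) (use finW van fin in auto)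
  show ?thesis
  proof (intro exI[of _ B] conjI impI ballI allI)
    show "card B \<le> (if ?M = {} then 1 else k ^ d * card S)" using B(2) cardW by linarith
    show "tproj n k {1..d} c b = b" if "b \<in> B" for b
      using B(5) that W_fix by (intro tproj_fun_span[of b W]) auto
    show "tproj n k {1..d} c f \<in> fun_span B" if "?M = {}" for f
    proof -
      have "tproj n k {1..d} (csel ?M ?h) f \<in> fun_span (Phi_t k d n ` atom_index k d n ?M ?h)"
        using tproj_in_anova_space[OF M h] by (simp add: anova_space_def)
      thus ?thesis using that single by (simp add: T B(4) W_def)
    qed
    show "Phi_t k d n (atom_merge ?M ?h \<kappa>) \<in> fun_span B"
      if "?M \<noteq> {}" "\<tau> \<in> S" "\<kappa> \<in> (\<Pi>\<^sub>E i\<in>?M. {\<tau> i..\<tau> i + k - 1})" for \<tau> \<kappa>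
      unfolding B(4) using that finW by (intro fun_span_base) (auto simp: W_def)
  qed (use B in auto)
qed

text \<open>The data margin is an explicit finite sum in the noise, and the minimizer depends on it
  in a Lipschitz way.\<close>

lemma measurable_margin_estimator:
  assumes "M \<subseteq> {1..d}" "h \<in> hset k d M" "lam > 0"
  shows "(\<lambda>e. margin_estimator k d n M h lam (\<lambda>j. f0 j + e j) x) \<in> borel_measurable (iid_gauss G \<sigma>)"
proof -
  interpret P: pen_ls "grid n M" "inner_grid k n M" "dmat M" lam "nprod n M" by (rule pen_ls_margin[OF assms(1,3)])
  show ?thesis
    unfolding margin_estimator_eq[OF assms(1,3)] margin_eq[OF assms(1,2)]
  proof (rule P.amin_measurable)
    fix x
    show "(\<lambda>e. pmargin M h (\<lambda>j. f0 j + e j) x) \<in> borel_measurable (iid_gauss G \<sigma>)"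
      unfolding pmargin_def
      by (intro borel_measurable_sum borel_measurable_times borel_measurable_add borel_measurable_const
          measurable_iid_gauss_component)
  qed
qed

lemma measurable_estimator:
  assumes "\<And>M h. M \<in> Pow {1..d} - {{}} \<Longrightarrow> h \<in> hset k d M \<Longrightarrow> lam M h > 0"
  shows "(\<lambda>e. estimator k d n lam (\<lambda>j. f0 j + e j) x) \<in> borel_measurable (iid_gauss G \<sigma>)"
  unfolding estimator_def
proof (intro borel_measurable_sum)
  fix M h assume M: "M \<in> Pow {1..d}" and h: "h \<in> hset k d M"
  show "(\<lambda>e. if M = {} then anova_part k d n M h (\<lambda>j. f0 j + e j) x
      else extend_margin k d n M h (margin_estimator k d n M h (lam M h) (\<lambda>j. f0 j + e j)) x)
      \<in> borel_measurable (iid_gauss G \<sigma>)"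
  proof (cases "M = {}")
    case True
    have "(\<lambda>e. tproj n k {1..d} (csel M h) (\<lambda>j. f0 j + e j) x) \<in> borel_measurable (iid_gauss G \<sigma>)"
    proof (cases "x \<in> G")
      case True
      thus ?thesis unfolding tproj_def
        by (simp only: if_True) (intro borel_measurable_sum borel_measurable_times borel_measurable_add
            borel_measurable_const measurable_iid_gauss_component)
    qed (simp add: tproj_def)
    thus ?thesis using True M h by (simp add: anova_part_eq)
  next
    case False
    have "(\<lambda>e. extend_margin k d n M h (margin_estimator k d n M h (lam M h) (\<lambda>j. f0 j + e j)) x)
      \<in> borel_measurable (iid_gauss G \<sigma>)"
    proof (cases "x \<in> G")
      case True
      thus ?thesis unfolding extend_margin_def using M h False assms
        by (simp only: if_True) (intro borel_measurable_times borel_measurable_const measurable_margin_estimator, auto)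
    qed (simp add: extend_margin_def)
    thus ?thesis using False by simp
  qed
qed

text \<open>Every component of the error is fixed by its own projection, so Parseval splits the
  squared error with no cross terms.\<close>

lemma estimator_error:
  fixes e f0 :: tensor
  assumes lam: "\<And>M h. M \<in> Pow {1..d} - {{}} \<Longrightarrow> h \<in> hset k d M \<Longrightarrow> lam M h > 0"
  defines "F \<equiv> (\<lambda>c. if zeros c = {} then tproj n k {1..d} c (\<lambda>j. f0 j + e j)
      else extend_margin k d n (zeros c) (nonzeros c)
        (margin_estimator k d n (zeros c) (nonzeros c) (lam (zeros c) (nonzeros c)) (\<lambda>j. f0 j + e j)))"
  shows "(\<Sum>j\<in>G. (estimator k d n lam (\<lambda>j. f0 j + e j) j - f0 j)\<^sup>2) =
    (\<Sum>c\<in>comps. ip G (\<lambda>x. F c x - tproj n k {1..d} c f0 x) (\<lambda>x. F c x - tproj n k {1..d} c f0 x))"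
proof -
  let ?u = "\<lambda>c x. F c x - tproj n k {1..d} c f0 x"
  have est: "estimator k d n lam (\<lambda>j. f0 j + e j) j = (\<Sum>c\<in>comps. F c j)" for j
    unfolding estimator_def sum_components
  proof (intro sum.cong refl)
    fix c assume c: "c \<in> comps"
    show "(if zeros c = {} then anova_part k d n (zeros c) (nonzeros c) (\<lambda>j. f0 j + e j) j
        else extend_margin k d n (zeros c) (nonzeros c)
          (margin_estimator k d n (zeros c) (nonzeros c) (lam (zeros c) (nonzeros c)) (\<lambda>j. f0 j + e j)) j) = F c j"
      unfolding anova_part_eq[OF zeros_subset nonzeros_in[OF c]] tproj_component[OF c] F_def by simp
  qed
  have fix_u: "tproj n k {1..d} c (?u c) = ?u c" if c: "c \<in> comps" for c
  proof -
    have ck: "c i \<le> k" if "i \<in> {1..d}" for i using c that by (auto simp: PiE_iff)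
    have idem: "tproj n k {1..d} c (tproj n k {1..d} c f) = tproj n k {1..d} c f" for f by (rule tproj_idem) (rule ck)
    have "tproj n k {1..d} c (F c) = F c"
    proof (cases "zeros c = {}")
      case False
      hence l: "lam (zeros c) (nonzeros c) > 0" using zeros_subset nonzeros_in[OF c] by (intro lam) auto
      show ?thesis
        unfolding tproj_component[OF c, symmetric] F_def using False
          tproj_extend_margin[OF zeros_subset nonzeros_in[OF c] margin_estimator_in_range[OF zeros_subset nonzeros_in[OF c] l]]
        by simp
    qed (simp add: F_def idem)
    thus ?thesis unfolding tproj_diff idem by simp
  qed
  have "(\<Sum>j\<in>G. (estimator k d n lam (\<lambda>j. f0 j + e j) j - f0 j)\<^sup>2) =
      ip G (\<lambda>x. \<Sum>c\<in>comps. ?u c x) (\<lambda>x. \<Sum>c\<in>comps. ?u c x)"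
    unfolding ip_def
  proof (intro sum.cong refl)
    fix j assume "j \<in> G"
    hence "estimator k d n lam (\<lambda>j. f0 j + e j) j - f0 j = (\<Sum>c\<in>comps. ?u c j)"
      unfolding est sum_subtractf by (simp add: tproj_partition)
    thus "(estimator k d n lam (\<lambda>j. f0 j + e j) j - f0 j)\<^sup>2 = (\<Sum>c\<in>comps. ?u c j) * (\<Sum>c\<in>comps. ?u c j)"
      by (simp only: power2_eq_square)
  qed
  also have "\<dots> = (\<Sum>c\<in>comps. ip G (?u c) (?u c))" by (rule Parseval_components[OF fix_u])
  finally show ?thesis .
qed

lemma oracle_error:
  "(\<Sum>j\<in>G. (g j - f0 j)\<^sup>2) =
    (\<Sum>c\<in>comps. ip G (\<lambda>x. tproj n k {1..d} c g x - tproj n k {1..d} c f0 x) (\<lambda>x. tproj n k {1..d} c g x - tproj n k {1..d} c f0 x))"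
proof -
  let ?u = "\<lambda>c x. tproj n k {1..d} c g x - tproj n k {1..d} c f0 x"
  have fix_u: "tproj n k {1..d} c (?u c) = ?u c" if c: "c \<in> comps" for c
  proof -
    have ck: "c i \<le> k" if "i \<in> {1..d}" for i using c that by (auto simp: PiE_iff)
    have idem: "tproj n k {1..d} c (tproj n k {1..d} c f) = tproj n k {1..d} c f" for f by (rule tproj_idem) (rule ck)
    show ?thesis unfolding tproj_diff idem ..
  qed
  have "(\<Sum>j\<in>G. (g j - f0 j)\<^sup>2) = ip G (\<lambda>x. \<Sum>c\<in>comps. ?u c x) (\<lambda>x. \<Sum>c\<in>comps. ?u c x)"
    unfolding ip_def sum_subtractf by (intro sum.cong refl) (simp add: tproj_partition power2_eq_square)
  also have "\<dots> = (\<Sum>c\<in>comps. ip G (?u c) (?u c))" by (rule Parseval_components[OF fix_u])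
  finally show ?thesis .
qed

end

text \<open>The first summand comes from the energy of the interpolating tensors; the second, 8 k^d,
  from the number of basis vectors, at most 2 k^d times the total number of active points,
  multiplied by 4.\<close>

definition oracle_const :: "nat \<Rightarrow> nat \<Rightarrow> real" where
  "oracle_const k d = 3 * ((real k + 1) * energy_const k) ^ d + 8 * real k ^ d"

context anova begin

lemma nprod_ge_1: "1 \<le> nprod n {1..d}"
  unfolding nprod_def using n_pos by (intro prod_ge_1) (auto simp: Suc_leI One_nat_def)

text \<open>The claim for the constant 1 in the lower bound on the tuning parameters; larger
  constants are covered because the assumption is an inequality.\<close>

theorem oracle_probability:
  fixes \<sigma> x t :: real and f0 g :: tensor and S :: "nat set \<Rightarrow> mindex \<Rightarrow> mindex set"
    and lo hi :: "nat set \<Rightarrow> mindex \<Rightarrow> mindex \<Rightarrow> mindex" and lam :: "nat set \<Rightarrow> mindex \<Rightarrow> real"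
  assumes d: "d \<ge> 1" and \<sigma>: "\<sigma> > 0" and x: "x > 0" and t: "t > 0"
    and H: "\<And>M h. M \<in> Pow {1..d} - {{}} \<Longrightarrow> h \<in> hset k d M \<Longrightarrow>
      tessellation k n M (S M h) (lo M h) (hi M h) \<and> derivative_matching k M (S M h) (lo M h) (hi M h) \<and>
      lam M h > 0 \<and>
      real (card M) * sqrt (\<Sum>i\<in>M. (real (dist_max k (S M h) (lo M h) (hi M h) i) / real (n i)) ^ (2 * k - 1))
        * lambda0 d n \<sigma> (t + real d * ln (real k + 1)) \<le> lam M h"
  shows "1 - exp (- x) - exp (- t) \<le> measure (noise d n \<sigma>)
     {e \<in> space (noise d n \<sigma>).
       (\<Sum>j\<in>G. (estimator k d n lam (\<lambda>j. f0 j + e j) j - f0 j)\<^sup>2) / nprod n {1..d}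
       \<le> (\<Sum>j\<in>G. (g j - f0 j)\<^sup>2) / nprod n {1..d}
         + 4 * (\<Sum>M\<in>Pow {1..d} - {{}}. \<Sum>h\<in>hset k d M. lam M h
             * (\<Sum>j\<in>inner_grid k n M - S M h. \<bar>diff_ops k n M (margin k d n M h g) j\<bar>))
         + 2 * \<sigma>\<^sup>2 / nprod n {1..d} * (sqrt (x + real d * ln (real k + 1)) + sqrt (real k ^ d))\<^sup>2
         + (\<Sum>M\<in>Pow {1..d} - {{}}. \<Sum>h\<in>hset k d M. 2 * \<sigma>\<^sup>2 / nprod n {1..d}
             * (sqrt (x + real d * ln (real k + 1)) + sqrt (real k * real (card (S M h))))\<^sup>2)
         + oracle_const k d * (\<Sum>M\<in>Pow {1..d} - {{}}. \<Sum>h\<in>hset k d M. (lam M h)\<^sup>2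
             * (\<Sum>i\<in>M. ln (exp 1 * real (dist_max k (S M h) (lo M h) (hi M h) i)))
             * (\<Sum>\<tau>\<in>S M h. \<Sum>z\<in>(\<Pi>\<^sub>E i\<in>M. (UNIV :: bool set)).
                 (nprod n M / dist_prod k M (lo M h) (hi M h) \<tau> z) ^ (2 * k - 1)))}"
    (is "_ \<le> measure _ {e \<in> _. ?lhs e / ?n \<le> ?bound}")
proof -
  define Sc where "Sc = (\<lambda>c. S (zeros c) (nonzeros c))"
  define lc where "lc = (\<lambda>c. lam (zeros c) (nonzeros c))"
  define Zc where "Zc = (\<lambda>c. (\<Sum>i\<in>zeros c. ln (exp 1 * real (dist_max k (S (zeros c) (nonzeros c)) (lo (zeros c) (nonzeros c)) (hi (zeros c) (nonzeros c)) i)))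
             * (\<Sum>\<tau>\<in>S (zeros c) (nonzeros c). \<Sum>z\<in>(\<Pi>\<^sub>E i\<in>zeros c. (UNIV :: bool set)).
                 (nprod n (zeros c) / dist_prod k (zeros c) (lo (zeros c) (nonzeros c)) (hi (zeros c) (nonzeros c)) \<tau> z) ^ (2 * k - 1)))"
  define Pc where "Pc = (\<lambda>c. \<Sum>j\<in>inner_grid k n (zeros c) - S (zeros c) (nonzeros c). \<bar>diff_ops k n (zeros c) (margin k d n (zeros c) (nonzeros c) g) j\<bar>)"
  define t' where "t' = t + real d * ln (real k + 1)"
  define x' where "x' = x + real d * ln (real k + 1)"
  define L where "L = ln (2 * ?n) + t'"
  define \<Lambda> where "\<Lambda> = \<sigma> * sqrt (2 * L)"
  have n1: "1 \<le> ?n" by (rule nprod_ge_1)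
  have lnk: "0 \<le> real d * ln (real k + 1)" by simp
  have ln2n: "1/2 \<le> ln (2 * ?n)"
  proof -
    have "1/2 \<le> ln (2::real)" using ln_2_less_1 ln2_ge_two_thirds by linarith
    also have "\<dots> \<le> ln (2 * ?n)" using n1 by simp
    finally show ?thesis .
  qed
  \<comment> \<open>Ensures 2L \<ge> 1, hence that the squared noise level is at least the variance,
    as the absorption of the dimension terms requires.\<close>
  have L: "1/2 \<le> L" unfolding L_def t'_def using ln2n t lnk by linarith
  have lambda0_eq: "lambda0 d n \<sigma> t' = \<Lambda> / sqrt ?n"
    unfolding lambda0_def \<Lambda>_def L_def by (simp add: real_sqrt_divide algebra_simps)
  have \<Lambda>0: "\<Lambda> \<ge> 0" using \<sigma> L by (simp add: \<Lambda>_def)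
  have ne: "zeros c \<in> Pow {1..d} - {{}}" if "zeros c \<noteq> {}" for c using that zeros_subset by auto
  have Hc: "tess_grid n k (zeros c) (Sc c) (lo (zeros c) (nonzeros c)) (hi (zeros c) (nonzeros c))"
      "tessellation k n (zeros c) (Sc c) (lo (zeros c) (nonzeros c)) (hi (zeros c) (nonzeros c))"
      "derivative_matching k (zeros c) (Sc c) (lo (zeros c) (nonzeros c)) (hi (zeros c) (nonzeros c))"
      "lc c > 0"
      "real (card (zeros c)) * sqrt (\<Sum>i\<in>zeros c. (real (dist_max k (Sc c) (lo (zeros c) (nonzeros c)) (hi (zeros c) (nonzeros c)) i) / real (n i)) ^ (2 * k - 1))
        * (\<Lambda> / sqrt ?n) \<le> lc c"
    if c: "c \<in> comps" "zeros c \<noteq> {}" for c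
  proof -
    note * = H[OF ne[OF c(2)] nonzeros_in[OF c(1)], folded t'_def, unfolded lambda0_eq]
    show "tessellation k n (zeros c) (Sc c) (lo (zeros c) (nonzeros c)) (hi (zeros c) (nonzeros c))"
      "derivative_matching k (zeros c) (Sc c) (lo (zeros c) (nonzeros c)) (hi (zeros c) (nonzeros c))"
      "lc c > 0"
      "real (card (zeros c)) * sqrt (\<Sum>i\<in>zeros c. (real (dist_max k (Sc c) (lo (zeros c) (nonzeros c)) (hi (zeros c) (nonzeros c)) i) / real (n i)) ^ (2 * k - 1))
        * (\<Lambda> / sqrt ?n) \<le> lc c"
      using * unfolding Sc_def lc_def by blast+
    thus "tess_grid n k (zeros c) (Sc c) (lo (zeros c) (nonzeros c)) (hi (zeros c) (nonzeros c))"
      by (intro tess_grid.intro dict_grid_subset zeros_subset tess_grid_axioms.intro c(2))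
  qed
  have lam_pos: "lam M h > 0" if "M \<in> Pow {1..d} - {{}}" "h \<in> hset k d M" for M h using H[OF that] by blast

  \<comment> \<open>One orthonormal system for all components\<close>
  define basis where "basis = (\<lambda>c B. finite B \<and> card B \<le> (if zeros c = {} then 1 else k ^ d * card (Sc c)) \<and> orthonormal G B \<and>
     (\<forall>b\<in>B. tproj n k {1..d} c b = b) \<and>
     (zeros c = {} \<longrightarrow> (\<forall>f. tproj n k {1..d} c f \<in> fun_span B)) \<and>
     (zeros c \<noteq> {} \<longrightarrow> (\<forall>\<tau>\<in>Sc c. \<forall>\<kappa>\<in>(\<Pi>\<^sub>E i\<in>zeros c. {\<tau> i..\<tau> i + k - 1}).
        Phi_t k d n (atom_merge (zeros c) (nonzeros c) \<kappa>) \<in> fun_span B)))"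
  have "\<forall>c\<in>comps. \<exists>B. basis c B"
  proof (intro ballI)
    fix c assume c: "c \<in> comps"
    show "\<exists>B. basis c B"
      unfolding basis_def
      by (rule component_basis[OF c, where lo="lo (zeros c) (nonzeros c)" and hi="hi (zeros c) (nonzeros c)"]) (rule Hc(1)[OF c])
  qed
  from bchoice[OF this] obtain B where basis: "\<forall>c\<in>comps. basis c (B c)" by blast
  note b = bspec[OF basis, unfolded basis_def]
  note B = b[THEN conjunct1]
    b[THEN conjunct2, THEN conjunct1]
    b[THEN conjunct2, THEN conjunct2, THEN conjunct1]
    b[THEN conjunct2, THEN conjunct2, THEN conjunct2, THEN conjunct1, THEN bspec]
    b[THEN conjunct2, THEN conjunct2, THEN conjunct2, THEN conjunct2, THEN conjunct1, THEN mp, THEN spec]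
    b[THEN conjunct2, THEN conjunct2, THEN conjunct2, THEN conjunct2, THEN conjunct2, THEN mp, THEN bspec, THEN bspec]
  define BB where "BB = (\<Union>c\<in>comps. B c)"
  \<comment> \<open>Vectors fixed by the projections of different components are orthogonal. Being
    unit vectors, they are also distinct, so the union of the bases is disjoint.\<close>
  have cross: "ip G b b' = 0" if "c \<in> comps" "c' \<in> comps" "c \<noteq> c'" "b \<in> B c" "b' \<in> B c'" for c c' b b'
    using that B(4) by (intro ip_component_orthogonal[of c c']) auto
  have self: "ip G b b' = (if b = b' then 1 else 0)" if "c \<in> comps" "b \<in> B c" "b' \<in> B c" for c b b'
    using B(3)[OF that(1)] that(2,3) by (simp add: orthonormal_def)
  have disj: "B c \<inter> B c' = {}" if "c \<in> comps" "c' \<in> comps" "c \<noteq> c'" for c c'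
  proof (rule equals0I)
    fix b assume b: "b \<in> B c \<inter> B c'"
    thus False using cross[OF that, of b b] self[OF that(1), of b b] by simp
  qed
  have finBB: "finite BB" unfolding BB_def using finite_comps B(1) by blast
  have onBB: "orthonormal G BB"
    unfolding orthonormal_def
  proof (intro ballI)
    fix b b' assume "b \<in> BB" "b' \<in> BB"
    then obtain c c' where c: "c \<in> comps" "b \<in> B c" "c' \<in> comps" "b' \<in> B c'" by (auto simp: BB_def)
    show "ip G b b' = (if b = b' then 1 else 0)"
    proof (cases "c = c'")
      case True
      thus ?thesis using self c by simp
    next
      case False
      hence "b \<noteq> b'" using disj[OF c(1,3) False] c by auto
      thus ?thesis using cross[OF c(1,3) False c(2,4)] by simp
    qed
  qed

  \<comment> \<open>Residual atoms and the exceptional events\<close>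
  define a where "a = (\<lambda>c \<kappa> x. Phi_t k d n (atom_merge (zeros c) (nonzeros c) \<kappa>) x
     - coord_proj G (B c) (Phi_t k d n (atom_merge (zeros c) (nonzeros c) \<kappa>)) x)"
  define A where "A = Sigma comps (\<lambda>c. inner_grid k n (zeros c))"
  let ?P = "iid_gauss G \<sigma>"
  interpret P: prob_space ?P by (rule prob_space_iid_gauss[OF \<sigma>])
  have noise_eq: "noise d n \<sigma> = ?P" by (simp add: noise_def iid_gauss_def)
  define bad1 where "bad1 = (\<lambda>p. {e \<in> space ?P. \<bar>ip G e (a (fst p) (snd p))\<bar> > \<sigma> * sqrt (2 * L) * sqrt (ip G (a (fst p) (snd p)) (a (fst p) (snd p)))})"
  \<comment> \<open>One event for the union of all bases, so that its probability is exp(-x) without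
    a factor for the number of components.\<close>
  define bad2 where "bad2 = {e \<in> space ?P. 8/3 * \<sigma>\<^sup>2 * (x + real (card BB)) < (\<Sum>b\<in>BB. (ip G e b)\<^sup>2)}"
  \<comment> \<open>The final step passes to the complement of the good event, which has to be
    measurable.\<close>
  have lam_measurable: "(\<lambda>e. ?lhs e / ?n) \<in> borel_measurable ?P"
    by (intro borel_measurable_divide borel_measurable_const borel_measurable_sum borel_measurable_power
        borel_measurable_diff measurable_estimator lam_pos)
  define good where "good = {e \<in> space ?P. ?lhs e / ?n \<le> ?bound}"
  have good_sets: "good \<in> sets ?P"
    unfolding good_def by (rule borel_measurable_le[OF lam_measurable borel_measurable_const])
  have bad1_sets: "bad1 p \<in> sets ?P" for p
    unfolding bad1_def
    by (intro borel_measurable_less borel_measurable_const borel_measurable_abs measurable_iid_gauss_ip)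
  have bad2_sets: "bad2 \<in> sets ?P"
    unfolding bad2_def
    by (intro borel_measurable_less borel_measurable_const borel_measurable_sum borel_measurable_power measurable_iid_gauss_ip)
  have fin_inner: "finite (inner_grid k n (zeros c))" for c
    unfolding inner_grid_def by (intro finite_PiE finite_subset[OF zeros_subset]) auto
  have finA: "finite A"
    unfolding A_def by (intro finite_SigmaI finite_comps fin_inner)
  have cardA: "real (card A) \<le> (real k + 1) ^ d * ?n"
  proof -
    have "real (card (inner_grid k n (zeros c))) \<le> ?n" for c
    proof -
      interpret M: dict_grid n k "zeros c" by (rule dict_grid_subset[OF zeros_subset])
      have "card (inner_grid k n (zeros c)) \<le> card (grid n (zeros c))"
        using M.fin inner_grid_subset by (intro card_mono) auto
      hence "real (card (inner_grid k n (zeros c))) \<le> nprod n (zeros c)"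
        using card_grid[OF M.fin, of n] by linarith
      also have "\<dots> \<le> nprod n (zeros c) * nprod n ({1..d} - zeros c)"
      proof -
        have "1 \<le> nprod n ({1..d} - zeros c)"
          unfolding nprod_def using n_pos by (intro prod_ge_1) (auto simp: Suc_leI One_nat_def)
        thus ?thesis using mult_left_mono[of 1 "nprod n ({1..d} - zeros c)" "nprod n (zeros c)"] M.nprod_pos by simp
      qed
      finally show ?thesis using nprod_split[OF zeros_subset, of c] by simp
    qed
    hence "(\<Sum>c\<in>comps. real (card (inner_grid k n (zeros c)))) \<le> (\<Sum>c\<in>comps. ?n)" by (intro sum_mono)
    moreover have "card A = (\<Sum>c\<in>comps. card (inner_grid k n (zeros c)))"
      unfolding A_def using finite_comps fin_inner by (simp add: card_SigmaI)
    ultimately show ?thesis by (simp add: card_comps add.commute)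
  qed
  \<comment> \<open>There are at most (k + 1)^d n residual atoms with two tails each; L contains
    exactly the logarithms of 2n and (k + 1)^d besides t.\<close>
  have p1: "measure ?P (\<Union>p\<in>A. bad1 p) \<le> exp (- t)"
  proof -
    have "measure ?P (\<Union>p\<in>A. bad1 p) \<le> (\<Sum>p\<in>A. measure ?P (bad1 p))"
      using finA bad1_sets by (intro P.finite_measure_subadditive_finite) auto
    also have "\<dots> \<le> (\<Sum>p\<in>A. 2 * exp (- L))"
      unfolding bad1_def using L by (intro sum_mono iid_gauss_tail fin \<sigma>) auto
    also have "\<dots> \<le> ((real k + 1) ^ d * ?n) * (2 * exp (- L))"
      using cardA by (simp add: mult_right_mono)
    also have "exp (- L) = exp (- t) / ((2 * ?n) * (real k + 1) ^ d)"
    proof -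
      have m: "- L = - ln (2 * ?n) + - t + - (real d * ln (real k + 1))" by (simp add: L_def t'_def)
      have "exp (ln (2 * ?n)) = 2 * ?n" using n1 by (intro exp_ln) simp
      hence 1: "exp (- ln (2 * ?n)) = 1 / (2 * ?n)" by (simp only: exp_minus inverse_eq_divide)
      have "exp (real d * ln (real k + 1)) = (real k + 1) ^ d" by (subst exp_of_nat_mult) simp
      hence 2: "exp (- (real d * ln (real k + 1))) = 1 / (real k + 1) ^ d" by (simp only: exp_minus inverse_eq_divide)
      have "exp (- L) = 1 / (2 * ?n) * exp (- t) * (1 / (real k + 1) ^ d)" by (simp only: m exp_add 1 2)
      thus ?thesis by simp
    qed
    also have "((real k + 1) ^ d * ?n) * (2 * (exp (- t) / ((2 * ?n) * (real k + 1) ^ d))) = exp (- t)"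
    proof -
      have "(real k + 1) ^ d > 0" "?n > 0" using n1 by auto
      thus ?thesis by (simp add: field_simps)
    qed
    finally show ?thesis .
  qed
  have p2: "measure ?P bad2 \<le> exp (- x)"
    unfolding bad2_def by (rule iid_gauss_chi_square_tail[OF finite_grid[OF fin] \<sigma> finBB onBB])

  \<comment> \<open>The bound off the exceptional events\<close>
  have det: "?lhs e / ?n \<le> ?bound" if e: "e \<in> space ?P" "e \<notin> (\<Union>p\<in>A. bad1 p)" "e \<notin> bad2" for e
  proof -
    define F where "F = (\<lambda>c. if zeros c = {} then tproj n k {1..d} c (\<lambda>j. f0 j + e j)
      else extend_margin k d n (zeros c) (nonzeros c)
        (margin_estimator k d n (zeros c) (nonzeros c) (lam (zeros c) (nonzeros c)) (\<lambda>j. f0 j + e j)))"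
    define ac where "ac = (\<lambda>c. ip G (\<lambda>x. F c x - tproj n k {1..d} c f0 x) (\<lambda>x. F c x - tproj n k {1..d} c f0 x))"
    define gc where "gc = (\<lambda>c. ip G (\<lambda>x. tproj n k {1..d} c g x - tproj n k {1..d} c f0 x) (\<lambda>x. tproj n k {1..d} c g x - tproj n k {1..d} c f0 x))"
    define Nc where "Nc = (\<lambda>c. \<Sum>b\<in>B c. (ip G e b)\<^sup>2)"
    define E where "E = ((real k + 1) * energy_const k) ^ d"
    have comp: "ac c \<le> gc c + 3/2 * Nc c + (if zeros c = {} then 0 else 4 * ?n * (lc c * Pc c))
        + (if zeros c = {} then 0 else 3 * ?n * E * ((lc c)\<^sup>2 * Zc c))" if c: "c \<in> comps" for c
    proof (cases "zeros c = {}")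
      case True
      have "ac c = ip G (tproj n k {1..d} c e) (tproj n k {1..d} c e)"
        unfolding ac_def F_def using True by (simp add: tproj_add)
      also have "\<dots> = (\<Sum>b\<in>B c. (ip G (tproj n k {1..d} c e) b)\<^sup>2)"
        by (rule ip_in_span[OF B(1)[OF c] B(3)[OF c] B(5)[OF c True]])
      also have "\<dots> = Nc c"
        unfolding Nc_def
      proof (intro sum.cong refl)
        fix b assume "b \<in> B c"
        thus "(ip G (tproj n k {1..d} c e) b)\<^sup>2 = (ip G e b)\<^sup>2" using B(4)[OF c] by (simp add: tproj_symmetric)
      qed
      moreover have "0 \<le> gc c" "0 \<le> Nc c" by (auto simp: gc_def Nc_def intro: sum_nonneg)
      ultimately show ?thesis using True by simp
    next
      case False
      interpret M: tess_grid n k "zeros c" "Sc c" "lo (zeros c) (nonzeros c)" "hi (zeros c) (nonzeros c)"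
        by (rule Hc(1)[OF c False])
      have noise: "\<bar>ip G e (a c \<kappa>)\<bar> \<le> \<Lambda> * sqrt (ip G (a c \<kappa>) (a c \<kappa>))" if "\<kappa> \<in> inner_grid k n (zeros c)" for \<kappa>
      proof -
        have "(c, \<kappa>) \<in> A" using c that by (simp add: A_def)
        hence "e \<notin> bad1 (c, \<kappa>)" using e(2) by blast
        thus ?thesis using e(1) by (simp add: bad1_def \<Lambda>_def not_less)
      qed
      have "ac c \<le> gc c + 4 * ?n * lc c * Pc c + 3/2 * Nc c +
         3 * ?n * (lc c)\<^sup>2 * (((real k + 1) * energy_const k) ^ card (zeros c) * 
        (\<Sum>i\<in>zeros c. ln (exp 1 * real (M.dmax i))) *
        (\<Sum>\<tau>\<in>Sc c. \<Sum>z\<in>(\<Pi>\<^sub>E i\<in>zeros c. (UNIV :: bool set)). (nprod n (zeros c) / dist_prod k (zeros c) (lo (zeros c) (nonzeros c)) (hi (zeros c) (nonzeros c)) \<tau> z) ^ (2 * k - 1)))"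
        using component_oracle[where ?f0.0 = f0 and g = g and e = e, OF zeros_subset False nonzeros_in[OF c] Hc(4)[OF c False] Hc(2)[OF c False] Hc(3)[OF c False]
            B(1)[OF c] B(3)[OF c] B(6)[OF c False] noise[unfolded a_def] \<Lambda>0 Hc(5)[OF c False]]
        unfolding ac_def gc_def Nc_def Pc_def tproj_component[OF c] F_def lc_def Sc_def using False by (simp only: if_False)
      also have "(((real k + 1) * energy_const k) ^ card (zeros c) * 
        (\<Sum>i\<in>zeros c. ln (exp 1 * real (M.dmax i))) *
        (\<Sum>\<tau>\<in>Sc c. \<Sum>z\<in>(\<Pi>\<^sub>E i\<in>zeros c. (UNIV :: bool set)). (nprod n (zeros c) / dist_prod k (zeros c) (lo (zeros c) (nonzeros c)) (hi (zeros c) (nonzeros c)) \<tau> z) ^ (2 * k - 1)))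
        = ((real k + 1) * energy_const k) ^ card (zeros c) * Zc c"
        unfolding Zc_def Sc_def by (simp only: mult.assoc)
      also have "3 * ?n * (lc c)\<^sup>2 * (((real k + 1) * energy_const k) ^ card (zeros c) * Zc c) \<le> 3 * ?n * (lc c)\<^sup>2 * (E * Zc c)"
      proof (intro mult_left_mono mult_right_mono)
        have "1 \<le> (real k + 1) * energy_const k" using energy_const_ge_1[OF k1] mult_mono[of 1 "real k + 1" 1 "energy_const k"] by simp
        moreover have "card (zeros c) \<le> d" using card_mono[OF _ zeros_subset, of c] by simp
        ultimately show "((real k + 1) * energy_const k) ^ card (zeros c) \<le> E"
          unfolding E_def by (intro power_increasing)
        show "0 \<le> Zc c"
          unfolding Zc_def nprod_def dist_prod_def
          using M.ln_dmax_ge_1 unfolding Sc_def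
          by (intro mult_nonneg_nonneg sum_nonneg zero_le_power divide_nonneg_nonneg prod_nonneg)
            (auto intro: order_trans[OF zero_le_one])
      qed (use n1 in auto)
      finally show ?thesis using False by (simp add: mult_ac)
    qed
    have NB: "(\<Sum>c\<in>comps. Nc c) \<le> 8/3 * \<sigma>\<^sup>2 * (x + real (card BB))"
    proof -
      have "(\<Sum>c\<in>comps. Nc c) = (\<Sum>b\<in>BB. (ip G e b)\<^sup>2)"
        unfolding Nc_def BB_def using finite_comps B(1) disj by (intro sum.UNION_disjoint[symmetric]) auto
      thus ?thesis using e(1,3) by (simp add: bad2_def not_less)
    qed
    \<comment> \<open>The variance times the number of active points of a component is paid for by
      its energy term.\<close>
    have lower: "\<sigma>\<^sup>2 / ?n * real (card (Sc c)) \<le> (lc c)\<^sup>2 * Zc c" if c: "c \<in> comps" "zeros c \<noteq> {}" for c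
    proof -
      interpret M: tess_grid n k "zeros c" "Sc c" "lo (zeros c) (nonzeros c)" "hi (zeros c) (nonzeros c)"
        by (rule Hc(1)[OF c])
      define q where "q = sqrt (\<Sum>i\<in>zeros c. (real (M.dmax i) / real (n i)) ^ (2 * k - 1))"
      have q0: "q \<ge> 0" unfolding q_def by (intro real_sqrt_ge_zero sum_nonneg) auto
      have "q * (\<Lambda> / sqrt ?n) \<le> real (card (zeros c)) * (q * (\<Lambda> / sqrt ?n))"
        using mult_right_mono[OF M.card_M, of "q * (\<Lambda> / sqrt ?n)"] q0 \<Lambda>0 n1 by simp
      also have "\<dots> \<le> lc c" using Hc(5)[OF c] by (simp only: q_def mult.assoc)
      finally have "(\<Lambda> / sqrt ?n)\<^sup>2 * real (card (Sc c)) \<le> (lc c)\<^sup>2 * Zc c"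
        using M.effective_sparsity_lower[of "\<Lambda> / sqrt ?n" "lc c"] \<Lambda>0 n1
        unfolding q_def Zc_def Sc_def by (simp only: mult.assoc) auto
      moreover have "\<sigma>\<^sup>2 / ?n \<le> (\<Lambda> / sqrt ?n)\<^sup>2"
      proof -
        have "(\<Lambda> / sqrt ?n)\<^sup>2 = \<sigma>\<^sup>2 * (2 * L) / ?n" using L n1 by (simp add: \<Lambda>_def power_divide power_mult_distrib)
        moreover have "\<sigma>\<^sup>2 * 1 \<le> \<sigma>\<^sup>2 * (2 * L)" using L by (intro mult_left_mono) auto
        ultimately show ?thesis using n1 by (simp add: divide_right_mono)
      qed
      hence "\<sigma>\<^sup>2 / ?n * real (card (Sc c)) \<le> (\<Lambda> / sqrt ?n)\<^sup>2 * real (card (Sc c))" by (rule mult_right_mono) simp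
      ultimately show ?thesis by linarith
    qed
    define Ssum where "Ssum = (\<Sum>c\<in>comps. if zeros c = {} then 0 else real (card (Sc c)))"
    define Zsum where "Zsum = (\<Sum>c\<in>comps. if zeros c = {} then 0 else (lc c)\<^sup>2 * Zc c)"
    define Psum where "Psum = (\<Sum>c\<in>comps. if zeros c = {} then 0 else lc c * Pc c)"
    \<comment> \<open>The component with M = {1..d}, which is nonempty as d \<ge> 1. It guarantees
      at least one active point overall and a variance summand that can take a share of x.\<close>
    define c0 where "c0 = (\<lambda>i\<in>{1..d}. 0::nat)"
    have c0: "c0 \<in> comps" "zeros c0 = {1..d}" "zeros c0 \<noteq> {}" using d by (auto simp: c0_def zeros_def)
    have S1: "1 \<le> Ssum"
    proof -
      interpret M: tess_grid n k "zeros c0" "Sc c0" "lo (zeros c0) (nonzeros c0)" "hi (zeros c0) (nonzeros c0)"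
        by (rule Hc(1)[OF c0(1,3)])
      have "card (Sc c0) > 0" using M.finite_S M.S_ne by (simp add: card_gt_0_iff)
      hence "1 \<le> real (card (Sc c0))" by simp
      also have "\<dots> = (if zeros c0 = {} then 0 else real (card (Sc c0)))" using c0 by simp
      also have "\<dots> \<le> Ssum" unfolding Ssum_def using finite_comps c0 by (intro member_le_sum) auto
      finally show ?thesis .
    qed
    have SZ: "\<sigma>\<^sup>2 / ?n * Ssum \<le> Zsum"
      unfolding Ssum_def Zsum_def sum_distrib_left using lower by (intro sum_mono) auto
    \<comment> \<open>The unpenalized components contribute at most k^d vectors; as there is at
      least one active point, they are absorbed by doubling the count of the penalized ones.\<close>
    have cardBB: "real (card BB) \<le> 2 * real k ^ d * Ssum"
    proof -
      have "card BB \<le> (\<Sum>c\<in>comps. card (B c))" unfolding BB_def by (rule card_UN_le[OF finite_comps])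
      hence "real (card BB) \<le> (\<Sum>c\<in>comps. real (card (B c)))" by (simp flip: of_nat_sum)
      also have "\<dots> \<le> (\<Sum>c\<in>comps. (if zeros c = {} then 1 else 0) + real k ^ d * (if zeros c = {} then 0 else real (card (Sc c))))"
      proof (intro sum_mono)
        fix c assume "c \<in> comps"
        from B(2)[OF this] have "real (card (B c)) \<le> real (if zeros c = {} then 1 else k ^ d * card (Sc c))"
          by (simp only: of_nat_le_iff)
        thus "real (card (B c)) \<le> (if zeros c = {} then 1 else 0) + real k ^ d * (if zeros c = {} then 0 else real (card (Sc c)))"
          by (simp split: if_splits del: of_nat_le_iff)
      qed
      also have "\<dots> = real (card {c \<in> comps. zeros c = {}}) + real k ^ d * Ssum"
        unfolding Ssum_def sum_distrib_left sum.distrib using finite_comps by (simp add: sum.If_cases Int_def)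
      finally have u: "real (card BB) \<le> real (card {c \<in> comps. zeros c = {}}) + real k ^ d * Ssum" .
      have "real (card {c \<in> comps. zeros c = {}}) \<le> real k ^ d"
      proof -
        have "{c \<in> comps. zeros c = {}} \<subseteq> (\<Pi>\<^sub>E i\<in>{1..d}. {1..k})"
          by (force simp: zeros_def PiE_iff)
        hence "card {c \<in> comps. zeros c = {}} \<le> card (\<Pi>\<^sub>E i\<in>{1..d}. {1..k})"
          by (intro card_mono finite_PiE) auto
        also have "\<dots> = k ^ d" by (simp add: card_PiE)
        finally show ?thesis by (simp only: of_nat_power[symmetric] of_nat_le_iff)
      qed
      moreover have "real k ^ d \<le> real k ^ d * Ssum" using S1 mult_left_mono[of 1 Ssum "real k ^ d"] by simp
      ultimately show ?thesis using u by linarith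
    qed
    have lhs: "?lhs e = (\<Sum>c\<in>comps. ac c)"
      using estimator_error[of lam f0 e] lam_pos unfolding ac_def F_def by blast
    have "?lhs e \<le> (\<Sum>c\<in>comps. gc c + 3/2 * Nc c + (if zeros c = {} then 0 else 4 * ?n * (lc c * Pc c))
        + (if zeros c = {} then 0 else 3 * ?n * E * ((lc c)\<^sup>2 * Zc c)))"
      unfolding lhs by (intro sum_mono comp)
    also have "\<dots> = (\<Sum>c\<in>comps. gc c) + 3/2 * (\<Sum>c\<in>comps. Nc c) + 4 * ?n * Psum + 3 * ?n * E * Zsum"
      unfolding sum.distrib Psum_def Zsum_def sum_distrib_left
      by (intro arg_cong2[where f = "(+)"] sum.cong refl) auto
    also have "(\<Sum>c\<in>comps. gc c) = (\<Sum>j\<in>G. (g j - f0 j)\<^sup>2)"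
      unfolding gc_def by (rule oracle_error[symmetric])
    finally have main: "?lhs e \<le> (\<Sum>j\<in>G. (g j - f0 j)\<^sup>2) + 4 * \<sigma>\<^sup>2 * (x + real (card BB)) + 4 * ?n * Psum + 3 * ?n * E * Zsum"
      using NB by linarith
    have "4 * \<sigma>\<^sup>2 * (x + real (card BB)) \<le> 4 * \<sigma>\<^sup>2 * (x + 2 * real k ^ d * Ssum)"
      using cardBB by (intro mult_left_mono add_left_mono) auto
    also have "\<dots> = 4 * \<sigma>\<^sup>2 * x + ?n * (8 * real k ^ d) * (\<sigma>\<^sup>2 / ?n * Ssum)"
      using n1 by (simp add: algebra_simps)
    also have "\<dots> \<le> 4 * \<sigma>\<^sup>2 * x + ?n * (8 * real k ^ d) * Zsum"
      using SZ n1 by (intro add_left_mono mult_left_mono) auto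
    finally have "?lhs e \<le> (\<Sum>j\<in>G. (g j - f0 j)\<^sup>2) + 4 * \<sigma>\<^sup>2 * x + 4 * ?n * Psum + ?n * (oracle_const k d * Zsum)"
      using main by (simp add: oracle_const_def E_def algebra_simps)
    hence "?lhs e / ?n \<le> ((\<Sum>j\<in>G. (g j - f0 j)\<^sup>2) + 4 * \<sigma>\<^sup>2 * x + 4 * ?n * Psum + ?n * (oracle_const k d * Zsum)) / ?n"
      using n1 by (intro divide_right_mono) auto
    also have "\<dots> = (\<Sum>j\<in>G. (g j - f0 j)\<^sup>2) / ?n + 4 * \<sigma>\<^sup>2 * x / ?n + 4 * Psum + oracle_const k d * Zsum"
      using n1 by (simp add: add_divide_distrib)
    finally have 1: "?lhs e / ?n \<le> (\<Sum>j\<in>G. (g j - f0 j)\<^sup>2) / ?n + 4 * \<sigma>\<^sup>2 * x / ?n + 4 * Psum + oracle_const k d * Zsum" .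
    \<comment> \<open>Either variance term of the bound is at least 2 \<sigma>^2 x / n; applied once
      to the unpenalized term and once to the summand of \<open>c0\<close>.\<close>
    have sq: "2 * \<sigma>\<^sup>2 / ?n * x \<le> 2 * \<sigma>\<^sup>2 / ?n * (sqrt x' + sqrt y)\<^sup>2" if "y \<ge> 0" for y
    proof (rule mult_left_mono)
      have "x \<le> x'" using lnk by (simp add: x'_def)
      also have "x' = (sqrt x')\<^sup>2" using lnk x by (simp add: x'_def)
      also have "\<dots> \<le> (sqrt x' + sqrt y)\<^sup>2" using that lnk x by (intro power_mono) (auto simp: x'_def)
      finally show "x \<le> (sqrt x' + sqrt y)\<^sup>2" .
    qed (use n1 in auto)
    have "2 * \<sigma>\<^sup>2 / ?n * x \<le> 2 * \<sigma>\<^sup>2 / ?n * (sqrt x' + sqrt (real k * real (card (Sc c0))))\<^sup>2" by (rule sq) simp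
    also have "\<dots> = (if zeros c0 = {} then 0 else 2 * \<sigma>\<^sup>2 / ?n * (sqrt x' + sqrt (real k * real (card (Sc c0))))\<^sup>2)"
      using c0 by simp
    also have "\<dots> \<le> (\<Sum>c\<in>comps. if zeros c = {} then 0 else 2 * \<sigma>\<^sup>2 / ?n * (sqrt x' + sqrt (real k * real (card (Sc c))))\<^sup>2)"
      using finite_comps c0(1) n1 by (intro member_le_sum) auto
    finally have "2 * \<sigma>\<^sup>2 / ?n * x \<le> (\<Sum>c\<in>comps. if zeros c = {} then 0 else 2 * \<sigma>\<^sup>2 / ?n * (sqrt x' + sqrt (real k * real (card (Sc c))))\<^sup>2)" .
    moreover have "2 * \<sigma>\<^sup>2 / ?n * x \<le> 2 * \<sigma>\<^sup>2 / ?n * (sqrt x' + sqrt (real k ^ d))\<^sup>2" by (rule sq) simp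
    moreover have "4 * \<sigma>\<^sup>2 * x / ?n = 2 * \<sigma>\<^sup>2 / ?n * x + 2 * \<sigma>\<^sup>2 / ?n * x" by simp
    ultimately have 2: "?lhs e / ?n \<le> (\<Sum>j\<in>G. (g j - f0 j)\<^sup>2) / ?n + 4 * Psum
       + 2 * \<sigma>\<^sup>2 / ?n * (sqrt x' + sqrt (real k ^ d))\<^sup>2
       + (\<Sum>c\<in>comps. if zeros c = {} then 0 else 2 * \<sigma>\<^sup>2 / ?n * (sqrt x' + sqrt (real k * real (card (Sc c))))\<^sup>2)
       + oracle_const k d * Zsum"
      using 1 by linarith
    thus ?thesis
      unfolding sum_nonempty_components Psum_def Zsum_def lc_def Pc_def Zc_def Sc_def x'_def by (simp only: mult.assoc)
  qed
  have "space ?P - good \<subseteq> (\<Union>p\<in>A. bad1 p) \<union> bad2"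
    using det unfolding good_def by blast
  hence "measure ?P (space ?P - good) \<le> measure ?P ((\<Union>p\<in>A. bad1 p) \<union> bad2)"
    using finA bad1_sets bad2_sets by (intro P.finite_measure_mono sets.Un sets.finite_UN) auto
  also have "\<dots> \<le> measure ?P (\<Union>p\<in>A. bad1 p) + measure ?P bad2"
    using finA bad1_sets bad2_sets by (intro measure_Un_le sets.finite_UN) auto
  finally have "1 - measure ?P good \<le> exp (- t) + exp (- x)"
    using p1 p2 P.prob_compl[OF good_sets] by linarith
  thus ?thesis unfolding noise_eq good_def by linarith
qed

end

text \<open>The values are 1, 7/4, 19/4 and 128/10.10 for k = 1, ..., 4, so the limiting constant is
  itself an admissible one.\<close>

lemma tuning_limit_ge_1:
  assumes "k \<in> {1..4}"
  shows "1 \<le> real k powr ((2 * real k - 1) / 2) / a0 k"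
proof -
  have pw: "real k powr ((2 * real k - 1) / 2) = real k ^ (k - 1) * sqrt (real k)"
  proof -
    have e: "(2 * real k - 1) / 2 = real (k - 1) + 1/2" using assms by (simp add: field_simps of_nat_diff)
    have "real k powr real (k - 1) = real k ^ (k - 1)" using assms by (intro powr_realpow) auto
    thus ?thesis unfolding e powr_add by (simp add: powr_half_sqrt)
  qed
  consider "k = 1" | "k = 2" | "k = 3" | "k = 4" using assms by force
  thus ?thesis
  proof cases
    case 1
    thus ?thesis by (simp add: a0_def)
  next
    case 2
    have "8 * sqrt 2 / 7 \<le> 2 * sqrt (2::real)" by simp
    thus ?thesis using pw 2 by (simp add: a0_def)
  next
    case 3
    thus ?thesis using pw by (simp add: a0_def)
  next
    case 4
    thus ?thesis using pw by (simp add: a0_def)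
  qed
qed

text \<open>Both conjuncts of the final statement follow once every constant threshold of at least
  one works: the constant 1 for the first, and the sequence constantly equal to the required limit
  for the second.\<close>

lemma let_constant_thresholds:
  fixes P :: "(nat \<Rightarrow> real) \<Rightarrow> bool"
  assumes "\<And>C. C \<ge> 1 \<Longrightarrow> P (\<lambda>_. C)" "L \<ge> 1"
  shows "let p = P in (\<exists>C>0. p (\<lambda>_. C)) \<and>
    (\<exists>thr. (\<forall>m. thr m > 0) \<and> thr \<longlonglongrightarrow> L \<and> p thr)"
  unfolding Let_def using assms(1)[of 1] assms(1)[OF assms(2)] assms(2)
  by (intro conjI exI[of _ "1::real"] exI[of _ "\<lambda>_. L"]) auto

(* bound_holds thr: the conclusion, when the constant in the lower bound on the tuning parameters
   for (M, h) is thr m, with m the smallest distance for M. A constant thr gives the first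
   conjunct; the second conjunct lets the constant vary with m and identifies its limit. *)
theorem theorem8p1:
  fixes k :: nat
  assumes "k \<in> {1..4}"
  shows
    "let
       bound_holds = (\<lambda>thr :: nat \<Rightarrow> real.
         \<forall>d\<ge>1. \<exists>K>0.
           \<forall>(n :: nat \<Rightarrow> nat) (\<sigma> :: real) (x :: real) (t :: real) (f0 :: tensor) (g :: tensor)
            (S :: nat set \<Rightarrow> mindex \<Rightarrow> mindex set)
            (lo :: nat set \<Rightarrow> mindex \<Rightarrow> mindex \<Rightarrow> mindex)
            (hi :: nat set \<Rightarrow> mindex \<Rightarrow> mindex \<Rightarrow> mindex)
            (lam :: nat set \<Rightarrow> mindex \<Rightarrow> real).
             (\<forall>i\<in>{1..d}. k < n i) \<longrightarrow> \<sigma> > 0 \<longrightarrow> x > 0 \<longrightarrow> t > 0 \<longrightarrow>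
             (\<forall>M\<in>Pow {1..d} - {{}}. \<forall>h\<in>hset k d M.
                tessellation k n M (S M h) (lo M h) (hi M h) \<and>
                derivative_matching k M (S M h) (lo M h) (hi M h) \<and>
                lam M h > 0 \<and>
                lam M h \<ge> thr (dist_min k d M (S M) (lo M) (hi M)) * real (card M)
                  * sqrt (\<Sum>i\<in>M. (real (dist_max k (S M h) (lo M h) (hi M h) i) / real (n i))
                                   ^ (2 * k - 1))
                  * lambda0 d n \<sigma> (t + real d * ln (real k + 1))) \<longrightarrow>
             measure (noise d n \<sigma>)
               {\<epsilon> \<in> space (noise d n \<sigma>).
                 (\<Sum>j\<in>grid n {1..d}. (estimator k d n lam (\<lambda>j. f0 j + \<epsilon> j) j - f0 j)\<^sup>2)
                     / nprod n {1..d}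
                 \<le> (\<Sum>j\<in>grid n {1..d}. (g j - f0 j)\<^sup>2) / nprod n {1..d}
                   + 4 * (\<Sum>M\<in>Pow {1..d} - {{}}. \<Sum>h\<in>hset k d M. lam M h
                       * (\<Sum>j\<in>inner_grid k n M - S M h. \<bar>diff_ops k n M (margin k d n M h g) j\<bar>))
                   + 2 * \<sigma>\<^sup>2 / nprod n {1..d}
                       * (sqrt (x + real d * ln (real k + 1)) + sqrt (real k ^ d))\<^sup>2
                   + (\<Sum>M\<in>Pow {1..d} - {{}}. \<Sum>h\<in>hset k d M. 2 * \<sigma>\<^sup>2 / nprod n {1..d}
                       * (sqrt (x + real d * ln (real k + 1))
                          + sqrt (real k * real (card (S M h))))\<^sup>2)
                   + K * (\<Sum>M\<in>Pow {1..d} - {{}}. \<Sum>h\<in>hset k d M. (lam M h)\<^sup>2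
                       * (\<Sum>i\<in>M. ln (exp 1 * real (dist_max k (S M h) (lo M h) (hi M h) i)))
                       * (\<Sum>\<tau>\<in>S M h. \<Sum>z\<in>(\<Pi>\<^sub>E i\<in>M. (UNIV :: bool set)).
                           (nprod n M / dist_prod k M (lo M h) (hi M h) \<tau> z) ^ (2 * k - 1)))}
             \<ge> 1 - exp (- x) - exp (- t))
     in
       (\<exists>C>0. bound_holds (\<lambda>_. C)) \<and>
       (\<exists>thr. (\<forall>m. thr m > 0) \<and>
              thr \<longlonglongrightarrow> real k powr ((2 * real k - 1) / 2) / a0 k \<and>
              bound_holds thr)"
proof (rule let_constant_thresholds[OF _ tuning_limit_ge_1[OF assms]], intro allI impI, goal_cases)
  case (1 C d)
  note C = 1(1)
  show ?case
  proof (intro exI[of _ "oracle_const k d"] conjI allI impI, goal_cases)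
    case 1
    have "energy_const k \<ge> 1" using assms by (intro energy_const_ge_1) auto
    thus ?case using assms by (auto simp: oracle_const_def intro!: add_pos_nonneg)
  next
    case (2 n \<sigma> x t f0 g S lo hi lam)
    interpret anova n k d by unfold_locales (use assms 2(1) in auto)
    show ?case
    proof (rule oracle_probability[OF 1(2) 2(2-4)], goal_cases)
      case Mh: (1 M h)
      have l0: "lambda0 d n \<sigma> (t + real d * ln (real k + 1)) \<ge> 0"
      proof -
        have "0 \<le> ln (2 * nprod n {1..d})" using nprod_ge_1 by simp
        moreover have "0 \<le> real d * ln (real k + 1)" by simp
        ultimately show ?thesis
          unfolding lambda0_def using 2(2-4) nprod_ge_1
          by (intro mult_nonneg_nonneg real_sqrt_ge_zero divide_nonneg_nonneg add_nonneg_nonneg) auto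
      qed
      define Q where "Q = real (card M) * sqrt (\<Sum>i\<in>M. (real (dist_max k (S M h) (lo M h) (hi M h) i) / real (n i)) ^ (2 * k - 1))
          * lambda0 d n \<sigma> (t + real d * ln (real k + 1))"
      have "0 \<le> Q" unfolding Q_def using l0
        by (intro mult_nonneg_nonneg real_sqrt_ge_zero sum_nonneg) auto
      \<comment> \<open>Since Q is nonnegative, the assumption with C \<ge> 1 implies the one with
        constant 1.\<close>
      hence "Q \<le> C * Q" using C mult_right_mono[of 1 C Q] by simp
      also have "C * Q \<le> lam M h"
        using conjunct2[OF conjunct2[OF conjunct2[OF bspec[OF bspec[OF 2(5) Mh(1)] Mh(2)]]]] by (simp only: Q_def mult.assoc)
      finally show ?case using 2(5) Mh unfolding Q_def by blast
    qed
  qed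
qed

end
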